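(* Let $a_1,a_2\in\mathbb{R}$, let $a_3,B,K,l>0$ and let $q\ge 0$. Let $$\mathcal{J}(u,\mathbf{Q})=\int_\Omega\left(f_s(u)+B\left|\mathcal{D}^2u+q^2\left(\mathbf{Q}+\frac{\mathbf{I}_d}{d}\right)u\right|^2+f_n(\mathbf{Q},\nabla\mathbf{Q})\right)$$ and $$\mathcal{A}=\left\{(u,\mathbf{Q})\in H^2(\Omega,\mathbb{R})\times H^1(\Omega,S_0):\ \mathbf{Q}=\mathbf{Q}_b,\ u=u_b\ \text{on }\partial\Omega\right\}.$$ Then there exists a pair $(u^\star,\mathbf{Q}^\star)\in\mathcal{A}$ that solves the minimisation problem $\min_{(u,\mathbf{Q})\in\mathcal{A}}\mathcal{J}(u,\mathbf{Q})$, i.e. $\mathcal{J}(u^\star,\mathbf{Q}^\star)\le\mathcal{J}(u,\mathbf{Q})$ for all $(u,\mathbf{Q})\in\mathcal{A}$.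
   Context: $\Omega\subset\mathbb{R}^d$, $d\in\{2,3\}$, is an open, bounded and convex domain with Lipschitz boundary $\partial\Omega$. $S_0$ is the space of symmetric traceless real $d\times d$ matrices, $\mathbf{I}_d$ is the $d\times d$ identity matrix, $\mathcal{D}^2$ is the Hessian operator, $|\cdot|$ is the Frobenius (Euclidean) norm. The smectic bulk density is $$f_s(u)=\frac{a_1}{2}u^2+\frac{a_2}{3}u^3+\frac{a_3}{4}u^4,$$ and the nematic density is $$f_n(\mathbf{Q},\nabla\mathbf{Q})=\frac K2|\nabla\mathbf{Q}|^2+\begin{cases}-l\,\mathrm{tr}(\mathbf{Q}^2)+l\,(\mathrm{tr}(\mathbf{Q}^2))^2,&d=2,\\-\frac l2\mathrm{tr}(\mathbf{Q}^2)-\frac l3\mathrm{tr}(\mathbf{Q}^3)+\frac l2(\mathrm{tr}(\mathbf{Q}^2))^2,&d=3.\end{cases}$$ The Dirichlet data are $\mathbf{Q}_b\in H^{1/2}(\partial\Omega,S_0)$ and $u_b\in H^{3/2}(\partial\Omega,\mathbb{R})$, where these spaces are the spaces of traces on $\partial\Omega$ of functions in $H^1(\Omega,S_0)$ and $H^2(\Omega,\mathbb{R})$ respectively (so $\mathcal{A}\neq\emptyset$). Boundary values are understood in the sense of traces. *)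

theory Defs
  imports "HOL-Analysis.Analysis"
begin

section \<open>Hausdorff measure\<close>

text \<open>
  The normalisation is the usual one, for which the \<open>n\<close>-dimensional Hausdorff measure on an
  \<open>n\<close>-dimensional Euclidean space is Lebesgue measure. The empty set is singled out because of
  \<open>0 ^ 0 = 1\<close>, and covering sets have to be bounded because \<open>diameter\<close> is unspecified otherwise.
\<close>

definition hausdorff_gauge :: "nat \<Rightarrow> 'a::metric_space set \<Rightarrow> ennreal" where
  "hausdorff_gauge s C =
     (if C = {} then 0 else ennreal (unit_ball_vol (real s) * (diameter C / 2) ^ s))"

definition hausdorff_pre :: "nat \<Rightarrow> real \<Rightarrow> 'a::metric_space set \<Rightarrow> ennreal" where
  "hausdorff_pre s \<delta> A =
     (INF C\<in>{C :: nat \<Rightarrow> 'a set. A \<subseteq> (\<Union>n. C n) \<and> (\<forall>n. bounded (C n) \<and> diameter (C n) \<le> \<delta>)}.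
        \<Sum>n. hausdorff_gauge s (C n))"

definition hausdorff_outer :: "nat \<Rightarrow> 'a::metric_space set \<Rightarrow> ennreal" where
  "hausdorff_outer s A = (SUP \<delta>\<in>{0<..}. hausdorff_pre s \<delta> A)"

definition hausdorff_measure :: "nat \<Rightarrow> 'a::metric_space measure" where
  "hausdorff_measure s = measure_of UNIV (sets borel) (hausdorff_outer s)"

text \<open>
  \<^const>\<open>measure_of\<close> yields the zero measure if it is given a set function that is not a
  measure. That this does not happen here is Caratheodory's criterion for metric outer measures.
\<close>

lemma hausdorff_gauge_empty [simp]: "hausdorff_gauge s {} = 0"
  by (simp add: hausdorff_gauge_def)

lemma hausdorff_pre_mono: "A \<subseteq> B \<Longrightarrow> hausdorff_pre s \<delta> A \<le> hausdorff_pre s \<delta> B"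
  unfolding hausdorff_pre_def by (rule INF_superset_mono) auto

lemma hausdorff_pre_antimono: "\<delta> \<le> \<delta>' \<Longrightarrow> hausdorff_pre s \<delta>' A \<le> hausdorff_pre s \<delta> A"
  unfolding hausdorff_pre_def
  by (rule INF_superset_mono) (auto intro: order_trans)

lemma hausdorff_outer_mono: "A \<subseteq> B \<Longrightarrow> hausdorff_outer s A \<le> hausdorff_outer s B"
  unfolding hausdorff_outer_def by (intro SUP_mono) (auto intro: hausdorff_pre_mono)

lemma hausdorff_outer_empty: "hausdorff_outer s {} = 0"
proof -
  have "hausdorff_pre s \<delta> ({} :: 'a set) = 0" if "\<delta> > 0" for \<delta>
  proof -
    have "hausdorff_pre s \<delta> ({} :: 'a set) \<le> (\<Sum>n. hausdorff_gauge s ((\<lambda>_::nat. {} :: 'a set) n))"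
      unfolding hausdorff_pre_def by (rule INF_lower) (use that in auto)
    then show ?thesis by simp
  qed
  then show ?thesis
    unfolding hausdorff_outer_def by (simp cong: SUP_cong_simp add: SUP_eq_iff)
qed

lemma hausdorff_pre_subadditive:
  "hausdorff_pre s \<delta> (\<Union>i. A i) \<le> (\<Sum>i::nat. hausdorff_pre s \<delta> (A i))"
proof (rule ennreal_le_epsilon)
  fix e :: real
  assume "0 < e" "(\<Sum>n. hausdorff_pre s \<delta> (A n)) < top"
  then have *: "\<And>n. hausdorff_pre s \<delta> (A n) < hausdorff_pre s \<delta> (A n) + e * (1/2)^Suc n"
    by (auto simp add: less_top dest!: ennreal_suminf_lessD)
  have "\<exists>C. A n \<subseteq> (\<Union>k. C k) \<and> (\<forall>k. bounded (C k) \<and> diameter (C k) \<le> \<delta>) \<and>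
          (\<Sum>k. hausdorff_gauge s (C k)) \<le> hausdorff_pre s \<delta> (A n) + e * (1/2)^Suc n" for n
    using *[of n] unfolding hausdorff_pre_def INF_less_iff by (auto intro: less_imp_le)
  then obtain B where cov: "\<And>n. A n \<subseteq> (\<Union>k. B n k)"
    and B: "\<And>n k. bounded (B n k) \<and> diameter (B n k) \<le> \<delta>"
    and le: "\<And>n. (\<Sum>k. hausdorff_gauge s (B n k)) \<le> hausdorff_pre s \<delta> (A n) + e * (1/2)^Suc n"
    by metis
  define C where "C = case_prod B \<circ> prod_decode"
  have A_C: "(\<Union>i. A i) \<subseteq> (\<Union>i. C i)"
    using cov by (auto simp add: C_def subset_eq) (metis prod.case prod_encode_inverse)
  have "hausdorff_pre s \<delta> (\<Union>i. A i) \<le> (\<Sum>i. hausdorff_gauge s (C i))"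
    unfolding hausdorff_pre_def
    by (rule INF_lower) (use A_C B in \<open>auto simp: C_def split_def\<close>)
  also have "\<dots> = (\<Sum>n. \<Sum>i. hausdorff_gauge s (B n i))"
    unfolding C_def comp_def by (intro suminf_ennreal_2dimen) auto
  also have "\<dots> \<le> (\<Sum>n. hausdorff_pre s \<delta> (A n) + e * (1/2) ^ Suc n)"
    by (intro suminf_le le summableI)
  also have "\<dots> = (\<Sum>n. hausdorff_pre s \<delta> (A n)) + (\<Sum>n. ennreal e * ennreal ((1/2) ^ Suc n))"
    using \<open>0 < e\<close> by (subst suminf_add[symmetric])
                     (auto simp del: ennreal_suminf_cmult simp add: ennreal_mult[symmetric])
  also have "\<dots> = (\<Sum>n. hausdorff_pre s \<delta> (A n)) + e"
    unfolding ennreal_suminf_cmult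
    by (subst suminf_ennreal_eq[OF zero_le_power power_half_series]) auto
  finally show "hausdorff_pre s \<delta> (\<Union>i. A i) \<le> (\<Sum>n. hausdorff_pre s \<delta> (A n)) + e" .
qed

lemma hausdorff_outer_subadditive:
  "hausdorff_outer s (\<Union>i. A i) \<le> (\<Sum>i::nat. hausdorff_outer s (A i))"
  unfolding hausdorff_outer_def[of s "\<Union>i. A i"]
proof (rule SUP_least)
  fix \<delta> :: real assume \<delta>: "\<delta> \<in> {0<..}"
  have "(\<Sum>i. hausdorff_pre s \<delta> (A i)) \<le> (\<Sum>i. hausdorff_outer s (A i))"
    unfolding hausdorff_outer_def using \<delta> by (intro suminf_le summableI SUP_upper)
  then show "hausdorff_pre s \<delta> (\<Union>i. A i) \<le> (\<Sum>i. hausdorff_outer s (A i))"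
    using hausdorff_pre_subadditive order_trans by blast
qed

lemma outer_measure_space_hausdorff_outer:
  "outer_measure_space (Pow UNIV) (hausdorff_outer s)"
  by (auto simp: outer_measure_space_def positive_def increasing_def countably_subadditive_def
      hausdorff_outer_empty intro: hausdorff_outer_mono hausdorff_outer_subadditive)

lemma hausdorff_outer_Un:
  "hausdorff_outer s (A \<union> B) \<le> hausdorff_outer s A + hausdorff_outer s B"
proof -
  have "subadditive (Pow UNIV) (hausdorff_outer s :: 'a set \<Rightarrow> ennreal)"
  proof -
    interpret sigma_algebra "UNIV :: 'a set" "Pow UNIV"
      by (rule sigma_algebra_Pow)
    have "outer_measure_space (Pow UNIV) (hausdorff_outer s :: 'a set \<Rightarrow> ennreal)"
      by (rule outer_measure_space_hausdorff_outer)
    then show ?thesis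
      unfolding outer_measure_space_def using countably_subadditive_subadditive by blast
  qed
  then have "hausdorff_outer s (A \<union> (B - A)) \<le> hausdorff_outer s A + hausdorff_outer s (B - A)"
    by (intro subadditiveD[where M = "Pow UNIV"]) auto
  also have "\<dots> \<le> hausdorff_outer s A + hausdorff_outer s B"
    by (intro add_left_mono hausdorff_outer_mono) auto
  finally show ?thesis by simp
qed

lemma hausdorff_pre_separated:
  assumes "\<And>a b. a \<in> A \<Longrightarrow> b \<in> B \<Longrightarrow> \<delta> < dist a b"
  shows "hausdorff_pre s \<delta> A + hausdorff_pre s \<delta> B \<le> hausdorff_pre s \<delta> (A \<union> B)"
  unfolding hausdorff_pre_def[of s \<delta> "A \<union> B"]
proof (rule INF_greatest)
  fix C :: "nat \<Rightarrow> 'a set"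
  assume "C \<in> {C. A \<union> B \<subseteq> (\<Union>n. C n) \<and> (\<forall>n. bounded (C n) \<and> diameter (C n) \<le> \<delta>)}"
  then have cov: "A \<union> B \<subseteq> (\<Union>n. C n)" and C: "\<And>n. bounded (C n)" "\<And>n. diameter (C n) \<le> \<delta>"
    by auto
  define D where "D = (\<lambda>S n. if C n \<inter> S = {} then {} else C n)"
  have \<delta>: "0 \<le> \<delta>" using C diameter_ge_0 order_trans by blast
  have pre: "hausdorff_pre s \<delta> S \<le> (\<Sum>n. hausdorff_gauge s (D S n))" if "S \<subseteq> A \<union> B" for S
    unfolding hausdorff_pre_def
    by (rule INF_lower) (use that cov C \<delta> in \<open>auto simp: D_def; blast\<close>)
  have sep: "C n \<inter> A = {} \<or> C n \<inter> B = {}" for n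
  proof (rule ccontr)
    assume "\<not> ?thesis"
    then obtain a b where "a \<in> C n" "a \<in> A" "b \<in> C n" "b \<in> B" by blast
    with assms[of a b] diameter_bounded_bound[OF C(1), of a n b] C(2)[of n] show False by simp
  qed
  have "hausdorff_pre s \<delta> A + hausdorff_pre s \<delta> B
      \<le> (\<Sum>n. hausdorff_gauge s (D A n)) + (\<Sum>n. hausdorff_gauge s (D B n))"
    by (intro add_mono pre) auto
  also have "\<dots> = (\<Sum>n. hausdorff_gauge s (D A n) + hausdorff_gauge s (D B n))"
    by (intro suminf_add summableI)
  also have "\<dots> \<le> (\<Sum>n. hausdorff_gauge s (C n))"
  proof (intro suminf_le summableI)
    fix n show "hausdorff_gauge s (D A n) + hausdorff_gauge s (D B n) \<le> hausdorff_gauge s (C n)"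
      using sep[of n] by (auto simp: D_def)
  qed
  finally show "hausdorff_pre s \<delta> A + hausdorff_pre s \<delta> B \<le> (\<Sum>n. hausdorff_gauge s (C n))" .
qed

lemma hausdorff_outer_separated:
  assumes "0 < \<epsilon>" "\<And>a b. a \<in> A \<Longrightarrow> b \<in> B \<Longrightarrow> \<epsilon> \<le> dist a b"
  shows "hausdorff_outer s A + hausdorff_outer s B \<le> hausdorff_outer s (A \<union> B)"
proof -
  have "hausdorff_outer s A + hausdorff_outer s B
      = (SUP \<delta>\<in>{0<..}. hausdorff_pre s \<delta> A + hausdorff_pre s \<delta> B)"
    unfolding hausdorff_outer_def
  proof (rule SUP_add_directed_ennreal[symmetric])
    fix \<delta> \<delta>' :: real assume "\<delta> \<in> {0<..}" "\<delta>' \<in> {0<..}"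
    then show "\<exists>k\<in>{0<..}. hausdorff_pre s \<delta> A + hausdorff_pre s \<delta>' B
        \<le> hausdorff_pre s k A + hausdorff_pre s k B"
      by (intro bexI[of _ "min \<delta> \<delta>'"] add_mono hausdorff_pre_antimono) auto
  qed
  also have "\<dots> \<le> hausdorff_outer s (A \<union> B)"
  proof (rule SUP_least)
    fix \<delta> :: real assume \<delta>: "\<delta> \<in> {0<..}"
    define \<eta> where "\<eta> = min \<delta> (\<epsilon> / 2)"
    have \<eta>: "0 < \<eta>" "\<eta> \<le> \<delta>" "\<eta> < \<epsilon>" using \<delta> assms(1) by (auto simp: \<eta>_def)
    have "hausdorff_pre s \<delta> A + hausdorff_pre s \<delta> B \<le> hausdorff_pre s \<eta> A + hausdorff_pre s \<eta> B"
      by (intro add_mono hausdorff_pre_antimono \<eta>)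
    also have "\<dots> \<le> hausdorff_pre s \<eta> (A \<union> B)"
      using assms(2) \<eta>(3) by (intro hausdorff_pre_separated) force
    also have "\<dots> \<le> hausdorff_outer s (A \<union> B)"
      unfolding hausdorff_outer_def using \<eta>(1) by (intro SUP_upper) auto
    finally show "hausdorff_pre s \<delta> A + hausdorff_pre s \<delta> B \<le> hausdorff_outer s (A \<union> B)" .
  qed
  finally show ?thesis .
qed

lemma closed_in_lambda_system_hausdorff_outer:
  assumes F: "closed F"
  shows "F \<in> lambda_system UNIV (Pow UNIV) (hausdorff_outer s)"
proof -
  let ?\<mu> = "hausdorff_outer s :: 'a set \<Rightarrow> ennreal"
  have main: "?\<mu> (X \<inter> F) + ?\<mu> (X - F) \<le> ?\<mu> X" if "F \<noteq> {}" "?\<mu> X < \<infinity>" for X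
  proof -
    define A where "A = (\<lambda>n::nat. {x\<in>X - F. infdist x F \<ge> 1 / real (Suc n)})"
    define R where "R = (\<lambda>n. A (Suc n) - A n)"
    have A_X: "A n \<subseteq> X - F" for n by (auto simp: A_def)
    have A_Suc: "A n \<subseteq> A (Suc n)" for n
    proof -
      have "1 / real (Suc (Suc n)) \<le> 1 / real (Suc n)" by (simp add: frac_le)
      then show ?thesis unfolding A_def by (auto intro: order_trans)
    qed
    have step: "?\<mu> (A n) + ?\<mu> (R (Suc n)) \<le> ?\<mu> (A (Suc (Suc n)))" for n
    proof -
      have "?\<mu> (A n) + ?\<mu> (R (Suc n)) \<le> ?\<mu> (A n \<union> R (Suc n))"
      proof (rule hausdorff_outer_separated)
        show "0 < 1 / real (Suc n) - 1 / real (Suc (Suc n))"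
          using frac_less2[of 1 1 "real (Suc n)" "real (Suc (Suc n))"] by simp
        fix a b assume "a \<in> A n" "b \<in> R (Suc n)"
        then have "1 / real (Suc n) \<le> infdist a F" "infdist b F < 1 / real (Suc (Suc n))"
          by (auto simp: A_def R_def)
        with infdist_triangle[of a F b]
        show "1 / real (Suc n) - 1 / real (Suc (Suc n)) \<le> dist a b" by linarith
      qed
      also have "\<dots> \<le> ?\<mu> (A (Suc (Suc n)))"
        using A_Suc[of n] A_Suc[of "Suc n"] by (intro hausdorff_outer_mono) (auto simp: R_def)
      finally show ?thesis .
    qed
    have sum_le: "(\<Sum>k<2 * N. ?\<mu> (R (Suc k))) \<le> ?\<mu> (A (2 * N)) + ?\<mu> (A (2 * N + 1))" for N
    proof (induction N)
      case (Suc N)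
      have "(\<Sum>k<2 * Suc N. ?\<mu> (R (Suc k)))
          = (\<Sum>k<2 * N. ?\<mu> (R (Suc k))) + ?\<mu> (R (Suc (2 * N))) + ?\<mu> (R (Suc (2 * N + 1)))"
        by simp
      also have "\<dots> \<le> ?\<mu> (A (2 * N)) + ?\<mu> (A (2 * N + 1))
          + ?\<mu> (R (Suc (2 * N))) + ?\<mu> (R (Suc (2 * N + 1)))"
        by (intro add_right_mono Suc.IH)
      also have "\<dots> = (?\<mu> (A (2 * N)) + ?\<mu> (R (Suc (2 * N))))
          + (?\<mu> (A (2 * N + 1)) + ?\<mu> (R (Suc (2 * N + 1))))"
        by (simp add: ac_simps)
      also have "\<dots> \<le> ?\<mu> (A (2 * Suc N)) + ?\<mu> (A (2 * Suc N + 1))"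
        using add_mono[OF step[of "2 * N"] step[of "2 * N + 1"]] by simp
      finally show ?case .
    qed simp
    have "(\<Sum>k. ?\<mu> (R (Suc k))) \<le> ?\<mu> X + ?\<mu> X"
    proof (rule suminf_le_const[OF summableI])
      fix n
      have "(\<Sum>k<n. ?\<mu> (R (Suc k))) \<le> (\<Sum>k<2 * n. ?\<mu> (R (Suc k)))"
        by (intro sum_mono2) auto
      also have "\<dots> \<le> ?\<mu> X + ?\<mu> X"
        using sum_le[of n] A_X
        by (meson add_mono hausdorff_outer_mono order_trans Diff_subset)
      finally show "(\<Sum>k<n. ?\<mu> (R (Suc k))) \<le> ?\<mu> X + ?\<mu> X" .
    qed
    also have "\<dots> < \<infinity>" using that(2) by simp
    finally have fin: "(\<Sum>k. ?\<mu> (R (Suc k))) < \<infinity>" .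
    define g where "g = (\<lambda>k. enn2real (?\<mu> (R (Suc k))))"
    have g: "?\<mu> (R (Suc k)) = ennreal (g k)" for k
      using ennreal_suminf_lessD[of "\<lambda>k. ?\<mu> (R (Suc k))" \<infinity> k] fin
      by (simp add: g_def)
    have g0: "0 \<le> g k" for k by (simp add: g_def)
    have "summable g"
      using fin g0 unfolding g by (intro summable_suminf_not_top) auto
    then have "(\<lambda>n. \<Sum>k. g (k + n)) \<longlonglongrightarrow> 0"
      by (rule suminf_exist_split2)
    then have "(\<lambda>n. ?\<mu> X + ennreal (\<Sum>k. g (k + n))) \<longlonglongrightarrow> ?\<mu> X + ennreal 0"
      by (intro tendsto_add tendsto_const tendsto_ennrealI)
    moreover have "?\<mu> (X \<inter> F) + ?\<mu> (X - F) \<le> ?\<mu> X + ennreal (\<Sum>k. g (k + n))" for n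
    proof -
      have "X - F \<subseteq> A (Suc n) \<union> (\<Union>k. R (Suc (k + n)))"
      proof
        fix x assume x: "x \<in> X - F"
        then have "infdist x F > 0"
          using F that(1) by (simp add: infdist_pos_not_in_closed)
        then obtain m where "1 / real (Suc m) < infdist x F"
          using nat_approx_posE by blast
        then have ex: "x \<in> A m" using x by (auto simp: A_def)
        define p where "p = (LEAST m. x \<in> A m)"
        have p: "x \<in> A p" "\<And>j. j < p \<Longrightarrow> x \<notin> A j"
          using LeastI[of "\<lambda>m. x \<in> A m", OF ex] not_less_Least by (auto simp: p_def)
        show "x \<in> A (Suc n) \<union> (\<Union>k. R (Suc (k + n)))"
        proof (cases "p \<le> Suc n")
          case True
          then have "A p \<subseteq> A (Suc n)" by (rule lift_Suc_mono_le[of A, OF A_Suc])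
          with p show ?thesis by auto
        next
          case False
          then obtain k where "p = Suc (Suc (k + n))"
            by (metis add.commute less_imp_Suc_add not_le add_Suc)
          with p(1) p(2)[of "Suc (k + n)"] have "x \<in> R (Suc (k + n))" by (simp add: R_def)
          then show ?thesis by blast
        qed
      qed
      then have "?\<mu> (X - F) \<le> ?\<mu> (A (Suc n)) + ?\<mu> (\<Union>k. R (Suc (k + n)))"
        by (meson hausdorff_outer_Un hausdorff_outer_mono order_trans)
      also have "?\<mu> (\<Union>k. R (Suc (k + n))) \<le> (\<Sum>k. ?\<mu> (R (Suc (k + n))))"
        by (rule hausdorff_outer_subadditive)
      also have "\<dots> = ennreal (\<Sum>k. g (k + n))"
        unfolding g using g0 \<open>summable g\<close> by (intro suminf_ennreal2) (auto simp: summable_iff_shift)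
      finally have "?\<mu> (X \<inter> F) + ?\<mu> (X - F)
          \<le> ?\<mu> (X \<inter> F) + ?\<mu> (A (Suc n)) + ennreal (\<Sum>k. g (k + n))"
        by (simp add: add_left_mono add.assoc)
      also have "?\<mu> (X \<inter> F) + ?\<mu> (A (Suc n)) \<le> ?\<mu> ((X \<inter> F) \<union> A (Suc n))"
      proof (rule hausdorff_outer_separated)
        show "0 < 1 / real (Suc (Suc n))" by simp
        fix a b assume "a \<in> X \<inter> F" "b \<in> A (Suc n)"
        then show "1 / real (Suc (Suc n)) \<le> dist a b"
          using infdist_le[of a F b] by (auto simp: A_def dist_commute)
      qed
      also have "\<dots> \<le> ?\<mu> X" using A_X by (intro hausdorff_outer_mono) auto
      finally show ?thesis by (simp add: add_right_mono)
    qed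
    ultimately show ?thesis by (intro LIMSEQ_le_const[where a = "?\<mu> (X \<inter> F) + ?\<mu> (X - F)"]) auto
  qed
  have "?\<mu> (F \<inter> X) + ?\<mu> ((UNIV - F) \<inter> X) = ?\<mu> X" for X
  proof -
    have eq: "F \<inter> X = X \<inter> F" "(UNIV - F) \<inter> X = X - F" by auto
    have "?\<mu> (X \<inter> F) + ?\<mu> (X - F) \<le> ?\<mu> X"
    proof (cases "F = {} \<or> ?\<mu> X = \<infinity>")
      case True then show ?thesis by (auto simp: hausdorff_outer_empty)
    next
      case False then show ?thesis using main by (simp add: less_top)
    qed
    moreover have "?\<mu> X \<le> ?\<mu> (X \<inter> F) + ?\<mu> (X - F)"
      using hausdorff_outer_Un[of s "X \<inter> F" "X - F"] by (simp add: Int_Diff_Un)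
    ultimately show ?thesis unfolding eq by (rule antisym)
  qed
  then show ?thesis by (simp add: lambda_system_def)
qed

lemma emeasure_hausdorff_measure:
  assumes "A \<in> sets borel"
  shows "emeasure (hausdorff_measure s) A = hausdorff_outer s (A :: 'a::metric_space set)"
proof -
  let ?L = "lambda_system (UNIV :: 'a set) (Pow UNIV) (hausdorff_outer s)"
  interpret P: sigma_algebra "UNIV :: 'a set" "Pow UNIV" by (rule sigma_algebra_Pow)
  have ms: "measure_space UNIV ?L (hausdorff_outer s)"
    by (rule P.caratheodory_lemma[OF outer_measure_space_hausdorff_outer])
  then interpret L: sigma_algebra UNIV ?L by (simp add: measure_space_def)
  have "sets (borel :: 'a measure) = sigma_sets UNIV (Collect closed)"
    by (simp add: borel_eq_closed)
  also have "\<dots> \<subseteq> ?L"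
    using closed_in_lambda_system_hausdorff_outer by (intro L.sigma_sets_subset) blast
  finally have "measure_space UNIV (sets (borel :: 'a measure)) (hausdorff_outer s)"
    using measure_down[OF ms] sets.sigma_algebra_axioms[of "borel :: 'a measure"] by simp
  then show ?thesis
    using assms sets.sigma_algebra_axioms[of "borel :: 'a measure"] unfolding hausdorff_measure_def
    by (intro emeasure_measure_of_sigma) (auto simp: measure_space_def)
qed


section \<open>Domains with Lipschitz boundary\<close>

text \<open>
  Near each boundary point, the domain is the strict epigraph of a Lipschitz function in the
  direction of some unit vector \<open>e\<close>; the function is evaluated at the component of the point
  orthogonal to \<open>e\<close>.
\<close>

definition lipschitz_boundary :: "'a::euclidean_space set \<Rightarrow> bool" where
  "lipschitz_boundary \<Omega> \<longleftrightarrow>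
     (\<forall>p\<in>frontier \<Omega>. \<exists>r>0. \<exists>e. norm e = 1 \<and>
        (\<exists>\<gamma> :: 'a \<Rightarrow> real. \<exists>L. L-lipschitz_on {y. y \<bullet> e = 0} \<gamma> \<and>
           \<Omega> \<inter> ball p r = {x \<in> ball p r. \<gamma> (x - (x \<bullet> e) *\<^sub>R e) < x \<bullet> e}))"


section \<open>Sobolev spaces and traces\<close>

definition partial :: "'n::finite \<Rightarrow> (real^'n \<Rightarrow> 'b::real_normed_vector) \<Rightarrow> real^'n \<Rightarrow> 'b" where
  "partial i f x = frechet_derivative f (at x) (axis i 1)"

primrec Ck :: "nat \<Rightarrow> (real^'n::finite \<Rightarrow> 'b::real_normed_vector) \<Rightarrow> bool" where
  "Ck 0 f \<longleftrightarrow> continuous_on UNIV f"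
| "Ck (Suc k) f \<longleftrightarrow> (\<forall>x. f differentiable (at x)) \<and> (\<forall>i. Ck k (partial i f))"

definition smooth :: "(real^'n::finite \<Rightarrow> 'b::real_normed_vector) \<Rightarrow> bool" where
  "smooth f \<longleftrightarrow> (\<forall>k. Ck k f)"

definition test_function :: "(real^'n::finite) set \<Rightarrow> (real^'n \<Rightarrow> real) \<Rightarrow> bool" where
  "test_function \<Omega> \<phi> \<longleftrightarrow>
     smooth \<phi> \<and> compact (closure {x. \<phi> x \<noteq> 0}) \<and> closure {x. \<phi> x \<noteq> 0} \<subseteq> \<Omega>"

text \<open>
  Elements of \<open>L\<^sup>2\<close> and of the Sobolev spaces are represented by functions on the whole space
  whose values outside of the set in question are irrelevant; functions that agree almost
  everywhere are not identified.
\<close>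

definition L2 :: "'a measure \<Rightarrow> ('a \<Rightarrow> 'b::euclidean_space) set" where
  "L2 M = {f \<in> borel_measurable M. integrable M (\<lambda>x. (norm (f x))\<^sup>2)}"

definition L2_converges ::
  "'a measure \<Rightarrow> (nat \<Rightarrow> 'a \<Rightarrow> 'b::euclidean_space) \<Rightarrow> ('a \<Rightarrow> 'b) \<Rightarrow> bool" where
  "L2_converges M f g \<longleftrightarrow> (\<lambda>k. \<integral>\<^sup>+x. ennreal ((norm (f k x - g x))\<^sup>2) \<partial>M) \<longlonglongrightarrow> 0"

definition has_weak_partial ::
  "(real^'n::finite) set \<Rightarrow> 'n \<Rightarrow> (real^'n \<Rightarrow> 'b::euclidean_space) \<Rightarrow> (real^'n \<Rightarrow> 'b) \<Rightarrow> bool" where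
  "has_weak_partial \<Omega> i f g \<longleftrightarrow>
     (\<forall>\<phi>. test_function \<Omega> \<phi> \<longrightarrow>
        (\<integral>x. partial i \<phi> x *\<^sub>R f x \<partial>lebesgue_on \<Omega>) = - (\<integral>x. \<phi> x *\<^sub>R g x \<partial>lebesgue_on \<Omega>))"

text \<open>Weak derivatives are determined up to null sets only, so a representative is chosen.\<close>

definition weak_partial ::
  "(real^'n::finite) set \<Rightarrow> 'n \<Rightarrow> (real^'n \<Rightarrow> 'b::euclidean_space) \<Rightarrow> real^'n \<Rightarrow> 'b" where
  "weak_partial \<Omega> i f = (SOME g. g \<in> L2 (lebesgue_on \<Omega>) \<and> has_weak_partial \<Omega> i f g)"

definition H1 :: "(real^'n::finite) set \<Rightarrow> (real^'n \<Rightarrow> 'b::euclidean_space) set" where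
  "H1 \<Omega> = {f \<in> L2 (lebesgue_on \<Omega>). \<forall>i. \<exists>g \<in> L2 (lebesgue_on \<Omega>). has_weak_partial \<Omega> i f g}"

definition H2 :: "(real^'n::finite) set \<Rightarrow> (real^'n \<Rightarrow> 'b::euclidean_space) set" where
  "H2 \<Omega> = {f \<in> H1 \<Omega>. \<forall>i. weak_partial \<Omega> i f \<in> H1 \<Omega>}"

definition weak_hessian :: "(real^'n::finite) set \<Rightarrow> (real^'n \<Rightarrow> real) \<Rightarrow> real^'n \<Rightarrow> real^'n^'n" where
  "weak_hessian \<Omega> u x = (\<chi> i j. weak_partial \<Omega> i (weak_partial \<Omega> j u) x)"

definition surface_measure :: "(real^'n::finite) set \<Rightarrow> (real^'n) measure" where
  "surface_measure \<Omega> = restrict_space (hausdorff_measure (CARD('n) - 1)) (frontier \<Omega>)"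

text \<open>
  The trace operator on \<open>H1 \<Omega>\<close> is the continuous extension, with values in \<open>L\<^sup>2\<close> of the
  boundary, of the restriction map on functions that are smooth up to the boundary; these are
  dense in \<open>H1 \<Omega>\<close> if the boundary is Lipschitz. The following is the graph of that extension.
\<close>

definition has_trace ::
  "(real^'n::finite) set \<Rightarrow> (real^'n \<Rightarrow> 'b::euclidean_space) \<Rightarrow> (real^'n \<Rightarrow> 'b) \<Rightarrow> bool" where
  "has_trace \<Omega> f g \<longleftrightarrow>
     f \<in> H1 \<Omega> \<and> g \<in> L2 (surface_measure \<Omega>) \<and>
     (\<exists>\<phi>. (\<forall>k. smooth (\<phi> k)) \<and>
          L2_converges (lebesgue_on \<Omega>) \<phi> f \<and>
          (\<forall>i. L2_converges (lebesgue_on \<Omega>) (\<lambda>k. partial i (\<phi> k)) (weak_partial \<Omega> i f)) \<and>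
          L2_converges (surface_measure \<Omega>) \<phi> g)"


section \<open>The smectic energy\<close>

definition S0 :: "(real^'n^'n) set" where
  "S0 = {Q. transpose Q = Q \<and> trace Q = 0}"

definition H1_S0 :: "(real^'n::finite) set \<Rightarrow> (real^'n \<Rightarrow> real^'n^'n) set" where
  "H1_S0 \<Omega> = {Q \<in> H1 \<Omega>. \<forall>x\<in>\<Omega>. Q x \<in> S0}"

definition H_half_S0 :: "(real^'n::finite) set \<Rightarrow> (real^'n \<Rightarrow> real^'n^'n) set" where
  "H_half_S0 \<Omega> = {g. \<exists>Q \<in> H1_S0 \<Omega>. has_trace \<Omega> Q g}"

definition H_three_halves :: "(real^'n::finite) set \<Rightarrow> (real^'n \<Rightarrow> real) set" where
  "H_three_halves \<Omega> = {g. \<exists>u \<in> H2 \<Omega>. has_trace \<Omega> u g}"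

definition smectic_bulk :: "real \<Rightarrow> real \<Rightarrow> real \<Rightarrow> real \<Rightarrow> real" where
  "smectic_bulk a1 a2 a3 u = a1 / 2 * u^2 + a2 / 3 * u^3 + a3 / 4 * u^4"

text \<open>
  The argument \<open>G\<close> is the gradient of \<open>Q\<close>, with \<open>G i\<close> in the role of the \<open>i\<close>-th partial
  derivative. The case distinction is on the dimension; only dimensions 2 and 3 are relevant.
\<close>

definition nematic_density ::
  "real \<Rightarrow> real \<Rightarrow> real^'n^'n \<Rightarrow> ('n::finite \<Rightarrow> real^'n^'n) \<Rightarrow> real" where
  "nematic_density K l Q G =
     K / 2 * (\<Sum>i\<in>UNIV. (norm (G i))\<^sup>2) +
     (if CARD('n) = 2
      then - l * trace (Q ** Q) + l * (trace (Q ** Q))\<^sup>2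
      else - (l / 2) * trace (Q ** Q) - l / 3 * trace (Q ** Q ** Q) + l / 2 * (trace (Q ** Q))\<^sup>2)"

text \<open>The norm on \<^typ>\<open>real^'n^'n\<close> is the Frobenius norm.\<close>

definition smectic_energy ::
  "(real^'n::finite) set \<Rightarrow> real \<Rightarrow> real \<Rightarrow> real \<Rightarrow> real \<Rightarrow> real \<Rightarrow> real \<Rightarrow> real \<Rightarrow>
     (real^'n \<Rightarrow> real) \<Rightarrow> (real^'n \<Rightarrow> real^'n^'n) \<Rightarrow> real" where
  "smectic_energy \<Omega> a1 a2 a3 B K l q u Q =
     (\<integral>x. smectic_bulk a1 a2 a3 (u x)
          + B * (norm (weak_hessian \<Omega> u x
                   + (q\<^sup>2 * u x) *\<^sub>R (Q x + (1 / real CARD('n)) *\<^sub>R mat 1)))\<^sup>2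
          + nematic_density K l (Q x) (\<lambda>i. weak_partial \<Omega> i Q x) \<partial>lebesgue_on \<Omega>)"

definition admissible ::
  "(real^'n::finite) set \<Rightarrow> (real^'n \<Rightarrow> real) \<Rightarrow> (real^'n \<Rightarrow> real^'n^'n) \<Rightarrow>
     ((real^'n \<Rightarrow> real) \<times> (real^'n \<Rightarrow> real^'n^'n)) set" where
  "admissible \<Omega> u_b Q_b =
     {(u, Q). u \<in> H2 \<Omega> \<and> Q \<in> H1_S0 \<Omega> \<and> has_trace \<Omega> Q Q_b \<and> has_trace \<Omega> u u_b}"

end

theory Submission
  imports Defs "HOL-Library.Diagonal_Subsequence" "HOL-Complex_Analysis.Great_Picard"
begin

text \<open>
  The direct method. Along a minimising sequence the quartic terms bound \<open>u\<close> and \<open>Q\<close> in \<open>L\<^sup>4\<close>, hence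
  the coupling term and with it the Hessian of \<open>u\<close> in \<open>L\<^sup>2\<close>; an interpolation inequality on the
  convex domain bounds \<open>\<nabla>u\<close>. A subsequence converges almost everywhere, which deals with the nonconvex
  terms by Fatou's lemma. The remaining terms are convex, and weak convergence is replaced by strong
  convergence of convex combinations. No trace theorem is needed: for fixed boundary data the
  functions with that trace form a convex and strongly closed set, and each of them is a limit
  of smooth functions, so that compactness has to be shown for smooth functions only.
\<close>

section \<open>Functions of class \<open>L\<^sup>2\<close>\<close>

text \<open>The coupling term contains the product of \<open>u\<close> and \<open>Q\<close>, so it
  does not commute with the convex combinations that replace weak convergence. It is therefore
  carried along as a coordinate of its own and combined at every point with the same weights as
  \<open>u\<close> and \<open>Q\<close>; combinations of the tails of a convergent sequence keep its
  limit, so this coordinate ends at the coupling of the limits almost everywhere. The energy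
  contains no first derivatives of \<open>u\<close>, while the boundary condition and the
  compactness argument both involve them; hence the need for an interpolation inequality. Since weak
  derivatives are known only through their pairings, the shrinking and translating behind that
  inequality is applied to test functions, never to \<open>u\<close> itself. Two conventions of the
  definitions leave their mark. A Bochner integral that does not exist is \<open>0\<close>, so an
  admissible pair whose density is not integrable competes with energy \<open>0\<close>. And
  \<open>Q x\<close> has to lie in \<open>S0\<close> at every point of the domain, not just almost
  everywhere, so limits are set to \<open>0\<close> wherever the sequence diverges.\<close>

definition sqnorm :: "'a measure \<Rightarrow> ('a \<Rightarrow> 'b::real_normed_vector) \<Rightarrow> ennreal" where
  "sqnorm M f = (\<integral>\<^sup>+x. ennreal ((norm (f x))\<^sup>2) \<partial>M)"

text \<open>\<open>sqnorm\<close> takes values in the extended reals so that estimates ask for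
  measurability only; integrability is recovered at the end from finiteness.\<close>

lemma L2_iff_sqnorm:
  "f \<in> L2 M \<longleftrightarrow> f \<in> borel_measurable M \<and> sqnorm M f < \<infinity>"
  unfolding L2_def sqnorm_def by (auto simp: integrable_iff_bounded)

lemma L2_measurable [measurable_dest]: "f \<in> L2 M \<Longrightarrow> f \<in> borel_measurable M"
  by (simp add: L2_def)

lemma L2_sqnorm_finite: "f \<in> L2 M \<Longrightarrow> sqnorm M f < \<infinity>"
  by (simp add: L2_iff_sqnorm)

lemma sqnorm_eq_integral:
  "f \<in> L2 M \<Longrightarrow> sqnorm M f = ennreal (\<integral>x. (norm (f x))\<^sup>2 \<partial>M)"
  unfolding sqnorm_def L2_def by (auto intro!: nn_integral_eq_integral)

lemma L2_converges_sqnorm: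
  "L2_converges M f g \<longleftrightarrow> (\<lambda>k. sqnorm M (\<lambda>x. f k x - g x)) \<longlonglongrightarrow> 0"
  by (simp add: L2_converges_def sqnorm_def)

lemma sqnorm_mono:
  assumes "\<And>x. x \<in> space M \<Longrightarrow> norm (f x) \<le> norm (g x)"
  shows "sqnorm M f \<le> sqnorm M g"
  unfolding sqnorm_def using assms
  by (intro nn_integral_mono ennreal_leI power_mono) auto

lemma sqnorm_cong_AE:
  assumes "AE x in M. norm (f x) = norm (g x)"
  shows "sqnorm M f = sqnorm M g"
  unfolding sqnorm_def using assms by (intro nn_integral_cong_AE) auto

lemma sqnorm_minus_commute: "sqnorm M (\<lambda>x. f x - g x) = sqnorm M (\<lambda>x. g x - f x)"
  by (simp add: sqnorm_def norm_minus_commute)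

lemma norm_add_sq_le: "(norm (a + b))\<^sup>2 \<le> 2 * (norm a)\<^sup>2 + 2 * (norm (b::'a::real_normed_vector))\<^sup>2"
proof -
  have "(norm (a + b))\<^sup>2 \<le> (norm a + norm b)\<^sup>2"
    by (intro power_mono norm_triangle_ineq) auto
  also have "\<dots> \<le> 2 * (norm a)\<^sup>2 + 2 * (norm b)\<^sup>2"
    using zero_le_power2[of "norm a - norm b"] by (simp add: power2_eq_square algebra_simps)
  finally show ?thesis .
qed

lemma sqnorm_add:
  fixes f g :: "'a \<Rightarrow> 'b::euclidean_space"
  assumes [measurable]: "f \<in> borel_measurable M" "g \<in> borel_measurable M"
  shows "sqnorm M (\<lambda>x. f x + g x) \<le> 2 * sqnorm M f + 2 * sqnorm M g"
proof -
  have "sqnorm M (\<lambda>x. f x + g x)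
      \<le> (\<integral>\<^sup>+x. 2 * ennreal ((norm (f x))\<^sup>2) + 2 * ennreal ((norm (g x))\<^sup>2) \<partial>M)"
    unfolding sqnorm_def
  proof (intro nn_integral_mono)
    fix x
    have "2 * ennreal ((norm (f x))\<^sup>2) + 2 * ennreal ((norm (g x))\<^sup>2)
        = ennreal (2 * (norm (f x))\<^sup>2 + 2 * (norm (g x))\<^sup>2)"
      by (simp add: ennreal_plus ennreal_mult)
    then show "ennreal ((norm (f x + g x))\<^sup>2)
        \<le> 2 * ennreal ((norm (f x))\<^sup>2) + 2 * ennreal ((norm (g x))\<^sup>2)"
      using norm_add_sq_le[of "f x" "g x"] by (simp only: ennreal_leI)
  qed
  also have "\<dots> = 2 * sqnorm M f + 2 * sqnorm M g"
    unfolding sqnorm_def by (simp add: nn_integral_add nn_integral_cmult)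
  finally show ?thesis .
qed

lemma sqnorm_scaleR: 
  fixes f :: "'a \<Rightarrow> 'b::euclidean_space"
  assumes [measurable]: "f \<in> borel_measurable M"
  shows "sqnorm M (\<lambda>x. c *\<^sub>R f x) = ennreal (c\<^sup>2) * sqnorm M f"
  unfolding sqnorm_def by (subst nn_integral_cmult[symmetric]) (auto simp: power_mult_distrib ennreal_mult)

lemma sqnorm_diff:
  fixes f g h :: "'a \<Rightarrow> 'b::euclidean_space"
  assumes [measurable]: "f \<in> borel_measurable M" "g \<in> borel_measurable M" "h \<in> borel_measurable M"
  shows "sqnorm M (\<lambda>x. f x - h x) \<le> 2 * sqnorm M (\<lambda>x. f x - g x) + 2 * sqnorm M (\<lambda>x. g x - h x)"
  using sqnorm_add[of "\<lambda>x. f x - g x" M "\<lambda>x. g x - h x"] by simp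

lemma sqnorm_diff_le:
  fixes f g :: "'a \<Rightarrow> 'b::euclidean_space"
  assumes [measurable]: "f \<in> borel_measurable M" "g \<in> borel_measurable M"
  shows "sqnorm M (\<lambda>x. f x - g x) \<le> 2 * sqnorm M f + 2 * sqnorm M g"
  using sqnorm_add[of f M "\<lambda>x. - g x"] by (simp add: sqnorm_def)

lemma sqnorm_parallelogram:
  fixes f g :: "'a \<Rightarrow> 'b::euclidean_space"
  assumes [measurable]: "f \<in> borel_measurable M" "g \<in> borel_measurable M"
  shows "sqnorm M (\<lambda>x. f x - g x) + sqnorm M (\<lambda>x. f x + g x) = 2 * sqnorm M f + 2 * sqnorm M g"
proof -
  have "sqnorm M (\<lambda>x. f x - g x) + sqnorm M (\<lambda>x. f x + g x)
     = (\<integral>\<^sup>+x. ennreal ((norm (f x - g x))\<^sup>2) + ennreal ((norm (f x + g x))\<^sup>2) \<partial>M)"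
    unfolding sqnorm_def by (subst nn_integral_add) auto
  also have "\<dots> = (\<integral>\<^sup>+x. 2 * ennreal ((norm (f x))\<^sup>2) + 2 * ennreal ((norm (g x))\<^sup>2) \<partial>M)"
  proof (intro nn_integral_cong)
    fix x
    have "(norm (f x - g x))\<^sup>2 + (norm (f x + g x))\<^sup>2 = 2 * (norm (f x))\<^sup>2 + 2 * (norm (g x))\<^sup>2"
      by (simp add: power2_norm_eq_inner inner_simps algebra_simps inner_commute)
    then have "ennreal ((norm (f x - g x))\<^sup>2 + (norm (f x + g x))\<^sup>2) =
      ennreal (2 * (norm (f x))\<^sup>2 + 2 * (norm (g x))\<^sup>2)" by simp
    then show "ennreal ((norm (f x - g x))\<^sup>2) + ennreal ((norm (f x + g x))\<^sup>2)
       = 2 * ennreal ((norm (f x))\<^sup>2) + 2 * ennreal ((norm (g x))\<^sup>2)"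
      by (simp add: ennreal_plus ennreal_mult)
  qed
  also have "\<dots> = 2 * sqnorm M f + 2 * sqnorm M g"
    unfolding sqnorm_def by (simp add: nn_integral_add nn_integral_cmult)
  finally show ?thesis .
qed

text \<open>Dropping the difference term from the parallelogram law leaves midpoint convexity.
  Midpoints are the only convex combinations that the Hilbert space argument below uses.\<close>

lemma sqnorm_midpoint_le:
  fixes f g :: "'a \<Rightarrow> 'b::euclidean_space"
  assumes [measurable]: "f \<in> borel_measurable M" "g \<in> borel_measurable M"
    and "sqnorm M f \<le> c" "sqnorm M g \<le> c"
  shows "sqnorm M (\<lambda>x. (1/2) *\<^sub>R (f x + g x)) \<le> c"
proof -
  have "4 * sqnorm M (\<lambda>x. (1/2) *\<^sub>R (f x + g x)) = ennreal (4 * (1/2)\<^sup>2) * sqnorm M (\<lambda>x. f x + g x)"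
    by (subst sqnorm_scaleR) (auto simp: mult.assoc[symmetric] ennreal_mult[symmetric] simp flip: ennreal_numeral)
  also have "\<dots> \<le> sqnorm M (\<lambda>x. f x - g x) + sqnorm M (\<lambda>x. f x + g x)"
    by (simp add: power2_eq_square)
  also have "\<dots> \<le> 2 * c + 2 * c"
    unfolding sqnorm_parallelogram[OF assms(1,2)] using assms by (intro add_mono mult_left_mono) auto
  also have "\<dots> = 4 * c"
    by (simp flip: distrib_right)
  finally show ?thesis
    by (subst (asm) ennreal_mult_le_mult_iff) auto
qed

lemma L2_add: "f \<in> L2 M \<Longrightarrow> g \<in> L2 M \<Longrightarrow> (\<lambda>x. f x + g x) \<in> L2 M"
  using sqnorm_add[of f M g] unfolding L2_iff_sqnorm
  by (auto simp: ennreal_mult_less_top order.strict_trans1 elim!: order.strict_trans1)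

lemma L2_scaleR: "f \<in> L2 M \<Longrightarrow> (\<lambda>x. c *\<^sub>R f x) \<in> L2 M"
  unfolding L2_iff_sqnorm by (auto simp: sqnorm_scaleR ennreal_mult_less_top)

lemma L2_diff: "f \<in> L2 M \<Longrightarrow> g \<in> L2 M \<Longrightarrow> (\<lambda>x. f x - g x) \<in> L2 M"
  using L2_add[of f M "\<lambda>x. (-1) *\<^sub>R g x"] L2_scaleR[of g M "-1"] by simp

lemma L2_bounded_linear:
  fixes T :: "'b::euclidean_space \<Rightarrow> 'c::euclidean_space"
  assumes "f \<in> L2 M" "\<And>x. norm (T x) \<le> norm x" "T \<in> borel_measurable borel"
  shows "(\<lambda>x. T (f x)) \<in> L2 M"
  using assms sqnorm_mono[of M "\<lambda>x. T (f x)" f] unfolding L2_iff_sqnorm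
  by (auto intro: measurable_compose elim: order.strict_trans1)

section \<open>Completeness and almost everywhere convergence\<close>

lemma ennreal_LIMSEQ_0_I:
  assumes "\<And>e::real. 0 < e \<Longrightarrow> \<exists>N. \<forall>n\<ge>N. X n \<le> ennreal e"
  shows "X \<longlonglongrightarrow> 0"
proof (rule order_tendstoI)
  fix a :: ennreal assume "0 < a"
  then obtain e where e: "0 < ennreal e" "ennreal e < a"
    by (metis ennreal_enn2real ennreal_enn2real_if ennreal_less_top dense less_top order.strict_trans)
  then have "0 < e" by (simp add: ennreal_less_zero_iff)
  with assms obtain N where "\<forall>n\<ge>N. X n \<le> ennreal e" by blast
  then show "\<forall>\<^sub>F n in sequentially. X n < a"
    using e by (auto simp: eventually_sequentially intro!: exI[of _ N] elim: order.strict_trans1)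
qed auto

lemma ennreal_LIMSEQ_0_D:
  assumes "X \<longlonglongrightarrow> 0" "0 < (e::real)"
  shows "\<exists>N::nat. \<forall>n\<ge>N. X n \<le> ennreal e"
proof -
  have "\<forall>\<^sub>F n in sequentially. X n < ennreal e"
    using assms by (intro order_tendstoD) (auto simp: ennreal_less_zero_iff)
  then show ?thesis by (auto simp: eventually_sequentially intro: less_imp_le)
qed

text \<open>\<open>P k m n\<close> stands for closeness of the terms \<open>m\<close> and
  \<open>n\<close> at a scale attached to \<open>k\<close>; this is the passage from a Cauchy
  sequence to a rapidly convergent subsequence. The maximum in the recursion secures strict growth
  and the next threshold at once.\<close>

lemma exists_fast_subseq:
  fixes P :: "nat \<Rightarrow> nat \<Rightarrow> nat \<Rightarrow> bool"
  assumes "\<And>k. \<exists>N. \<forall>m\<ge>N. \<forall>n\<ge>N. P k m n"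
  shows "\<exists>r. strict_mono r \<and> (\<forall>k. \<forall>m\<ge>r k. \<forall>n\<ge>r k. P k m n)"
proof -
  obtain N where N: "\<And>k m n. m \<ge> N k \<Longrightarrow> n \<ge> N k \<Longrightarrow> P k m n" using assms by metis
  define r where "r = rec_nat (N 0) (\<lambda>k a. max (Suc a) (N (Suc k)))"
  have r: "r 0 = N 0" "\<And>k. r (Suc k) = max (Suc (r k)) (N (Suc k))" by (simp_all add: r_def)
  have "strict_mono r" by (rule strict_monoI_Suc) (simp add: r less_max_iff_disj)
  moreover have "N k \<le> r k" for k by (cases k) (auto simp: r)
  ultimately show ?thesis using N order_trans by blast
qed

text \<open>The weight \<open>2^n\<close> is small enough against \<open>(1/8)^n\<close> for the
  weighted sum of squared increments to have a finite integral, and large enough that finiteness of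
  that sum at a point makes the increments there decay geometrically. A point of the union lies in
  \<open>S n\<close> from some index on, and only the tail matters; this allows estimates that hold
  merely on the sets of an exhaustion.\<close>

lemma sqnorm_fast_AE_convergent:
  fixes f :: "nat \<Rightarrow> 'a \<Rightarrow> 'b::euclidean_space"
  assumes [measurable]: "\<And>n. f n \<in> borel_measurable M" "\<And>n. S n \<in> sets M"
    and mono: "\<And>n. S n \<subseteq> S (Suc n)"
    and fast: "\<And>n. (\<integral>\<^sup>+x. ennreal ((norm (f (Suc n) x - f n x))\<^sup>2) * indicator (S n) x \<partial>M) \<le> ennreal ((1/8)^n)"
  shows "AE x in M. x \<in> (\<Union>n. S n) \<longrightarrow> convergent (\<lambda>n. f n x)"
proof -
  let ?g = "\<lambda>n x. ennreal (2^n) * (ennreal ((norm (f (Suc n) x - f n x))\<^sup>2) * indicator (S n) x)"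
  have "(\<integral>\<^sup>+x. (\<Sum>n. ?g n x) \<partial>M) = (\<Sum>n. ennreal (2^n) * (\<integral>\<^sup>+x. ennreal ((norm (f (Suc n) x - f n x))\<^sup>2) * indicator (S n) x \<partial>M))"
    by (subst nn_integral_suminf) (auto simp: nn_integral_cmult)
  also have "\<dots> \<le> (\<Sum>n. ennreal ((1/4)^n))"
  proof (intro suminf_le summableI)
    fix n
    have "ennreal (2^n) * (\<integral>\<^sup>+x. ennreal ((norm (f (Suc n) x - f n x))\<^sup>2) * indicator (S n) x \<partial>M) \<le> ennreal (2^n) * ennreal ((1/8)^n)"
      by (intro mult_left_mono fast) auto
    also have "\<dots> = ennreal ((1/4)^n)"
      by (simp flip: ennreal_mult power_mult_distrib)
    finally show "ennreal (2^n) * (\<integral>\<^sup>+x. ennreal ((norm (f (Suc n) x - f n x))\<^sup>2) * indicator (S n) x \<partial>M) \<le> ennreal ((1/4)^n)" .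
  qed
  also have "\<dots> = ennreal (\<Sum>n. (1/4)^n)" by (intro suminf_ennreal2) auto
  finally have "(\<integral>\<^sup>+x. (\<Sum>n. ?g n x) \<partial>M) \<noteq> \<infinity>" by (auto simp: top_unique)
  then have "AE x in M. (\<Sum>n. ?g n x) \<noteq> \<infinity>"
    by (intro nn_integral_PInf_AE) auto
  then show ?thesis
  proof (rule AE_mp, intro AE_I2 impI)
    fix x assume x: "(\<Sum>n. ?g n x) \<noteq> \<infinity>" "x \<in> (\<Union>n. S n)"
    then obtain N where N: "x \<in> S N" by auto
    have SN: "x \<in> S n" if "n \<ge> N" for n
      using lift_Suc_mono_le[of S, OF mono that] N by auto
    define C where "C = enn2real (\<Sum>n. ?g n x)"
    have C: "(\<Sum>n. ?g n x) = ennreal C" "C \<ge> 0" using x by (auto simp: C_def less_top)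
    have bd: "norm (f (Suc n) x - f n x) \<le> sqrt C * (sqrt (1/2))^n" if "n \<ge> N" for n
    proof -
      have "?g n x \<le> (\<Sum>n. ?g n x)" 
        using sum_le_suminf[of "\<lambda>n. ?g n x" "{n}"] by (auto intro: summableI)
      then have "2^n * (norm (f (Suc n) x - f n x))\<^sup>2 \<le> C"
        using SN[OF that] C by (simp add: ennreal_mult[symmetric] del: ennreal_power)
      then have "(norm (f (Suc n) x - f n x))\<^sup>2 \<le> C * (1/2)^n"
        by (simp add: field_simps)
      then have "norm (f (Suc n) x - f n x) \<le> sqrt (C * (1/2)^n)"
        by (rule real_le_rsqrt)
      then show ?thesis by (simp add: real_sqrt_mult real_sqrt_power)
    qed
    have "summable (\<lambda>n. f (Suc n) x - f n x)"
    proof (rule summable_comparison_test_ev)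
      show "\<forall>\<^sub>F n in sequentially. norm (f (Suc n) x - f n x) \<le> sqrt C * (sqrt (1/2))^n"
        using bd by (auto simp: eventually_sequentially)
      show "summable (\<lambda>n. sqrt C * (sqrt (1/2))^n)"
        by (intro summable_mult summable_geometric) (auto simp: real_sqrt_divide)
    qed
    then have "convergent (\<lambda>n. \<Sum>i<n. f (Suc i) x - f i x)" by (simp add: summable_iff_convergent)
    then have "convergent (\<lambda>n. f n x - f 0 x)"
      using sum_lessThan_telescope[of "\<lambda>n. f n x"] by simp
    then have "convergent (\<lambda>n. (f n x - f 0 x) + f 0 x)" by (intro convergent_add convergent_const)
    then show "convergent (\<lambda>n. f n x)" by simp
  qed
qed

lemma sqnorm_Fatou:
  fixes f :: "nat \<Rightarrow> 'a \<Rightarrow> 'b::euclidean_space"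
  assumes [measurable]: "\<And>n. f n \<in> borel_measurable M"
    and "AE x in M. (\<lambda>n. f n x) \<longlonglongrightarrow> g x"
  shows "sqnorm M g \<le> liminf (\<lambda>n. sqnorm M (f n))"
proof -
  have "sqnorm M g = (\<integral>\<^sup>+x. liminf (\<lambda>n. ennreal ((norm (f n x))\<^sup>2)) \<partial>M)"
    unfolding sqnorm_def
  proof (rule nn_integral_cong_AE, use assms(2) in \<open>rule AE_mp\<close>, intro AE_I2 impI)
    fix x assume "(\<lambda>n. f n x) \<longlonglongrightarrow> g x"
    then have "(\<lambda>n. ennreal ((norm (f n x))\<^sup>2)) \<longlonglongrightarrow> ennreal ((norm (g x))\<^sup>2)"
      by (intro tendsto_intros)
    then show "ennreal ((norm (g x))\<^sup>2) = liminf (\<lambda>n. ennreal ((norm (f n x))\<^sup>2))"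
      by (intro lim_imp_Liminf[symmetric]) auto
  qed
  also have "\<dots> \<le> liminf (\<lambda>n. sqnorm M (f n))"
    unfolding sqnorm_def by (rule nn_integral_liminf) simp
  finally show ?thesis .
qed

lemma liminf_le_const:
  fixes X :: "nat \<Rightarrow> ennreal"
  assumes "\<And>n. n \<ge> N \<Longrightarrow> X n \<le> c"
  shows "liminf X \<le> c"
proof -
  have "liminf X \<le> liminf (\<lambda>_. c)"
    using assms by (intro Liminf_mono) (auto simp: eventually_sequentially)
  then show ?thesis by (simp add: Liminf_const)
qed

text \<open>A fast subsequence converges almost everywhere, and Fatou's lemma applied to
  \<open>f n - f (r k)\<close> for growing \<open>k\<close> turns the Cauchy bound into a bound for
  \<open>f n - y\<close>. The last conjunct describes \<open>y\<close> at every point: it is what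
  carries constraints imposed everywhere over to the limit.\<close>

lemma L2_complete:
  fixes f :: "nat \<Rightarrow> 'a \<Rightarrow> 'b::euclidean_space"
  assumes L2: "\<And>n. f n \<in> L2 M"
    and Cauchy: "\<And>e::real. 0 < e \<Longrightarrow> \<exists>N. \<forall>m\<ge>N. \<forall>n\<ge>N. sqnorm M (\<lambda>x. f m x - f n x) \<le> ennreal e"
  shows "\<exists>y r. y \<in> L2 M \<and> L2_converges M f y \<and> strict_mono r \<and>
           (AE x in M. (\<lambda>n. f (r n) x) \<longlonglongrightarrow> y x) \<and>
           (\<forall>x. ((\<lambda>n. f (r n) x) \<longlonglongrightarrow> y x) \<or> y x = 0)"
proof -
  have [measurable]: "\<And>n. f n \<in> borel_measurable M" using L2 by (auto simp: L2_def)
  obtain r where r: "strict_mono r"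
    "\<And>k m n. m \<ge> r k \<Longrightarrow> n \<ge> r k \<Longrightarrow> sqnorm M (\<lambda>x. f m x - f n x) \<le> ennreal ((1/8)^k)"
    using exists_fast_subseq[of "\<lambda>k m n. sqnorm M (\<lambda>x. f m x - f n x) \<le> ennreal ((1/8)^k)"] Cauchy
    by (auto simp: power_one_over)
  \<comment> \<open>Outside the set of convergence the value is \<open>0\<close>, a value that the
    constraint set \<open>S0\<close> contains.\<close>
  define y where "y = (\<lambda>x. if Cauchy (\<lambda>n. f (r n) x) then lim (\<lambda>n. f (r n) x) else 0)"
  have [measurable]: "y \<in> borel_measurable M"
    unfolding y_def by measurable
  have y: "(\<lambda>n. f (r n) x) \<longlonglongrightarrow> y x" if "convergent (\<lambda>n. f (r n) x)" for x
    using that by (auto simp: y_def Cauchy_convergent_iff convergent_LIMSEQ_iff)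
  have y0: "((\<lambda>n. f (r n) x) \<longlonglongrightarrow> y x) \<or> y x = 0" for x
    using y[of x] by (auto simp: y_def Cauchy_convergent_iff)
  have "AE x in M. x \<in> (\<Union>n::nat. space M) \<longrightarrow> convergent (\<lambda>n. f (r n) x)"
  proof (rule sqnorm_fast_AE_convergent)
    fix n
    have "(\<integral>\<^sup>+x. ennreal ((norm (f (r (Suc n)) x - f (r n) x))\<^sup>2) * indicator (space M) x \<partial>M)
       = sqnorm M (\<lambda>x. f (r (Suc n)) x - f (r n) x)"
      unfolding sqnorm_def by (intro nn_integral_cong) auto
    also have "\<dots> \<le> ennreal ((1/8)^n)" using r(1) by (intro r(2)) (auto simp: strict_mono_less_eq)
    finally show "(\<integral>\<^sup>+x. ennreal ((norm (f (r (Suc n)) x - f (r n) x))\<^sup>2) * indicator (space M) x \<partial>M) \<le> ennreal ((1/8)^n)" .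
  qed auto
  then have AE: "AE x in M. (\<lambda>n. f (r n) x) \<longlonglongrightarrow> y x" by (auto intro: y)
  have conv: "L2_converges M f y"
    unfolding L2_converges_sqnorm
  proof (rule ennreal_LIMSEQ_0_I)
    fix e :: real assume "0 < e"
    then obtain N where N: "\<And>m n. m \<ge> N \<Longrightarrow> n \<ge> N \<Longrightarrow> sqnorm M (\<lambda>x. f m x - f n x) \<le> ennreal e"
      using Cauchy by blast
    have "sqnorm M (\<lambda>x. f n x - y x) \<le> ennreal e" if "n \<ge> N" for n
    proof -
      have "sqnorm M (\<lambda>x. f n x - y x) \<le> liminf (\<lambda>k. sqnorm M (\<lambda>x. f n x - f (r k) x))"
        using AE by (intro sqnorm_Fatou) (auto intro!: tendsto_diff)
      also have "\<dots> \<le> ennreal e"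
        using that seq_suble[OF r(1)] by (intro liminf_le_const[of N] N) (auto intro: order_trans)
      finally show ?thesis .
    qed
    then show "\<exists>N. \<forall>n\<ge>N. sqnorm M (\<lambda>x. f n x - y x) \<le> ennreal e" by blast
  qed
  have "y \<in> L2 M"
  proof -
    obtain N where "sqnorm M (\<lambda>x. f N x - y x) \<le> ennreal 1"
      using ennreal_LIMSEQ_0_D[of "\<lambda>k. sqnorm M (\<lambda>x. f k x - y x)" 1] conv by (auto simp: L2_converges_sqnorm)
    then have "(\<lambda>x. f N x - y x) \<in> L2 M" by (auto simp: L2_iff_sqnorm elim: order.strict_trans1)
    from L2_diff[OF L2[of N] this] show ?thesis by simp
  qed
  with conv r(1) AE y0 show ?thesis by blast
qed

text \<open>Only the differences \<open>f n - g\<close> have to be square integrable, and only from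
  some index \<open>N\<close> on, whence the shift. Their squares then tend to \<open>0\<close> in
  the L^1 sense, for which an almost everywhere convergent subsequence is available.\<close>

lemma L2_converges_AE_subseq:
  fixes f :: "nat \<Rightarrow> 'a \<Rightarrow> 'b::euclidean_space"
  assumes [measurable]: "\<And>n. f n \<in> borel_measurable M" "g \<in> borel_measurable M"
    and "L2_converges M f g"
  shows "\<exists>r. strict_mono r \<and> (AE x in M. (\<lambda>n. f (r n) x) \<longlonglongrightarrow> g x)"
proof -
  obtain N where N: "\<And>n. n \<ge> N \<Longrightarrow> sqnorm M (\<lambda>x. f n x - g x) \<le> ennreal 1"
    using ennreal_LIMSEQ_0_D[of "\<lambda>k. sqnorm M (\<lambda>x. f k x - g x)" 1] assms(3) by (auto simp: L2_converges_sqnorm)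
  define u where "u n x = (norm (f (n + N) x - g x))\<^sup>2" for n x
  have L: "(\<lambda>x. f (n + N) x - g x) \<in> L2 M" for n
    using N[of "n + N"] by (auto simp: L2_iff_sqnorm elim: order.strict_trans1)
  have int: "integrable M (u n)" for n using L[of n] by (simp add: L2_def u_def[abs_def])
  have "(\<lambda>n. ennreal (\<integral>x. u n x \<partial>M)) \<longlonglongrightarrow> ennreal 0"
    using LIMSEQ_ignore_initial_segment[OF assms(3)[unfolded L2_converges_sqnorm], of N] 
    by (simp add: sqnorm_eq_integral[OF L] u_def)
  moreover have nonneg: "0 \<le> u n x" for n x by (simp add: u_def)
  ultimately have "(\<lambda>n. \<integral>x. u n x \<partial>M) \<longlonglongrightarrow> 0"
    by (subst (asm) tendsto_ennreal_iff) (auto intro: Bochner_Integration.integral_nonneg)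
  moreover have "norm (u n x) = u n x" for n x by (simp add: u_def)
  ultimately have "(\<lambda>n. \<integral>x. norm (u n x) \<partial>M) \<longlonglongrightarrow> 0" by simp
  from tendsto_L1_AE_subseq[OF int this] obtain r where r: "strict_mono r" "AE x in M. (\<lambda>n. u (r n) x) \<longlonglongrightarrow> 0"
    by blast
  have "AE x in M. (\<lambda>n. f (r n + N) x) \<longlonglongrightarrow> g x"
    using r(2)
  proof (rule AE_mp, intro AE_I2 impI)
    fix x assume "(\<lambda>n. u (r n) x) \<longlonglongrightarrow> 0"
    then have "(\<lambda>n. sqrt (u (r n) x)) \<longlonglongrightarrow> sqrt 0" by (intro tendsto_intros)
    then have "(\<lambda>n. f (r n + N) x - g x) \<longlonglongrightarrow> 0" by (simp add: u_def tendsto_norm_zero_iff)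
    then show "(\<lambda>n. f (r n + N) x) \<longlonglongrightarrow> g x" by (simp add: LIM_zero_iff)
  qed
  moreover have "strict_mono (\<lambda>n. r n + N)" using r(1) by (auto simp: strict_mono_def)
  ultimately show ?thesis by blast
qed

lemma L2_converges_sqnorm_le:
  fixes f :: "nat \<Rightarrow> 'a \<Rightarrow> 'b::euclidean_space"
  assumes [measurable]: "\<And>n. f n \<in> borel_measurable M" "g \<in> borel_measurable M"
    and "L2_converges M f g" and le: "\<And>n. n \<ge> N \<Longrightarrow> sqnorm M (f n) \<le> c"
  shows "sqnorm M g \<le> c"
proof -
  obtain r where r: "strict_mono r" "AE x in M. (\<lambda>n. f (r n) x) \<longlonglongrightarrow> g x"
    using L2_converges_AE_subseq[OF assms(1-3)] by blast
  have "sqnorm M g \<le> liminf (\<lambda>n. sqnorm M (f (r n)))" using r by (intro sqnorm_Fatou) auto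
  also have "\<dots> \<le> c" using seq_suble[OF r(1)] by (intro liminf_le_const[of N] le) (auto intro: order_trans)
  finally show ?thesis .
qed


text \<open>
  The Hilbert space argument behind Mazur's lemma: elements of almost minimal norm of decreasing
  convex sets form a Cauchy sequence by the parallelogram law.
\<close>

lemma L2_nested_convex:
  fixes C :: "nat \<Rightarrow> ('a \<Rightarrow> 'b::euclidean_space) set"
  assumes sub: "\<And>n. C n \<subseteq> L2 M" and dec: "\<And>n. C (Suc n) \<subseteq> C n"
    and mid: "\<And>n f g. f \<in> C n \<Longrightarrow> g \<in> C n \<Longrightarrow> (\<lambda>x. (1/2) *\<^sub>R (f x + g x)) \<in> C n"
    and bdd: "\<And>n. \<exists>f\<in>C n. sqnorm M f \<le> ennreal R"
  shows "\<exists>y z. (\<forall>n. y n \<in> C n) \<and> z \<in> L2 M \<and> L2_converges M y z \<and>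
           (AE x in M. (\<lambda>n. y n x) \<longlonglongrightarrow> z x) \<and>
           (\<forall>x. ((\<lambda>n. y n x) \<longlonglongrightarrow> z x) \<or> z x = 0) \<and>
           (\<forall>w. (\<forall>n. w \<in> C n) \<longrightarrow> sqnorm M z \<le> sqnorm M w)"
proof -
  define d where "d n = (INF f\<in>C n. sqnorm M f)" for n
  define e where "e n = enn2real (d n)" for n
  have dR: "d n \<le> ennreal R" for n
    using bdd[of n] by (auto simp: d_def intro: INF_lower2)
  have de: "d n = ennreal (e n)" for n 
    using dR[of n] by (simp add: e_def less_top top_unique le_less_trans[OF _ ennreal_less_top])
  have e0: "0 \<le> e n" for n by (simp add: e_def)
  \<comment> \<open>Smaller sets have larger infima; bounded by \<open>R\<close>, the infima
    increase to a limit \<open>D\<close>, so that elements of nearly minimal norm all have squared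
    norm close to \<open>D\<close>.\<close>
  have d_inc: "d n \<le> d (Suc n)" for n
    unfolding d_def by (intro INF_superset_mono dec) auto
  then have e_inc: "incseq e"
    using e0 by (intro incseq_SucI) (simp add: de)
  have eR: "e n \<le> max R 0" for n 
    using dR[of n] e0[of n] unfolding de by (auto simp: ennreal_le_iff2)
  obtain D where D: "e \<longlonglongrightarrow> D" "\<And>n. e n \<le> D"
    using incseq_convergent[OF e_inc, of "max R 0"] eR by auto
  have "\<exists>f\<in>C n. sqnorm M f < ennreal (e n + 1 / Suc n)" for n
  proof -
    have "d n < ennreal (e n + 1 / Suc n)" using e0[of n] by (simp add: de ennreal_less_iff)
    then show ?thesis unfolding d_def INF_less_iff .
  qed
  then obtain y0 where y0: "\<And>n. y0 n \<in> C n" "\<And>n. sqnorm M (y0 n) < ennreal (e n + 1 / Suc n)"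
    by metis
  have y0L: "y0 n \<in> L2 M" for n using y0(1) sub by blast
  then have [measurable]: "y0 n \<in> borel_measurable M" for n by (simp add: L2_def)
  have dec': "C n \<subseteq> C m" if "m \<le> n" for m n using lift_Suc_antimono_le[of C, OF dec that] .
  have diff: "sqnorm M (\<lambda>x. y0 m x - y0 n x) \<le> ennreal (4 * (D - e N) + 4 / Suc N)" if mn: "N \<le> m" "N \<le> n" for m n N
  proof -
    \<comment> \<open>The midpoint of two late terms lies in \<open>C N\<close>, so its squared norm
      is at least \<open>e N\<close>. The parallelogram law then leaves for the difference at most
      the gap between \<open>D\<close> and \<open>e N\<close>, up to the slack
      \<open>1 / Suc N\<close>.\<close>
    let ?h = "\<lambda>x. (1/2) *\<^sub>R (y0 m x + y0 n x)"
    have "?h \<in> C N" using mid dec' mn y0(1) by blast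
    then have "ennreal (e N) \<le> sqnorm M ?h" unfolding de[symmetric] d_def by (rule INF_lower)
    then have h: "4 * ennreal (e N) \<le> 4 * sqnorm M ?h" by (rule mult_left_mono) auto
    have h4: "4 * sqnorm M ?h = sqnorm M (\<lambda>x. y0 m x + y0 n x)"
      by (subst sqnorm_scaleR) (auto simp: mult.assoc[symmetric] power2_eq_square ennreal_mult[symmetric] simp flip: ennreal_numeral)
    have le: "sqnorm M (y0 k) \<le> ennreal (D + 1 / Suc N)" if "N \<le> k" for k
    proof -
      have "e k + 1 / Suc k \<le> D + 1 / Suc N"
        using D(2)[of k] that by (intro add_mono) (auto simp: frac_le)
      then show ?thesis using y0(2)[of k] by (meson ennreal_leI less_imp_le order_trans)
    qed
    have "sqnorm M (\<lambda>x. y0 m x - y0 n x) + 4 * ennreal (e N)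
        \<le> sqnorm M (\<lambda>x. y0 m x - y0 n x) + sqnorm M (\<lambda>x. y0 m x + y0 n x)"
      using h unfolding h4 by (intro add_left_mono)
    also have "\<dots> = 2 * sqnorm M (y0 m) + 2 * sqnorm M (y0 n)" by (intro sqnorm_parallelogram) auto
    also have "\<dots> \<le> 2 * ennreal (D + 1 / Suc N) + 2 * ennreal (D + 1 / Suc N)"
      using mn by (intro add_mono mult_left_mono le) auto
    also have "\<dots> = ennreal (4 * D + 4 / Suc N)"
    proof -
      have "2 * (D + 1 / Suc N) + 2 * (D + 1 / Suc N) = 4 * D + 4 / Suc N" by simp
      moreover have "0 \<le> D + 1 / Suc N" using D(2)[of 0] e0[of 0] by simp
      ultimately show ?thesis by (simp flip: ennreal_plus ennreal_mult ennreal_numeral)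
    qed
    finally have "sqnorm M (\<lambda>x. y0 m x - y0 n x) + ennreal (4 * e N) \<le> ennreal (4 * D + 4 / Suc N)"
      using e0[of N] by (simp add: ennreal_mult)
    then show ?thesis
      using e0[of N] D(2)[of N]
      by (cases "sqnorm M (\<lambda>x. y0 m x - y0 n x)") (auto simp flip: ennreal_plus simp: algebra_simps top_unique)
  qed
  have "\<exists>N. \<forall>m\<ge>N. \<forall>n\<ge>N. sqnorm M (\<lambda>x. y0 m x - y0 n x) \<le> ennreal \<epsilon>" if "0 < \<epsilon>" for \<epsilon>
  proof -
    have "(\<lambda>N. 4 * (D - e N) + 4 * (1 / Suc N)) \<longlonglongrightarrow> 4 * (D - D) + 4 * 0"
      by (intro tendsto_intros D LIMSEQ_Suc lim_1_over_n)
    then have "\<forall>\<^sub>F N in sequentially. 4 * (D - e N) + 4 * (1 / Suc N) < \<epsilon>"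
      using that by (intro order_tendstoD) auto
    then obtain N where N: "4 * (D - e N) + 4 * (1 / Suc N) < \<epsilon>" by (auto simp: eventually_sequentially)
    show ?thesis
    proof (intro exI allI impI)
      fix m n assume mn: "N \<le> m" "N \<le> n"
      have "ennreal (4 * (D - e N) + 4 / Suc N) \<le> ennreal \<epsilon>" using N by (intro ennreal_leI) auto
      with diff[OF mn] show "sqnorm M (\<lambda>x. y0 m x - y0 n x) \<le> ennreal \<epsilon>" by (rule order_trans)
    qed
  qed
  from L2_complete[OF y0L this] obtain z r where z: "z \<in> L2 M" "L2_converges M y0 z" "strict_mono r"
    "AE x in M. (\<lambda>n. y0 (r n) x) \<longlonglongrightarrow> z x" "\<And>x. (\<lambda>n. y0 (r n) x) \<longlonglongrightarrow> z x \<or> z x = 0"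
    by blast
  have conv: "L2_converges M (\<lambda>n. y0 (r n)) z"
    using LIMSEQ_subseq_LIMSEQ[OF z(2)[unfolded L2_converges_sqnorm] z(3)] by (simp add: L2_converges_sqnorm o_def)
  \<comment> \<open>The subsequence may be used in place of the sequence because \<open>r n\<close>
    is at least \<open>n\<close> and the sets decrease.\<close>
  have inC: "y0 (r n) \<in> C n" for n using y0(1) dec' seq_suble[OF z(3)] by blast
  \<comment> \<open>For a constant sequence of sets this says that \<open>z\<close> has least norm,
    which makes the lemma usable as a projection theorem.\<close>
  have min: "sqnorm M z \<le> sqnorm M w" if w: "\<And>n. w \<in> C n" for w
  proof -
    have "sqnorm M z \<le> liminf (\<lambda>n. sqnorm M (y0 (r n)))" using z(4) by (intro sqnorm_Fatou) auto
    also have "\<dots> \<le> liminf (\<lambda>n. ennreal (D + 1 / Suc (r n)))"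
    proof (intro Liminf_mono always_eventually allI)
      fix n show "sqnorm M (y0 (r n)) \<le> ennreal (D + 1 / Suc (r n))"
        using D(2)[of "r n"] by (intro order_trans[OF less_imp_le[OF y0(2)]] ennreal_leI) auto
    qed
    also have "(\<lambda>n. ennreal (D + 1 / Suc (r n))) \<longlonglongrightarrow> ennreal (D + 0)"
      by (intro tendsto_intros tendsto_ennrealI LIMSEQ_subseq_LIMSEQ[OF LIMSEQ_Suc[OF lim_1_over_n] z(3), unfolded o_def])
    then have "liminf (\<lambda>n. ennreal (D + 1 / Suc (r n))) = ennreal (D + 0)"
      by (intro lim_imp_Liminf) auto
    also have "ennreal (D + 0) \<le> sqnorm M w"
    proof -
      have "ennreal (e n) \<le> sqnorm M w" for n unfolding de[symmetric] d_def using w by (intro INF_lower)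
      moreover have "(\<lambda>n. ennreal (e n)) \<longlonglongrightarrow> ennreal (D + 0)" using D(1) by (auto intro: tendsto_ennrealI)
      ultimately show ?thesis by (intro LIMSEQ_le_const2) auto
    qed
    finally show ?thesis .
  qed
  show ?thesis
    using inC z(1,4,5) conv min by (intro exI[of _ "\<lambda>n. y0 (r n)"] exI[of _ z]) auto
qed

section \<open>Pairing of square integrable functions\<close>

lemma L2_pairing:
  fixes f :: "'a \<Rightarrow> 'b::euclidean_space" and \<phi> :: "'a \<Rightarrow> real"
  assumes "\<phi> \<in> L2 M" "f \<in> L2 M"
  shows "integrable M (\<lambda>x. \<phi> x *\<^sub>R f x)" (is ?I)
    and "ennreal ((norm (\<integral>x. \<phi> x *\<^sub>R f x \<partial>M))\<^sup>2) \<le> sqnorm M \<phi> * sqnorm M f" (is ?C)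
proof -
  have [measurable]: "\<phi> \<in> borel_measurable M" "f \<in> borel_measurable M" using assms by (auto simp: L2_def)
  have *: "(\<integral>\<^sup>+x. ennreal (norm (\<phi> x *\<^sub>R f x)) \<partial>M)\<^sup>2 \<le> sqnorm M \<phi> * sqnorm M f"
    using Cauchy_Schwarz_nn_integral[of "\<lambda>x. ennreal (norm (\<phi> x))" M "\<lambda>x. ennreal (norm (f x))"]
    by (simp add: sqnorm_def ennreal_mult ennreal_power)
  also have "\<dots> < \<infinity>" using assms by (simp add: L2_iff_sqnorm ennreal_mult_less_top)
  finally have "(\<integral>\<^sup>+x. ennreal (norm (\<phi> x *\<^sub>R f x)) \<partial>M) < \<infinity>"
    by (auto simp: power2_eq_square ennreal_mult_less_top)
  then show I: ?I by (simp add: integrable_iff_bounded)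
  have "ennreal ((norm (\<integral>x. \<phi> x *\<^sub>R f x \<partial>M))\<^sup>2) = (ennreal (norm (\<integral>x. \<phi> x *\<^sub>R f x \<partial>M)))\<^sup>2"
    by (simp add: ennreal_power)
  also have "\<dots> \<le> (\<integral>\<^sup>+x. ennreal (norm (\<phi> x *\<^sub>R f x)) \<partial>M)\<^sup>2"
    using I by (intro power_mono integral_norm_bound_ennreal) auto
  finally show ?C using * by (rule order_trans)
qed

lemma L2_converges_pairing:
  fixes f :: "nat \<Rightarrow> 'a \<Rightarrow> 'b::euclidean_space" and \<phi> :: "'a \<Rightarrow> real"
  assumes "\<phi> \<in> L2 M" "\<And>n. f n \<in> L2 M" "g \<in> L2 M" "L2_converges M f g"
  shows "(\<lambda>n. \<integral>x. \<phi> x *\<^sub>R f n x \<partial>M) \<longlonglongrightarrow> (\<integral>x. \<phi> x *\<^sub>R g x \<partial>M)"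
proof -
  have "(\<lambda>n. sqnorm M \<phi> * sqnorm M (\<lambda>x. f n x - g x)) \<longlonglongrightarrow> sqnorm M \<phi> * 0"
    using assms(4) L2_sqnorm_finite[OF assms(1)] unfolding L2_converges_sqnorm
    by (intro ennreal_tendsto_cmult) auto
  moreover have "ennreal ((norm ((\<integral>x. \<phi> x *\<^sub>R f n x \<partial>M) - (\<integral>x. \<phi> x *\<^sub>R g x \<partial>M)))\<^sup>2)
      \<le> sqnorm M \<phi> * sqnorm M (\<lambda>x. f n x - g x)" for n
    using L2_pairing(2)[OF assms(1) L2_diff[OF assms(2)[of n] assms(3)]]
    using L2_pairing(1)[OF assms(1) assms(2)[of n]] L2_pairing(1)[OF assms(1) assms(3)]
    by (simp add: scaleR_diff_right)
  ultimately have "(\<lambda>n. ennreal ((norm ((\<integral>x. \<phi> x *\<^sub>R f n x \<partial>M) - (\<integral>x. \<phi> x *\<^sub>R g x \<partial>M)))\<^sup>2)) \<longlonglongrightarrow> ennreal 0"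
    using tendsto_sandwich[OF _ _ tendsto_const[of 0],
        of "\<lambda>n. ennreal ((norm ((\<integral>x. \<phi> x *\<^sub>R f n x \<partial>M) - (\<integral>x. \<phi> x *\<^sub>R g x \<partial>M)))\<^sup>2)"
           sequentially "\<lambda>n. sqnorm M \<phi> * sqnorm M (\<lambda>x. f n x - g x)"]
    by simp
  then have "(\<lambda>n. (norm ((\<integral>x. \<phi> x *\<^sub>R f n x \<partial>M) - (\<integral>x. \<phi> x *\<^sub>R g x \<partial>M)))\<^sup>2) \<longlonglongrightarrow> 0"
    by (subst (asm) tendsto_ennreal_iff) auto
  then have "(\<lambda>n. sqrt ((norm ((\<integral>x. \<phi> x *\<^sub>R f n x \<partial>M) - (\<integral>x. \<phi> x *\<^sub>R g x \<partial>M)))\<^sup>2)) \<longlonglongrightarrow> sqrt 0"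
    by (intro tendsto_intros)
  then show ?thesis by (simp add: tendsto_norm_zero_iff LIM_zero_iff)
qed

section \<open>Test functions\<close>

lemma partial_eqI: "(f has_derivative f') (at x) \<Longrightarrow> partial i f x = f' (axis i 1)"
  unfolding partial_def using frechet_derivative_at by metis

lemma Ck_Suc_imp_Ck: "Ck (Suc k) f \<Longrightarrow> Ck k f"
proof (induction k arbitrary: f)
  case 0
  then show ?case
    by (auto intro!: continuous_at_imp_continuous_on differentiable_imp_continuous_within)
qed auto

lemma Ck_const: 
  fixes c :: "'b::real_normed_vector"
  shows "Ck k (\<lambda>_::real^'n::finite. c)"
proof (induction k arbitrary: c)
  case (Suc k)
  have "partial i (\<lambda>_::real^'n. c) = (\<lambda>_. 0)" for i
    by (rule ext, rule partial_eqI) (auto intro: derivative_eq_intros)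
  with Suc show ?case by simp
qed simp

lemma Ck_add: "Ck k f \<Longrightarrow> Ck k g \<Longrightarrow> Ck k (\<lambda>x. f x + g x)"
proof (induction k arbitrary: f g)
  case (Suc k)
  have "partial i (\<lambda>x. f x + g x) = (\<lambda>x. partial i f x + partial i g x)" for i
  proof
    fix x
    have "(f has_derivative frechet_derivative f (at x)) (at x)" "(g has_derivative frechet_derivative g (at x)) (at x)"
      using Suc.prems by (auto simp: frechet_derivative_works)
    then show "partial i (\<lambda>x. f x + g x) x = partial i f x + partial i g x"
      using partial_eqI[OF has_derivative_add] by (simp add: partial_def)
  qed
  with Suc show ?case by (auto intro: differentiable_add)
qed (auto intro: continuous_on_add)

lemma Ck_scaleR:
  fixes f :: "real^'n::finite \<Rightarrow> real" and g :: "real^'n \<Rightarrow> 'b::real_normed_vector"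
  shows "Ck k f \<Longrightarrow> Ck k g \<Longrightarrow> Ck k (\<lambda>x. f x *\<^sub>R g x)"
proof (induction k arbitrary: f g)
  case (Suc k)
  have "partial i (\<lambda>x. f x *\<^sub>R g x) = (\<lambda>x. f x *\<^sub>R partial i g x + partial i f x *\<^sub>R g x)" for i
  proof
    fix x
    have "(f has_derivative frechet_derivative f (at x)) (at x)" "(g has_derivative frechet_derivative g (at x)) (at x)"
      using Suc.prems by (auto simp: frechet_derivative_works)
    then show "partial i (\<lambda>x. f x *\<^sub>R g x) x = f x *\<^sub>R partial i g x + partial i f x *\<^sub>R g x"
      using partial_eqI[OF has_derivative_scaleR] by (simp add: partial_def)
  qed
  moreover have "Ck k (\<lambda>x. f x *\<^sub>R partial i g x + partial i f x *\<^sub>R g x)" for i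
    using Suc.prems Ck_Suc_imp_Ck[of k f] Ck_Suc_imp_Ck[of k g] by (intro Ck_add Suc.IH) auto
  ultimately show ?case using Suc.prems by (auto intro: differentiable_scaleR)
qed (auto intro: continuous_on_scaleR)

lemma Ck_affine:
  fixes f :: "real^'n::finite \<Rightarrow> 'b::real_normed_vector"
  shows "Ck k f \<Longrightarrow> Ck k (\<lambda>x. f (c *\<^sub>R (x - p)))"
proof (induction k arbitrary: f)
  case 0
  then show ?case by (auto intro!: continuous_on_compose2[of UNIV f] continuous_intros)
next
  case (Suc k)
  have d: "((\<lambda>x. f (c *\<^sub>R (x - p))) has_derivative (\<lambda>v. frechet_derivative f (at (c *\<^sub>R (x - p))) (c *\<^sub>R v))) (at x)" for x
  proof (rule has_derivative_compose[of "\<lambda>x. c *\<^sub>R (x - p)" "\<lambda>v. c *\<^sub>R v"])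
    show "((\<lambda>x. c *\<^sub>R (x - p)) has_derivative (*\<^sub>R) c) (at x)"
      by (auto intro!: derivative_eq_intros)
    show "(f has_derivative frechet_derivative f (at (c *\<^sub>R (x - p)))) (at (c *\<^sub>R (x - p)))"
      using Suc.prems by (auto simp: frechet_derivative_works)
  qed
  have "partial i (\<lambda>x. f (c *\<^sub>R (x - p))) = (\<lambda>x. c *\<^sub>R partial i f (c *\<^sub>R (x - p)))" for i
  proof
    fix x
    have "linear (frechet_derivative f (at (c *\<^sub>R (x - p))))"
      using Suc.prems by (auto intro: linear_frechet_derivative)
    then show "partial i (\<lambda>x. f (c *\<^sub>R (x - p))) x = c *\<^sub>R partial i f (c *\<^sub>R (x - p))"
      by (simp add: partial_eqI[OF d] partial_def linear_scale)
  qed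
  moreover have "Ck k (\<lambda>x. c *\<^sub>R partial i f (c *\<^sub>R (x - p)))" for i
    by (intro Ck_scaleR Ck_const Suc.IH) (use Suc.prems in simp)
  moreover have "(\<lambda>x. f (c *\<^sub>R (x - p))) differentiable at x" for x
    unfolding differentiable_def using d by blast
  ultimately show ?case by simp
qed

text \<open>All derivatives of a one-variable function are supplied at once as the sequence
  \<open>h\<close>, so that differentiating merely shifts the index \<open>k\<close> and the
  induction on \<open>m\<close> goes through.\<close>

lemma Ck_component:
  fixes h :: "nat \<Rightarrow> real \<Rightarrow> real" and j :: "'n::finite"
  assumes h: "\<And>k t. (h k has_real_derivative h (Suc k) t) (at t)"
  shows "Ck m (\<lambda>x. h k (x $ j))"
proof (induction m arbitrary: k)
  case (0 k)
  have c: "continuous_on UNIV (h k)"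
    using h by (intro continuous_at_imp_continuous_on) (auto intro: DERIV_isCont)
  then show ?case
    using continuous_on_compose2[OF c linear_continuous_on[OF bounded_linear_vec_nth[of j]], of UNIV] by simp
next
  case (Suc m k)
  have d: "((\<lambda>x. h k (x $ j)) has_derivative (\<lambda>v. h (Suc k) (x $ j) * v $ j)) (at x)" for x
    using has_derivative_compose[OF bounded_linear_imp_has_derivative[OF bounded_linear_vec_nth]
        h[unfolded has_field_derivative_def]] .
  have "partial i (\<lambda>x. h k (x $ j)) = (\<lambda>x. (if i = j then 1 else 0) *\<^sub>R h (Suc k) (x $ j))" for i
    by (rule ext, subst partial_eqI[OF d]) (auto simp: axis_def)
  moreover have "Ck m (\<lambda>x. (if i = j then 1 else 0) *\<^sub>R h (Suc k) (x $ j))" for i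
    by (intro Ck_scaleR Ck_const Suc.IH)
  moreover have "(\<lambda>x. h k (x $ j)) differentiable at x" for x
    unfolding differentiable_def using d by blast
  ultimately show ?case by simp
qed

lemma smooth_const: "smooth (\<lambda>_. c)"
  and smooth_add: "smooth f \<Longrightarrow> smooth g \<Longrightarrow> smooth (\<lambda>x. f x + g x)"
  and smooth_affine: "smooth f \<Longrightarrow> smooth (\<lambda>x. f (c *\<^sub>R (x - p)))"
  by (auto simp: smooth_def Ck_const Ck_add Ck_affine)

lemma smooth_scaleR: "smooth f \<Longrightarrow> smooth g \<Longrightarrow> smooth (\<lambda>x. f x *\<^sub>R g x)"
  by (auto simp: smooth_def Ck_scaleR)

lemma smooth_mult: "smooth f \<Longrightarrow> smooth g \<Longrightarrow> smooth (\<lambda>x. f x * g x :: real)"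
  using smooth_scaleR[of f g] by simp

lemma smooth_prod:
  "(\<And>i. i \<in> I \<Longrightarrow> smooth (f i)) \<Longrightarrow> smooth (\<lambda>x. \<Prod>i\<in>I. f i x :: real)"
  by (induction I rule: infinite_finite_induct) (auto intro: smooth_const smooth_mult)

lemma smooth_nth: "smooth (\<lambda>x. x $ j)"
proof -
  define h where "h = (\<lambda>(k::nat) (t::real). if k = 0 then t else if k = 1 then 1 else 0 :: real)"
  have "(h k has_real_derivative h (Suc k) t) (at t)" for k t
    by (cases k) (auto simp: h_def[abs_def] intro!: derivative_eq_intros)
  from Ck_component[of h, OF this, of _ 0 j] show ?thesis by (simp add: smooth_def h_def)
qed

lemma smooth_partial: "smooth f \<Longrightarrow> smooth (partial i f)"
  unfolding smooth_def using Ck.simps(2) by blast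

lemma smooth_differentiable: "smooth f \<Longrightarrow> f differentiable (at x)"
  unfolding smooth_def using Ck.simps(2) by blast

lemma smooth_continuous_on: "smooth f \<Longrightarrow> continuous_on S f"
  unfolding smooth_def using Ck.simps(1) continuous_on_subset by blast

lemma smooth_borel_measurable [measurable_dest]: "smooth f \<Longrightarrow> f \<in> borel_measurable borel"
  by (intro borel_measurable_continuous_onI smooth_continuous_on)

lemma smooth_has_derivative:
  assumes "smooth f"
  shows "(f has_derivative (\<lambda>v. \<Sum>i\<in>UNIV. v $ i *\<^sub>R partial i f x)) (at x)"
proof -
  have d: "(f has_derivative frechet_derivative f (at x)) (at x)"
    using smooth_differentiable[OF assms] by (simp add: frechet_derivative_works)
  then interpret linear "frechet_derivative f (at x)"
    by (simp add: has_derivative_linear)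
  have "frechet_derivative f (at x) v = (\<Sum>i\<in>UNIV. v $ i *\<^sub>R partial i f x)" for v
  proof -
    have "v = (\<Sum>i\<in>UNIV. v $ i *\<^sub>R axis i 1)"
      using basis_expansion[of v] by (simp add: scalar_mult_eq_scaleR)
    then have "frechet_derivative f (at x) v = frechet_derivative f (at x) (\<Sum>i\<in>UNIV. v $ i *\<^sub>R axis i 1)"
      by simp
    then show ?thesis by (simp add: sum scale partial_def)
  qed
  then have "frechet_derivative f (at x) = (\<lambda>v. \<Sum>i\<in>UNIV. v $ i *\<^sub>R partial i f x)" by auto
  with d show ?thesis by simp
qed

lemma test_functionI:
  assumes "smooth \<phi>" "compact K" "K \<subseteq> \<Omega>" "\<And>x. x \<notin> K \<Longrightarrow> \<phi> x = 0"
  shows "test_function \<Omega> \<phi>"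
proof -
  have "closure {x. \<phi> x \<noteq> 0} \<subseteq> K"
    using assms by (intro closure_minimal compact_imp_closed) auto
  moreover have "compact (K \<inter> closure {x. \<phi> x \<noteq> 0})"
    using assms by (intro compact_Int_closed) auto
  ultimately show ?thesis
    using assms unfolding test_function_def by (auto simp: Int_absorb1)
qed

lemma test_functionE:
  assumes "test_function \<Omega> \<phi>"
  obtains K where "smooth \<phi>" "compact K" "K \<subseteq> \<Omega>" "\<forall>x. x \<notin> K \<longrightarrow> \<phi> x = 0"
  using assms closure_subset[of "{x. \<phi> x \<noteq> 0}"] unfolding test_function_def by blast

lemma test_function_smooth: "test_function \<Omega> \<phi> \<Longrightarrow> smooth \<phi>"
  by (simp add: test_function_def)

lemma test_function_mult:
  assumes "smooth f" "test_function \<Omega> \<phi>"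
  shows "test_function \<Omega> (\<lambda>x. f x * \<phi> x)"
  using assms(2) by (rule test_functionE) (auto intro!: test_functionI smooth_mult assms(1))

lemma test_function_cmult: "test_function \<Omega> \<phi> \<Longrightarrow> test_function \<Omega> (\<lambda>x. c * \<phi> x)"
  by (intro test_function_mult smooth_const)

lemma test_function_add:
  assumes "test_function \<Omega> \<phi>" "test_function \<Omega> \<psi>"
  shows "test_function \<Omega> (\<lambda>x. \<phi> x + \<psi> x)"
proof -
  from assms obtain K L where "smooth \<phi>" "smooth \<psi>" "compact K" "compact L" "K \<subseteq> \<Omega>" "L \<subseteq> \<Omega>"
    "\<forall>x. x \<notin> K \<longrightarrow> \<phi> x = 0" "\<forall>x. x \<notin> L \<longrightarrow> \<psi> x = 0"
    by (metis test_functionE)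
  then show ?thesis by (intro test_functionI[of _ "K \<union> L"] smooth_add) auto
qed

lemma test_function_partial:
  assumes "test_function \<Omega> \<phi>" shows "test_function \<Omega> (partial i \<phi>)"
proof -
  obtain K where K: "smooth \<phi>" "compact K" "K \<subseteq> \<Omega>" "\<forall>x. x \<notin> K \<longrightarrow> \<phi> x = 0"
    using assms by (rule test_functionE)
  have "partial i \<phi> x = 0" if "x \<notin> K" for x
  proof -
    have "(\<phi> has_derivative (\<lambda>_. 0)) (at x)"
      by (rule has_derivative_transform_within_open[of "\<lambda>_. 0" _ _ _ "- K"])
         (use K that in \<open>auto intro: compact_imp_closed\<close>)
    then show ?thesis by (simp add: partial_eqI)
  qed
  with K show ?thesis by (intro test_functionI smooth_partial)
qed

lemma test_function_bounded:
  assumes "test_function \<Omega> \<phi>"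
  obtains C where "0 \<le> C" "\<And>x. \<bar>\<phi> x\<bar> \<le> C"
proof -
  obtain K where K: "smooth \<phi>" "compact K" "K \<subseteq> \<Omega>" "\<forall>x. x \<notin> K \<longrightarrow> \<phi> x = 0"
    using assms by (rule test_functionE)
  have "compact (\<phi> ` K)" using K by (intro compact_continuous_image smooth_continuous_on)
  then have "bounded (\<phi> ` K)" by (rule compact_imp_bounded)
  then obtain C where C: "\<forall>x\<in>K. \<bar>\<phi> x\<bar> \<le> C"
    by (auto simp: bounded_iff)
  have "\<bar>\<phi> x\<bar> \<le> max C 0" for x
    using C K(4) by (cases "x \<in> K") (auto simp: le_max_iff_disj)
  then show thesis using that[of "max C 0"] by auto
qed

section \<open>Smooth functions supported in a box\<close>

text \<open>For \<open>p = 1\<close> this is the classical function \<open>exp (- c / t)\<close>,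
  flat at the origin. The polynomial factor in \<open>1 / t\<close> makes the family closed under
  differentiation.\<close>

definition expfun :: "real poly \<Rightarrow> real \<Rightarrow> real \<Rightarrow> real" where
  "expfun p c t = (if 0 < t then poly p (1 / t) * exp (- c / t) else 0)"

lemma poly_times_exp_tendsto_0:
  assumes "0 < (c::real)"
  shows "((\<lambda>y. poly p y * exp (- c * y)) \<longlongrightarrow> 0) at_top"
proof -
  have "((\<lambda>y. y ^ i * exp (- c * y)) \<longlongrightarrow> 0) at_top" for i
  proof -
    have "filterlim (\<lambda>y. c * y) at_top at_top"
      using assms by (intro filterlim_tendsto_pos_mult_at_top[OF tendsto_const]) (auto simp: filterlim_ident)
    from filterlim_compose[OF tendsto_power_div_exp_0 this, of i]
    have "((\<lambda>y. (1 / c^i) * ((c * y) ^ i / exp (c * y))) \<longlongrightarrow> (1 / c^i) * 0) at_top"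
      by (intro tendsto_intros)
    then show ?thesis using assms by (simp add: power_mult_distrib exp_minus field_simps)
  qed
  then have "((\<lambda>y. \<Sum>i\<le>degree p. coeff p i * (y ^ i * exp (- c * y))) \<longlongrightarrow> (\<Sum>i\<le>degree p. coeff p i * 0)) at_top"
    by (intro tendsto_intros)
  then show ?thesis by (simp add: poly_altdef sum_distrib_right mult.assoc)
qed

text \<open>For positive \<open>t\<close> the chain rule produces the factor \<open>1 / t^2\<close>,
  which is the polynomial \<open>[:0, 0, 1:]\<close> evaluated at \<open>1 / t\<close>. At the
  origin the right difference quotient is again a polynomial in \<open>1 / h\<close> times the
  exponential and tends to \<open>0\<close>.\<close>

lemma expfun_has_derivative:
  assumes c: "0 < c"
  shows "(expfun p c has_real_derivative expfun ([:0, 0, 1:] * (smult c p - pderiv p)) c t) (at t)"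
proof -
  consider "t < 0" | "t = 0" | "0 < t" by linarith
  then show ?thesis
  proof cases
    case 1
    have "((\<lambda>_. 0) has_real_derivative expfun ([:0, 0, 1:] * (smult c p - pderiv p)) c t) (at t)"
      using 1 by (simp add: expfun_def)
    then show ?thesis
      by (rule has_field_derivative_transform_within_open[of _ _ _ "{..<0}"]) (use 1 in \<open>auto simp: expfun_def\<close>)
  next
    case 3
    have "((\<lambda>t. poly p (1 / t) * exp (- c / t)) has_real_derivative
       (poly (pderiv p) (1/t) * (- 1 / t\<^sup>2)) * exp (- c / t) + poly p (1/t) * (exp (- c / t) * (c / t\<^sup>2))) (at t)"
      using 3 by (auto intro!: derivative_eq_intros DERIV_chain2[OF poly_DERIV] simp: power2_eq_square)
    also have "(poly (pderiv p) (1/t) * (- 1 / t\<^sup>2)) * exp (- c / t) + poly p (1/t) * (exp (- c / t) * (c / t\<^sup>2))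
       = expfun ([:0, 0, 1:] * (smult c p - pderiv p)) c t"
      using 3 by (simp add: expfun_def power2_eq_square field_simps)
    finally show ?thesis
      by (rule has_field_derivative_transform_within_open[of _ _ _ "{0<..}"]) (use 3 in \<open>auto simp: expfun_def\<close>)
  next
    case 2
    have "filterlim (\<lambda>h::real. 1 / h) at_top (at_right 0)"
      using filterlim_inverse_at_top_right by (simp add: inverse_eq_divide)
    \<comment> \<open>\<open>pCons 0 p\<close> is \<open>p\<close> multiplied by its variable; this
      accounts for the division by \<open>h\<close> in the difference quotient.\<close>
    from filterlim_compose[OF poly_times_exp_tendsto_0[OF c, of "pCons 0 p"] this]
    have R: "((\<lambda>h. poly (pCons 0 p) (1 / h) * exp (- c * (1 / h))) \<longlongrightarrow> 0) (at_right 0)" .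
    have "((\<lambda>h. (expfun p c (0 + h) - expfun p c 0) / h) \<longlongrightarrow> 0) (at 0)"
    proof (rule filterlim_split_at)
      show "((\<lambda>h. (expfun p c (0 + h) - expfun p c 0) / h) \<longlongrightarrow> 0) (at_left 0)"
        by (rule tendsto_eventually) (auto simp: eventually_at_filter expfun_def)
      show "((\<lambda>h. (expfun p c (0 + h) - expfun p c 0) / h) \<longlongrightarrow> 0) (at_right 0)"
        using R by (rule Lim_transform_eventually) (auto simp: eventually_at_filter expfun_def)
    qed
    then show ?thesis using 2 by (simp add: DERIV_def expfun_def)
  qed
qed

text \<open>The rate \<open>1 / Suc m\<close> tends to \<open>0\<close>, so for a fixed box these
  functions converge pointwise to its indicator while their support stays in the closed box.\<close>

definition bump :: "nat \<Rightarrow> real^'n::finite \<Rightarrow> real^'n \<Rightarrow> real^'n \<Rightarrow> real" where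
  "bump m a b x = (\<Prod>i\<in>UNIV. expfun 1 (1 / Suc m) (x $ i - a $ i) * expfun 1 (1 / Suc m) (b $ i - x $ i))"

lemma smooth_expfun:
  fixes a :: "real^'n::finite"
  assumes c: "0 < c"
  shows "smooth (\<lambda>x. expfun p c (x $ i - a $ i))" "smooth (\<lambda>x. expfun p c (a $ i - x $ i))"
proof -
  define q where "q = (\<lambda>k. ((\<lambda>p. [:0, 0, 1:] * (smult c p - pderiv p)) ^^ k) p)"
  have q0: "q 0 = p" and qS: "\<And>k. q (Suc k) = [:0, 0, 1:] * (smult c (q k) - pderiv (q k))"
    by (simp_all add: q_def)
  have h: "(expfun (q k) c has_real_derivative expfun (q (Suc k)) c t) (at t)" for k t
    unfolding qS by (rule expfun_has_derivative[OF c])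
  have "Ck m (\<lambda>x::real^'n. expfun (q k) c (x $ i))" for m k
    by (rule Ck_component[where h="\<lambda>k. expfun (q k) c"]) (rule h)
  then have *: "smooth (\<lambda>x::real^'n. expfun p c (x $ i))" by (simp add: smooth_def flip: q0)
  show "smooth (\<lambda>x. expfun p c (x $ i - a $ i))"
    using smooth_affine[OF *, of 1 a] by simp
  show "smooth (\<lambda>x. expfun p c (a $ i - x $ i))"
    using smooth_affine[OF *, of "-1" a] by simp
qed

lemma bump_nonzero_iff: "bump m a b x \<noteq> 0 \<longleftrightarrow> x \<in> box a b"
  by (auto simp: bump_def expfun_def mem_box_cart)

lemma bump_bounds: "0 \<le> bump m a b x" "bump m a b x \<le> 1"
proof -
  have e: "0 \<le> expfun 1 (1 / Suc m) t" "expfun 1 (1 / Suc m) t \<le> 1" for t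
    by (auto simp: expfun_def)
  show "0 \<le> bump m a b x" unfolding bump_def by (intro prod_nonneg mult_nonneg_nonneg e ballI)
  show "bump m a b x \<le> 1" unfolding bump_def by (intro prod_le_1 conjI mult_nonneg_nonneg mult_le_one e)
qed

lemma bump_tendsto: "(\<lambda>m. bump m a b x) \<longlonglongrightarrow> indicator (box a b) (x :: real^'n::finite)"
proof (cases "x \<in> box a b")
  case True
  have e: "(\<lambda>m. expfun 1 (1 / Suc m) t) \<longlonglongrightarrow> 1" if "0 < t" for t
  proof -
    have "(\<lambda>m. exp (- (1 / Suc m) / t)) \<longlonglongrightarrow> exp (- 0 / t)"
      using that by (intro tendsto_intros LIMSEQ_Suc lim_1_over_n) auto
    then show ?thesis using that by (simp add: expfun_def)
  qed
  have "(\<lambda>m. bump m a b x) \<longlonglongrightarrow> (\<Prod>i\<in>(UNIV :: 'n set). 1 * 1)"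
    unfolding bump_def
  proof (intro tendsto_prod tendsto_mult e)
    fix i
    show "0 < x $ i - a $ i" "0 < b $ i - x $ i" using True by (auto simp: mem_box_cart)
  qed
  then show ?thesis using True by simp
next
  case False
  then have "bump m a b x = 0" for m using bump_nonzero_iff[of m a b x] by blast
  then show ?thesis using False by simp
qed

lemma test_function_bump:
  assumes "cbox a b \<subseteq> \<Omega>" shows "test_function \<Omega> (bump m a b)"
proof (rule test_functionI[OF _ compact_cbox assms])
  show "smooth (bump m a b)"
  proof -
    have "smooth (\<lambda>x. expfun 1 (1 / Suc m) (x $ i - a $ i) * expfun 1 (1 / Suc m) (b $ i - x $ i))" for i
      by (rule smooth_mult[OF smooth_expfun(1) smooth_expfun(2)]) simp_all
    then show ?thesis
      unfolding bump_def[abs_def] by (rule smooth_prod)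
  qed
  show "bump m a b x = 0" if "x \<notin> cbox a b" for x
    using that box_subset_cbox[of a b] bump_nonzero_iff[of m a b x] by blast
qed

section \<open>The fundamental lemma and density of test functions\<close>

lemma L2_bounded:
  fixes f :: "'a \<Rightarrow> 'b::euclidean_space"
  assumes "f \<in> borel_measurable M" "\<And>x. norm (f x) \<le> C" "emeasure M (space M) < \<infinity>"
  shows "f \<in> L2 M"
proof -
  have "sqnorm M f \<le> (\<integral>\<^sup>+x. ennreal (C\<^sup>2) \<partial>M)"
    unfolding sqnorm_def by (intro nn_integral_mono ennreal_leI power_mono assms) auto
  also have "\<dots> < \<infinity>" using assms(3) by (simp add: ennreal_mult_less_top)
  finally show ?thesis using assms(1) by (simp add: L2_iff_sqnorm)
qed

lemma L2_integrable:
  fixes f :: "'a \<Rightarrow> 'b::euclidean_space"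
  assumes "f \<in> L2 M" "emeasure M (space M) < \<infinity>"
  shows "integrable M f"
  using L2_pairing(1)[OF L2_bounded[of "\<lambda>_. 1 :: real" M 1] assms(1)] assms(2) by simp

lemma emeasure_lebesgue_on_finite:
  "S \<in> lmeasurable \<Longrightarrow> emeasure (lebesgue_on S) (space (lebesgue_on S)) < \<infinity>"
  by (auto simp: emeasure_restrict_space fmeasurable_def less_top)

lemma borel_measurable_lebesgue_on:
  "f \<in> borel_measurable borel \<Longrightarrow> f \<in> borel_measurable (lebesgue_on S)"
  by (intro measurable_restrict_space1 measurable_completion) simp

lemma test_function_L2:
  assumes "test_function \<Omega> \<phi>" "S \<in> lmeasurable"
  shows "\<phi> \<in> L2 (lebesgue_on S)"
proof -
  obtain C where "\<And>x. \<bar>\<phi> x\<bar> \<le> C" using test_function_bounded[OF assms(1)] by blast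
  then show ?thesis
    using test_function_smooth[OF assms(1)]
    by (intro L2_bounded[of _ _ C] emeasure_lebesgue_on_finite assms(2) borel_measurable_lebesgue_on
        smooth_borel_measurable) auto
qed

text \<open>With a Borel representative \<open>h\<close> of \<open>g\<close>, the positive and the
  negative part of \<open>h\<close> are densities of finite measures. These agree on open boxes, an
  intersection-stable generator, hence everywhere, and then the densities agree almost everywhere.
  As \<open>ennreal\<close> sends negative numbers to \<open>0\<close>, both parts being equal
  forces \<open>h x = 0\<close>.\<close>

lemma AE_eq_0_of_integral_box_eq_0:
  fixes g :: "'a::euclidean_space \<Rightarrow> real"
  assumes g: "integrable lebesgue g"
    and z: "\<And>a b. (\<integral>x. indicator (box a b) x * g x \<partial>lebesgue) = 0"
  shows "AE x in lebesgue. g x = 0"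
proof -
  obtain h where h: "h \<in> borel_measurable lborel" "AE x in lborel. g x = h x"
    using completion_ex_borel_measurable_real[of g lborel] g by auto
  have hm[measurable]: "h \<in> borel_measurable borel" using h(1) by simp
  have AE: "AE x in lebesgue. g x = h x" using h(2) by (rule AE_completion)
  have hi: "integrable lborel h"
    using integrable_cong_AE_imp[OF g measurable_completion AE] by (simp add: integrable_completion)
  have hz: "(\<integral>x. indicator (box a b) x * h x \<partial>lborel) = 0" for a b
  proof -
    have "(\<integral>x. indicator (box a b) x * h x \<partial>lborel) = (\<integral>x. indicator (box a b) x * h x \<partial>lebesgue)"
      by (intro integral_completion[symmetric]) auto
    also have "\<dots> = (\<integral>x. indicator (box a b) x * g x \<partial>lebesgue)"
      using AE borel_measurable_integrable[OF g] measurable_completion[OF h(1)]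
      by (intro integral_cong_AE borel_measurable_times borel_measurable_indicator) auto
    finally show ?thesis using z by simp
  qed
  let ?p = "density lborel (\<lambda>x. ennreal (h x))" and ?m = "density lborel (\<lambda>x. ennreal (- h x))"
  have fin: "(\<integral>\<^sup>+x. ennreal (norm (h x)) \<partial>lborel) < \<infinity>" using hi by (simp add: integrable_iff_bounded)
  have eqb: "emeasure ?p (box a b) = emeasure ?m (box a b)" for a b
  proof -
    have i: "integrable lborel (\<lambda>x. indicator (box a b) x * h x)"
      using integrable_mult_indicator[OF _ hi, of "box a b"] by simp
    have e: "ennreal (indicator A x * y) = ennreal y * indicator A x" for A :: "'a set" and x y
      by (auto simp: indicator_def)
    have e': "ennreal (- (indicator A x * y)) = ennreal (- y) * indicator A x" for A :: "'a set" and x y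
      by (auto simp: indicator_def)
    have "enn2real (emeasure ?p (box a b)) - enn2real (emeasure ?m (box a b)) = 0"
      using hz[of a b] unfolding real_lebesgue_integral_def[OF i] e e' by (simp add: emeasure_density)
    moreover have "emeasure ?p (box a b) < \<infinity>"
    proof -
      have "emeasure ?p (box a b) \<le> (\<integral>\<^sup>+x. ennreal (norm (h x)) \<partial>lborel)"
        by (subst emeasure_density) (auto intro!: nn_integral_mono ennreal_leI simp: indicator_def)
      with fin show ?thesis by (auto elim: le_less_trans)
    qed
    moreover have "emeasure ?m (box a b) < \<infinity>"
    proof -
      have "emeasure ?m (box a b) \<le> (\<integral>\<^sup>+x. ennreal (norm (h x)) \<partial>lborel)"
        by (subst emeasure_density) (auto intro!: nn_integral_mono ennreal_leI simp: indicator_def)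
      with fin show ?thesis by (auto elim: le_less_trans)
    qed
    ultimately show ?thesis by (metis ennreal_enn2real_if eq_iff_diff_eq_0 infinity_ennreal_def less_irrefl)
  qed
  have "?p = ?m"
  proof (rule measure_eqI_generator_eq[where E = "range (\<lambda>(a, b). box a b)" and \<Omega> = UNIV
        and A = "\<lambda>n. box (- real n *\<^sub>R One) (real n *\<^sub>R One)"])
    show "Int_stable (range (\<lambda>(a, b). box a b :: 'a set))"
      by (force simp: Int_stable_def box_Int_box)
    show "emeasure ?p X = emeasure ?m X" if "X \<in> range (\<lambda>(a, b). box a b)" for X
      using that eqb by auto
    show "sets ?p = sigma_sets UNIV (range (\<lambda>(a, b). box a b))"
      "sets ?m = sigma_sets UNIV (range (\<lambda>(a, b). box a b))"
      by (simp_all add: borel_eq_box)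
    show "(\<Union>i. box (- real i *\<^sub>R One) (real i *\<^sub>R One)) = (UNIV :: 'a set)"
      using UN_box_eq_UNIV by simp
    show "emeasure ?p (box (- real i *\<^sub>R One) (real i *\<^sub>R One)) \<noteq> \<infinity>" for i
    proof -
      have "emeasure ?p (box (- real i *\<^sub>R One) (real i *\<^sub>R One)) \<le> (\<integral>\<^sup>+x. ennreal (norm (h x)) \<partial>lborel)"
        by (subst emeasure_density) (auto intro!: nn_integral_mono ennreal_leI simp: indicator_def)
      with fin show ?thesis by (auto simp: top_unique)
    qed
  qed auto
  moreover have "(\<integral>\<^sup>+x. ennreal (h x) \<partial>lborel) \<noteq> \<infinity>"
  proof -
    have "(\<integral>\<^sup>+x. ennreal (h x) \<partial>lborel) \<le> (\<integral>\<^sup>+x. ennreal (norm (h x)) \<partial>lborel)"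
      by (intro nn_integral_mono ennreal_leI) auto
    with fin show ?thesis by (auto simp: top_unique)
  qed
  ultimately have "AE x in lborel. ennreal (h x) = ennreal (- h x)"
    by (subst (asm) finite_density_unique) auto
  then have "AE x in lborel. h x = 0"
  proof (rule AE_mp, intro AE_I2 impI)
    fix x assume "ennreal (h x) = ennreal (- h x)"
    then show "h x = 0" by (cases "0 \<le> h x") (auto simp: ennreal_eq_0_iff ennreal_neg)
  qed
  from AE_completion[OF this] AE show ?thesis by eventually_elim simp
qed

text \<open>Dominated convergence carries the hypothesis from bump functions to indicators of boxes
  with closure in the domain. The criterion for boxes is applied to \<open>g\<close> cut off to one
  such box, and countably many of these cover the domain.\<close>

lemma AE_eq_0_of_test_functions_real:
  fixes g :: "real^'n::finite \<Rightarrow> real"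
  assumes "open \<Omega>" and g: "integrable (lebesgue_on \<Omega>) g"
    and z: "\<And>\<phi>. test_function \<Omega> \<phi> \<Longrightarrow> (\<integral>x. \<phi> x * g x \<partial>lebesgue_on \<Omega>) = 0"
  shows "AE x in lebesgue_on \<Omega>. g x = 0"
proof -
  have \<Omega>: "\<Omega> \<in> sets lebesgue" using assms(1) by auto
  have box0: "(\<integral>x. indicator (box a b) x * g x \<partial>lebesgue_on \<Omega>) = 0" if "cbox a b \<subseteq> \<Omega>" for a b
  proof -
    have "(\<lambda>m. \<integral>x. bump m a b x * g x \<partial>lebesgue_on \<Omega>) \<longlonglongrightarrow> (\<integral>x. indicator (box a b) x * g x \<partial>lebesgue_on \<Omega>)"
    proof (rule integral_dominated_convergence[where w="\<lambda>x. norm (g x)"])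
      show "(\<lambda>x. bump m a b x * g x) \<in> borel_measurable (lebesgue_on \<Omega>)" for m
        using smooth_borel_measurable[OF test_function_smooth[OF test_function_bump[OF that]]]
        by (intro borel_measurable_times[OF borel_measurable_lebesgue_on borel_measurable_integrable[OF g]])
      show "(\<lambda>x. indicator (box a b) x * g x) \<in> borel_measurable (lebesgue_on \<Omega>)"
        by (intro borel_measurable_times[OF borel_measurable_lebesgue_on borel_measurable_integrable[OF g]]) auto
      show "AE x in lebesgue_on \<Omega>. norm (bump m a b x * g x) \<le> norm (g x)" for m
        using bump_bounds[of m a b] by (auto simp: abs_mult intro!: mult_left_le_one_le)
      show "AE x in lebesgue_on \<Omega>. (\<lambda>m. bump m a b x * g x) \<longlonglongrightarrow> indicator (box a b) x * g x"
        by (intro AE_I2 tendsto_intros bump_tendsto)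
    qed (use g in auto)
    moreover have "(\<integral>x. bump m a b x * g x \<partial>lebesgue_on \<Omega>) = 0" for m
      by (intro z test_function_bump that)
    ultimately show ?thesis by (simp add: LIMSEQ_const_iff)
  qed
  have loc: "AE x in lebesgue. x \<in> box p q \<longrightarrow> g x = 0" if "cbox p q \<subseteq> \<Omega>" for p q
  proof -
    have bs: "box p q \<subseteq> \<Omega>" using that box_subset_cbox by blast
    define G where "G x = indicator (box p q) x * g x" for x
    have res: "(\<integral>x. indicator A x * G x \<partial>lebesgue) = (\<integral>x. indicator (A \<inter> box p q) x * g x \<partial>lebesgue_on \<Omega>)" for A
      using bs by (subst integral_restrict_space)
        (auto simp: \<Omega> G_def indicator_def intro!: Bochner_Integration.integral_cong)
    have "integrable lebesgue G"
    proof -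
      have "integrable (lebesgue_on \<Omega>) (\<lambda>x. indicator (box p q) x *\<^sub>R g x)"
        using g bs by (intro integrable_mult_indicator) (auto simp: sets_restrict_space_iff \<Omega>)
      then have "integrable lebesgue (\<lambda>x. indicator \<Omega> x *\<^sub>R (indicator (box p q) x *\<^sub>R g x))"
        by (subst (asm) integrable_restrict_space) (auto simp: \<Omega>)
      also have "(\<lambda>x. indicator \<Omega> x *\<^sub>R (indicator (box p q) x *\<^sub>R g x)) = G"
        using bs by (intro ext) (auto simp: G_def indicator_def)
      finally show ?thesis .
    qed
    moreover have "(\<integral>x. indicator (box a b) x * G x \<partial>lebesgue) = 0" for a b
    proof -
      \<comment> \<open>An intersection of boxes is a box, but if it is empty its corners need not
        lie anywhere near the domain; this case has to be separated before \<open>box0\<close> can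
        be used.\<close>
      have "box a b \<inter> box p q = {} \<or> (\<exists>c d. box a b \<inter> box p q = box c d \<and> cbox c d \<subseteq> \<Omega>)"
      proof -
        obtain c d where cd: "box a b \<inter> box p q = box c d" unfolding box_Int_box by blast
        have "box c d = {} \<or> cbox c d \<subseteq> cbox p q"
          using cd by (metis box_subset_cbox closure_box closure_minimal closed_cbox inf.cobounded2 order_trans)
        with cd that show ?thesis by blast
      qed
      then show ?thesis unfolding res using box0 by auto
    qed
    ultimately have "AE x in lebesgue. G x = 0" by (rule AE_eq_0_of_integral_box_eq_0)
    then show ?thesis by eventually_elim (auto simp: G_def)
  qed
  define F where "F = {box p q | p q. cbox p q \<subseteq> \<Omega>}"
  have "\<Union>F = \<Omega>"
  proof
    show "\<Union>F \<subseteq> \<Omega>" using box_subset_cbox by (fastforce simp: F_def)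
    show "\<Omega> \<subseteq> \<Union>F"
    proof
      fix x assume "x \<in> \<Omega>"
      then obtain e where e: "0 < e" "cball x e \<subseteq> \<Omega>" using assms(1) open_contains_cball by blast
      then obtain a b where ab: "x \<in> box a b" "box a b \<subseteq> ball x e" using rational_boxes[of e x] by blast
      then have "cbox a b = closure (box a b)" using closure_box[of a b] by blast
      also have "\<dots> \<subseteq> cball x e"
        using ab(2) ball_subset_cball by (intro closure_minimal) auto
      finally have "cbox a b \<subseteq> cball x e" .
      with e ab show "x \<in> \<Union>F" unfolding F_def by blast
    qed
  qed
  moreover obtain F' where "F' \<subseteq> F" "countable F'" "\<Union>F' = \<Union>F"
    using Lindelof[of F] by (auto simp: F_def)
  ultimately have F': "countable F'" "\<Union>F' = \<Omega>" "F' \<subseteq> F" by auto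
  have "AE x in lebesgue. \<forall>P\<in>F'. x \<in> P \<longrightarrow> g x = 0"
    using F' loc by (subst AE_ball_countable) (auto simp: F_def)
  then have "AE x in lebesgue. x \<in> \<Omega> \<longrightarrow> g x = 0"
    by eventually_elim (use F' in blast)
  then show ?thesis by (simp add: AE_restrict_space_iff \<Omega>)
qed

lemma AE_eq_0_of_test_functions:
  fixes g :: "real^'n::finite \<Rightarrow> 'b::euclidean_space"
  assumes "open \<Omega>" "\<Omega> \<in> lmeasurable" and g: "g \<in> L2 (lebesgue_on \<Omega>)"
    and z: "\<And>\<phi>. test_function \<Omega> \<phi> \<Longrightarrow> (\<integral>x. \<phi> x *\<^sub>R g x \<partial>lebesgue_on \<Omega>) = 0"
  shows "AE x in lebesgue_on \<Omega>. g x = 0"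
proof -
  have "AE x in lebesgue_on \<Omega>. g x \<bullet> b = 0" for b
  proof (rule AE_eq_0_of_test_functions_real[OF assms(1)])
    show "integrable (lebesgue_on \<Omega>) (\<lambda>x. g x \<bullet> b)"
      using L2_integrable[OF g emeasure_lebesgue_on_finite[OF assms(2)]] by simp
    fix \<phi> assume \<phi>: "test_function \<Omega> \<phi>"
    have "(\<integral>x. \<phi> x * (g x \<bullet> b) \<partial>lebesgue_on \<Omega>) = (\<integral>x. (\<phi> x *\<^sub>R g x) \<bullet> b \<partial>lebesgue_on \<Omega>)"
      by simp
    also have "\<dots> = (\<integral>x. \<phi> x *\<^sub>R g x \<partial>lebesgue_on \<Omega>) \<bullet> b"
      using L2_pairing(1)[OF test_function_L2[OF \<phi> assms(2)] g] by (intro integral_inner_left) auto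
    finally show "(\<integral>x. \<phi> x * (g x \<bullet> b) \<partial>lebesgue_on \<Omega>) = 0" using z[OF \<phi>] by simp
  qed
  then have "AE x in lebesgue_on \<Omega>. \<forall>b\<in>Basis. g x \<bullet> b = 0" by (intro AE_finite_allI) auto
  then show ?thesis by eventually_elim (simp add: euclidean_all_zero_iff)
qed

lemma L2_converges_integral_square:
  fixes f :: "nat \<Rightarrow> 'a \<Rightarrow> real"
  assumes "\<And>n. f n \<in> L2 M" "g \<in> L2 M" "L2_converges M f g"
  shows "(\<lambda>n. \<integral>x. (f n x)\<^sup>2 \<partial>M) \<longlonglongrightarrow> (\<integral>x. (g x)\<^sup>2 \<partial>M)"
proof -
  have d: "(\<lambda>x. f n x - g x) \<in> L2 M" for n by (intro L2_diff assms)
  have "(\<lambda>n. ennreal (\<integral>x. (f n x - g x)\<^sup>2 \<partial>M)) \<longlonglongrightarrow> ennreal 0"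
    using assms(3) unfolding L2_converges_sqnorm by (simp add: sqnorm_eq_integral[OF d])
  then have 1: "(\<lambda>n. \<integral>x. (f n x - g x)\<^sup>2 \<partial>M) \<longlonglongrightarrow> 0"
    by (subst (asm) tendsto_ennreal_iff) auto
  have 2: "(\<lambda>n. \<integral>x. g x * f n x \<partial>M) \<longlonglongrightarrow> (\<integral>x. g x * g x \<partial>M)"
    using L2_converges_pairing[OF assms(2,1,2,3)] by simp
  have "(\<lambda>n. (\<integral>x. (f n x - g x)\<^sup>2 \<partial>M) + 2 * (\<integral>x. g x * f n x \<partial>M) - (\<integral>x. g x * g x \<partial>M))
     \<longlonglongrightarrow> 0 + 2 * (\<integral>x. g x * g x \<partial>M) - (\<integral>x. g x * g x \<partial>M)"
    by (intro tendsto_intros 1 2)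
  moreover have "(\<integral>x. (f n x - g x)\<^sup>2 \<partial>M) + 2 * (\<integral>x. g x * f n x \<partial>M) - (\<integral>x. g x * g x \<partial>M) = (\<integral>x. (f n x)\<^sup>2 \<partial>M)" for n
  proof -
    have [simp]: "integrable M (\<lambda>x. g x * f n x)" "integrable M (\<lambda>x. g x * g x)" "integrable M (\<lambda>x. (f n x - g x)\<^sup>2)"
      using L2_pairing(1)[OF assms(2) assms(1)[of n]] L2_pairing(1)[OF assms(2,2)] d[of n] by (auto simp: L2_def)
    have "(\<integral>x. (f n x)\<^sup>2 \<partial>M) = (\<integral>x. ((f n x - g x)\<^sup>2 + 2 * (g x * f n x)) - g x * g x \<partial>M)"
      by (intro Bochner_Integration.integral_cong) (auto simp: power2_eq_square algebra_simps)
    then show ?thesis by simp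
  qed
  ultimately show ?thesis by (simp add: power2_eq_square)
qed

text \<open>A projection argument: the element \<open>z\<close> of least norm in the closure of all
  \<open>g - \<psi>\<close> is orthogonal to every test function, hence zero almost everywhere by
  the fundamental lemma, and so \<open>g\<close> lies in the closure of the test functions.\<close>

lemma test_functions_dense_L2:
  fixes g :: "real^'n::finite \<Rightarrow> real"
  assumes "open \<Omega>" "\<Omega> \<in> lmeasurable" and g: "g \<in> L2 (lebesgue_on \<Omega>)" and "0 < (e::real)"
  shows "\<exists>\<psi>. test_function \<Omega> \<psi> \<and> sqnorm (lebesgue_on \<Omega>) (\<lambda>x. \<psi> x - g x) \<le> ennreal e"
proof -
  let ?M = "lebesgue_on \<Omega>"
  \<comment> \<open>The closure is written out with \<open>e\<close> and passed to the lemma on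
    nested convex sets as a constant sequence.\<close>
  define C where "C = {f \<in> L2 ?M. \<forall>e::real>0. \<exists>\<psi>. test_function \<Omega> \<psi> \<and> sqnorm ?M (\<lambda>x. f x - (g x - \<psi> x)) \<le> ennreal e}"
  have tL: "test_function \<Omega> \<psi> \<Longrightarrow> \<psi> \<in> L2 ?M" for \<psi> using test_function_L2 assms(2) by blast
  have "test_function \<Omega> (\<lambda>_. 0)" by (rule test_functionI[of _ "{}"]) (auto intro: smooth_const)
  then have gC: "g \<in> C" using g by (auto simp: C_def sqnorm_def intro!: exI[of _ "\<lambda>_. 0"])
  have "(\<lambda>x. (1/2) *\<^sub>R (f x + h x)) \<in> C" if "f \<in> C" "h \<in> C" for f h
  proof -
    have fh: "f \<in> L2 ?M" "h \<in> L2 ?M" using that by (auto simp: C_def)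
    have "\<exists>\<psi>. test_function \<Omega> \<psi> \<and> sqnorm ?M (\<lambda>x. (1/2) *\<^sub>R (f x + h x) - (g x - \<psi> x)) \<le> ennreal e" if "0 < e" for e :: real
    proof -
      obtain \<psi> \<eta> where p: "test_function \<Omega> \<psi>" "sqnorm ?M (\<lambda>x. f x - (g x - \<psi> x)) \<le> ennreal e"
        "test_function \<Omega> \<eta>" "sqnorm ?M (\<lambda>x. h x - (g x - \<eta> x)) \<le> ennreal e"
        using \<open>f \<in> C\<close> \<open>h \<in> C\<close> \<open>0 < e\<close> unfolding C_def by blast
      have "sqnorm ?M (\<lambda>x. (1/2) *\<^sub>R ((f x - (g x - \<psi> x)) + (h x - (g x - \<eta> x)))) \<le> ennreal e"
        using p fh g tL by (intro sqnorm_midpoint_le borel_measurable_diff L2_measurable) auto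
      also have "(\<lambda>x. (1/2) *\<^sub>R ((f x - (g x - \<psi> x)) + (h x - (g x - \<eta> x)))) = (\<lambda>x. (1/2) *\<^sub>R (f x + h x) - (g x - (1/2) * (\<psi> x + \<eta> x)))"
        by (auto simp: field_simps)
      finally show ?thesis
        using test_function_cmult[OF test_function_add[OF p(1,3)], of "1/2"] by blast
    qed
    then show ?thesis using L2_scaleR[OF L2_add[OF fh], of "1/2"] unfolding C_def by auto
  qed
  moreover have "\<exists>f\<in>C. sqnorm ?M f \<le> ennreal (enn2real (sqnorm ?M g))"
    using gC L2_sqnorm_finite[OF g] by (intro bexI[of _ g]) (auto simp: less_top)
  ultimately obtain y z where yz: "\<And>n. y n \<in> C" "z \<in> L2 ?M" "L2_converges ?M y z"
    and min: "\<And>w. w \<in> C \<Longrightarrow> sqnorm ?M z \<le> sqnorm ?M w"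
    using L2_nested_convex[of "\<lambda>_::nat. C" ?M "enn2real (sqnorm ?M g)"] by (auto simp: C_def)
  have yL: "y n \<in> L2 ?M" for n using yz(1) by (auto simp: C_def)
  \<comment> \<open>The limit of elements of \<open>C\<close> is approximated by a
    \<open>g - \<psi>\<close> as well, by splitting the error at \<open>y n\<close>.\<close>
  have zC: "\<exists>\<psi>. test_function \<Omega> \<psi> \<and> sqnorm ?M (\<lambda>x. z x - (g x - \<psi> x)) \<le> ennreal e" if "0 < e" for e :: real
  proof -
    obtain n where n: "sqnorm ?M (\<lambda>x. y n x - z x) \<le> ennreal (e / 4)"
      using ennreal_LIMSEQ_0_D[OF yz(3)[unfolded L2_converges_sqnorm], of "e / 4"] \<open>0 < e\<close> by auto
    obtain \<psi> where p: "test_function \<Omega> \<psi>" "sqnorm ?M (\<lambda>x. y n x - (g x - \<psi> x)) \<le> ennreal (e / 4)"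
      using yz(1)[of n] \<open>0 < e\<close> unfolding C_def by (auto dest!: spec[of _ "e / 4"])
    have "sqnorm ?M (\<lambda>x. z x - (g x - \<psi> x)) \<le> 2 * sqnorm ?M (\<lambda>x. z x - y n x) + 2 * sqnorm ?M (\<lambda>x. y n x - (g x - \<psi> x))"
      using yz(2) yL g tL[OF p(1)] by (intro sqnorm_diff) auto
    also have "\<dots> \<le> 2 * ennreal (e/4) + 2 * ennreal (e/4)"
      using n p by (intro add_mono mult_left_mono) (auto simp: sqnorm_minus_commute[of _ z])
    also have "\<dots> = ennreal e" using \<open>0 < e\<close> by (simp flip: ennreal_plus ennreal_mult ennreal_numeral)
    finally show ?thesis using p by blast
  qed
  have orth: "(\<integral>x. \<phi> x *\<^sub>R z x \<partial>?M) = 0" if \<phi>: "test_function \<Omega> \<phi>" for \<phi>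
  proof -
    define P where "P = (\<integral>x. (\<phi> x)\<^sup>2 \<partial>?M)"
    define I where "I = (\<integral>x. \<phi> x * z x \<partial>?M)"
    note \<phi>L = tL[OF \<phi>]
    have i[simp]: "integrable ?M (\<lambda>x. \<phi> x * z x)" "integrable ?M (\<lambda>x. (z x)\<^sup>2)" "integrable ?M (\<lambda>x. (\<phi> x)\<^sup>2)"
      using L2_pairing(1)[OF \<phi>L yz(2)] yz(2) \<phi>L by (auto simp: L2_def)
    \<comment> \<open>First variation: \<open>z - t * \<phi>\<close> is still in \<open>C\<close>,
      since a multiple of a test function is absorbed by \<open>\<psi>\<close>, so its norm is not
      below that of \<open>z\<close>.\<close>
    have key: "0 \<le> t\<^sup>2 * P - 2 * t * I" for t
    proof -
      let ?w = "\<lambda>x. z x - t * \<phi> x"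
      have wL: "?w \<in> L2 ?M" using L2_diff[OF yz(2) L2_scaleR[OF \<phi>L, of t]] by simp
      have "?w \<in> C"
      proof -
        have "\<exists>\<psi>. test_function \<Omega> \<psi> \<and> sqnorm ?M (\<lambda>x. ?w x - (g x - \<psi> x)) \<le> ennreal e" if "0 < e" for e :: real
        proof -
          obtain \<psi> where p: "test_function \<Omega> \<psi>" "sqnorm ?M (\<lambda>x. z x - (g x - \<psi> x)) \<le> ennreal e"
            using zC[OF \<open>0 < e\<close>] by blast
          have "(\<lambda>x. ?w x - (g x - (\<psi> x + t * \<phi> x))) = (\<lambda>x. z x - (g x - \<psi> x))" by auto
          with p \<phi> show ?thesis
            by (intro exI[of _ "\<lambda>x. \<psi> x + t * \<phi> x"]) (auto intro!: test_function_cmult test_function_add)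
        qed
        then show ?thesis using wL by (auto simp: C_def)
      qed
      from min[OF this] have "(\<integral>x. (z x)\<^sup>2 \<partial>?M) \<le> (\<integral>x. (?w x)\<^sup>2 \<partial>?M)"
        by (simp add: sqnorm_eq_integral yz(2) wL)
      also have "(\<integral>x. (?w x)\<^sup>2 \<partial>?M) = (\<integral>x. (z x)\<^sup>2 - 2 * t * (\<phi> x * z x) + t\<^sup>2 * (\<phi> x)\<^sup>2 \<partial>?M)"
        by (intro Bochner_Integration.integral_cong) (auto simp: power2_eq_square algebra_simps)
      also have "\<dots> = (\<integral>x. (z x)\<^sup>2 \<partial>?M) - 2 * t * I + t\<^sup>2 * P"
        by (simp add: I_def P_def)
      finally show ?thesis by simp
    qed
    have "0 \<le> P" unfolding P_def by simp
    have "I = 0"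
    proof (rule ccontr)
      assume "I \<noteq> 0"
      \<comment> \<open>A value of \<open>t\<close> at which the quadratic in \<open>key\<close> is
        negative. The vertex would be \<open>I / P\<close>; adding \<open>1\<close> allows for
        \<open>P = 0\<close>.\<close>
      define w where "w = I / (P + 1)"
      have I: "I = w * (P + 1)" "w \<noteq> 0" using \<open>I \<noteq> 0\<close> \<open>0 \<le> P\<close> by (auto simp: w_def)
      have "w\<^sup>2 * P - 2 * w * I = - (w\<^sup>2 * (P + 2))"
        by (simp add: I(1) power2_eq_square algebra_simps)
      also have "\<dots> < 0" using I(2) \<open>0 \<le> P\<close> by simp
      finally show False using key[of w] by simp
    qed
    then show ?thesis by (simp add: I_def)
  qed
  have z0: "AE x in ?M. z x = 0"
    by (rule AE_eq_0_of_test_functions[OF assms(1,2) yz(2) orth])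
  obtain \<psi> where p: "test_function \<Omega> \<psi>" "sqnorm ?M (\<lambda>x. z x - (g x - \<psi> x)) \<le> ennreal e"
    using zC[OF \<open>0 < e\<close>] by blast
  have "sqnorm ?M (\<lambda>x. z x - (g x - \<psi> x)) = sqnorm ?M (\<lambda>x. \<psi> x - g x)"
    using z0 by (intro sqnorm_cong_AE) auto
  with p show ?thesis by auto
qed

text \<open>Duality. With test functions tending to \<open>g\<close>, the hypothesis becomes
  \<open>G\<^sup>2 \<le> K * G\<close> for the squared norm \<open>G\<close> of
  \<open>g\<close>.\<close>

lemma sqnorm_le_of_test_functions:
  fixes g :: "real^'n::finite \<Rightarrow> real"
  assumes "open \<Omega>" "\<Omega> \<in> lmeasurable" and g: "g \<in> L2 (lebesgue_on \<Omega>)" and "0 \<le> K"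
    and le: "\<And>\<psi>. test_function \<Omega> \<psi> \<Longrightarrow>
      (\<integral>x. \<psi> x * g x \<partial>lebesgue_on \<Omega>)\<^sup>2 \<le> K * (\<integral>x. (\<psi> x)\<^sup>2 \<partial>lebesgue_on \<Omega>)"
  shows "(\<integral>x. (g x)\<^sup>2 \<partial>lebesgue_on \<Omega>) \<le> K"
proof -
  let ?M = "lebesgue_on \<Omega>"
  have "\<exists>\<psi>. test_function \<Omega> \<psi> \<and> sqnorm ?M (\<lambda>x. \<psi> x - g x) \<le> ennreal (1 / Suc n)" for n
    by (rule test_functions_dense_L2[OF assms(1-3)]) simp
  then obtain \<psi> where p: "\<And>n. test_function \<Omega> (\<psi> n)" "\<And>n. sqnorm ?M (\<lambda>x. \<psi> n x - g x) \<le> ennreal (1 / Suc n)"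
    by metis
  have pL: "\<psi> n \<in> L2 ?M" for n by (rule test_function_L2[OF p(1) assms(2)])
  have "(\<lambda>n. ennreal (1 / Suc n)) \<longlonglongrightarrow> ennreal 0"
    by (intro tendsto_ennrealI LIMSEQ_Suc lim_1_over_n)
  then have conv: "L2_converges ?M \<psi> g"
    unfolding L2_converges_sqnorm
    using tendsto_sandwich[OF _ _ tendsto_const[of 0], of "\<lambda>n. sqnorm ?M (\<lambda>x. \<psi> n x - g x)" sequentially "\<lambda>n. ennreal (1 / Suc n)"] p(2)
    by simp
  define G where "G = (\<integral>x. (g x)\<^sup>2 \<partial>?M)"
  have "(\<lambda>n. \<integral>x. g x * \<psi> n x \<partial>?M) \<longlonglongrightarrow> (\<integral>x. g x * g x \<partial>?M)"
    using L2_converges_pairing[OF g pL g conv] by simp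
  then have "(\<lambda>n. (\<integral>x. \<psi> n x * g x \<partial>?M)\<^sup>2) \<longlonglongrightarrow> G\<^sup>2"
    unfolding G_def by (intro tendsto_power) (simp add: mult.commute power2_eq_square)
  moreover have "(\<lambda>n. K * (\<integral>x. (\<psi> n x)\<^sup>2 \<partial>?M)) \<longlonglongrightarrow> K * G"
    unfolding G_def by (intro tendsto_intros L2_converges_integral_square pL g conv)
  ultimately have "G\<^sup>2 \<le> K * G"
    by (rule LIMSEQ_le) (auto intro: le p(1))
  moreover have "0 \<le> G" by (simp add: G_def)
  ultimately have "G \<le> K" using \<open>0 \<le> K\<close> by (cases "G = 0") (auto simp: power2_eq_square)
  then show ?thesis by (simp add: G_def)
qed

section \<open>Weak derivatives and rescaled test functions\<close>

lemma weak_partial_H1: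
  assumes "f \<in> H1 \<Omega>"
  shows "weak_partial \<Omega> i f \<in> L2 (lebesgue_on \<Omega>)" "has_weak_partial \<Omega> i f (weak_partial \<Omega> i f)"
proof -
  have "\<exists>g. g \<in> L2 (lebesgue_on \<Omega>) \<and> has_weak_partial \<Omega> i f g"
    using assms by (auto simp: H1_def)
  from someI_ex[OF this] show "weak_partial \<Omega> i f \<in> L2 (lebesgue_on \<Omega>)" "has_weak_partial \<Omega> i f (weak_partial \<Omega> i f)"
    by (auto simp: weak_partial_def)
qed

lemma has_weak_partial_unique:
  fixes f :: "real^'n::finite \<Rightarrow> 'b::euclidean_space"
  assumes \<Omega>: "open \<Omega>" "\<Omega> \<in> lmeasurable"
    and g: "g \<in> L2 (lebesgue_on \<Omega>)" "h \<in> L2 (lebesgue_on \<Omega>)"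
    and w: "has_weak_partial \<Omega> i f g" "has_weak_partial \<Omega> i f h"
  shows "AE x in lebesgue_on \<Omega>. g x = h x"
proof -
  have "AE x in lebesgue_on \<Omega>. g x - h x = 0"
  proof (rule AE_eq_0_of_test_functions[OF \<Omega> L2_diff[OF g]])
    fix \<phi> assume \<phi>: "test_function \<Omega> \<phi>"
    note L = test_function_L2[OF \<phi> \<Omega>(2)]
    have "- (\<integral>x. \<phi> x *\<^sub>R g x \<partial>lebesgue_on \<Omega>) = - (\<integral>x. \<phi> x *\<^sub>R h x \<partial>lebesgue_on \<Omega>)"
      using w \<phi> by (simp add: has_weak_partial_def)
    then show "(\<integral>x. \<phi> x *\<^sub>R (g x - h x) \<partial>lebesgue_on \<Omega>) = 0"
      using L2_pairing(1)[OF L g(1)] L2_pairing(1)[OF L g(2)] by (simp add: scaleR_diff_right)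
  qed
  then show ?thesis by simp
qed

lemma has_weak_partial_cong_AE:
  fixes f :: "real^'n::finite \<Rightarrow> 'b::euclidean_space"
  assumes \<Omega>: "\<Omega> \<in> lmeasurable" and w: "has_weak_partial \<Omega> i f g"
    and L: "f \<in> L2 (lebesgue_on \<Omega>)" "g \<in> L2 (lebesgue_on \<Omega>)" "f' \<in> L2 (lebesgue_on \<Omega>)" "g' \<in> L2 (lebesgue_on \<Omega>)"
    and AE: "AE x in lebesgue_on \<Omega>. f x = f' x" "AE x in lebesgue_on \<Omega>. g x = g' x"
  shows "has_weak_partial \<Omega> i f' g'"
  unfolding has_weak_partial_def
proof (intro allI impI)
  fix \<phi> assume \<phi>: "test_function \<Omega> \<phi>"
  have m: "(\<lambda>x. \<psi> x *\<^sub>R h x) \<in> borel_measurable (lebesgue_on \<Omega>)" 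
    if "test_function \<Omega> \<psi>" "h \<in> L2 (lebesgue_on \<Omega>)" for \<psi> and h :: "real^'n \<Rightarrow> 'b"
    by (rule borel_measurable_integrable[OF L2_pairing(1)[OF test_function_L2[OF that(1) \<Omega>] that(2)]])
  note p = test_function_partial[OF \<phi>, of i]
  have "(\<integral>x. partial i \<phi> x *\<^sub>R f' x \<partial>lebesgue_on \<Omega>) = (\<integral>x. partial i \<phi> x *\<^sub>R f x \<partial>lebesgue_on \<Omega>)"
    using AE(1) by (intro integral_cong_AE m p L) auto
  also have "\<dots> = - (\<integral>x. \<phi> x *\<^sub>R g x \<partial>lebesgue_on \<Omega>)"
    using w \<phi> by (simp add: has_weak_partial_def)
  also have "(\<integral>x. \<phi> x *\<^sub>R g x \<partial>lebesgue_on \<Omega>) = (\<integral>x. \<phi> x *\<^sub>R g' x \<partial>lebesgue_on \<Omega>)"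
    using AE(2) by (intro integral_cong_AE m \<phi> L) auto
  finally show "(\<integral>x. partial i \<phi> x *\<^sub>R f' x \<partial>lebesgue_on \<Omega>) = - (\<integral>x. \<phi> x *\<^sub>R g' x \<partial>lebesgue_on \<Omega>)" .
qed

lemma has_weak_partial_limit:
  fixes f :: "nat \<Rightarrow> real^'n::finite \<Rightarrow> 'b::euclidean_space"
  assumes \<Omega>: "\<Omega> \<in> lmeasurable" and w: "\<And>n. has_weak_partial \<Omega> i (f n) (g n)"
    and L: "\<And>n. f n \<in> L2 (lebesgue_on \<Omega>)" "\<And>n. g n \<in> L2 (lebesgue_on \<Omega>)" "f' \<in> L2 (lebesgue_on \<Omega>)" "g' \<in> L2 (lebesgue_on \<Omega>)"
    and conv: "L2_converges (lebesgue_on \<Omega>) f f'" "L2_converges (lebesgue_on \<Omega>) g g'"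
  shows "has_weak_partial \<Omega> i f' g'"
  unfolding has_weak_partial_def
proof (intro allI impI)
  fix \<phi> assume \<phi>: "test_function \<Omega> \<phi>"
  have "(\<lambda>n. \<integral>x. partial i \<phi> x *\<^sub>R f n x \<partial>lebesgue_on \<Omega>) \<longlonglongrightarrow> (\<integral>x. partial i \<phi> x *\<^sub>R f' x \<partial>lebesgue_on \<Omega>)"
    by (intro L2_converges_pairing test_function_L2[OF test_function_partial[OF \<phi>] \<Omega>] L conv)
  moreover have "(\<lambda>n. - (\<integral>x. \<phi> x *\<^sub>R g n x \<partial>lebesgue_on \<Omega>)) \<longlonglongrightarrow> - (\<integral>x. \<phi> x *\<^sub>R g' x \<partial>lebesgue_on \<Omega>)"
    by (intro tendsto_minus L2_converges_pairing test_function_L2[OF \<phi> \<Omega>] L conv)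
  ultimately show "(\<integral>x. partial i \<phi> x *\<^sub>R f' x \<partial>lebesgue_on \<Omega>) = - (\<integral>x. \<phi> x *\<^sub>R g' x \<partial>lebesgue_on \<Omega>)"
    using w \<phi> by (intro LIMSEQ_unique) (auto simp: has_weak_partial_def)
qed

lemma has_weak_partial_midpoint:
  fixes f :: "real^'n::finite \<Rightarrow> 'b::euclidean_space"
  assumes \<Omega>: "\<Omega> \<in> lmeasurable" and w: "has_weak_partial \<Omega> i f g" "has_weak_partial \<Omega> i f' g'"
    and L: "f \<in> L2 (lebesgue_on \<Omega>)" "g \<in> L2 (lebesgue_on \<Omega>)" "f' \<in> L2 (lebesgue_on \<Omega>)" "g' \<in> L2 (lebesgue_on \<Omega>)"
  shows "has_weak_partial \<Omega> i (\<lambda>x. (1/2) *\<^sub>R (f x + f' x)) (\<lambda>x. (1/2) *\<^sub>R (g x + g' x))"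
  unfolding has_weak_partial_def
proof (intro allI impI)
  fix \<phi> assume \<phi>: "test_function \<Omega> \<phi>"
  have e: "(\<integral>x. \<psi> x *\<^sub>R ((1/2) *\<^sub>R (h x + h' x)) \<partial>lebesgue_on \<Omega>)
      = (1/2) *\<^sub>R ((\<integral>x. \<psi> x *\<^sub>R h x \<partial>lebesgue_on \<Omega>) + (\<integral>x. \<psi> x *\<^sub>R h' x \<partial>lebesgue_on \<Omega>))"
    if t: "test_function \<Omega> \<psi>" and h: "h \<in> L2 (lebesgue_on \<Omega>)" "h' \<in> L2 (lebesgue_on \<Omega>)"
    for \<psi> and h h' :: "real^'n \<Rightarrow> 'b"
  proof -
    note i = L2_pairing(1)[OF test_function_L2[OF t \<Omega>]]
    have "(\<integral>x. \<psi> x *\<^sub>R ((1/2) *\<^sub>R (h x + h' x)) \<partial>lebesgue_on \<Omega>)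
      = (\<integral>x. (1/2) *\<^sub>R (\<psi> x *\<^sub>R h x + \<psi> x *\<^sub>R h' x) \<partial>lebesgue_on \<Omega>)"
      by (simp add: scaleR_add_right mult.commute)
    also have "\<dots> = (1/2) *\<^sub>R (\<integral>x. \<psi> x *\<^sub>R h x + \<psi> x *\<^sub>R h' x \<partial>lebesgue_on \<Omega>)"
      by (rule integral_scaleR_right)
    finally show ?thesis by (simp only: Bochner_Integration.integral_add[OF i[OF h(1)] i[OF h(2)]])
  qed
  show "(\<integral>x. partial i \<phi> x *\<^sub>R ((1/2) *\<^sub>R (f x + f' x)) \<partial>lebesgue_on \<Omega>)
      = - (\<integral>x. \<phi> x *\<^sub>R ((1/2) *\<^sub>R (g x + g' x)) \<partial>lebesgue_on \<Omega>)"
    unfolding e[OF \<phi> L(2,4)] e[OF test_function_partial[OF \<phi>] L(1,3)]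
    using w \<phi> by (simp add: has_weak_partial_def scaleR_add_right scaleR_diff_right)
qed

section \<open>Norm estimates and integrals depending on a parameter\<close>

text \<open>The norm as a real number, for estimates in which norms are multiplied. It has its usual
  meaning on \<open>L2\<close> only, because the integral defaults to \<open>0\<close>
  elsewhere.\<close>

definition l2norm :: "'a measure \<Rightarrow> ('a \<Rightarrow> real) \<Rightarrow> real" where
  "l2norm M f = sqrt (\<integral>x. (f x)\<^sup>2 \<partial>M)"

lemma l2norm_nonneg: "0 \<le> l2norm M f"
  by (simp add: l2norm_def)

lemma integral_mult_le_l2norm:
  assumes "f \<in> L2 M" "g \<in> L2 M"
  shows "\<bar>\<integral>x. f x * g x \<partial>M\<bar> \<le> l2norm M f * l2norm M g"
proof -
  have "ennreal ((\<integral>x. f x * g x \<partial>M)\<^sup>2) \<le> ennreal ((\<integral>x. (f x)\<^sup>2 \<partial>M) * (\<integral>x. (g x)\<^sup>2 \<partial>M))"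
    using L2_pairing(2)[OF assms] by (simp add: sqnorm_eq_integral assms ennreal_mult)
  then have "(\<integral>x. f x * g x \<partial>M)\<^sup>2 \<le> (\<integral>x. (f x)\<^sup>2 \<partial>M) * (\<integral>x. (g x)\<^sup>2 \<partial>M)"
    by (subst (asm) ennreal_le_iff) auto
  then have "sqrt ((\<integral>x. f x * g x \<partial>M)\<^sup>2) \<le> sqrt ((\<integral>x. (f x)\<^sup>2 \<partial>M) * (\<integral>x. (g x)\<^sup>2 \<partial>M))"
    by (rule real_sqrt_le_mono)
  then show ?thesis by (simp add: l2norm_def real_sqrt_mult)
qed

lemma l2norm_le:
  assumes "g \<in> L2 M" "f \<in> borel_measurable M" "0 \<le> c" "\<And>x. x \<in> space M \<Longrightarrow> \<bar>f x\<bar> \<le> c * \<bar>g x\<bar>"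
  shows "l2norm M f \<le> c * l2norm M g"
proof -
  have "(\<integral>x. (f x)\<^sup>2 \<partial>M) \<le> (\<integral>x. c\<^sup>2 * (g x)\<^sup>2 \<partial>M)"
  proof (rule integral_mono_AE')
    show "integrable M (\<lambda>x. c\<^sup>2 * (g x)\<^sup>2)" using assms(1) by (auto simp: L2_def)
    show "AE x in M. (f x)\<^sup>2 \<le> c\<^sup>2 * (g x)\<^sup>2"
    proof (rule AE_I2)
      fix x assume "x \<in> space M"
      from power_mono[OF assms(4)[OF this], of 2] show "(f x)\<^sup>2 \<le> c\<^sup>2 * (g x)\<^sup>2"
        by (simp add: power_mult_distrib)
    qed
  qed auto
  then have "sqrt (\<integral>x. (f x)\<^sup>2 \<partial>M) \<le> sqrt (c\<^sup>2 * (\<integral>x. (g x)\<^sup>2 \<partial>M))"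
    by (intro real_sqrt_le_mono) simp
  with assms(3) show ?thesis by (simp add: l2norm_def real_sqrt_mult)
qed

text \<open>Dominated convergence along an arbitrary null sequence: by the mean value inequality the
  difference quotients of \<open>k\<close> are bounded by \<open>C\<close>, so
  \<open>C * \<bar>f x\<bar>\<close> dominates. Finitely many terms are dropped to stay within the
  radius \<open>r\<close>.\<close>

lemma has_real_derivative_integral_mult:
  fixes k k' :: "real \<Rightarrow> 'a \<Rightarrow> real"
  assumes f: "integrable M f" and r: "0 < r"
    and d: "\<And>t x. \<bar>t - t0\<bar> < r \<Longrightarrow> ((\<lambda>t. k t x) has_real_derivative k' t x) (at t)"
    and k'b: "\<And>t x. \<bar>t - t0\<bar> < r \<Longrightarrow> \<bar>k' t x\<bar> \<le> C"
    and kb: "\<And>t. \<bar>t - t0\<bar> < r \<Longrightarrow> integrable M (\<lambda>x. k t x * f x)"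
    and k'm: "k' t0 \<in> borel_measurable M" 
  shows "((\<lambda>t. \<integral>x. k t x * f x \<partial>M) has_real_derivative (\<integral>x. k' t0 x * f x \<partial>M)) (at t0)"
  unfolding DERIV_def tendsto_at_iff_sequentially
proof (intro allI impI)
  fix X :: "nat \<Rightarrow> real" assume X: "\<forall>i. X i \<in> UNIV - {0}" "X \<longlonglongrightarrow> 0"
  obtain N where N: "\<And>n. n \<ge> N \<Longrightarrow> \<bar>X n\<bar> < r"
    using LIMSEQ_D[OF X(2) r] by auto
  define Y where "Y n = X (n + N)" for n
  have Y: "Y \<longlonglongrightarrow> 0" "\<And>n. \<bar>Y n\<bar> < r" "\<And>n. Y n \<noteq> 0"
    using X N LIMSEQ_ignore_initial_segment[OF X(2), of N] by (auto simp: Y_def[abs_def])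
  have [measurable]: "f \<in> borel_measurable M" using f by simp
  have "(\<lambda>n. \<integral>x. ((k (t0 + Y n) x - k t0 x) / Y n) * f x \<partial>M) \<longlonglongrightarrow> (\<integral>x. k' t0 x * f x \<partial>M)"
  proof (rule integral_dominated_convergence[where w="\<lambda>x. C * \<bar>f x\<bar>"])
    show "(\<lambda>x. k' t0 x * f x) \<in> borel_measurable M" using k'm by simp
    have "(\<lambda>x. (k (t0 + Y n) x * f x - k t0 x * f x) / Y n) \<in> borel_measurable M" for n
      using kb[of "t0 + Y n"] kb[of t0] Y(2)[of n] r by simp
    then show "(\<lambda>x. ((k (t0 + Y n) x - k t0 x) / Y n) * f x) \<in> borel_measurable M" for n
      by (simp add: left_diff_distrib)
    show "AE x in M. (\<lambda>n. ((k (t0 + Y n) x - k t0 x) / Y n) * f x) \<longlonglongrightarrow> k' t0 x * f x"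
    proof (intro AE_I2 tendsto_mult tendsto_const)
      fix x
      have "(\<lambda>h. (k (t0 + h) x - k t0 x) / h) \<midarrow>0\<rightarrow> k' t0 x"
        using d[of t0 x] r by (simp add: DERIV_def)
      then show "(\<lambda>n. (k (t0 + Y n) x - k t0 x) / Y n) \<longlonglongrightarrow> k' t0 x"
        using Y(1,3) unfolding tendsto_at_iff_sequentially by (auto simp: o_def)
    qed
    show "integrable M (\<lambda>x. C * \<bar>f x\<bar>)" using f by auto
    show "AE x in M. norm (((k (t0 + Y n) x - k t0 x) / Y n) * f x) \<le> C * \<bar>f x\<bar>" for n
    proof (rule AE_I2)
      fix x
      have "\<bar>k (t0 + Y n) x - k t0 x\<bar> \<le> C * \<bar>(t0 + Y n) - t0\<bar>"
      proof (rule field_differentiable_bound[where S="ball t0 r" and f'="\<lambda>t. k' t x", unfolded real_norm_def])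
        show "((\<lambda>t. k t x) has_real_derivative k' t x) (at t within ball t0 r)" if "t \<in> ball t0 r" for t
          using d[of t x] that by (auto simp: dist_real_def intro: has_field_derivative_at_within)
        show "\<bar>k' t x\<bar> \<le> C" if "t \<in> ball t0 r" for t
          using k'b[of t x] that by (auto simp: dist_real_def)
      qed (use Y(2)[of n] r in \<open>auto simp: dist_real_def\<close>)
      then have "\<bar>(k (t0 + Y n) x - k t0 x) / Y n\<bar> \<le> C" using Y(3)[of n] by (simp add: field_simps)
      then show "norm (((k (t0 + Y n) x - k t0 x) / Y n) * f x) \<le> C * \<bar>f x\<bar>"
        unfolding real_norm_def abs_mult by (intro mult_right_mono) auto
    qed
  qed
  moreover have "(\<integral>x. ((k (t0 + Y n) x - k t0 x) / Y n) * f x \<partial>M) 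
      = ((\<integral>x. k (t0 + Y n) x * f x \<partial>M) - (\<integral>x. k t0 x * f x \<partial>M)) / Y n" for n
  proof -
    have "(\<integral>x. ((k (t0 + Y n) x - k t0 x) / Y n) * f x \<partial>M) = (\<integral>x. (k (t0 + Y n) x * f x - k t0 x * f x) / Y n \<partial>M)"
      by (simp add: left_diff_distrib)
    also have "\<dots> = ((\<integral>x. k (t0 + Y n) x * f x \<partial>M) - (\<integral>x. k t0 x * f x \<partial>M)) / Y n"
      using kb[of "t0 + Y n"] kb[of t0] Y(2)[of n] r by simp
    finally show ?thesis .
  qed
  ultimately have "(\<lambda>n. ((\<integral>x. k (t0 + Y n) x * f x \<partial>M) - (\<integral>x. k t0 x * f x \<partial>M)) / Y n) \<longlonglongrightarrow> (\<integral>x. k' t0 x * f x \<partial>M)"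
    by (simp only:)
  then show "((\<lambda>h. ((\<integral>x. k (t0 + h) x * f x \<partial>M) - (\<integral>x. k t0 x * f x \<partial>M)) / h) \<circ> X) \<longlonglongrightarrow> (\<integral>x. k' t0 x * f x \<partial>M)"
    unfolding Y_def o_def by (rule LIMSEQ_offset)
qed

lemma partial_affine:
  assumes "smooth f"
  shows "partial i (\<lambda>x. f (c *\<^sub>R (x - p))) x = c *\<^sub>R partial i f (c *\<^sub>R (x - p))"
proof -
  have "((\<lambda>x. f (c *\<^sub>R (x - p))) has_derivative (\<lambda>v. \<Sum>i\<in>UNIV. (c *\<^sub>R v) $ i *\<^sub>R partial i f (c *\<^sub>R (x - p)))) (at x)"
    by (rule has_derivative_compose[OF _ smooth_has_derivative[OF assms]]) (auto intro!: derivative_eq_intros)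
  from partial_eqI[OF this, of i] show ?thesis
    by (simp add: axis_def if_distrib[of "\<lambda>x. x *\<^sub>R _"] if_distrib[of "\<lambda>x. _ * x"] cong: if_cong)
qed

lemma partial_mult:
  assumes "smooth f" "smooth g"
  shows "partial i (\<lambda>x. f x * g x :: real) x = f x * partial i g x + partial i f x * g x"
proof -
  have "(f has_derivative frechet_derivative f (at x)) (at x)" "(g has_derivative frechet_derivative g (at x)) (at x)"
    using smooth_differentiable[OF assms(1)] smooth_differentiable[OF assms(2)]
    by (auto simp: frechet_derivative_works)
  then show ?thesis
    using partial_eqI[OF has_derivative_mult] by (simp add: partial_def)
qed

lemma partial_affine_component: "partial i (\<lambda>z. v + a * z $ i) z = (a::real)"
proof -
  have "((\<lambda>z. v + a * z $ i) has_derivative (\<lambda>w. a * w $ i)) (at z)"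
    by (auto intro!: derivative_eq_intros bounded_linear_imp_has_derivative bounded_linear_vec_nth)
  from partial_eqI[OF this] show ?thesis by simp
qed


text \<open>
  The family of test functions along which weak derivatives are integrated: the push-forward
  (preserving the integral) of \<open>\<psi>\<close> under \<open>z \<mapsto> (1 + a t) z + t v\<close>. Its derivative with respect
  to \<open>t\<close> is a divergence.
\<close>

definition rescale :: "real \<Rightarrow> real^'n::finite \<Rightarrow> (real^'n \<Rightarrow> real) \<Rightarrow> real \<Rightarrow> real^'n \<Rightarrow> real" where
  "rescale a v \<psi> t x = inverse (1 + a * t) ^ CARD('n) * \<psi> (inverse (1 + a * t) *\<^sub>R (x - t *\<^sub>R v))"

text \<open>The point \<open>z\<close> is where the motion was at time \<open>0\<close> if it is at
  \<open>x\<close> at time \<open>t\<close>, and \<open>v + a z\<close> is its velocity. Up to the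
  power of \<open>inverse (1 + a * t)\<close> in \<open>rescale\<close>, this is density times
  velocity, the flux in the continuity equation.\<close>

definition rescale_flux ::
  "real \<Rightarrow> real^'n::finite \<Rightarrow> (real^'n \<Rightarrow> real) \<Rightarrow> real \<Rightarrow> 'n \<Rightarrow> real^'n \<Rightarrow> real" where
  "rescale_flux a v \<psi> t i x =
     (let z = inverse (1 + a * t) *\<^sub>R (x - t *\<^sub>R v) in (v $ i + a * z $ i) * \<psi> z)"

lemma smooth_affine_component: "smooth (\<lambda>z. v + a * z $ i)"
  by (intro smooth_add smooth_const smooth_mult smooth_nth)

lemma partial_rescale_flux:
  fixes \<psi> :: "real^'n::finite \<Rightarrow> real" and a :: real and v :: "real^'n"
  assumes "smooth \<psi>"
  defines "\<Theta> \<equiv> \<lambda>i z. (v $ i + a * z $ i) * \<psi> z"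
  shows "partial i (rescale_flux a v \<psi> t i) x =
    inverse (1 + a * t) * partial i (\<Theta> i) (inverse (1 + a * t) *\<^sub>R (x - t *\<^sub>R v))"
    and "partial i (\<Theta> i) z = (v $ i + a * z $ i) * partial i \<psi> z + a * \<psi> z"
    and "smooth (\<Theta> i)"
proof -
  show s: "smooth (\<Theta> i)"
    unfolding \<Theta>_def by (intro smooth_mult smooth_affine_component assms)
  have "rescale_flux a v \<psi> t i = (\<lambda>x. \<Theta> i (inverse (1 + a * t) *\<^sub>R (x - t *\<^sub>R v)))"
    by (auto simp: rescale_flux_def \<Theta>_def Let_def)
  then show "partial i (rescale_flux a v \<psi> t i) x =
    inverse (1 + a * t) * partial i (\<Theta> i) (inverse (1 + a * t) *\<^sub>R (x - t *\<^sub>R v))"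
    by (simp add: partial_affine[OF s])
  show "partial i (\<Theta> i) z = (v $ i + a * z $ i) * partial i \<psi> z + a * \<psi> z"
    unfolding \<Theta>_def by (subst partial_mult) (auto simp: smooth_affine_component assms partial_affine_component)
qed

text \<open>The continuity equation for mass carried by an affine motion. Differentiating the
  normalising power gives the term with \<open>CARD('n) * a * \<psi>\<close>, which is what the
  divergence of the velocity contributes on the other side.\<close>

lemma rescale_has_derivative:
  fixes \<psi> :: "real^'n::finite \<Rightarrow> real"
  assumes \<psi>: "smooth \<psi>" and t: "1 + a * t \<noteq> 0"
  shows "((\<lambda>t. rescale a v \<psi> t x) has_real_derivative
    - (inverse (1 + a * t) ^ CARD('n) * (\<Sum>i\<in>UNIV. partial i (rescale_flux a v \<psi> t i) x))) (at t)"
proof -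
  let ?c = "\<lambda>t. inverse (1 + a * t)"
  let ?z = "\<lambda>t. ?c t *\<^sub>R (x - t *\<^sub>R v)"
  define z where "z = ?z t"
  define c where "c = ?c t"
  obtain m where m: "CARD('n) = Suc m" using gr0_implies_Suc[OF zero_less_card_finite] by blast
  have dc: "(?c has_real_derivative - a * c\<^sup>2) (at t)"
    using t by (auto intro!: derivative_eq_intros simp: power2_eq_square c_def field_simps)
  have dz: "(?z has_vector_derivative c *\<^sub>R (- v) + (- a * c\<^sup>2) *\<^sub>R (x - t *\<^sub>R v)) (at t)"
    unfolding c_def
    by (rule has_vector_derivative_scaleR[OF dc[unfolded c_def]]) (auto intro!: derivative_eq_intros)
  have z': "c *\<^sub>R (- v) + (- a * c\<^sup>2) *\<^sub>R (x - t *\<^sub>R v) = (- c) *\<^sub>R (v + a *\<^sub>R z)"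
    by (simp add: z_def c_def power2_eq_square scaleR_add_right mult.commute mult.left_commute)
  have "((\<lambda>t. \<psi> (?z t)) has_derivative (\<lambda>h. \<Sum>i\<in>UNIV. (h *\<^sub>R ((- c) *\<^sub>R (v + a *\<^sub>R z))) $ i *\<^sub>R partial i \<psi> z)) (at t)"
    unfolding z_def
    by (rule has_derivative_compose[OF dz[unfolded z' has_vector_derivative_def, unfolded z_def] smooth_has_derivative[OF \<psi>]])
  also have "(\<lambda>h. \<Sum>i\<in>UNIV. (h *\<^sub>R ((- c) *\<^sub>R (v + a *\<^sub>R z))) $ i *\<^sub>R partial i \<psi> z)
      = (\<lambda>h. h * (- c * (\<Sum>i\<in>UNIV. (v $ i + a * z $ i) * partial i \<psi> z)))"
    by (auto simp: sum_distrib_left intro!: sum.cong simp: algebra_simps)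
  finally have dp: "((\<lambda>t. \<psi> (?z t)) has_real_derivative - c * (\<Sum>i\<in>UNIV. (v $ i + a * z $ i) * partial i \<psi> z)) (at t)"
    unfolding has_field_derivative_def mult_commute_abs .
  have "((\<lambda>t. rescale a v \<psi> t x) has_real_derivative
     (c ^ CARD('n) * (- c * (\<Sum>i\<in>UNIV. (v $ i + a * z $ i) * partial i \<psi> z))
      + real CARD('n) * (c ^ m * (- a * c\<^sup>2)) * \<psi> z)) (at t)"
    unfolding rescale_def z_def c_def
    using DERIV_mult[OF DERIV_power_Suc[OF dc, of m] dp]
    by (simp add: m z_def c_def mult.commute mult.left_commute add.commute)
  also have "(c ^ CARD('n) * (- c * (\<Sum>i\<in>UNIV. (v $ i + a * z $ i) * partial i \<psi> z))
      + real CARD('n) * (c ^ m * (- a * c\<^sup>2)) * \<psi> z)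
     = - (c ^ CARD('n) * (c * (\<Sum>i\<in>(UNIV :: 'n set). (v $ i + a * z $ i) * partial i \<psi> z + a * \<psi> z)))"
    by (simp add: sum.distrib algebra_simps power2_eq_square m del: of_nat_Suc)
  also have "c * (\<Sum>i\<in>(UNIV :: 'n set). (v $ i + a * z $ i) * partial i \<psi> z + a * \<psi> z)
     = (\<Sum>i\<in>UNIV. partial i (rescale_flux a v \<psi> t i) x)"
    by (simp add: partial_rescale_flux[OF \<psi>] c_def z_def sum_distrib_left)
  finally show ?thesis by (simp add: c_def)
qed

text \<open>The support moves with the motion: it lies in the image of \<open>K\<close> at time
  \<open>t\<close>, whatever domain \<open>\<Omega>'\<close> the function \<open>\<psi>\<close>
  belonged to.\<close>

lemma test_function_rescale_flux:
  assumes "test_function \<Omega>' \<psi>" and t: "1 + a * t \<noteq> 0"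
    and K: "compact K" "\<forall>z. z \<notin> K \<longrightarrow> \<psi> z = 0"
    and in\<Omega>: "\<And>z. z \<in> K \<Longrightarrow> (1 + a * t) *\<^sub>R z + t *\<^sub>R v \<in> \<Omega>"
  shows "test_function \<Omega> (rescale_flux a v \<psi> t i)" "test_function \<Omega> (rescale a v \<psi> t)"
proof -
  let ?c = "inverse (1 + a * t)"
  let ?K = "(\<lambda>z. (1 + a * t) *\<^sub>R z + t *\<^sub>R v) ` K"
  have comp: "compact ?K" using K(1) by (intro compact_continuous_image continuous_intros)
  have sub: "?K \<subseteq> \<Omega>" using in\<Omega> by auto
  have out: "?c *\<^sub>R (x - t *\<^sub>R v) \<notin> K" if "x \<notin> ?K" for x
  proof
    assume "?c *\<^sub>R (x - t *\<^sub>R v) \<in> K"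
    then have "(1 + a * t) *\<^sub>R (?c *\<^sub>R (x - t *\<^sub>R v)) + t *\<^sub>R v \<in> ?K" by blast
    with t that show False by simp
  qed
  note s = test_function_smooth[OF assms(1)]
  have "smooth (\<lambda>x. (\<lambda>z. (v $ i + a * z $ i) * \<psi> z) (?c *\<^sub>R (x - t *\<^sub>R v)))"
    by (rule smooth_affine, intro smooth_mult smooth_affine_component s)
  then have "smooth (rescale_flux a v \<psi> t i)"
    by (simp add: rescale_flux_def[abs_def] Let_def)
  then show "test_function \<Omega> (rescale_flux a v \<psi> t i)"
    by (rule test_functionI[OF _ comp sub]) (use out K(2) in \<open>auto simp: rescale_flux_def Let_def\<close>)
  have "smooth (rescale a v \<psi> t)"
    unfolding rescale_def[abs_def] by (rule smooth_mult[OF smooth_const smooth_affine[OF s]])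
  then show "test_function \<Omega> (rescale a v \<psi> t)"
    by (rule test_functionI[OF _ comp sub]) (use out K(2) in \<open>auto simp: rescale_def\<close>)
qed

lemma test_function_rescale_UNIV:
  assumes "test_function \<Omega>' \<psi>" and t: "1 + a * t \<noteq> 0"
  shows "test_function UNIV (rescale_flux a v \<psi> t i)" "test_function UNIV (rescale a v \<psi> t)"
proof -
  obtain K where "compact K" "\<forall>z. z \<notin> K \<longrightarrow> \<psi> z = 0" using assms(1) by (rule test_functionE)
  with assms show "test_function UNIV (rescale_flux a v \<psi> t i)" "test_function UNIV (rescale a v \<psi> t)"
    by (auto intro: test_function_rescale_flux)
qed

text \<open>All derivatives fall on the test function here, so that \<open>f\<close> only has to be
  square integrable.\<close>

lemma rescale_integral_has_derivative:
  fixes \<psi> :: "real^'n::finite \<Rightarrow> real"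
  assumes \<Omega>: "\<Omega> \<in> lmeasurable" and f: "f \<in> L2 (lebesgue_on \<Omega>)"
    and \<psi>: "test_function \<Omega>' \<psi>" and t0: "0 < 1 + a * t0"
  shows "((\<lambda>t. \<integral>x. rescale a v \<psi> t x * f x \<partial>lebesgue_on \<Omega>) has_real_derivative
    - (inverse (1 + a * t0) ^ CARD('n) * (\<Sum>i\<in>UNIV. \<integral>x. partial i (rescale_flux a v \<psi> t0 i) x * f x \<partial>lebesgue_on \<Omega>))) (at t0)"
proof -
  let ?M = "lebesgue_on \<Omega>"
  let ?k' = "\<lambda>t x. - (inverse (1 + a * t) ^ CARD('n) * (\<Sum>i\<in>UNIV. partial i (rescale_flux a v \<psi> t i) x))"
  note s = test_function_smooth[OF \<psi>]
  \<comment> \<open>Within this radius \<open>1 + a * t\<close> stays above half of its value at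
    \<open>t0\<close>, which yields the bound \<open>m\<close> for its inverse; the summand
    \<open>1\<close> covers \<open>a = 0\<close>.\<close>
  define r where "r = (1 + a * t0) / (2 * (\<bar>a\<bar> + 1))"
  have r: "0 < r" using t0 by (simp add: r_def)
  have pos: "(1 + a * t0) / 2 \<le> 1 + a * t" if "\<bar>t - t0\<bar> < r" for t
  proof -
    have "\<bar>a * (t - t0)\<bar> \<le> (\<bar>a\<bar> + 1) * r" unfolding abs_mult using that r by (intro mult_mono) auto
    also have "\<dots> = (1 + a * t0) / 2" by (simp add: r_def field_simps)
    finally have "- (a * (t - t0)) \<le> (1 + a * t0) / 2" by linarith
    then show ?thesis by (simp add: field_simps)
  qed
  have posn: "1 + a * t \<noteq> 0" if "\<bar>t - t0\<bar> < r" for t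
    using less_le_trans[OF half_gt_zero[OF t0] pos[OF that]] by simp
  have "\<exists>C\<ge>0. \<forall>z. \<bar>partial i (\<lambda>z. (v $ i + a * z $ i) * \<psi> z) z\<bar> \<le> C" for i
    using test_function_bounded[OF test_function_partial[OF test_function_mult[OF smooth_affine_component \<psi>]]] by metis
  then obtain C where C: "\<And>i. 0 \<le> C i" "\<And>i z. \<bar>partial i (\<lambda>z. (v $ i + a * z $ i) * \<psi> z) z\<bar> \<le> C i" by metis
  define m where "m = 2 / (1 + a * t0)"
  have m0: "0 \<le> m" using t0 by (simp add: m_def)
  have L: "test_function UNIV \<eta> \<Longrightarrow> integrable ?M (\<lambda>x. \<eta> x * f x)" for \<eta>
    using L2_pairing(1)[OF test_function_L2[OF _ \<Omega>] f] by simp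
  have "((\<lambda>t. \<integral>x. rescale a v \<psi> t x * f x \<partial>?M) has_real_derivative (\<integral>x. ?k' t0 x * f x \<partial>?M)) (at t0)"
  proof (rule has_real_derivative_integral_mult[where r=r and C = "m ^ CARD('n) * (\<Sum>i\<in>UNIV. m * C i)"])
    show "integrable ?M f" by (rule L2_integrable[OF f emeasure_lebesgue_on_finite[OF \<Omega>]])
    show "0 < r" by (fact r)
    show "((\<lambda>t. rescale a v \<psi> t x) has_real_derivative ?k' t x) (at t)" if "\<bar>t - t0\<bar> < r" for t x
      by (rule rescale_has_derivative[OF s posn[OF that]])
    show "\<bar>?k' t x\<bar> \<le> m ^ CARD('n) * (\<Sum>i\<in>UNIV. m * C i)" if "\<bar>t - t0\<bar> < r" for t x
    proof -
      have p: "0 < 1 + a * t" using less_le_trans[OF half_gt_zero[OF t0] pos[OF that]] .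
      have c: "inverse (1 + a * t) \<le> m" "0 \<le> inverse (1 + a * t)"
        using pos[OF that] t0 p by (auto simp: m_def field_simps)
      have "\<bar>partial i (rescale_flux a v \<psi> t i) x\<bar> \<le> m * C i" for i
        unfolding partial_rescale_flux(1)[OF s] abs_mult using c C m0 by (intro mult_mono) auto
      then have "\<bar>\<Sum>i\<in>UNIV. partial i (rescale_flux a v \<psi> t i) x\<bar> \<le> (\<Sum>i\<in>UNIV. m * C i)"
        by (intro order_trans[OF sum_abs] sum_mono)
      then show ?thesis
        unfolding abs_minus_cancel abs_mult using c m0
        by (intro mult_mono) (auto simp: power_mono)
    qed
    show "integrable ?M (\<lambda>x. rescale a v \<psi> t x * f x)" if "\<bar>t - t0\<bar> < r" for t
      by (rule L[OF test_function_rescale_UNIV(2)[OF \<psi> posn[OF that]]])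
    have "smooth (partial i (rescale_flux a v \<psi> t0 i))" for i
      using t0 by (intro smooth_partial test_function_smooth[OF test_function_rescale_UNIV(1)[OF \<psi>]]) simp
    then show "?k' t0 \<in> borel_measurable ?M"
      by (intro borel_measurable_lebesgue_on borel_measurable_uminus borel_measurable_times borel_measurable_const
        borel_measurable_sum smooth_borel_measurable)
  qed
  also have "(\<integral>x. ?k' t0 x * f x \<partial>?M) = (\<integral>x. - (inverse (1 + a * t0) ^ CARD('n)) *
      (\<Sum>i\<in>UNIV. partial i (rescale_flux a v \<psi> t0 i) x * f x) \<partial>?M)"
    by (simp add: sum_distrib_right mult.assoc)
  also have "\<dots> = - (inverse (1 + a * t0) ^ CARD('n)) * (\<Sum>i\<in>UNIV. \<integral>x. partial i (rescale_flux a v \<psi> t0 i) x * f x \<partial>?M)"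
    using t0 by (subst integral_mult_right_zero, subst Bochner_Integration.integral_sum)
      (auto intro!: L test_function_partial test_function_rescale_UNIV[OF \<psi>])
  finally show ?thesis by simp
qed

section \<open>An interpolation inequality for the gradient\<close>

text \<open>As long as the moved support is inside the domain, the components of the flux are
  admissible test functions, and the divergence can be shifted onto \<open>f\<close> by the
  definition of weak derivatives.\<close>

lemma rescale_integral_has_weak_derivative:
  fixes \<psi> :: "real^'n::finite \<Rightarrow> real"
  assumes \<Omega>: "\<Omega> \<in> lmeasurable" and f: "f \<in> L2 (lebesgue_on \<Omega>)"
    and w: "\<And>i. has_weak_partial \<Omega> i f (F i)"
    and \<psi>: "test_function \<Omega>' \<psi>" and t: "0 < 1 + a * t"
    and K: "compact K" "\<forall>z. z \<notin> K \<longrightarrow> \<psi> z = 0"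
    and in\<Omega>: "\<And>z. z \<in> K \<Longrightarrow> (1 + a * t) *\<^sub>R z + t *\<^sub>R v \<in> \<Omega>"
  shows "((\<lambda>t. \<integral>x. rescale a v \<psi> t x * f x \<partial>lebesgue_on \<Omega>) has_real_derivative
    inverse (1 + a * t) ^ CARD('n) * (\<Sum>i\<in>UNIV. \<integral>x. rescale_flux a v \<psi> t i x * F i x \<partial>lebesgue_on \<Omega>)) (at t)"
proof -
  have "(\<integral>x. partial i (rescale_flux a v \<psi> t i) x * f x \<partial>lebesgue_on \<Omega>)
      = - (\<integral>x. rescale_flux a v \<psi> t i x * F i x \<partial>lebesgue_on \<Omega>)" for i
    using w[of i] test_function_rescale_flux(1)[OF \<psi> _ K in\<Omega>, of i] t
    by (simp add: has_weak_partial_def)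
  then show ?thesis
    using rescale_integral_has_derivative[OF \<Omega> f \<psi> t, of v] by (simp add: sum_negf)
qed

text \<open>Contracting the argument by \<open>s\<close> scales the squared norm over the whole
  space by a power of \<open>s\<close>, hence does not increase it. The contracted function may
  stick out of the domain, but restricting it only makes its norm smaller, while
  \<open>\<psi>\<close> vanishes outside anyway.\<close>

lemma integral_square_affine_le:
  fixes \<psi> :: "real^'n::finite \<Rightarrow> real"
  assumes \<Omega>: "\<Omega> \<in> lmeasurable" and \<psi>: "test_function \<Omega> \<psi>" and s: "0 < s" "s \<le> 1"
  shows "l2norm (lebesgue_on \<Omega>) (\<lambda>x. \<psi> (inverse s *\<^sub>R (x - p))) \<le> l2norm (lebesgue_on \<Omega>) \<psi>"
proof -
  let ?c = "inverse s"
  let ?z = "\<lambda>x. \<psi> (?c *\<^sub>R (x - p))"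
  note sm = test_function_smooth[OF \<psi>]
  have m[measurable]: "\<psi> \<in> borel_measurable borel" "?z \<in> borel_measurable borel"
    using smooth_borel_measurable[OF sm] smooth_borel_measurable[OF smooth_affine[OF sm]] by auto
  have \<Omega>s: "\<Omega> \<in> sets lebesgue" using \<Omega> by (simp add: fmeasurableD)
  obtain K where K: "K \<subseteq> \<Omega>" "\<forall>x. x \<notin> K \<longrightarrow> \<psi> x = 0"
    using \<psi> by (rule test_functionE)
  then have off: "\<psi> x = 0" if "x \<notin> \<Omega>" for x
    using that by blast
  have lb: "sqnorm lebesgue g = sqnorm lborel g" if [measurable]: "g \<in> borel_measurable borel" for g :: "real^'n \<Rightarrow> real"
    unfolding sqnorm_def by (rule nn_integral_completion)
  have "sqnorm lborel \<psi> = (\<integral>\<^sup>+x. ennreal ((norm (\<psi> x))\<^sup>2) \<partial>density (distr lborel borel (\<lambda>x. - (?c *\<^sub>R p) + ?c *\<^sub>R x)) (\<lambda>_. ennreal (\<bar>?c\<bar> ^ DIM(real^'n))))"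
    unfolding sqnorm_def using s by (subst lborel_affine[of ?c "- (?c *\<^sub>R p)"]) (auto simp: ennreal_power)
  also have "\<dots> = ennreal (?c ^ DIM(real^'n)) * sqnorm lborel ?z"
    using s unfolding sqnorm_def
    by (simp add: nn_integral_density nn_integral_distr nn_integral_cmult scaleR_diff_right)
  finally have "1 * sqnorm lborel ?z \<le> sqnorm lborel \<psi>"
    using s by (simp only:, intro mult_right_mono) (auto simp: one_le_inverse)
  moreover have "sqnorm (lebesgue_on \<Omega>) ?z \<le> sqnorm lebesgue ?z"
    unfolding sqnorm_def using \<Omega>s
    by (subst nn_integral_restrict_space) (auto intro!: nn_integral_mono simp: indicator_def)
  moreover have "sqnorm lebesgue \<psi> = sqnorm (lebesgue_on \<Omega>) \<psi>"
    unfolding sqnorm_def using \<Omega>s off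
    by (subst nn_integral_restrict_space) (auto intro!: nn_integral_cong simp: indicator_def)
  ultimately have le: "sqnorm (lebesgue_on \<Omega>) ?z \<le> sqnorm (lebesgue_on \<Omega>) \<psi>"
    by (simp add: lb[OF m(1)] lb[OF m(2)])
  have pL: "\<psi> \<in> L2 (lebesgue_on \<Omega>)" by (rule test_function_L2[OF \<psi> \<Omega>])
  have zL: "?z \<in> L2 (lebesgue_on \<Omega>)"
    using le L2_sqnorm_finite[OF pL] borel_measurable_lebesgue_on[OF m(2)] unfolding L2_iff_sqnorm by auto
  show ?thesis
    unfolding l2norm_def using le
    by (intro real_sqrt_le_mono) (simp add: sqnorm_eq_integral pL zL)
qed

text \<open>The mean value theorem in \<open>t\<close>. The derivative is a pairing of the flux with
  the weak gradient \<open>F\<close>: \<open>R\<close> bounds the velocity on the support, and the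
  factor \<open>2 ^ CARD('n)\<close> comes from \<open>1 + a * t\<close> being at least
  \<open>1/2\<close>.\<close>

lemma rescale_integral_diff_le:
  fixes \<psi> :: "real^'n::finite \<Rightarrow> real"
  assumes \<Omega>: "\<Omega> \<in> lmeasurable" and f: "f \<in> L2 (lebesgue_on \<Omega>)"
    and F: "\<And>i. F i \<in> L2 (lebesgue_on \<Omega>)" "\<And>i. has_weak_partial \<Omega> i f (F i)"
    and \<psi>: "test_function \<Omega> \<psi>" and "0 < \<tau>"
    and s: "\<And>t. 0 \<le> t \<Longrightarrow> t \<le> \<tau> \<Longrightarrow> 1/2 \<le> 1 + a * t \<and> 1 + a * t \<le> 1"
    and K: "compact K" "\<forall>z. z \<notin> K \<longrightarrow> \<psi> z = 0"
    and in\<Omega>: "\<And>z t. z \<in> K \<Longrightarrow> 0 \<le> t \<Longrightarrow> t \<le> \<tau> \<Longrightarrow> (1 + a * t) *\<^sub>R z + t *\<^sub>R v \<in> \<Omega>"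
    and R: "0 \<le> R" "\<And>z i. z \<in> K \<Longrightarrow> \<bar>v $ i + a * z $ i\<bar> \<le> R"
  shows "\<bar>(\<integral>x. rescale a v \<psi> \<tau> x * f x \<partial>lebesgue_on \<Omega>) - (\<integral>x. \<psi> x * f x \<partial>lebesgue_on \<Omega>)\<bar>
    \<le> \<tau> * (2 ^ CARD('n) * R * l2norm (lebesgue_on \<Omega>) \<psi> * (\<Sum>i\<in>UNIV. l2norm (lebesgue_on \<Omega>) (F i)))"
proof -
  let ?M = "lebesgue_on \<Omega>"
  let ?I = "\<lambda>t. \<integral>x. rescale a v \<psi> t x * f x \<partial>?M"
  let ?d = "\<lambda>t. inverse (1 + a * t) ^ CARD('n) * (\<Sum>i\<in>UNIV. \<integral>x. rescale_flux a v \<psi> t i x * F i x \<partial>?M)"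
  let ?B = "2 ^ CARD('n) * R * l2norm ?M \<psi> * (\<Sum>i\<in>UNIV. l2norm ?M (F i))"
  have D: "(?I has_real_derivative ?d t) (at t)" if "0 \<le> t" "t \<le> \<tau>" for t
    using s[OF that] in\<Omega> that by (intro rescale_integral_has_weak_derivative[OF \<Omega> f F(2) \<psi> _ K]) auto
  have B: "\<bar>?d t\<bar> \<le> ?B" if t: "0 \<le> t" "t \<le> \<tau>" for t
  proof -
    let ?c = "inverse (1 + a * t)"
    have st: "1/2 \<le> 1 + a * t" "1 + a * t \<le> 1" using s[OF t] by auto
    then have c: "0 \<le> ?c" "?c \<le> 2" by (auto simp: field_simps)
    have comp: "test_function \<Omega> (rescale_flux a v \<psi> t i)" "test_function \<Omega> (rescale a v \<psi> t)" for i
      using test_function_rescale_flux[OF \<psi> _ K] in\<Omega> t st by auto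
    have zt: "test_function UNIV (\<lambda>x. \<psi> (?c *\<^sub>R (x - t *\<^sub>R v)))"
      using test_function_cmult[OF test_function_rescale_UNIV(2)[OF \<psi>, of a t v], of "(1 + a * t) ^ CARD('n)"] st
      by (simp add: rescale_def[abs_def] power_mult_distrib[symmetric] flip: mult.assoc)
    have flux: "l2norm ?M (rescale_flux a v \<psi> t i) \<le> R * l2norm ?M \<psi>" for i
    proof -
      have "l2norm ?M (rescale_flux a v \<psi> t i) \<le> R * l2norm ?M (\<lambda>x. \<psi> (?c *\<^sub>R (x - t *\<^sub>R v)))"
      proof (rule l2norm_le)
        show "(\<lambda>x. \<psi> (?c *\<^sub>R (x - t *\<^sub>R v))) \<in> L2 ?M" by (rule test_function_L2[OF zt \<Omega>])
        show "rescale_flux a v \<psi> t i \<in> borel_measurable ?M"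
          using test_function_L2[OF comp(1) \<Omega>] by (rule L2_measurable)
        show "\<bar>rescale_flux a v \<psi> t i x\<bar> \<le> R * \<bar>\<psi> (?c *\<^sub>R (x - t *\<^sub>R v))\<bar>" for x
        proof (cases "?c *\<^sub>R (x - t *\<^sub>R v) \<in> K")
          case True
          then show ?thesis
            using R(2)[OF True, of i] by (auto simp: rescale_flux_def Let_def abs_mult intro!: mult_right_mono)
        next
          case False
          then show ?thesis using K(2) by (simp add: rescale_flux_def Let_def)
        qed
      qed (fact R)
      also have "\<dots> \<le> R * l2norm ?M \<psi>"
        using st R(1) by (intro mult_left_mono integral_square_affine_le[OF \<Omega> \<psi>]) auto
      finally show ?thesis .
    qed
    have "\<bar>\<Sum>i\<in>UNIV. \<integral>x. rescale_flux a v \<psi> t i x * F i x \<partial>?M\<bar> \<le> (\<Sum>i\<in>UNIV. (R * l2norm ?M \<psi>) * l2norm ?M (F i))"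
    proof (rule order_trans[OF sum_abs], rule sum_mono)
      fix i
      have "\<bar>\<integral>x. rescale_flux a v \<psi> t i x * F i x \<partial>?M\<bar> \<le> l2norm ?M (rescale_flux a v \<psi> t i) * l2norm ?M (F i)"
        by (intro integral_mult_le_l2norm test_function_L2[OF comp(1) \<Omega>] F)
      also have "\<dots> \<le> (R * l2norm ?M \<psi>) * l2norm ?M (F i)"
        by (intro mult_right_mono flux l2norm_nonneg)
      finally show "\<bar>\<integral>x. rescale_flux a v \<psi> t i x * F i x \<partial>?M\<bar> \<le> (R * l2norm ?M \<psi>) * l2norm ?M (F i)" .
    qed
    then have "\<bar>?d t\<bar> \<le> 2 ^ CARD('n) * (\<Sum>i\<in>UNIV. (R * l2norm ?M \<psi>) * l2norm ?M (F i))"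
      unfolding abs_mult using c by (intro mult_mono) (auto intro!: power_mono)
    also have "\<dots> = ?B" by (simp only: sum_distrib_left[symmetric] mult.assoc)
    finally show ?thesis .
  qed
  obtain t where t: "0 < t" "t < \<tau>" "?I \<tau> - ?I 0 = (\<tau> - 0) * ?d t"
    using MVT2[of 0 \<tau> ?I ?d] D \<open>0 < \<tau>\<close> by auto
  have "\<bar>?I \<tau> - ?I 0\<bar> = \<bar>\<tau> - 0\<bar> * \<bar>?d t\<bar>" unfolding t(3) by (rule abs_mult)
  also have "\<dots> \<le> \<bar>\<tau> - 0\<bar> * ?B" using t by (intro mult_left_mono B) auto
  also have "\<dots> = \<tau> * ?B" using \<open>0 < \<tau>\<close> by simp
  finally have "\<bar>?I \<tau> - ?I 0\<bar> \<le> \<tau> * ?B" .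
  moreover have "rescale a v \<psi> 0 = \<psi>" by (auto simp: rescale_def)
  ultimately show ?thesis by simp
qed

text \<open>
  Convexity lets the domain be shrunk towards an interior point, which controls \<open>p\<close> near the
  boundary by \<open>p\<close> in the interior and by \<open>\<nabla>p\<close>; in the interior there is room for difference
  quotients of \<open>u\<close>. Both comparisons are made after pairing with test functions.
\<close>

lemma gradient_estimate:
  fixes \<Omega> :: "(real^'n::finite) set"
  assumes "open \<Omega>" "\<Omega> \<noteq> {}" "bounded \<Omega>" "convex \<Omega>"
  shows "\<exists>C\<ge>0. \<forall>u p G j. u \<in> L2 (lebesgue_on \<Omega>) \<longrightarrow> (\<forall>i. p i \<in> L2 (lebesgue_on \<Omega>)) \<longrightarrow>
     (\<forall>i. G i \<in> L2 (lebesgue_on \<Omega>)) \<longrightarrow>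
     (\<forall>i. has_weak_partial \<Omega> i u (p i)) \<longrightarrow> (\<forall>i. has_weak_partial \<Omega> i (p j) (G i)) \<longrightarrow>
     l2norm (lebesgue_on \<Omega>) (p j) \<le> C * (l2norm (lebesgue_on \<Omega>) u + (\<Sum>i\<in>UNIV. l2norm (lebesgue_on \<Omega>) (G i)))"
proof -
  let ?M = "lebesgue_on \<Omega>"
  let ?N = "2 ^ CARD('n) :: real"
  have \<Omega>: "\<Omega> \<in> lmeasurable" using assms lmeasurable_open by blast
  obtain x0 where "x0 \<in> \<Omega>" using assms(2) by blast
  then obtain \<rho> where \<rho>: "0 < \<rho>" "cball x0 \<rho> \<subseteq> \<Omega>" using assms(1) open_contains_cball by blast
  obtain D where D: "\<And>x. x \<in> \<Omega> \<Longrightarrow> norm x \<le> D" using assms(3) bounded_iff by blast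
  have D0: "0 \<le> D" using D[OF \<open>x0 \<in> \<Omega>\<close>] norm_ge_zero order_trans by blast
  \<comment> \<open>After shrinking halfway towards \<open>x0\<close>, every point has half of the
    room that \<open>x0\<close> has.\<close>
  define \<delta> where "\<delta> = \<rho> / 2"
  have \<delta>: "0 < \<delta>" using \<rho> by (simp add: \<delta>_def)
  \<comment> \<open>The two entries are the coefficients of \<open>A\<close> and of \<open>U\<close>
    that come out at the end of the estimate for \<open>\<psi>\<close>.\<close>
  define C where "C = max (?N * D + ?N * \<delta> * ?N) (?N * 2 / \<delta>)"
  show ?thesis
  proof (intro exI[of _ C] conjI allI impI)
    show "0 \<le> C" using \<delta> by (auto simp: C_def le_max_iff_disj)
    fix u :: "real^'n \<Rightarrow> real" and p G :: "'n \<Rightarrow> real^'n \<Rightarrow> real" and j :: 'n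
    assume u: "u \<in> L2 ?M" and p: "\<forall>i. p i \<in> L2 ?M" and G: "\<forall>i. G i \<in> L2 ?M"
      and wu: "\<forall>i. has_weak_partial \<Omega> i u (p i)" and wp: "\<forall>i. has_weak_partial \<Omega> i (p j) (G i)"
    define A where "A = (\<Sum>i\<in>UNIV. l2norm ?M (G i))"
    define U where "U = l2norm ?M u"
    have A0: "0 \<le> A" "0 \<le> U" by (auto simp: A_def U_def intro!: sum_nonneg l2norm_nonneg)
    have main: "\<bar>\<integral>x. \<psi> x * p j x \<partial>?M\<bar> \<le> C * (U + A) * l2norm ?M \<psi>" if \<psi>: "test_function \<Omega> \<psi>" for \<psi>
    proof -
      obtain K where K: "compact K" "K \<subseteq> \<Omega>" "\<forall>x. x \<notin> K \<longrightarrow> \<psi> x = 0"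
        using \<psi> by (rule test_functionE)
      define P where "P = l2norm ?M \<psi>"
      have P0: "0 \<le> P" by (simp add: P_def l2norm_nonneg)
      \<comment> \<open>The parameters \<open>-1\<close> and \<open>x0\<close> give the motion of
        \<open>z\<close> to \<open>(1 - t) z + t x0\<close>, stopped at \<open>t = 1/2\<close>;
        \<open>L\<close> is where it has carried the support by then.\<close>
      define \<eta> where "\<eta> = rescale (-1) x0 \<psi> (1/2)"
      define L where "L = (\<lambda>z. (1/2) *\<^sub>R z + (1/2) *\<^sub>R x0) ` K"
      have L: "compact L" unfolding L_def using K by (intro compact_continuous_image continuous_intros)
      have \<eta>0: "\<forall>x. x \<notin> L \<longrightarrow> \<eta> x = 0"
      proof (intro allI impI)
        fix x assume x: "x \<notin> L"
        have "2 *\<^sub>R (x - (1/2) *\<^sub>R x0) \<notin> K"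
        proof
          assume "2 *\<^sub>R (x - (1/2) *\<^sub>R x0) \<in> K"
          then have "(1/2) *\<^sub>R (2 *\<^sub>R (x - (1/2) *\<^sub>R x0)) + (1/2) *\<^sub>R x0 \<in> L" unfolding L_def by blast
          with x show False by simp
        qed
        with K(3) show "\<eta> x = 0" by (simp add: \<eta>_def rescale_def)
      qed
      have conv: "(1 + -1 * t) *\<^sub>R z + t *\<^sub>R x0 \<in> \<Omega>" if "z \<in> K" "0 \<le> t" "t \<le> 1/2" for z t
        using convexD_alt[OF assms(4), of z x0 t] that K(2) \<open>x0 \<in> \<Omega>\<close> by auto
      \<comment> \<open>A point of \<open>L\<close> moved by \<open>t\<close> in direction
        \<open>j\<close> is the midpoint of a point of \<open>K\<close> and a point of the ball
        around \<open>x0\<close>, so convexity keeps it in the domain.\<close>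
      have shift: "(1 + 0 * t) *\<^sub>R z + t *\<^sub>R axis j 1 \<in> \<Omega>" if "z \<in> L" "0 \<le> t" "t \<le> \<delta>" for z t
      proof -
        obtain y where y: "y \<in> K" "z = (1/2) *\<^sub>R y + (1/2) *\<^sub>R x0" using \<open>z \<in> L\<close> by (auto simp: L_def)
        have "x0 + (2 * t) *\<^sub>R axis j 1 \<in> cball x0 \<rho>" using that by (simp add: dist_norm \<delta>_def)
        then have "x0 + (2 * t) *\<^sub>R axis j 1 \<in> \<Omega>" using \<rho> by blast
        then have "(1 - 1/2) *\<^sub>R y + (1/2) *\<^sub>R (x0 + (2 * t) *\<^sub>R axis j 1) \<in> \<Omega>"
          using convexD_alt[OF assms(4), of y "x0 + (2 * t) *\<^sub>R axis j 1" "1/2"] y(1) K(2) by auto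
        also have "(1 - 1/2) *\<^sub>R y + (1/2) *\<^sub>R (x0 + (2 * t) *\<^sub>R axis j 1) = (1 + 0 * t) *\<^sub>R z + t *\<^sub>R axis j 1"
          by (simp add: y(2) scaleR_add_right)
        finally show ?thesis .
      qed
      have \<eta>: "test_function \<Omega> \<eta>"
        unfolding \<eta>_def by (rule test_function_rescale_flux(2)[OF \<psi> _ K(1,3)]) (use conv[of _ "1/2"] in auto)
      define Q where "Q = l2norm ?M \<eta>"
      have Q0: "0 \<le> Q" by (simp add: Q_def l2norm_nonneg)
      have QP: "Q \<le> ?N * P"
      proof -
        have z: "test_function UNIV (\<lambda>x. \<psi> (inverse (1/2) *\<^sub>R (x - (1/2) *\<^sub>R x0)))"
          using test_function_cmult[OF test_function_rescale_UNIV(2)[OF \<psi>, of "-1" "1/2" x0], of "(1/2) ^ CARD('n)"]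
          by (simp add: rescale_def[abs_def] power_mult_distrib[symmetric] flip: mult.assoc)
        have "Q \<le> ?N * l2norm ?M (\<lambda>x. \<psi> (inverse (1/2) *\<^sub>R (x - (1/2) *\<^sub>R x0)))"
          unfolding Q_def
          by (rule l2norm_le[OF test_function_L2[OF z \<Omega>] L2_measurable[OF test_function_L2[OF \<eta> \<Omega>]]])
             (auto simp: \<eta>_def rescale_def abs_mult)
        also have "\<dots> \<le> ?N * P"
          unfolding P_def by (intro mult_left_mono integral_square_affine_le[OF \<Omega> \<psi>]) auto
        finally show ?thesis .
      qed
      \<comment> \<open>Replacing \<open>\<psi>\<close> by \<open>\<eta>\<close> costs the gradient
        of \<open>p j\<close>, that is \<open>A\<close>; the velocity \<open>x0 - z\<close> is at
        most \<open>2 * D\<close>.\<close>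
      have 1: "\<bar>(\<integral>x. \<eta> x * p j x \<partial>?M) - (\<integral>x. \<psi> x * p j x \<partial>?M)\<bar> \<le> 1/2 * (?N * (2 * D) * P * A)"
        unfolding \<eta>_def P_def A_def
      proof (rule rescale_integral_diff_le[OF \<Omega> _ _ _ \<psi> _ _ K(1,3)])
        show "\<bar>x0 $ i + - 1 * z $ i\<bar> \<le> 2 * D" if "z \<in> K" for z i
        proof -
          have "\<bar>x0 $ i\<bar> \<le> D" "\<bar>z $ i\<bar> \<le> D"
            using D[OF \<open>x0 \<in> \<Omega>\<close>] D[of z] that K(2) component_le_norm_cart[of x0 i] component_le_norm_cart[of z i] by auto
          then show ?thesis by linarith
        qed
      qed (use p G wp conv D0 in auto)
      let ?J = "\<lambda>t. \<integral>x. rescale 0 (axis j 1) \<eta> t x * p j x \<partial>?M"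
      let ?K = "\<lambda>t. \<integral>x. rescale 0 (axis j 1) \<eta> t x * u x \<partial>?M"
      have 2: "\<bar>?J t - (\<integral>x. \<eta> x * p j x \<partial>?M)\<bar> \<le> t * (?N * 1 * Q * A)" if "0 < t" "t \<le> \<delta>" for t
        unfolding Q_def A_def
        by (rule rescale_integral_diff_le[OF \<Omega> _ _ _ \<eta> _ _ L \<eta>0]) (use p G wp shift that in \<open>auto simp: axis_def\<close>)
      \<comment> \<open>For a translation in direction \<open>j\<close> only the component
        \<open>j\<close> of the flux survives and equals the moved function itself. So the pairing
        \<open>?K\<close> with \<open>u\<close> has the pairing \<open>?J\<close> with
        \<open>p j\<close> as its derivative.\<close>
      have flux: "rescale_flux 0 (axis j 1) \<eta> t i x = (if i = j then rescale 0 (axis j 1) \<eta> t x else 0)" for t i x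
        by (simp add: rescale_flux_def rescale_def axis_def)
      have sumflux: "(\<Sum>i\<in>UNIV. \<integral>x. rescale_flux 0 (axis j 1) \<eta> t i x * p i x \<partial>?M) = ?J t" for t
      proof -
        have "(\<integral>x. rescale_flux 0 (axis j 1) \<eta> t i x * p i x \<partial>?M) = (if i = j then ?J t else 0)" for i
          by (simp add: flux)
        then show ?thesis by simp
      qed
      have "(?K has_real_derivative ?J t) (at t)" if "0 \<le> t" "t \<le> \<delta>" for t
        using rescale_integral_has_weak_derivative[OF \<Omega> u _ \<eta> _ L \<eta>0 shift, of p t] wu that
        by (simp add: sumflux)
      \<comment> \<open>At some intermediate time \<open>?J\<close> equals a difference quotient of
        pairings with \<open>u\<close>. That time depends on \<open>\<psi>\<close>, but
        \<open>2\<close> compares \<open>?J\<close> with the pairing of \<open>\<eta>\<close> at any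
        time up to \<open>\<delta>\<close>.\<close>
      then obtain t where t: "0 < t" "t < \<delta>" "?K \<delta> - ?K 0 = (\<delta> - 0) * ?J t"
        using MVT2[of 0 \<delta> ?K ?J] \<delta> by auto
      have 3: "\<bar>?K t\<bar> \<le> Q * U" if "0 \<le> t" "t \<le> \<delta>" for t
      proof -
        have "\<bar>?K t\<bar> \<le> l2norm ?M (rescale 0 (axis j 1) \<eta> t) * U"
          unfolding U_def using shift that
          by (intro integral_mult_le_l2norm test_function_L2[OF test_function_rescale_flux(2)[OF \<eta> _ L \<eta>0] \<Omega>] u) auto
        also have "l2norm ?M (rescale 0 (axis j 1) \<eta> t) \<le> Q"
          using integral_square_affine_le[OF \<Omega> \<eta>, of 1 "t *\<^sub>R axis j 1"] by (simp add: rescale_def[abs_def] Q_def)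
        finally show ?thesis using A0 by (simp add: mult_right_mono)
      qed
      have J: "\<bar>?J t\<bar> \<le> 2 * (Q * U) / \<delta>"
      proof -
        have "\<delta> * \<bar>?J t\<bar> = \<bar>?K \<delta> - ?K 0\<bar>" unfolding t(3) using \<delta> by (simp add: abs_mult)
        also have "\<dots> \<le> 2 * (Q * U)" using 3[of \<delta>] 3[of 0] \<delta> by linarith
        finally show ?thesis using \<delta> by (simp add: field_simps)
      qed
      have "t * (?N * 1 * Q * A) \<le> \<delta> * (?N * Q * A)" using t Q0 A0 by (intro mult_mono) auto
      then have "\<bar>\<integral>x. \<psi> x * p j x \<partial>?M\<bar> \<le> ?N * D * P * A + 2 * (Q * U) / \<delta> + \<delta> * (?N * Q * A)"
        using 1 2[OF t(1) less_imp_le[OF t(2)]] J by (simp add: algebra_simps)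
      also have "\<dots> = ?N * D * P * A + (2 * U / \<delta> + \<delta> * ?N * A) * Q" by (simp add: algebra_simps)
      also have "\<dots> \<le> ?N * D * P * A + (2 * U / \<delta> + \<delta> * ?N * A) * (?N * P)"
        using QP A0 \<delta> by (intro add_left_mono mult_left_mono) auto
      also have "\<dots> = ((?N * D + ?N * \<delta> * ?N) * A + (?N * 2 / \<delta>) * U) * P" by (simp add: algebra_simps)
      also have "\<dots> \<le> (C * A + C * U) * P"
        using A0 P0 by (intro mult_right_mono add_mono) (auto simp: C_def)
      finally show ?thesis by (simp add: P_def algebra_simps)
    qed
    \<comment> \<open>The bound on all pairings with test functions becomes a bound on the norm by
      density.\<close>
    have "(\<integral>x. (p j x)\<^sup>2 \<partial>?M) \<le> (C * (U + A))\<^sup>2"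
    proof (rule sqnorm_le_of_test_functions[OF assms(1) \<Omega>])
      show "p j \<in> L2 ?M" using p by blast
      fix \<psi> assume \<psi>: "test_function \<Omega> \<psi>"
      have "(\<integral>x. \<psi> x * p j x \<partial>?M)\<^sup>2 \<le> (C * (U + A) * l2norm ?M \<psi>)\<^sup>2"
        using power_mono[OF main[OF \<psi>] abs_ge_zero, of 2] by simp
      then show "(\<integral>x. \<psi> x * p j x \<partial>?M)\<^sup>2 \<le> (C * (U + A))\<^sup>2 * (\<integral>x. (\<psi> x)\<^sup>2 \<partial>?M)"
        by (simp add: power_mult_distrib l2norm_def)
    qed simp
    then have "l2norm ?M (p j) \<le> sqrt ((C * (U + A))\<^sup>2)"
      unfolding l2norm_def by (rule real_sqrt_le_mono)
    also have "\<dots> = C * (U + A)" using A0 \<open>0 \<le> C\<close> by simp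
    finally show "l2norm ?M (p j) \<le> C * (l2norm ?M u + (\<Sum>i\<in>UNIV. l2norm ?M (G i)))"
      by (simp add: U_def A_def)
  qed
qed

section \<open>Compactness\<close>

lemma norm_sum_scaleR_sq_le:
  fixes w :: "real^'n::finite" and D :: "'n \<Rightarrow> 'b::euclidean_space"
  shows "(norm (\<Sum>i\<in>UNIV. w $ i *\<^sub>R D i))\<^sup>2 \<le> (norm w)\<^sup>2 * (\<Sum>i\<in>UNIV. (norm (D i))\<^sup>2)"
proof -
  have "norm (\<Sum>i\<in>UNIV. w $ i *\<^sub>R D i) \<le> (\<Sum>i\<in>UNIV. \<bar>w $ i\<bar> * \<bar>norm (D i)\<bar>)"
    by (rule order_trans[OF norm_sum]) simp
  also have "\<dots> \<le> L2_set (\<lambda>i. w $ i) UNIV * L2_set (\<lambda>i. norm (D i)) UNIV"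
    by (rule L2_set_mult_ineq)
  finally have "(norm (\<Sum>i\<in>UNIV. w $ i *\<^sub>R D i))\<^sup>2 \<le> (L2_set (\<lambda>i. w $ i) UNIV * L2_set (\<lambda>i. norm (D i)) UNIV)\<^sup>2"
    by (intro power_mono) auto
  also have "\<dots> = (norm w)\<^sup>2 * (\<Sum>i\<in>UNIV. (norm (D i))\<^sup>2)"
    by (simp add: power_mult_distrib L2_set_def norm_vec_def sum_nonneg)
  finally show ?thesis .
qed

text \<open>The fundamental theorem of calculus along the segment, followed by Cauchy-Schwarz in the
  parameter, which runs through an interval of length one.\<close>

lemma smooth_segment_le:
  fixes \<phi> :: "real^'n::finite \<Rightarrow> 'b::euclidean_space"
  assumes \<phi>: "smooth \<phi>"
  shows "ennreal ((norm (\<phi> (z + w) - \<phi> z))\<^sup>2) \<le> ennreal ((norm w)\<^sup>2) *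
    (\<integral>\<^sup>+s. indicator {0..1} s * ennreal (\<Sum>i\<in>UNIV. (norm (partial i \<phi> (z + s *\<^sub>R w)))\<^sup>2) \<partial>lborel)"
proof -
  let ?F = "\<lambda>s::real. \<phi> (z + s *\<^sub>R w)"
  let ?f = "\<lambda>s::real. \<Sum>i\<in>UNIV. w $ i *\<^sub>R partial i \<phi> (z + s *\<^sub>R w)"
  let ?g = "\<lambda>s. \<Sum>i\<in>UNIV. (norm (partial i \<phi> (z + s *\<^sub>R w)))\<^sup>2"
  have cp: "continuous_on UNIV (\<lambda>s::real. partial i \<phi> (z + s *\<^sub>R w))" for i
    by (rule continuous_on_compose2[OF smooth_continuous_on[OF smooth_partial[OF \<phi>], of UNIV]])
       (auto intro!: continuous_intros)
  have cf: "continuous_on UNIV ?f" by (intro continuous_intros cp)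
  then have [measurable]: "?f \<in> borel_measurable borel" by (rule borel_measurable_continuous_onI)
  have [measurable]: "(\<lambda>s. partial i \<phi> (z + s *\<^sub>R w)) \<in> borel_measurable borel" for i
    by (intro borel_measurable_continuous_onI cp)
  have D: "(?F has_vector_derivative ?f s) (at s)" for s
  proof -
    have "((\<lambda>s. z + s *\<^sub>R w) has_derivative (\<lambda>h. h *\<^sub>R w)) (at s)" by (auto intro!: derivative_eq_intros)
    from has_derivative_compose[OF this smooth_has_derivative[OF \<phi>]]
    have "(?F has_derivative (\<lambda>h. \<Sum>i\<in>UNIV. (h *\<^sub>R w) $ i *\<^sub>R partial i \<phi> (z + s *\<^sub>R w))) (at s)" .
    then show ?thesis by (simp add: has_vector_derivative_def scaleR_sum_right)
  qed
  have FTC: "has_bochner_integral lborel (\<lambda>s. indicator {0..1} s *\<^sub>R ?f s) (?F 1 - ?F 0)"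
    by (rule has_bochner_integral_FTC_Icc)
       (auto intro: has_vector_derivative_at_within[OF D] continuous_on_subset[OF cf])
  have "ennreal (norm (?F 1 - ?F 0)) \<le> (\<integral>\<^sup>+s. ennreal (norm (indicator {0..1} s *\<^sub>R ?f s)) \<partial>lborel)"
    using integral_norm_bound_ennreal[OF integrable.intros[OF FTC]]
    unfolding has_bochner_integral_integral_eq[OF FTC] .
  also have "\<dots> = (\<integral>\<^sup>+s. indicator {0..1} s * (indicator {0..1} s * ennreal (norm (?f s))) \<partial>lborel)"
    by (intro nn_integral_cong) (auto simp: indicator_def)
  finally have "(ennreal (norm (?F 1 - ?F 0)))\<^sup>2 \<le> (\<integral>\<^sup>+s. indicator {0..1} s * (indicator {0..1} s * ennreal (norm (?f s))) \<partial>lborel)\<^sup>2"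
    by (rule power_mono) simp
  also have "\<dots> \<le> (\<integral>\<^sup>+s. (indicator {0..1::real} s)\<^sup>2 \<partial>lborel) * (\<integral>\<^sup>+s. (indicator {0..1} s * ennreal (norm (?f s)))\<^sup>2 \<partial>lborel)"
    by (rule Cauchy_Schwarz_nn_integral) auto
  also have "(\<integral>\<^sup>+s. (indicator {0..1::real} s)\<^sup>2 \<partial>lborel) = (\<integral>\<^sup>+s. indicator {0..1::real} s \<partial>lborel)"
    by (intro nn_integral_cong) (auto simp: indicator_def)
  also have "(\<integral>\<^sup>+s. indicator {0..1::real} s \<partial>lborel) = 1" by simp
  also have "(\<integral>\<^sup>+s. (indicator {0..1} s * ennreal (norm (?f s)))\<^sup>2 \<partial>lborel)
      \<le> (\<integral>\<^sup>+s. ennreal ((norm w)\<^sup>2) * (indicator {0..1} s * ennreal (?g s)) \<partial>lborel)"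
  proof (intro nn_integral_mono)
    fix s :: real
    have "ennreal ((norm (?f s))\<^sup>2) \<le> ennreal ((norm w)\<^sup>2 * ?g s)"
      by (intro ennreal_leI norm_sum_scaleR_sq_le)
    then show "(indicator {0..1} s * ennreal (norm (?f s)))\<^sup>2 \<le> ennreal ((norm w)\<^sup>2) * (indicator {0..1} s * ennreal (?g s))"
      by (auto simp: indicator_def ennreal_power ennreal_mult sum_nonneg)
  qed
  also have "\<dots> = ennreal ((norm w)\<^sup>2) * (\<integral>\<^sup>+s. indicator {0..1} s * ennreal (?g s) \<partial>lborel)"
    by (rule nn_integral_cmult) auto
  finally show ?thesis by (simp add: ennreal_power)
qed

lemma nn_integral_lborel_shift:
  fixes c :: "'a::euclidean_space"
  assumes [measurable]: "f \<in> borel_measurable borel"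
  shows "(\<integral>\<^sup>+x. f (x + c) \<partial>lborel) = (\<integral>\<^sup>+x. f x \<partial>lborel)"
proof -
  have "(\<integral>\<^sup>+x. f x \<partial>lborel) = (\<integral>\<^sup>+x. f x \<partial>distr lborel borel ((+) c))" by (simp only: lborel_distr_plus)
  also have "\<dots> = (\<integral>\<^sup>+x. f (x + c) \<partial>lborel)" by (simp add: nn_integral_distr add.commute)
  finally show ?thesis by simp
qed

text \<open>After integrating the bound for segments over \<open>z\<close> and exchanging the
  integrals, translation invariance of Lebesgue measure removes the dependence on \<open>s\<close>.
  The whole segments have to stay in \<open>\<Omega>\<close> because the gradient is controlled only
  there.\<close>

lemma smooth_translation_le:
  fixes \<phi> :: "real^'n::finite \<Rightarrow> 'b::euclidean_space"
  assumes \<phi>: "smooth \<phi>" and A[measurable]: "A \<in> sets borel" and \<Omega>[measurable]: "\<Omega> \<in> sets borel"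
    and sub: "\<And>z s. z \<in> A \<Longrightarrow> 0 \<le> s \<Longrightarrow> s \<le> 1 \<Longrightarrow> z + s *\<^sub>R w \<in> \<Omega>"
  shows "(\<integral>\<^sup>+z. indicator A z * ennreal ((norm (\<phi> (z + w) - \<phi> z))\<^sup>2) \<partial>lborel)
    \<le> ennreal ((norm w)\<^sup>2) * (\<integral>\<^sup>+z. indicator \<Omega> z * ennreal (\<Sum>i\<in>UNIV. (norm (partial i \<phi> z))\<^sup>2) \<partial>lborel)"
proof -
  define g where "g z = ennreal (\<Sum>i\<in>UNIV. (norm (partial i \<phi> z))\<^sup>2)" for z
  have pm[measurable]: "partial i \<phi> \<in> borel_measurable borel" for i
    using smooth_borel_measurable[OF smooth_partial[OF \<phi>]] .
  have [measurable]: "g \<in> borel_measurable borel" unfolding g_def by measurable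
  have "(\<integral>\<^sup>+z. indicator A z * ennreal ((norm (\<phi> (z + w) - \<phi> z))\<^sup>2) \<partial>lborel)
     \<le> (\<integral>\<^sup>+z. ennreal ((norm w)\<^sup>2) * (\<integral>\<^sup>+s. indicator {0..1::real} s * (indicator \<Omega> (z + s *\<^sub>R w) * g (z + s *\<^sub>R w)) \<partial>lborel) \<partial>lborel)"
  proof (intro nn_integral_mono)
    fix z
    show "indicator A z * ennreal ((norm (\<phi> (z + w) - \<phi> z))\<^sup>2)
      \<le> ennreal ((norm w)\<^sup>2) * (\<integral>\<^sup>+s. indicator {0..1::real} s * (indicator \<Omega> (z + s *\<^sub>R w) * g (z + s *\<^sub>R w)) \<partial>lborel)"
    proof (cases "z \<in> A")
      case True
      have "(\<integral>\<^sup>+s. indicator {0..1::real} s * (indicator \<Omega> (z + s *\<^sub>R w) * g (z + s *\<^sub>R w)) \<partial>lborel)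
          = (\<integral>\<^sup>+s. indicator {0..1::real} s * g (z + s *\<^sub>R w) \<partial>lborel)"
        using sub[OF True] by (intro nn_integral_cong) (auto simp: indicator_def)
      then show ?thesis using True smooth_segment_le[OF \<phi>, of z w] by (simp add: g_def)
    qed simp
  qed
  also have "\<dots> = ennreal ((norm w)\<^sup>2) * (\<integral>\<^sup>+z. (\<integral>\<^sup>+s. indicator {0..1::real} s * (indicator \<Omega> (z + s *\<^sub>R w) * g (z + s *\<^sub>R w)) \<partial>lborel) \<partial>lborel)"
    by (rule nn_integral_cmult) measurable
  also have "(\<integral>\<^sup>+z. (\<integral>\<^sup>+s. indicator {0..1::real} s * (indicator \<Omega> (z + s *\<^sub>R w) * g (z + s *\<^sub>R w)) \<partial>lborel) \<partial>lborel)
     = (\<integral>\<^sup>+s. (\<integral>\<^sup>+z. indicator {0..1::real} s * (indicator \<Omega> (z + s *\<^sub>R w) * g (z + s *\<^sub>R w)) \<partial>lborel) \<partial>lborel)"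
    by (rule lborel_pair.Fubini') measurable
  also have "\<dots> = (\<integral>\<^sup>+s. indicator {0..1::real} s * (\<integral>\<^sup>+z. indicator \<Omega> z * g z \<partial>lborel) \<partial>lborel)"
  proof (intro nn_integral_cong)
    fix s :: real
    have "(\<integral>\<^sup>+z. indicator {0..1::real} s * (indicator \<Omega> (z + s *\<^sub>R w) * g (z + s *\<^sub>R w)) \<partial>lborel)
       = indicator {0..1::real} s * (\<integral>\<^sup>+z. indicator \<Omega> (z + s *\<^sub>R w) * g (z + s *\<^sub>R w) \<partial>lborel)"
      by (rule nn_integral_cmult) measurable
    also have "(\<integral>\<^sup>+z. indicator \<Omega> (z + s *\<^sub>R w) * g (z + s *\<^sub>R w) \<partial>lborel) = (\<integral>\<^sup>+z. indicator \<Omega> z * g z \<partial>lborel)"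
      by (rule nn_integral_lborel_shift[of "\<lambda>z. indicator \<Omega> z * g z"]) measurable
    finally show "(\<integral>\<^sup>+z. indicator {0..1::real} s * (indicator \<Omega> (z + s *\<^sub>R w) * g (z + s *\<^sub>R w)) \<partial>lborel)
       = indicator {0..1::real} s * (\<integral>\<^sup>+z. indicator \<Omega> z * g z \<partial>lborel)" .
  qed
  also have "\<dots> = (\<integral>\<^sup>+z. indicator \<Omega> z * g z \<partial>lborel)"
    by (subst nn_integral_multc) auto
  finally show ?thesis by (simp add: g_def)
qed

lemma sqnorm_lebesgue_on_borel:
  fixes f :: "'a::euclidean_space \<Rightarrow> 'b::euclidean_space"
  assumes [measurable]: "f \<in> borel_measurable borel" and S[measurable]: "S \<in> sets borel"
  shows "sqnorm (lebesgue_on S) f = (\<integral>\<^sup>+x. indicator S x * ennreal ((norm (f x))\<^sup>2) \<partial>lborel)"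
proof -
  have "sqnorm (lebesgue_on S) f = (\<integral>\<^sup>+x. ennreal ((norm (f x))\<^sup>2) * indicator S x \<partial>lebesgue)"
    unfolding sqnorm_def by (subst nn_integral_restrict_space) auto
  also have "\<dots> = (\<integral>\<^sup>+x. ennreal ((norm (f x))\<^sup>2) * indicator S x \<partial>lborel)"
    by (rule nn_integral_completion)
  finally show ?thesis by (simp add: mult.commute)
qed

section \<open>Averages over small balls\<close>

text \<open>It replaces mollification: Arzela-Ascoli asks only for bounded and equicontinuous
  approximations, so no smooth kernel is required.\<close>

definition ball_average :: "real \<Rightarrow> ('a::euclidean_space \<Rightarrow> 'b::euclidean_space) \<Rightarrow> 'a \<Rightarrow> 'b" where
  "ball_average h f x = (\<integral>y. f (x + y) \<partial>uniform_measure lborel (ball 0 h))"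

lemma uniform_ball:
  assumes "0 < h"
  shows "emeasure lborel (ball (0 :: 'a::euclidean_space) h) \<noteq> 0"
    and "emeasure lborel (ball (0 :: 'a::euclidean_space) h) < \<infinity>"
    and "emeasure (uniform_measure lborel (ball (0 :: 'a) h)) (space (uniform_measure lborel (ball (0 :: 'a) h))) = 1"
proof -
  show 1: "emeasure lborel (ball (0 :: 'a) h) \<noteq> 0"
    using assms by (auto simp: emeasure_ball ennreal_eq_0_iff not_le unit_ball_vol_pos intro!: mult_pos_pos)
  show 2: "emeasure lborel (ball (0 :: 'a) h) < \<infinity>"
    by (rule emeasure_lborel_ball_finite)
  show "emeasure (uniform_measure lborel (ball (0 :: 'a) h)) (space (uniform_measure lborel (ball (0 :: 'a) h))) = 1"
    using 1 2 by (subst emeasure_uniform_measure) (auto simp: space_uniform_measure ennreal_divide_self less_top)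
qed

lemma finite_measure_uniform_ball:
  "0 < h \<Longrightarrow> finite_measure (uniform_measure lborel (ball (0 :: 'a::euclidean_space) h))"
  by (rule finite_measureI, subst uniform_ball(3)) simp_all

text \<open>Jensen's inequality for a probability measure, in the form of Cauchy-Schwarz against the
  constant \<open>1\<close>. If \<open>f\<close> is not in \<open>L2\<close>, the right-hand side is
  infinite.\<close>

lemma integral_sq_le_sqnorm:
  fixes f :: "'a \<Rightarrow> 'b::euclidean_space"
  assumes "emeasure M (space M) = 1" "f \<in> borel_measurable M"
  shows "ennreal ((norm (\<integral>x. f x \<partial>M))\<^sup>2) \<le> sqnorm M f"
proof (cases "f \<in> L2 M")
  case True
  have 1: "(\<lambda>_. 1 :: real) \<in> L2 M" by (rule L2_bounded[of _ _ 1]) (auto simp: assms(1))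
  show ?thesis using L2_pairing(2)[OF 1 True] assms(1) by (simp add: sqnorm_def)
next
  case False
  then have "sqnorm M f = \<infinity>" using assms(2) by (simp add: L2_iff_sqnorm less_top[symmetric])
  then show ?thesis by simp
qed

lemma sqnorm_uniform_ball:
  fixes f :: "'a::euclidean_space \<Rightarrow> 'b::euclidean_space"
  assumes [measurable]: "f \<in> borel_measurable borel" and h: "0 < h"
  shows "sqnorm (uniform_measure lborel (ball 0 h)) f
    = (\<integral>\<^sup>+y. indicator (ball 0 h) y * ennreal ((norm (f y))\<^sup>2) \<partial>lborel) / emeasure lborel (ball (0::'a) h)"
  unfolding sqnorm_def by (subst nn_integral_uniform_measure) (auto simp: mult.commute)

lemma continuous_L2_uniform_ball:
  fixes f :: "'a::euclidean_space \<Rightarrow> 'b::euclidean_space"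
  assumes f: "continuous_on UNIV f" and h: "0 < h"
  shows "f \<in> L2 (uniform_measure lborel (ball 0 h))"
proof -
  have m[measurable]: "f \<in> borel_measurable borel" by (rule borel_measurable_continuous_onI[OF f])
  have "compact (f ` cball 0 h)" by (intro compact_continuous_image continuous_on_subset[OF f]) auto
  then have "bounded (f ` cball 0 h)" by (rule compact_imp_bounded)
  then obtain C where C: "\<forall>y\<in>cball 0 h. norm (f y) \<le> C" by (auto simp: bounded_iff)
  have "sqnorm (uniform_measure lborel (ball 0 h)) f \<le> (\<integral>\<^sup>+y. ennreal (C\<^sup>2) \<partial>uniform_measure lborel (ball (0::'a) h))"
    unfolding sqnorm_def
  proof (intro nn_integral_mono_AE AE_uniform_measureI AE_I2 impI)
    fix y :: 'a assume "y \<in> ball 0 h"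
    then show "ennreal ((norm (f y))\<^sup>2) \<le> ennreal (C\<^sup>2)"
      using C by (intro ennreal_leI power_mono) auto
  qed auto
  also have "\<dots> < \<infinity>" unfolding nn_integral_const uniform_ball(3)[OF h] by simp
  finally show ?thesis by (simp add: L2_iff_sqnorm)
qed

lemma ball_average_measurable:
  fixes f :: "'a::euclidean_space \<Rightarrow> 'b::euclidean_space"
  assumes [measurable]: "f \<in> borel_measurable borel" and h: "0 < h"
  shows "ball_average h f \<in> borel_measurable borel"
proof -
  let ?U = "uniform_measure lborel (ball (0::'a) h)"
  interpret finite_measure ?U using h by (rule finite_measure_uniform_ball)
  have [measurable_cong]: "sets ?U = sets borel" by simp
  show ?thesis unfolding ball_average_def[abs_def] by measurable
qed

text \<open>The average differs from \<open>\<phi>\<close> by a mean of increments over shifts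
  shorter than \<open>h\<close>. Jensen's inequality and an exchange of integrals reduce this to the
  translation estimate for each single shift.\<close>

lemma ball_average_approx:
  fixes \<phi> :: "real^'n::finite \<Rightarrow> 'b::euclidean_space"
  assumes \<phi>: "smooth \<phi>" and h: "0 < h" and K[measurable]: "K \<in> sets borel" and \<Omega>[measurable]: "\<Omega> \<in> sets borel"
    and sub: "\<And>x y. x \<in> K \<Longrightarrow> norm y < h \<Longrightarrow> x + y \<in> \<Omega>"
    and G: "(\<integral>\<^sup>+z. indicator \<Omega> z * ennreal (\<Sum>i\<in>UNIV. (norm (partial i \<phi> z))\<^sup>2) \<partial>lborel) \<le> G"
  shows "(\<integral>\<^sup>+x. indicator K x * ennreal ((norm (ball_average h \<phi> x - \<phi> x))\<^sup>2) \<partial>lborel) \<le> ennreal (h\<^sup>2) * G"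
proof -
  let ?U = "uniform_measure lborel (ball (0::real^'n) h)"
  interpret U: finite_measure ?U using h by (rule finite_measure_uniform_ball)
  interpret pair_sigma_finite ?U lborel ..
  have [measurable_cong]: "sets ?U = sets borel" by simp
  have [measurable]: "\<phi> \<in> borel_measurable borel" by (rule smooth_borel_measurable[OF \<phi>])
  have "(\<integral>\<^sup>+x. indicator K x * ennreal ((norm (ball_average h \<phi> x - \<phi> x))\<^sup>2) \<partial>lborel)
     \<le> (\<integral>\<^sup>+x. (\<integral>\<^sup>+y. indicator K x * ennreal ((norm (\<phi> (x + y) - \<phi> x))\<^sup>2) \<partial>?U) \<partial>lborel)"
  proof (intro nn_integral_mono)
    fix x
    have c: "continuous_on UNIV (\<lambda>y. \<phi> (x + y))"
      by (rule continuous_on_compose2[OF smooth_continuous_on[OF \<phi>, of UNIV]]) (auto intro!: continuous_intros)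
    have i: "integrable ?U (\<lambda>y. \<phi> (x + y))"
      by (rule L2_integrable[OF continuous_L2_uniform_ball[OF c h]]) (simp only: uniform_ball(3)[OF h], simp)
    have "measure ?U (space ?U) = 1" using uniform_ball(3)[OF h] by (simp add: measure_def)
    then have "(\<integral>y. \<phi> (x + y) - \<phi> x \<partial>?U) = ball_average h \<phi> x - \<phi> x"
      using i by (subst Bochner_Integration.integral_diff) (auto simp: ball_average_def)
    then have "ennreal ((norm (ball_average h \<phi> x - \<phi> x))\<^sup>2) \<le> sqnorm ?U (\<lambda>y. \<phi> (x + y) - \<phi> x)"
      using integral_sq_le_sqnorm[OF uniform_ball(3)[OF h], of "\<lambda>y. \<phi> (x + y) - \<phi> x"] by simp
    then have "indicator K x * ennreal ((norm (ball_average h \<phi> x - \<phi> x))\<^sup>2) \<le> indicator K x * sqnorm ?U (\<lambda>y. \<phi> (x + y) - \<phi> x)"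
      by (rule mult_left_mono) simp
    also have "\<dots> = (\<integral>\<^sup>+y. indicator K x * ennreal ((norm (\<phi> (x + y) - \<phi> x))\<^sup>2) \<partial>?U)"
      unfolding sqnorm_def by (rule nn_integral_cmult[symmetric]) measurable
    finally show "indicator K x * ennreal ((norm (ball_average h \<phi> x - \<phi> x))\<^sup>2)
      \<le> (\<integral>\<^sup>+y. indicator K x * ennreal ((norm (\<phi> (x + y) - \<phi> x))\<^sup>2) \<partial>?U)" .
  qed
  also have "\<dots> = (\<integral>\<^sup>+y. (\<integral>\<^sup>+x. indicator K x * ennreal ((norm (\<phi> (x + y) - \<phi> x))\<^sup>2) \<partial>lborel) \<partial>?U)"
    by (rule Fubini') measurable
  also have "\<dots> \<le> (\<integral>\<^sup>+y. ennreal (h\<^sup>2) * G \<partial>?U)"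
  proof (intro nn_integral_mono_AE AE_uniform_measureI AE_I2 impI)
    fix y :: "real^'n" assume y: "y \<in> ball 0 h"
    have "(\<integral>\<^sup>+x. indicator K x * ennreal ((norm (\<phi> (x + y) - \<phi> x))\<^sup>2) \<partial>lborel)
       \<le> ennreal ((norm y)\<^sup>2) * (\<integral>\<^sup>+z. indicator \<Omega> z * ennreal (\<Sum>i\<in>UNIV. (norm (partial i \<phi> z))\<^sup>2) \<partial>lborel)"
    proof (rule smooth_translation_le[OF \<phi> K \<Omega>])
      fix x s assume "x \<in> K" "0 \<le> s" "s \<le> (1::real)"
      moreover from this y have "norm (s *\<^sub>R y) < h"
        using mult_left_le_one_le[of "norm y" s] by auto
      ultimately show "x + s *\<^sub>R y \<in> \<Omega>" by (intro sub)
    qed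
    also have "\<dots> \<le> ennreal (h\<^sup>2) * G"
      using y G by (intro mult_mono ennreal_leI power_mono) auto
    finally show "(\<integral>\<^sup>+x. indicator K x * ennreal ((norm (\<phi> (x + y) - \<phi> x))\<^sup>2) \<partial>lborel) \<le> ennreal (h\<^sup>2) * G" .
  qed auto
  also have "\<dots> = ennreal (h\<^sup>2) * G" unfolding nn_integral_const uniform_ball(3)[OF h] by simp
  finally show ?thesis .
qed


text \<open>For fixed \<open>h\<close> this bound and the Lipschitz bound that follows depend on the
  function through integrals over \<open>\<Omega>\<close> only; they are the two hypotheses of
  Arzela-Ascoli.\<close>

lemma ball_average_norm_le:
  fixes \<phi> :: "real^'n::finite \<Rightarrow> 'b::euclidean_space"
  assumes \<phi>: "smooth \<phi>" and h: "0 < h" and \<Omega>[measurable]: "\<Omega> \<in> sets borel" and sub: "\<And>y. norm y < h \<Longrightarrow> x + y \<in> \<Omega>"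
    and M: "(\<integral>\<^sup>+z. indicator \<Omega> z * ennreal ((norm (\<phi> z))\<^sup>2) \<partial>lborel) \<le> M"
  shows "ennreal ((norm (ball_average h \<phi> x))\<^sup>2) \<le> M / emeasure lborel (ball (0::real^'n) h)"
proof -
  have m[measurable]: "\<phi> \<in> borel_measurable borel" by (rule smooth_borel_measurable[OF \<phi>])
  have "ennreal ((norm (ball_average h \<phi> x))\<^sup>2) \<le> sqnorm (uniform_measure lborel (ball 0 h)) (\<lambda>y. \<phi> (x + y))"
    unfolding ball_average_def by (rule integral_sq_le_sqnorm[OF uniform_ball(3)[OF h]]) simp
  also have "\<dots> = (\<integral>\<^sup>+y. indicator (ball 0 h) y * ennreal ((norm (\<phi> (x + y)))\<^sup>2) \<partial>lborel) / emeasure lborel (ball (0::real^'n) h)"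
    by (rule sqnorm_uniform_ball[OF _ h]) simp
  also have "(\<integral>\<^sup>+y. indicator (ball 0 h) y * ennreal ((norm (\<phi> (x + y)))\<^sup>2) \<partial>lborel)
      \<le> (\<integral>\<^sup>+y. indicator \<Omega> (y + x) * ennreal ((norm (\<phi> (y + x)))\<^sup>2) \<partial>lborel)"
    using sub by (intro nn_integral_mono) (auto simp: indicator_def add.commute)
  also have "\<dots> = (\<integral>\<^sup>+z. indicator \<Omega> z * ennreal ((norm (\<phi> z))\<^sup>2) \<partial>lborel)"
    by (rule nn_integral_lborel_shift[of "\<lambda>z. indicator \<Omega> z * ennreal ((norm (\<phi> z))\<^sup>2)"]) measurable
  also note M
  finally show ?thesis by (simp add: divide_right_mono_ennreal)
qed

lemma ball_average_diff_le:
  fixes \<phi> :: "real^'n::finite \<Rightarrow> 'b::euclidean_space"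
  assumes \<phi>: "smooth \<phi>" and h: "0 < h" and \<Omega>[measurable]: "\<Omega> \<in> sets borel"
    and sub: "\<And>y s. norm y < h \<Longrightarrow> 0 \<le> s \<Longrightarrow> s \<le> 1 \<Longrightarrow> x + y + s *\<^sub>R (x' - x) \<in> \<Omega>"
    and G: "(\<integral>\<^sup>+z. indicator \<Omega> z * ennreal (\<Sum>i\<in>UNIV. (norm (partial i \<phi> z))\<^sup>2) \<partial>lborel) \<le> G"
  shows "ennreal ((norm (ball_average h \<phi> x' - ball_average h \<phi> x))\<^sup>2)
    \<le> ennreal ((norm (x' - x))\<^sup>2) * G / emeasure lborel (ball (0::real^'n) h)"
proof -
  let ?U = "uniform_measure lborel (ball (0::real^'n) h)"
  have m[measurable]: "\<phi> \<in> borel_measurable borel" by (rule smooth_borel_measurable[OF \<phi>])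
  have [measurable]: "(\<lambda>z. \<phi> (z + (x' - x))) \<in> borel_measurable borel" "ball x h \<in> sets borel"
    by (rule measurable_compose[OF _ m]) auto
  have i: "integrable ?U (\<lambda>y. \<phi> (x + y))" for x
  proof -
    have c: "continuous_on UNIV (\<lambda>y. \<phi> (x + y))"
      by (rule continuous_on_compose2[OF smooth_continuous_on[OF \<phi>, of UNIV]]) (auto intro!: continuous_intros)
    show ?thesis by (rule L2_integrable[OF continuous_L2_uniform_ball[OF c h]]) (simp only: uniform_ball(3)[OF h], simp)
  qed
  have "ball_average h \<phi> x' - ball_average h \<phi> x = (\<integral>y. \<phi> (x' + y) - \<phi> (x + y) \<partial>?U)"
    unfolding ball_average_def by (rule Bochner_Integration.integral_diff[symmetric]) (rule i)+
  then have "ennreal ((norm (ball_average h \<phi> x' - ball_average h \<phi> x))\<^sup>2) \<le> sqnorm ?U (\<lambda>y. \<phi> (x' + y) - \<phi> (x + y))"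
    by (simp add: integral_sq_le_sqnorm[OF uniform_ball(3)[OF h]])
  also have "\<dots> = (\<integral>\<^sup>+y. indicator (ball 0 h) y * ennreal ((norm (\<phi> (x' + y) - \<phi> (x + y)))\<^sup>2) \<partial>lborel) / emeasure lborel (ball (0::real^'n) h)"
    by (rule sqnorm_uniform_ball[OF _ h]) simp
  also have "(\<integral>\<^sup>+y. indicator (ball 0 h) y * ennreal ((norm (\<phi> (x' + y) - \<phi> (x + y)))\<^sup>2) \<partial>lborel)
      = (\<integral>\<^sup>+y. indicator (ball x h) (y + x) * ennreal ((norm (\<phi> ((y + x) + (x' - x)) - \<phi> (y + x)))\<^sup>2) \<partial>lborel)"
    by (intro nn_integral_cong) (auto simp: indicator_def dist_norm add.commute)
  also have "\<dots> = (\<integral>\<^sup>+z. indicator (ball x h) z * ennreal ((norm (\<phi> (z + (x' - x)) - \<phi> z))\<^sup>2) \<partial>lborel)"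
    by (rule nn_integral_lborel_shift[of "\<lambda>z. indicator (ball x h) z * ennreal ((norm (\<phi> (z + (x' - x)) - \<phi> z))\<^sup>2)"]) measurable
  also have "\<dots> \<le> ennreal ((norm (x' - x))\<^sup>2) * (\<integral>\<^sup>+z. indicator \<Omega> z * ennreal (\<Sum>i\<in>UNIV. (norm (partial i \<phi> z))\<^sup>2) \<partial>lborel)"
  proof (rule smooth_translation_le[OF \<phi> _ \<Omega>])
    fix z s assume "z \<in> ball x h" "0 \<le> s" "s \<le> (1::real)"
    then show "z + s *\<^sub>R (x' - x) \<in> \<Omega>" using sub[of "z - x" s] by (simp add: dist_norm norm_minus_commute)
  qed auto
  also have "\<dots> \<le> ennreal ((norm (x' - x))\<^sup>2) * G" by (intro mult_left_mono G) auto
  finally show ?thesis by (simp add: divide_right_mono_ennreal)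
qed

section \<open>Compactness for smooth functions\<close>

text \<open>The averages at a fixed scale have a uniformly convergent subsequence on
  \<open>K\<close>, and passing from a function to its average costs an error of order
  \<open>h\<close>. As the scale depends on \<open>e\<close>, only closeness up to \<open>e\<close>
  is obtained; a diagonal argument has to finish.\<close>

lemma smooth_bounded_imp_L2_close_subseq:
  fixes \<phi> :: "nat \<Rightarrow> real^'n::finite \<Rightarrow> 'b::euclidean_space"
  assumes \<Omega>: "open \<Omega>" "convex \<Omega>" and K: "compact K" "K \<subseteq> \<Omega>" and \<phi>: "\<And>k. smooth (\<phi> k)"
    and M: "\<And>k. (\<integral>\<^sup>+z. indicator \<Omega> z * ennreal ((norm (\<phi> k z))\<^sup>2) \<partial>lborel) \<le> ennreal M"
    and G: "\<And>k. (\<integral>\<^sup>+z. indicator \<Omega> z * ennreal (\<Sum>i\<in>UNIV. (norm (partial i (\<phi> k) z))\<^sup>2) \<partial>lborel) \<le> ennreal M"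
    and "0 < (e::real)"
  shows "\<exists>r :: nat \<Rightarrow> nat. strict_mono r \<and> (\<exists>N. \<forall>k\<ge>N. \<forall>l\<ge>N.
           (\<integral>\<^sup>+x. indicator K x * ennreal ((norm (\<phi> (r k) x - \<phi> (r l) x))\<^sup>2) \<partial>lborel) \<le> ennreal e)"
proof -
  have \<Omega>m[measurable]: "\<Omega> \<in> sets borel" and Km[measurable]: "K \<in> sets borel"
    using \<Omega> K by (auto intro!: borel_closed compact_imp_closed)
  obtain \<delta> where \<delta>: "\<delta> > 0" "(\<Union>x\<in>K. ball x \<delta>) \<subseteq> \<Omega>"
    using compact_subset_open_imp_ball_epsilon_subset[OF K(1) \<Omega>(1) K(2)] .
  define m where "m = max M 1"
  have m: "1 \<le> m" "M \<le> m" by (auto simp: m_def)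
  \<comment> \<open>Each of the two approximation errors becomes at most \<open>e / 12\<close>. They
    enter the final splitting with weights \<open>2\<close> and \<open>4\<close>, which amounts to
    \<open>e / 2\<close>.\<close>
  define h where "h = min \<delta> (sqrt (e / (12 * m)))"
  have h: "0 < h" "h \<le> \<delta>" using \<delta> m \<open>0 < e\<close> by (auto simp: h_def)
  have h2: "h\<^sup>2 * m \<le> e / 12"
  proof -
    have "h\<^sup>2 \<le> (sqrt (e / (12 * m)))\<^sup>2" using h(1) by (intro power_mono) (auto simp: h_def)
    also have "\<dots> = e / (12 * m)" using m \<open>0 < e\<close> by simp
    finally show ?thesis using m by (simp add: field_simps)
  qed
  have M': "(\<integral>\<^sup>+z. indicator \<Omega> z * ennreal ((norm (\<phi> k z))\<^sup>2) \<partial>lborel) \<le> ennreal m" for k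
    by (rule order_trans[OF M ennreal_leI[OF m(2)]])
  have G': "(\<integral>\<^sup>+z. indicator \<Omega> z * ennreal (\<Sum>i\<in>UNIV. (norm (partial i (\<phi> k) z))\<^sup>2) \<partial>lborel) \<le> ennreal m" for k
    by (rule order_trans[OF G ennreal_leI[OF m(2)]])
  have sub: "x + y \<in> \<Omega>" if "x \<in> K" "norm y < h" for x y
  proof -
    have "x + y \<in> ball x \<delta>" using that h by (simp add: dist_norm)
    with \<delta>(2) that show ?thesis by blast
  qed
  define v where "v = measure lborel (ball (0::real^'n) h)"
  have v: "emeasure lborel (ball (0::real^'n) h) = ennreal v" "0 < v"
  proof -
    show "emeasure lborel (ball (0::real^'n) h) = ennreal v"
      unfolding v_def using uniform_ball(2)[where 'a="real^'n", OF h(1)] by (intro emeasure_eq_ennreal_measure) auto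
    then show "0 < v" using uniform_ball(1)[where 'a="real^'n", OF h(1)] by (simp add: v_def zero_less_measure_iff)
  qed
  let ?A = "\<lambda>k. ball_average h (\<phi> k)"
  have A_bound: "norm (?A k x) \<le> sqrt (m / v)" if "x \<in> K" for k x
  proof -
    have "ennreal ((norm (?A k x))\<^sup>2) \<le> ennreal m / emeasure lborel (ball (0::real^'n) h)"
      by (rule ball_average_norm_le[OF \<phi> h(1) \<Omega>m _ M']) (use sub that in auto)
    also have "\<dots> = ennreal (m / v)" using v m by (simp add: divide_ennreal)
    finally have "(norm (?A k x))\<^sup>2 \<le> m / v" using v m by simp
    then show ?thesis by (rule real_le_rsqrt)
  qed
  have A_lip: "norm (?A k x - ?A k x') \<le> norm (x - x') * sqrt (m / v)" if "x \<in> K" "x' \<in> K" for k x x'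
  proof -
    have "ennreal ((norm (?A k x - ?A k x'))\<^sup>2) \<le> ennreal ((norm (x - x'))\<^sup>2) * ennreal m / emeasure lborel (ball (0::real^'n) h)"
    proof (rule ball_average_diff_le[OF \<phi> h(1) \<Omega>m _ G'])
      fix y :: "real^'n" and s :: real assume "norm y < h" "0 \<le> s" "s \<le> 1"
      \<comment> \<open>Convexity is used here: with both shifted points, the segment between them
        lies in the domain.\<close>
      then have "(1 - s) *\<^sub>R (x' + y) + s *\<^sub>R (x + y) \<in> \<Omega>"
        using sub that by (intro convexD_alt[OF \<Omega>(2)]) auto
      then show "x' + y + s *\<^sub>R (x - x') \<in> \<Omega>" by (simp add: algebra_simps)
    qed
    also have "\<dots> = ennreal ((norm (x - x'))\<^sup>2 * (m / v))"
      using v m by (simp add: divide_ennreal ennreal_mult[symmetric])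
    finally have "(norm (?A k x - ?A k x'))\<^sup>2 \<le> (norm (x - x'))\<^sup>2 * (m / v)" using v m by simp
    then have "norm (?A k x - ?A k x') \<le> sqrt ((norm (x - x'))\<^sup>2 * (m / v))" by (rule real_le_rsqrt)
    then show ?thesis unfolding real_sqrt_mult by simp
  qed
  have S: "0 < sqrt (m / v)" using m v by simp
  obtain g r where r: "strict_mono (r :: nat \<Rightarrow> nat)"
    and unif: "\<And>e. 0 < e \<Longrightarrow> \<exists>N. \<forall>n x. n \<ge> N \<and> x \<in> K \<longrightarrow> norm (?A (r n) x - g x) < e"
  proof (rule Arzela_Ascoli[OF K(1), of ?A "sqrt (m / v)"])
    show "norm (?A n x) \<le> sqrt (m / v)" if "x \<in> K" for n x by (rule A_bound[OF that])
    show "\<exists>d>0. \<forall>n y. y \<in> K \<and> norm (x - y) < d \<longrightarrow> norm (?A n x - ?A n y) < e" if "x \<in> K" "0 < e" for x e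
    proof (intro exI[of _ "e / sqrt (m / v)"] conjI allI impI)
      show "0 < e / sqrt (m / v)" using that S by simp
      fix n y assume y: "y \<in> K \<and> norm (x - y) < e / sqrt (m / v)"
      then have "norm (x - y) * sqrt (m / v) < e" using S by (simp add: pos_less_divide_eq)
      with A_lip[of x y n] y that show "norm (?A n x - ?A n y) < e" by linarith
    qed
  qed blast
  define \<kappa> where "\<kappa> = measure lborel K"
  have \<kappa>: "emeasure lborel K = ennreal \<kappa>" "0 \<le> \<kappa>"
    using emeasure_compact_finite[OF K(1)] by (auto simp: \<kappa>_def intro!: emeasure_eq_ennreal_measure)
  \<comment> \<open>The uniform error, with weight \<open>4\<close> and integrated over
    \<open>K\<close>, takes up the other \<open>e / 2\<close>; the summand \<open>1\<close> allows
    for \<open>K\<close> of measure zero.\<close>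
  define \<eta> where "\<eta> = sqrt (e / (8 * (\<kappa> + 1)))"
  have \<eta>: "0 < \<eta>" "4 * (\<eta>\<^sup>2 * \<kappa>) \<le> e / 2"
  proof -
    show "0 < \<eta>" using \<kappa> \<open>0 < e\<close> by (simp add: \<eta>_def)
    have "\<eta>\<^sup>2 = e / (8 * (\<kappa> + 1))" using \<kappa> \<open>0 < e\<close> by (simp add: \<eta>_def)
    then have "4 * (\<eta>\<^sup>2 * \<kappa>) = (e / 2) * (\<kappa> / (\<kappa> + 1))" using \<kappa> by (simp add: field_simps)
    also have "\<dots> \<le> (e / 2) * 1" using \<kappa> \<open>0 < e\<close> by (intro mult_left_mono) auto
    finally show "4 * (\<eta>\<^sup>2 * \<kappa>) \<le> e / 2" by simp
  qed
  obtain N where N: "\<And>n x. n \<ge> N \<Longrightarrow> x \<in> K \<Longrightarrow> norm (?A (r n) x - g x) < \<eta> / 2"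
    using unif[of "\<eta> / 2"] \<eta> by auto
  let ?R = "restrict_space lborel K"
  have R: "sqnorm ?R f = (\<integral>\<^sup>+x. indicator K x * ennreal ((norm (f x))\<^sup>2) \<partial>lborel)" for f :: "real^'n \<Rightarrow> 'b"
    unfolding sqnorm_def by (subst nn_integral_restrict_space) (auto simp: mult.commute)
  have meas: "?A k \<in> borel_measurable ?R" "\<phi> k \<in> borel_measurable ?R" for k
    using smooth_borel_measurable[OF \<phi>[of k]] ball_average_measurable[OF smooth_borel_measurable[OF \<phi>[of k]] h(1)]
    by (auto intro!: measurable_restrict_space1)
  have app: "sqnorm ?R (\<lambda>x. ?A k x - \<phi> k x) \<le> ennreal (e / 12)" for k
  proof -
    have "sqnorm ?R (\<lambda>x. ?A k x - \<phi> k x) \<le> ennreal (h\<^sup>2) * ennreal m"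
      unfolding R by (rule ball_average_approx[OF \<phi> h(1) Km \<Omega>m _ G']) (use sub in auto)
    also have "\<dots> \<le> ennreal (e / 12)" using h2 m by (simp flip: ennreal_mult add: ennreal_leI)
    finally show ?thesis .
  qed
  have "(\<integral>\<^sup>+x. indicator K x * ennreal ((norm (\<phi> (r k) x - \<phi> (r l) x))\<^sup>2) \<partial>lborel) \<le> ennreal e"
    if kl: "k \<ge> N" "l \<ge> N" for k l
  proof -
    have AA: "sqnorm ?R (\<lambda>x. ?A (r k) x - ?A (r l) x) \<le> ennreal (\<eta>\<^sup>2 * \<kappa>)"
    proof -
      have "sqnorm ?R (\<lambda>x. ?A (r k) x - ?A (r l) x) \<le> (\<integral>\<^sup>+x. ennreal (\<eta>\<^sup>2) * indicator K x \<partial>lborel)"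
        unfolding R
      proof (intro nn_integral_mono)
        fix x
        show "indicator K x * ennreal ((norm (?A (r k) x - ?A (r l) x))\<^sup>2) \<le> ennreal (\<eta>\<^sup>2) * indicator K x"
        proof (cases "x \<in> K")
          case True
          have "norm (?A (r k) x - ?A (r l) x) \<le> norm (?A (r k) x - g x) + norm (?A (r l) x - g x)"
            using dist_triangle2[of "?A (r k) x" "?A (r l) x" "g x"] by (simp add: dist_norm)
          also have "\<dots> \<le> \<eta>" using N[OF kl(1) True] N[OF kl(2) True] by linarith
          finally have "ennreal ((norm (?A (r k) x - ?A (r l) x))\<^sup>2) \<le> ennreal (\<eta>\<^sup>2)"
            by (intro ennreal_leI power_mono) auto
          with True show ?thesis by simp
        qed simp
      qed
      also have "\<dots> = ennreal (\<eta>\<^sup>2 * \<kappa>)"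
        using \<kappa> by (simp add: nn_integral_cmult ennreal_mult)
      finally show ?thesis .
    qed
    have "sqnorm ?R (\<lambda>x. \<phi> (r k) x - \<phi> (r l) x)
        \<le> 2 * sqnorm ?R (\<lambda>x. \<phi> (r k) x - ?A (r k) x) + 2 * sqnorm ?R (\<lambda>x. ?A (r k) x - \<phi> (r l) x)"
      by (intro sqnorm_diff meas)
    also have "\<dots> \<le> 2 * sqnorm ?R (\<lambda>x. \<phi> (r k) x - ?A (r k) x) +
        2 * (2 * sqnorm ?R (\<lambda>x. ?A (r k) x - ?A (r l) x) + 2 * sqnorm ?R (\<lambda>x. ?A (r l) x - \<phi> (r l) x))"
      by (intro add_left_mono mult_left_mono sqnorm_diff meas) auto
    also have "\<dots> \<le> 2 * ennreal (e / 12) + 2 * (2 * ennreal (\<eta>\<^sup>2 * \<kappa>) + 2 * ennreal (e / 12))"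
      unfolding sqnorm_minus_commute[of ?R "\<phi> (r k)"] by (intro add_mono mult_left_mono app AA) auto
    also have "\<dots> = ennreal (2 * (e / 12) + 2 * (2 * (\<eta>\<^sup>2 * \<kappa>) + 2 * (e / 12)))"
      using \<kappa>(2) \<open>0 < e\<close> by (simp only: ennreal_plus ennreal_mult ennreal_numeral zero_le_power2 mult_nonneg_nonneg add_nonneg_nonneg zero_le_divide_iff zero_le_numeral less_imp_le simp_thms)
    also have "\<dots> \<le> ennreal e" using \<eta>(2) by (intro ennreal_leI) simp
    finally show ?thesis by (simp add: R)
  qed
  with r show ?thesis by (intro exI[of _ r] conjI exI[of _ N] allI impI) auto
qed

text \<open>A diagonal sequence over an exhaustion by compact sets is Cauchy on each of them in the
  L^2 sense, and a fast subsequence of it converges almost everywhere on their union. No estimate up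
  to the boundary is involved.\<close>

lemma smooth_bounded_imp_AE_convergent_subseq:
  fixes \<phi> :: "nat \<Rightarrow> real^'n::finite \<Rightarrow> 'b::euclidean_space"
  assumes \<Omega>: "open \<Omega>" "convex \<Omega>" and \<phi>: "\<And>k. smooth (\<phi> k)"
    and M: "\<And>k. sqnorm (lebesgue_on \<Omega>) (\<phi> k) \<le> ennreal M"
    and G: "\<And>k i. sqnorm (lebesgue_on \<Omega>) (partial i (\<phi> k)) \<le> ennreal M"
  shows "\<exists>r :: nat \<Rightarrow> nat. strict_mono r \<and> (AE x in lebesgue_on \<Omega>. convergent (\<lambda>k. \<phi> (r k) x))"
proof -
  have \<Omega>m[measurable]: "\<Omega> \<in> sets borel" using \<Omega> by auto
  have m[measurable]: "\<phi> k \<in> borel_measurable borel" "partial i (\<phi> k) \<in> borel_measurable borel" for k i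
    using smooth_borel_measurable[OF \<phi>] smooth_borel_measurable[OF smooth_partial[OF \<phi>]] by auto
  define M' where "M' = max (real CARD('n) * max M 0) (max M 0)"
  have M': "(\<integral>\<^sup>+z. indicator \<Omega> z * ennreal ((norm (\<phi> k z))\<^sup>2) \<partial>lborel) \<le> ennreal M'" for k
    using M[of k] unfolding sqnorm_lebesgue_on_borel[OF m(1) \<Omega>m]
    by (rule order_trans) (auto simp: M'_def intro!: ennreal_leI)
  have G': "(\<integral>\<^sup>+z. indicator \<Omega> z * ennreal (\<Sum>i\<in>UNIV. (norm (partial i (\<phi> k) z))\<^sup>2) \<partial>lborel) \<le> ennreal M'" for k
  proof -
    have "(\<integral>\<^sup>+z. indicator \<Omega> z * ennreal (\<Sum>i\<in>UNIV. (norm (partial i (\<phi> k) z))\<^sup>2) \<partial>lborel)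
       = (\<Sum>i\<in>UNIV. sqnorm (lebesgue_on \<Omega>) (partial i (\<phi> k)))"
    proof -
      have "indicator \<Omega> z * ennreal (\<Sum>i\<in>UNIV. (norm (partial i (\<phi> k) z))\<^sup>2)
          = (\<Sum>i\<in>UNIV. indicator \<Omega> z * ennreal ((norm (partial i (\<phi> k) z))\<^sup>2))" for z
        by (subst sum_ennreal[symmetric]) (auto simp only: sum_distrib_left zero_le_power2)
      then show ?thesis
        by (simp only: sqnorm_lebesgue_on_borel[OF m(2) \<Omega>m], subst nn_integral_sum[symmetric]) simp_all
    qed
    also have "\<dots> \<le> (\<Sum>i\<in>(UNIV::'n set). ennreal (max M 0))"
      by (intro sum_mono order_trans[OF G] ennreal_leI) auto
    also have "\<dots> = ennreal (real CARD('n) * max M 0)"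
      by (simp add: ennreal_mult ennreal_of_nat_eq_real_of_nat)
    also have "\<dots> \<le> ennreal M'" by (intro ennreal_leI) (simp add: M'_def)
    finally show ?thesis .
  qed
  obtain K :: "nat \<Rightarrow> (real^'n) set" where K: "\<And>n. compact (K n)" "\<And>n. K n \<subseteq> \<Omega>" "\<And>n. K n \<subseteq> interior (K (Suc n))" "\<Union>(range K) = \<Omega>"
    using open_Union_compact_subsets[OF \<Omega>(1)] by metis
  have KS: "K n \<subseteq> K (Suc n)" for n using K(3) interior_subset by blast
  have Kmono: "K n \<subseteq> K n'" if "n \<le> n'" for n n' using lift_Suc_mono_le[of K, OF KS that] .
  have Km[measurable]: "K n \<in> sets borel" for n using K(1) by (auto intro!: borel_closed compact_imp_closed)
  define I where "I n f = (\<integral>\<^sup>+x. indicator (K n) x * ennreal ((norm (f x))\<^sup>2) \<partial>lborel)" for n and f :: "real^'n \<Rightarrow> 'b"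
  \<comment> \<open>One index counts both the compact sets and the accuracies.\<close>
  define P where "P n s \<longleftrightarrow> (\<exists>N. \<forall>k\<ge>N. \<forall>l\<ge>N. I n (\<lambda>x. \<phi> (s k) x - \<phi> (s l) x) \<le> ennreal (1 / Suc n))" for n and s :: "nat \<Rightarrow> nat"
  interpret subseqs P
  proof
    fix n and s :: "nat \<Rightarrow> nat" assume "strict_mono s"
    have "\<exists>r :: nat \<Rightarrow> nat. strict_mono r \<and> (\<exists>N. \<forall>k\<ge>N. \<forall>l\<ge>N.
           (\<integral>\<^sup>+x. indicator (K n) x * ennreal ((norm (\<phi> (s (r k)) x - \<phi> (s (r l)) x))\<^sup>2) \<partial>lborel) \<le> ennreal (1 / Suc n))"
      by (rule smooth_bounded_imp_L2_close_subseq[OF \<Omega> K(1,2) \<phi> M' G']) simp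
    then show "\<exists>r'. strict_mono r' \<and> P n (s \<circ> r')" by (simp add: P_def I_def)
  qed
  \<comment> \<open>The diagonal sequence is a subsequence of the one chosen at stage
    \<open>k\<close> from index \<open>Suc k\<close> on only; the shift is undone right
    after.\<close>
  have "P k (diagseq \<circ> ((+) (Suc k)))" for k
  proof (rule diagseq_holds)
    fix r s :: "nat \<Rightarrow> nat" and n assume r: "strict_mono r" and "P n s"
    then obtain N where N: "\<And>k l. k \<ge> N \<Longrightarrow> l \<ge> N \<Longrightarrow> I n (\<lambda>x. \<phi> (s k) x - \<phi> (s l) x) \<le> ennreal (1 / Suc n)"
      by (auto simp: P_def)
    have "r k \<ge> N" if "k \<ge> N" for k using seq_suble[OF r, of k] that by simp
    then show "P n (s \<circ> r)" unfolding P_def o_def by (intro exI[of _ N] allI impI N)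
  qed
  then have d: "\<exists>N. \<forall>k\<ge>N. \<forall>l\<ge>N. I n (\<lambda>x. \<phi> (diagseq k) x - \<phi> (diagseq l) x) \<le> ennreal (1 / Suc n)" for n
  proof -
    obtain N where N: "\<And>k l. k \<ge> N \<Longrightarrow> l \<ge> N \<Longrightarrow> I n (\<lambda>x. \<phi> (diagseq (Suc n + k)) x - \<phi> (diagseq (Suc n + l)) x) \<le> ennreal (1 / Suc n)"
      using \<open>\<And>k. P k (diagseq \<circ> ((+) (Suc k)))\<close>[of n] by (auto simp: P_def)
    have "I n (\<lambda>x. \<phi> (diagseq k) x - \<phi> (diagseq l) x) \<le> ennreal (1 / Suc n)" if "k \<ge> Suc n + N" "l \<ge> Suc n + N" for k l
      using N[of "k - Suc n" "l - Suc n"] that by simp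
    then show ?thesis by blast
  qed
  have "\<exists>N. \<forall>k\<ge>N. \<forall>l\<ge>N. I j (\<lambda>x. \<phi> (diagseq k) x - \<phi> (diagseq l) x) \<le> ennreal ((1/8)^j)" for j
  proof -
    obtain n0 where n0: "1 / real (Suc n0) < (1/8)^j" using nat_approx_posE[of "(1/8)^j"] by auto
    \<comment> \<open>A stage late enough for the accuracy \<open>(1/8)^j\<close> whose compact set
      contains \<open>K j\<close>.\<close>
    define n where "n = max n0 j"
    have "1 / real (Suc n) \<le> 1 / real (Suc n0)" by (simp add: n_def frac_le)
    with n0 have n: "1 / real (Suc n) \<le> (1/8)^j" by linarith
    obtain N where N: "\<And>k l. k \<ge> N \<Longrightarrow> l \<ge> N \<Longrightarrow> I n (\<lambda>x. \<phi> (diagseq k) x - \<phi> (diagseq l) x) \<le> ennreal (1 / Suc n)"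
      using d[of n] by blast
    have "I j f \<le> I n f" for f
      unfolding I_def using Kmono[of j n] by (intro nn_integral_mono mult_right_mono) (auto simp: n_def indicator_def)
    then show ?thesis using N n by (meson ennreal_leI order_trans)
  qed
  then obtain t where t: "strict_mono t"
    "\<And>j k l. k \<ge> t j \<Longrightarrow> l \<ge> t j \<Longrightarrow> I j (\<lambda>x. \<phi> (diagseq k) x - \<phi> (diagseq l) x) \<le> ennreal ((1/8)^j)"
    using exists_fast_subseq[of "\<lambda>j k l. I j (\<lambda>x. \<phi> (diagseq k) x - \<phi> (diagseq l) x) \<le> ennreal ((1/8)^j)"] by blast
  have "AE x in lborel. x \<in> (\<Union>n. K n) \<longrightarrow> convergent (\<lambda>n. \<phi> (diagseq (t n)) x)"
  proof (rule sqnorm_fast_AE_convergent)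
    fix n
    have "(\<integral>\<^sup>+x. ennreal ((norm (\<phi> (diagseq (t (Suc n))) x - \<phi> (diagseq (t n)) x))\<^sup>2) * indicator (K n) x \<partial>lborel)
       = I n (\<lambda>x. \<phi> (diagseq (t (Suc n))) x - \<phi> (diagseq (t n)) x)" by (simp add: I_def mult.commute)
    also have "\<dots> \<le> ennreal ((1/8)^n)" using t(1) by (intro t(2)) (auto simp: strict_mono_less_eq)
    finally show "(\<integral>\<^sup>+x. ennreal ((norm (\<phi> (diagseq (t (Suc n))) x - \<phi> (diagseq (t n)) x))\<^sup>2) * indicator (K n) x \<partial>lborel)
       \<le> ennreal ((1/8)^n)" .
  qed (auto simp: KS)
  then have "AE x in lebesgue. x \<in> \<Omega> \<longrightarrow> convergent (\<lambda>n. \<phi> (diagseq (t n)) x)"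
    unfolding K(4) by (rule AE_completion)
  then have "AE x in lebesgue_on \<Omega>. convergent (\<lambda>n. \<phi> (diagseq (t n)) x)"
    by (subst AE_restrict_space_iff) auto
  moreover have "strict_mono (\<lambda>n. diagseq (t n))" using strict_mono_o[OF subseq_diagseq t(1)] by (simp add: o_def)
  ultimately show ?thesis by blast
qed

section \<open>Traces\<close>

lemma L2_converges_comp:
  fixes T :: "'b::euclidean_space \<Rightarrow> 'c::euclidean_space"
  assumes "L2_converges M f g" "\<And>x y. T (x - y) = T x - T y" "\<And>x. norm (T x) \<le> norm x"
  shows "L2_converges M (\<lambda>n x. T (f n x)) (\<lambda>x. T (g x))"
proof -
  have "sqnorm M (\<lambda>x. T (f n x) - T (g x)) \<le> sqnorm M (\<lambda>x. f n x - g x)" for n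
    by (rule sqnorm_mono) (metis assms(2,3))
  then show ?thesis
    using assms(1) unfolding L2_converges_sqnorm
    by (intro tendsto_sandwich[OF _ _ tendsto_const[of 0],
        of "\<lambda>n. sqnorm M (\<lambda>x. T (f n x) - T (g x))" _ "\<lambda>n. sqnorm M (\<lambda>x. f n x - g x)"]) auto
qed

lemma sqnorm_Pair:
  fixes f :: "'a \<Rightarrow> 'b::euclidean_space" and g :: "'a \<Rightarrow> 'c::euclidean_space"
  assumes [measurable]: "f \<in> borel_measurable M" "g \<in> borel_measurable M"
  shows "sqnorm M (\<lambda>x. (f x, g x)) = sqnorm M f + sqnorm M g"
  unfolding sqnorm_def by (subst nn_integral_add[symmetric]) (auto simp: norm_Pair ennreal_plus)

lemma L2_Pair:
  fixes f :: "'a \<Rightarrow> 'b::euclidean_space" and g :: "'a \<Rightarrow> 'c::euclidean_space"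
  shows "f \<in> L2 M \<Longrightarrow> g \<in> L2 M \<Longrightarrow> (\<lambda>x. (f x, g x)) \<in> L2 M"
  unfolding L2_iff_sqnorm by (auto simp: sqnorm_Pair)

lemma borel_measurable_vecI:
  fixes f :: "'a \<Rightarrow> 'b::euclidean_space^'n::finite"
  assumes "\<And>i. (\<lambda>x. f x $ i) \<in> borel_measurable M"
  shows "f \<in> borel_measurable M"
proof -
  have "(\<lambda>x. f x \<bullet> b) \<in> borel_measurable M" if bB: "b \<in> Basis" for b
  proof -
    obtain i c where b: "b = axis i c" using bB by (auto simp: Basis_vec_def)
    have "(\<lambda>x. f x $ i \<bullet> c) \<in> borel_measurable M" using assms[of i] by measurable
    then show ?thesis by (simp add: b inner_axis)
  qed
  then show ?thesis by (subst borel_measurable_euclidean_space) auto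
qed

lemma sqnorm_vec:
  fixes f :: "'a \<Rightarrow> 'b::euclidean_space^'n::finite"
  assumes [measurable]: "\<And>i. (\<lambda>x. f x $ i) \<in> borel_measurable M"
  shows "sqnorm M f = (\<Sum>i\<in>UNIV. sqnorm M (\<lambda>x. f x $ i))"
proof -
  have "ennreal ((norm (f x))\<^sup>2) = (\<Sum>i\<in>UNIV. ennreal ((norm (f x $ i))\<^sup>2))" for x
    by (subst sum_ennreal) (auto simp: norm_vec_def L2_set_def sum_nonneg)
  then show ?thesis unfolding sqnorm_def by (simp only:, subst nn_integral_sum) simp_all
qed

lemma L2_vecI:
  fixes f :: "'a \<Rightarrow> 'b::euclidean_space^'n::finite"
  assumes "\<And>i. (\<lambda>x. f x $ i) \<in> L2 M"
  shows "f \<in> L2 M"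
  using assms borel_measurable_vecI[of f M] unfolding L2_iff_sqnorm
  by (auto simp: sqnorm_vec less_top[symmetric])

lemma vec_nth_norm_le: "norm (x $ i) \<le> norm (x :: 'b::euclidean_space^'n::finite)"
  by (rule Finite_Cartesian_Product.norm_nth_le)

lemma smooth_measurable_surface_measure:
  "smooth f \<Longrightarrow> f \<in> borel_measurable (surface_measure \<Omega>)"
proof -
  assume f: "smooth f"
  have "sets (hausdorff_measure s) = sets borel" for s
    unfolding hausdorff_measure_def by (metis sets_measure_of sets.space_closed sets.sigma_sets_eq space_borel)
  then have "borel_measurable (hausdorff_measure s) = (borel_measurable borel :: ((real^'a) \<Rightarrow> 'b) set)" for s
    by (rule measurable_cong_sets) simp
  then have "f \<in> borel_measurable (hausdorff_measure (CARD('a) - 1))"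
    using smooth_borel_measurable[OF f] by simp
  then show ?thesis unfolding surface_measure_def by (rule measurable_restrict_space1)
qed

text \<open>
  The set of pairs \<open>(f, D)\<close> described below is convex and closed in \<open>L\<^sup>2\<close>, which is all that is
  needed about the boundary condition.
\<close>

definition trace_approx :: "(real^'n::finite) set \<Rightarrow> (real^'n \<Rightarrow> 'b::euclidean_space) \<Rightarrow>
    (real^'n \<Rightarrow> 'b) \<Rightarrow> ('n \<Rightarrow> real^'n \<Rightarrow> 'b) \<Rightarrow> bool" where
  "trace_approx \<Omega> g f D \<longleftrightarrow> (\<forall>e>0. \<exists>\<psi>. smooth \<psi> \<and>
      sqnorm (lebesgue_on \<Omega>) (\<lambda>x. \<psi> x - f x) \<le> ennreal e \<and>
      (\<forall>i. sqnorm (lebesgue_on \<Omega>) (\<lambda>x. partial i \<psi> x - D i x) \<le> ennreal e) \<and>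
      sqnorm (surface_measure \<Omega>) (\<lambda>x. \<psi> x - g x) \<le> ennreal e)"

lemma ennreal_LIMSEQ_0_eventually:
  assumes "X \<longlonglongrightarrow> 0" "0 < (e::real)"
  shows "\<forall>\<^sub>F n in sequentially. X n \<le> ennreal e"
  using ennreal_LIMSEQ_0_D[OF assms] by (auto simp: eventually_sequentially)

lemma LIMSEQ_0_of_le_inverse:
  assumes "\<And>n. X n \<le> ennreal (1 / Suc n)"
  shows "X \<longlonglongrightarrow> 0"
proof -
  have "(\<lambda>n. ennreal (1 / Suc n)) \<longlonglongrightarrow> ennreal 0"
    by (intro tendsto_ennrealI LIMSEQ_Suc lim_1_over_n)
  then show ?thesis
    using tendsto_sandwich[OF _ _ tendsto_const[of 0], of X sequentially "\<lambda>n. ennreal (1 / Suc n)"] assms by simp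
qed

lemma trace_approx_choice:
  assumes "\<And>k. trace_approx \<Omega> g (f k) (D k)"
  shows "\<exists>\<psi>. \<forall>k. smooth (\<psi> k) \<and> sqnorm (lebesgue_on \<Omega>) (\<lambda>x. \<psi> k x - f k x) \<le> ennreal (1 / Suc k) \<and>
      (\<forall>i. sqnorm (lebesgue_on \<Omega>) (\<lambda>x. partial i (\<psi> k) x - D k i x) \<le> ennreal (1 / Suc k)) \<and>
      sqnorm (surface_measure \<Omega>) (\<lambda>x. \<psi> k x - g x) \<le> ennreal (1 / Suc k)"
  by (rule choice, rule allI, rule assms[unfolded trace_approx_def, rule_format]) simp

text \<open>An approximating sequence is traded for approximation within every \<open>e\<close>.
  There are finitely many directions \<open>i\<close>, so one index of the sequence serves all
  derivatives simultaneously. In this form arbitrary functions may take the place of the chosen weak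
  derivatives.\<close>

lemma has_trace_iff:
  "has_trace \<Omega> f g \<longleftrightarrow> f \<in> H1 \<Omega> \<and> g \<in> L2 (surface_measure \<Omega>) \<and> trace_approx \<Omega> g f (\<lambda>i. weak_partial \<Omega> i f)"
proof (intro iffI conjI)
  assume t: "has_trace \<Omega> f g"
  then show "f \<in> H1 \<Omega>" "g \<in> L2 (surface_measure \<Omega>)" by (auto simp: has_trace_def)
  from t obtain \<phi> where \<phi>: "\<And>k. smooth (\<phi> k)" "L2_converges (lebesgue_on \<Omega>) \<phi> f"
    "\<And>i. L2_converges (lebesgue_on \<Omega>) (\<lambda>k. partial i (\<phi> k)) (weak_partial \<Omega> i f)"
    "L2_converges (surface_measure \<Omega>) \<phi> g"
    by (auto simp: has_trace_def)
  show "trace_approx \<Omega> g f (\<lambda>i. weak_partial \<Omega> i f)"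
    unfolding trace_approx_def
  proof (intro allI impI)
    fix e :: real assume "0 < e"
    have "\<forall>\<^sub>F k in sequentially. sqnorm (lebesgue_on \<Omega>) (\<lambda>x. \<phi> k x - f x) \<le> ennreal e \<and>
      (\<forall>i. sqnorm (lebesgue_on \<Omega>) (\<lambda>x. partial i (\<phi> k) x - weak_partial \<Omega> i f x) \<le> ennreal e) \<and>
      sqnorm (surface_measure \<Omega>) (\<lambda>x. \<phi> k x - g x) \<le> ennreal e"
      using \<phi>(2-4) \<open>0 < e\<close> unfolding L2_converges_sqnorm
      by (intro eventually_conj eventually_all_finite ennreal_LIMSEQ_0_eventually) auto
    then obtain k where "sqnorm (lebesgue_on \<Omega>) (\<lambda>x. \<phi> k x - f x) \<le> ennreal e \<and>
      (\<forall>i. sqnorm (lebesgue_on \<Omega>) (\<lambda>x. partial i (\<phi> k) x - weak_partial \<Omega> i f x) \<le> ennreal e) \<and>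
      sqnorm (surface_measure \<Omega>) (\<lambda>x. \<phi> k x - g x) \<le> ennreal e"
      using eventually_happens'[OF sequentially_bot] by blast
    with \<phi>(1) show "\<exists>\<psi>. smooth \<psi> \<and> sqnorm (lebesgue_on \<Omega>) (\<lambda>x. \<psi> x - f x) \<le> ennreal e \<and>
      (\<forall>i. sqnorm (lebesgue_on \<Omega>) (\<lambda>x. partial i \<psi> x - weak_partial \<Omega> i f x) \<le> ennreal e) \<and>
      sqnorm (surface_measure \<Omega>) (\<lambda>x. \<psi> x - g x) \<le> ennreal e" by blast
  qed
next
  assume a: "f \<in> H1 \<Omega> \<and> g \<in> L2 (surface_measure \<Omega>) \<and> trace_approx \<Omega> g f (\<lambda>i. weak_partial \<Omega> i f)"
  then have t: "trace_approx \<Omega> g f (\<lambda>i. weak_partial \<Omega> i f)" by blast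
  from trace_approx_choice[of \<Omega> g "\<lambda>_. f" "\<lambda>_ i. weak_partial \<Omega> i f", OF t]
  obtain \<psi> where "\<forall>n. smooth (\<psi> n) \<and> sqnorm (lebesgue_on \<Omega>) (\<lambda>x. \<psi> n x - f x) \<le> ennreal (1 / Suc n) \<and>
      (\<forall>i. sqnorm (lebesgue_on \<Omega>) (\<lambda>x. partial i (\<psi> n) x - weak_partial \<Omega> i f x) \<le> ennreal (1 / Suc n)) \<and>
      sqnorm (surface_measure \<Omega>) (\<lambda>x. \<psi> n x - g x) \<le> ennreal (1 / Suc n)" by blast
  then have \<psi>: "\<And>n. smooth (\<psi> n)" "\<And>n. sqnorm (lebesgue_on \<Omega>) (\<lambda>x. \<psi> n x - f x) \<le> ennreal (1 / Suc n)"
    "\<And>n i. sqnorm (lebesgue_on \<Omega>) (\<lambda>x. partial i (\<psi> n) x - weak_partial \<Omega> i f x) \<le> ennreal (1 / Suc n)"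
    "\<And>n. sqnorm (surface_measure \<Omega>) (\<lambda>x. \<psi> n x - g x) \<le> ennreal (1 / Suc n)"
    by blast+
  have "L2_converges (lebesgue_on \<Omega>) \<psi> f" 
    "\<And>i. L2_converges (lebesgue_on \<Omega>) (\<lambda>k. partial i (\<psi> k)) (weak_partial \<Omega> i f)"
    "L2_converges (surface_measure \<Omega>) \<psi> g"
    unfolding L2_converges_sqnorm by (rule LIMSEQ_0_of_le_inverse, rule \<psi>)+
  with a \<psi>(1) show "has_trace \<Omega> f g"
    unfolding has_trace_def by blast
qed

text \<open>The average of the two smooth approximations works with the same \<open>e\<close>, since
  the squared norm is midpoint convex and the common boundary function is the average of itself with
  itself.\<close>

lemma trace_approx_midpoint:
  fixes f f' :: "real^'n::finite \<Rightarrow> 'b::euclidean_space"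
  assumes t: "trace_approx \<Omega> g f D" "trace_approx \<Omega> g f' D'" and g: "g \<in> L2 (surface_measure \<Omega>)"
    and L: "f \<in> L2 (lebesgue_on \<Omega>)" "f' \<in> L2 (lebesgue_on \<Omega>)"
      "\<And>i. D i \<in> L2 (lebesgue_on \<Omega>)" "\<And>i. D' i \<in> L2 (lebesgue_on \<Omega>)"
  shows "trace_approx \<Omega> g (\<lambda>x. (1/2) *\<^sub>R (f x + f' x)) (\<lambda>i x. (1/2) *\<^sub>R (D i x + D' i x))"
  unfolding trace_approx_def
proof (intro allI impI)
  fix e :: real assume "0 < e"
  obtain \<psi> where \<psi>: "smooth \<psi>" "sqnorm (lebesgue_on \<Omega>) (\<lambda>x. \<psi> x - f x) \<le> ennreal e"
      "\<And>i. sqnorm (lebesgue_on \<Omega>) (\<lambda>x. partial i \<psi> x - D i x) \<le> ennreal e"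
      "sqnorm (surface_measure \<Omega>) (\<lambda>x. \<psi> x - g x) \<le> ennreal e"
    using t(1) \<open>0 < e\<close> unfolding trace_approx_def by blast
  obtain \<eta> where \<eta>: "smooth \<eta>" "sqnorm (lebesgue_on \<Omega>) (\<lambda>x. \<eta> x - f' x) \<le> ennreal e"
      "\<And>i. sqnorm (lebesgue_on \<Omega>) (\<lambda>x. partial i \<eta> x - D' i x) \<le> ennreal e"
      "sqnorm (surface_measure \<Omega>) (\<lambda>x. \<eta> x - g x) \<le> ennreal e"
    using t(2) \<open>0 < e\<close> unfolding trace_approx_def by blast
  have mid: "(1/2) *\<^sub>R (a + b) - (1/2) *\<^sub>R (c + d) = (1/2) *\<^sub>R ((a - c) + (b - d))" for a b c d :: 'b
    by (simp add: algebra_simps)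
  have mid': "(1/2) *\<^sub>R (a + b) - c = (1/2) *\<^sub>R ((a - c) + (b - c))" for a b c :: 'b
  proof -
    have "c = (1/2) *\<^sub>R (c + c)" by (simp flip: scaleR_2)
    then show ?thesis using mid[of a b c c] by simp
  qed
  have p: "partial i (\<lambda>x. (1/2) *\<^sub>R (\<psi> x + \<eta> x)) x = (1/2) *\<^sub>R (partial i \<psi> x + partial i \<eta> x)" for i x
  proof -
    have "((\<lambda>x. (1/2) *\<^sub>R (\<psi> x + \<eta> x)) has_derivative (\<lambda>v. (1/2) *\<^sub>R (frechet_derivative \<psi> (at x) v + frechet_derivative \<eta> (at x) v))) (at x)"
      using smooth_differentiable[OF \<psi>(1)] smooth_differentiable[OF \<eta>(1)]
      by (intro has_derivative_scaleR_right has_derivative_add) (auto simp: frechet_derivative_works)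
    from partial_eqI[OF this] show ?thesis by (simp add: partial_def)
  qed
  have m: "\<psi> \<in> borel_measurable (lebesgue_on \<Omega>)" "\<eta> \<in> borel_measurable (lebesgue_on \<Omega>)"
     "\<And>i. partial i \<psi> \<in> borel_measurable (lebesgue_on \<Omega>)" "\<And>i. partial i \<eta> \<in> borel_measurable (lebesgue_on \<Omega>)"
     "\<psi> \<in> borel_measurable (surface_measure \<Omega>)" "\<eta> \<in> borel_measurable (surface_measure \<Omega>)"
    using \<psi>(1) \<eta>(1) by (auto intro!: borel_measurable_lebesgue_on smooth_borel_measurable smooth_partial smooth_measurable_surface_measure)
  note L' = L[THEN L2_measurable] L2_measurable[OF g]
  show "\<exists>\<psi>. smooth \<psi> \<and> sqnorm (lebesgue_on \<Omega>) (\<lambda>x. \<psi> x - (1/2) *\<^sub>R (f x + f' x)) \<le> ennreal e \<and>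
      (\<forall>i. sqnorm (lebesgue_on \<Omega>) (\<lambda>x. partial i \<psi> x - (1/2) *\<^sub>R (D i x + D' i x)) \<le> ennreal e) \<and>
      sqnorm (surface_measure \<Omega>) (\<lambda>x. \<psi> x - g x) \<le> ennreal e"
  proof (intro exI[of _ "\<lambda>x. (1/2) *\<^sub>R (\<psi> x + \<eta> x)"] conjI allI)
    show "smooth (\<lambda>x. (1/2) *\<^sub>R (\<psi> x + \<eta> x))"
      by (rule smooth_scaleR[OF smooth_const smooth_add[OF \<psi>(1) \<eta>(1)]])
    show "sqnorm (lebesgue_on \<Omega>) (\<lambda>x. (1/2) *\<^sub>R (\<psi> x + \<eta> x) - (1/2) *\<^sub>R (f x + f' x)) \<le> ennreal e"
      unfolding mid by (intro sqnorm_midpoint_le \<psi> \<eta> borel_measurable_diff m L')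
    show "sqnorm (lebesgue_on \<Omega>) (\<lambda>x. partial i (\<lambda>x. (1/2) *\<^sub>R (\<psi> x + \<eta> x)) x - (1/2) *\<^sub>R (D i x + D' i x)) \<le> ennreal e" for i
      unfolding p mid by (intro sqnorm_midpoint_le \<psi> \<eta> borel_measurable_diff m L')
    show "sqnorm (surface_measure \<Omega>) (\<lambda>x. (1/2) *\<^sub>R (\<psi> x + \<eta> x) - g x) \<le> ennreal e"
      unfolding mid' by (intro sqnorm_midpoint_le \<psi> \<eta> borel_measurable_diff m L')
  qed
qed

text \<open>A smooth approximation of a late \<open>f n\<close> approximates the limit. On the
  boundary nothing has to converge because \<open>g\<close> is fixed; this is where continuity of
  the trace operator would otherwise enter.\<close>

lemma trace_approx_limit:
  fixes f :: "nat \<Rightarrow> real^'n::finite \<Rightarrow> 'b::euclidean_space"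
  assumes t: "\<And>n. trace_approx \<Omega> g (f n) (D n)"
    and L: "\<And>n. f n \<in> L2 (lebesgue_on \<Omega>)" "f' \<in> L2 (lebesgue_on \<Omega>)"
      "\<And>n i. D n i \<in> L2 (lebesgue_on \<Omega>)" "\<And>i. D' i \<in> L2 (lebesgue_on \<Omega>)"
    and conv: "L2_converges (lebesgue_on \<Omega>) f f'" "\<And>i. L2_converges (lebesgue_on \<Omega>) (\<lambda>n. D n i) (D' i)"
  shows "trace_approx \<Omega> g f' D'"
  unfolding trace_approx_def
proof (intro allI impI)
  fix e :: real assume e: "0 < e"
  have "\<forall>\<^sub>F n in sequentially. sqnorm (lebesgue_on \<Omega>) (\<lambda>x. f n x - f' x) \<le> ennreal (e/4) \<and>
      (\<forall>i. sqnorm (lebesgue_on \<Omega>) (\<lambda>x. D n i x - D' i x) \<le> ennreal (e/4))"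
    using conv e unfolding L2_converges_sqnorm
    by (intro eventually_conj eventually_all_finite ennreal_LIMSEQ_0_eventually) auto
  then obtain n where n: "sqnorm (lebesgue_on \<Omega>) (\<lambda>x. f n x - f' x) \<le> ennreal (e/4)"
      "\<And>i. sqnorm (lebesgue_on \<Omega>) (\<lambda>x. D n i x - D' i x) \<le> ennreal (e/4)"
    using eventually_happens'[OF sequentially_bot] by blast
  obtain \<psi> where \<psi>: "smooth \<psi>" "sqnorm (lebesgue_on \<Omega>) (\<lambda>x. \<psi> x - f n x) \<le> ennreal (e/4)"
      "\<And>i. sqnorm (lebesgue_on \<Omega>) (\<lambda>x. partial i \<psi> x - D n i x) \<le> ennreal (e/4)"
      "sqnorm (surface_measure \<Omega>) (\<lambda>x. \<psi> x - g x) \<le> ennreal (e/4)"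
    using t[of n, unfolded trace_approx_def, rule_format, of "e/4"] e by auto
  have m: "\<psi> \<in> borel_measurable (lebesgue_on \<Omega>)" "\<And>i. partial i \<psi> \<in> borel_measurable (lebesgue_on \<Omega>)"
    using \<psi>(1) by (auto intro!: borel_measurable_lebesgue_on smooth_borel_measurable smooth_partial)
  note L' = L[THEN L2_measurable]
  have e4: "a \<le> ennreal e" if "a \<le> 2 * b + 2 * c" "b \<le> ennreal (e/4)" "c \<le> ennreal (e/4)" for a b c
  proof -
    have "2 * b + 2 * c \<le> 2 * ennreal (e/4) + 2 * ennreal (e/4)"
      using that by (intro add_mono mult_left_mono) auto
    also have "\<dots> = ennreal e" using e by (simp flip: ennreal_plus ennreal_mult ennreal_numeral)
    finally show ?thesis using that(1) by simp
  qed
  show "\<exists>\<psi>. smooth \<psi> \<and> sqnorm (lebesgue_on \<Omega>) (\<lambda>x. \<psi> x - f' x) \<le> ennreal e \<and>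
      (\<forall>i. sqnorm (lebesgue_on \<Omega>) (\<lambda>x. partial i \<psi> x - D' i x) \<le> ennreal e) \<and>
      sqnorm (surface_measure \<Omega>) (\<lambda>x. \<psi> x - g x) \<le> ennreal e"
  proof (intro exI[of _ \<psi>] conjI allI)
    show "sqnorm (lebesgue_on \<Omega>) (\<lambda>x. \<psi> x - f' x) \<le> ennreal e"
      by (rule e4[OF sqnorm_diff[OF m(1) L'(1)[of n] L'(2)] \<psi>(2) n(1)])
    show "sqnorm (lebesgue_on \<Omega>) (\<lambda>x. partial i \<psi> x - D' i x) \<le> ennreal e" for i
      by (rule e4[OF sqnorm_diff[OF m(2)[of i] L'(3)[of n i] L'(4)[of i]] \<psi>(3)[of i] n(2)[of i]])
    show "sqnorm (surface_measure \<Omega>) (\<lambda>x. \<psi> x - g x) \<le> ennreal e"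
      using e by (intro order_trans[OF \<psi>(4)] ennreal_leI) simp
  qed (fact \<psi>(1))
qed

lemma trace_approx_cong_AE:
  assumes t: "trace_approx \<Omega> g f D"
    and "AE x in lebesgue_on \<Omega>. f x = f' x" "\<And>i. AE x in lebesgue_on \<Omega>. D i x = D' i x"
  shows "trace_approx \<Omega> g f' D'"
proof -
  have "sqnorm (lebesgue_on \<Omega>) (\<lambda>x. \<psi> x - f x) = sqnorm (lebesgue_on \<Omega>) (\<lambda>x. \<psi> x - f' x)" for \<psi>
    using assms(2) by (intro sqnorm_cong_AE) auto
  moreover have "sqnorm (lebesgue_on \<Omega>) (\<lambda>x. \<psi> x - D i x) = sqnorm (lebesgue_on \<Omega>) (\<lambda>x. \<psi> x - D' i x)" for \<psi> i
    using assms(3)[of i] by (intro sqnorm_cong_AE) auto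
  ultimately show ?thesis using t unfolding trace_approx_def by simp
qed

text \<open>Rellich's theorem, in the weak form of convergence almost everywhere.\<close>

lemma H1_bounded_imp_AE_convergent_subseq:
  fixes f :: "nat \<Rightarrow> real^'n::finite \<Rightarrow> 'b::euclidean_space"
  assumes \<Omega>: "open \<Omega>" "convex \<Omega>" and t: "\<And>k. trace_approx \<Omega> g (f k) (D k)"
    and L: "\<And>k. f k \<in> L2 (lebesgue_on \<Omega>)" "\<And>k i. D k i \<in> L2 (lebesgue_on \<Omega>)"
    and R: "\<And>k. sqnorm (lebesgue_on \<Omega>) (f k) \<le> ennreal R" "\<And>k i. sqnorm (lebesgue_on \<Omega>) (D k i) \<le> ennreal R"
  shows "\<exists>r :: nat \<Rightarrow> nat. strict_mono r \<and> (AE x in lebesgue_on \<Omega>. convergent (\<lambda>k. f (r k) x))"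
proof -
  let ?M = "lebesgue_on \<Omega>"
  from trace_approx_choice[of \<Omega> g f D, OF t]
  obtain \<psi> where "\<forall>k. smooth (\<psi> k) \<and> sqnorm ?M (\<lambda>x. \<psi> k x - f k x) \<le> ennreal (1 / Suc k) \<and>
      (\<forall>i. sqnorm ?M (\<lambda>x. partial i (\<psi> k) x - D k i x) \<le> ennreal (1 / Suc k)) \<and>
      sqnorm (surface_measure \<Omega>) (\<lambda>x. \<psi> k x - g x) \<le> ennreal (1 / Suc k)" by blast
  then have \<psi>: "\<And>k. smooth (\<psi> k)" "\<And>k. sqnorm ?M (\<lambda>x. \<psi> k x - f k x) \<le> ennreal (1 / Suc k)"
      "\<And>k i. sqnorm ?M (\<lambda>x. partial i (\<psi> k) x - D k i x) \<le> ennreal (1 / Suc k)"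
    by blast+
  have m: "\<psi> k \<in> borel_measurable ?M" "partial i (\<psi> k) \<in> borel_measurable ?M" for k i
    using \<psi>(1) by (auto intro!: borel_measurable_lebesgue_on smooth_borel_measurable smooth_partial)
  note L' = L[THEN L2_measurable]
  have bd: "sqnorm ?M a \<le> ennreal (2 + 2 * max R 0)"
    if "sqnorm ?M (\<lambda>x. a x - b x) \<le> ennreal (1 / Suc k)" "sqnorm ?M b \<le> ennreal R" 
      "a \<in> borel_measurable ?M" "b \<in> borel_measurable ?M" for a b :: "real^'n \<Rightarrow> 'b" and k
  proof -
    have "sqnorm ?M a = sqnorm ?M (\<lambda>x. (a x - b x) + b x)" by simp
    also have "\<dots> \<le> 2 * sqnorm ?M (\<lambda>x. a x - b x) + 2 * sqnorm ?M b"
      using that by (intro sqnorm_add borel_measurable_diff)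
    also have "\<dots> \<le> 2 * ennreal 1 + 2 * ennreal (max R 0)"
    proof (intro add_mono mult_left_mono)
      show "sqnorm ?M (\<lambda>x. a x - b x) \<le> ennreal 1" by (rule order_trans[OF that(1)], rule ennreal_leI) simp
      show "sqnorm ?M b \<le> ennreal (max R 0)" by (rule order_trans[OF that(2)], rule ennreal_leI) simp
    qed auto
    also have "\<dots> = ennreal (2 + 2 * max R 0)" by (simp add: ennreal_plus ennreal_mult)
    finally show ?thesis .
  qed
  obtain r where r: "strict_mono r" "AE x in ?M. convergent (\<lambda>k. \<psi> (r k) x)"
    using smooth_bounded_imp_AE_convergent_subseq[where \<phi> = \<psi>, OF \<Omega> \<psi>(1)
        bd[OF \<psi>(2) R(1) m(1) L'(1)] bd[OF \<psi>(3) R(2) m(2) L'(2)]] by blast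
  \<comment> \<open>The smooth functions and the given ones differ by a sequence tending to
    \<open>0\<close>, so along a further subsequence pointwise convergence passes from
    \<open>\<psi>\<close> to \<open>f\<close>.\<close>
  have "L2_converges ?M (\<lambda>k x. \<psi> (r k) x - f (r k) x) (\<lambda>_. 0)"
    unfolding L2_converges_sqnorm diff_zero
    by (rule LIMSEQ_subseq_LIMSEQ[OF LIMSEQ_0_of_le_inverse[OF \<psi>(2)] r(1), unfolded o_def])
  then obtain s where s: "strict_mono s" "AE x in ?M. (\<lambda>k. \<psi> (r (s k)) x - f (r (s k)) x) \<longlonglongrightarrow> 0"
    using L2_converges_AE_subseq[of "\<lambda>k x. \<psi> (r k) x - f (r k) x" ?M "\<lambda>_. 0"] m L' by auto
  have "AE x in ?M. convergent (\<lambda>k. f (r (s k)) x)"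
    using r(2) s(2)
  proof eventually_elim
    case (elim x)
    then obtain l where "(\<lambda>k. \<psi> (r k) x) \<longlonglongrightarrow> l" by (auto simp: convergent_def)
    from LIMSEQ_subseq_LIMSEQ[OF this s(1)] have "(\<lambda>k. \<psi> (r (s k)) x) \<longlonglongrightarrow> l" by (simp add: o_def)
    from tendsto_diff[OF this elim(2)] show ?case by (auto simp: convergent_def)
  qed
  moreover have "strict_mono (\<lambda>k. r (s k))" using strict_mono_o[OF r(1) s(1)] by (simp add: o_def)
  ultimately show ?thesis by blast
qed

section \<open>Configurations\<close>

text \<open>Made for the coordinate projections of a configuration: linearity lets them commute with
  midpoints, and the norm bound lets membership in \<open>L2\<close>, convergence and bounds pass
  from the whole configuration to its components.\<close>

definition linear_contraction :: "('a::euclidean_space \<Rightarrow> 'b::euclidean_space) \<Rightarrow> bool" where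
  "linear_contraction T \<longleftrightarrow> bounded_linear T \<and> (\<forall>x. norm (T x) \<le> norm x)"

lemma linear_contraction_compose:
  "linear_contraction S \<Longrightarrow> linear_contraction T \<Longrightarrow> linear_contraction (\<lambda>x. S (T x))"
  unfolding linear_contraction_def by (auto intro: bounded_linear_compose order_trans)

lemma linear_contraction_fst: "linear_contraction fst"
  and linear_contraction_snd: "linear_contraction snd"
  and linear_contraction_nth: "linear_contraction (\<lambda>x :: 'b::euclidean_space^'n::finite. x $ i)"
  unfolding linear_contraction_def
  by (auto simp: bounded_linear_fst bounded_linear_snd bounded_linear_vec_nth norm_fst_le norm_snd_le vec_nth_norm_le)

lemma linear_contraction_midpoint:
  "linear_contraction T \<Longrightarrow> T ((1/2) *\<^sub>R (x + y)) = (1/2) *\<^sub>R (T x + T y)"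
  unfolding linear_contraction_def
  using linear_add[of T x y] linear_scale[of T "1/2" "x + y"] bounded_linear.linear[of T] by simp

lemma linear_contraction_L2:
  assumes "linear_contraction T" "f \<in> L2 M"
  shows "(\<lambda>x. T (f x)) \<in> L2 M"
  using assms unfolding linear_contraction_def
  by (intro L2_bounded_linear[where T=T] borel_measurable_continuous_onI linear_continuous_on) auto

lemma linear_contraction_L2_converges:
  assumes "linear_contraction T" "L2_converges M f g"
  shows "L2_converges M (\<lambda>n x. T (f n x)) (\<lambda>x. T (g x))"
  using assms unfolding linear_contraction_def
  by (intro L2_converges_comp[where T=T]) (auto intro: linear_diff bounded_linear.linear)

lemma has_weak_partial_midpoint_contraction:
  assumes "\<Omega> \<in> lmeasurable" "linear_contraction S" "linear_contraction T"
    and "f \<in> L2 (lebesgue_on \<Omega>)" "g \<in> L2 (lebesgue_on \<Omega>)"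
    and "has_weak_partial \<Omega> i (\<lambda>x. S (f x)) (\<lambda>x. T (f x))" "has_weak_partial \<Omega> i (\<lambda>x. S (g x)) (\<lambda>x. T (g x))"
  shows "has_weak_partial \<Omega> i (\<lambda>x. S ((1/2) *\<^sub>R (f x + g x))) (\<lambda>x. T ((1/2) *\<^sub>R (f x + g x)))"
  unfolding linear_contraction_midpoint[OF assms(2)] linear_contraction_midpoint[OF assms(3)]
  by (intro has_weak_partial_midpoint linear_contraction_L2[OF assms(2)] linear_contraction_L2[OF assms(3)] assms)

text \<open>
  A configuration bundles \<open>u\<close>, \<open>Q\<close>, \<open>\<nabla>u\<close>, \<open>\<nabla>Q\<close> and the Hessian of \<open>u\<close>; the last component is
  room for the lower order term that is added to the Hessian in the energy.
\<close>

type_synonym 'n config =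
  "real \<times> (real^'n^'n) \<times> (real^'n) \<times> ((real^'n^'n)^'n) \<times> (real^'n^'n) \<times> (real^'n^'n)"

abbreviation cu :: "'n::finite config \<Rightarrow> real" where "cu w \<equiv> fst w"
abbreviation cQ :: "'n::finite config \<Rightarrow> real^'n^'n" where "cQ w \<equiv> fst (snd w)"
abbreviation cp :: "'n::finite config \<Rightarrow> real^'n" where "cp w \<equiv> fst (snd (snd w))"
abbreviation cP :: "'n::finite config \<Rightarrow> (real^'n^'n)^'n" where "cP w \<equiv> fst (snd (snd (snd w)))"
abbreviation cH :: "'n::finite config \<Rightarrow> real^'n^'n" where "cH w \<equiv> fst (snd (snd (snd (snd w))))"
abbreviation ch :: "'n::finite config \<Rightarrow> real^'n^'n" where "ch w \<equiv> snd (snd (snd (snd (snd w))))"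

lemmas linear_contraction_intros =
  linear_contraction_fst linear_contraction_snd linear_contraction_nth
  linear_contraction_compose[OF linear_contraction_nth] linear_contraction_compose[OF linear_contraction_fst]
  linear_contraction_compose[OF linear_contraction_snd]

lemma linear_contraction_config:
  "linear_contraction (\<lambda>w :: 'n::finite config. cu w)" "linear_contraction (\<lambda>w :: 'n::finite config. cQ w)"
  "linear_contraction (\<lambda>w :: 'n::finite config. cp w $ i)" "linear_contraction (\<lambda>w :: 'n::finite config. cP w $ i)"
  "linear_contraction (\<lambda>w :: 'n::finite config. cH w)" "linear_contraction (\<lambda>w :: 'n::finite config. ch w)"
  "linear_contraction (\<lambda>w :: 'n::finite config. cH w $ i $ j)" "linear_contraction (\<lambda>w :: 'n::finite config. cP w)"
  by (intro linear_contraction_intros)+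

text \<open>The derivatives are components of \<open>w\<close> tied to it by
  \<open>has_weak_partial\<close> instead of being given by \<open>weak_partial\<close>: the latter
  selects a representative and so commutes with sums and limits only almost everywhere. In this form
  the set is closed under midpoints and strong limits. The component \<open>ch\<close> is left free
  apart from being square integrable.\<close>

definition weak_config :: "(real^'n::finite) set \<Rightarrow> (real^'n \<Rightarrow> real) \<Rightarrow> (real^'n \<Rightarrow> real^'n^'n) \<Rightarrow> (real^'n \<Rightarrow> 'n config) set" where
  "weak_config \<Omega> u_b Q_b = {w \<in> L2 (lebesgue_on \<Omega>).
     (\<forall>i. has_weak_partial \<Omega> i (\<lambda>x. cu (w x)) (\<lambda>x. cp (w x) $ i)) \<and>
     (\<forall>i j. has_weak_partial \<Omega> i (\<lambda>x. cp (w x) $ j) (\<lambda>x. cH (w x) $ i $ j)) \<and>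
     (\<forall>i. has_weak_partial \<Omega> i (\<lambda>x. cQ (w x)) (\<lambda>x. cP (w x) $ i)) \<and>
     trace_approx \<Omega> u_b (\<lambda>x. cu (w x)) (\<lambda>i x. cp (w x) $ i) \<and>
     trace_approx \<Omega> Q_b (\<lambda>x. cQ (w x)) (\<lambda>i x. cP (w x) $ i)}"

lemma weak_config_midpoint:
  fixes f g :: "real^'n::finite \<Rightarrow> 'n config"
  assumes \<Omega>: "\<Omega> \<in> lmeasurable" and b: "u_b \<in> L2 (surface_measure \<Omega>)" "Q_b \<in> L2 (surface_measure \<Omega>)"
    and fg: "f \<in> weak_config \<Omega> u_b Q_b" "g \<in> weak_config \<Omega> u_b Q_b"
  shows "(\<lambda>x. (1/2) *\<^sub>R (f x + g x)) \<in> weak_config \<Omega> u_b Q_b"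
proof -
  note lc = linear_contraction_config[where 'n='n]
  have L: "f \<in> L2 (lebesgue_on \<Omega>)" "g \<in> L2 (lebesgue_on \<Omega>)" using fg by (auto simp: weak_config_def)
  have 1: "(\<lambda>x. (1/2) *\<^sub>R (f x + g x)) \<in> L2 (lebesgue_on \<Omega>)"
    by (rule L2_scaleR[OF L2_add[OF L]])
  have 2: "has_weak_partial \<Omega> i (\<lambda>x. cu ((1/2) *\<^sub>R (f x + g x))) (\<lambda>x. cp ((1/2) *\<^sub>R (f x + g x)) $ i)" for i
    using fg by (intro has_weak_partial_midpoint_contraction[OF \<Omega> lc(1) lc(3) L]) (auto simp: weak_config_def)
  have 3: "has_weak_partial \<Omega> i (\<lambda>x. cp ((1/2) *\<^sub>R (f x + g x)) $ j) (\<lambda>x. cH ((1/2) *\<^sub>R (f x + g x)) $ i $ j)" for i j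
    using fg by (intro has_weak_partial_midpoint_contraction[OF \<Omega> lc(3) lc(7) L]) (auto simp: weak_config_def)
  have 4: "has_weak_partial \<Omega> i (\<lambda>x. cQ ((1/2) *\<^sub>R (f x + g x))) (\<lambda>x. cP ((1/2) *\<^sub>R (f x + g x)) $ i)" for i
    using fg by (intro has_weak_partial_midpoint_contraction[OF \<Omega> lc(2) lc(4) L]) (auto simp: weak_config_def)
  have 5: "trace_approx \<Omega> u_b (\<lambda>x. cu ((1/2) *\<^sub>R (f x + g x))) (\<lambda>i x. cp ((1/2) *\<^sub>R (f x + g x)) $ i)"
    unfolding linear_contraction_midpoint[OF lc(1)] linear_contraction_midpoint[OF lc(3)]
    using fg by (intro trace_approx_midpoint b linear_contraction_L2[OF lc(1)] linear_contraction_L2[OF lc(3)] L) (auto simp: weak_config_def)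
  have 6: "trace_approx \<Omega> Q_b (\<lambda>x. cQ ((1/2) *\<^sub>R (f x + g x))) (\<lambda>i x. cP ((1/2) *\<^sub>R (f x + g x)) $ i)"
    unfolding linear_contraction_midpoint[OF lc(2)] linear_contraction_midpoint[OF lc(4)]
    using fg by (intro trace_approx_midpoint b linear_contraction_L2[OF lc(2)] linear_contraction_L2[OF lc(4)] L) (auto simp: weak_config_def)
  show ?thesis
    unfolding weak_config_def using 1 2 3 4 5 6 by blast
qed

lemma weak_config_limit:
  fixes y :: "nat \<Rightarrow> real^'n::finite \<Rightarrow> 'n config"
  assumes \<Omega>: "\<Omega> \<in> lmeasurable" and y: "\<And>n. y n \<in> weak_config \<Omega> u_b Q_b"
    and z: "z \<in> L2 (lebesgue_on \<Omega>)" "L2_converges (lebesgue_on \<Omega>) y z"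
  shows "z \<in> weak_config \<Omega> u_b Q_b"
proof -
  note lc = linear_contraction_config[where 'n='n]
  have L: "y n \<in> L2 (lebesgue_on \<Omega>)" for n using y by (auto simp: weak_config_def)
  have wp: "has_weak_partial \<Omega> i (\<lambda>x. S (z x)) (\<lambda>x. T (z x))"
    if ST: "linear_contraction S" "linear_contraction T" 
      and w: "\<And>n. has_weak_partial \<Omega> i (\<lambda>x. S (y n x)) (\<lambda>x. T (y n x))" for S T :: "'n config \<Rightarrow> 'b::euclidean_space" and i
    by (rule has_weak_partial_limit[where f = "\<lambda>n x. S (y n x)" and g = "\<lambda>n x. T (y n x)", OF \<Omega> w])
      (intro linear_contraction_L2[OF ST(1)] linear_contraction_L2[OF ST(2)] linear_contraction_L2_converges[OF ST(1)]
        linear_contraction_L2_converges[OF ST(2)] L z)+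
  have 2: "has_weak_partial \<Omega> i (\<lambda>x. cu (z x)) (\<lambda>x. cp (z x) $ i)" for i
    using y by (intro wp lc) (auto simp: weak_config_def)
  have 3: "has_weak_partial \<Omega> i (\<lambda>x. cp (z x) $ j) (\<lambda>x. cH (z x) $ i $ j)" for i j
    using y by (intro wp[of "\<lambda>w. cp w $ j" "\<lambda>w. cH w $ i $ j"] lc) (auto simp: weak_config_def)
  have 4: "has_weak_partial \<Omega> i (\<lambda>x. cQ (z x)) (\<lambda>x. cP (z x) $ i)" for i
    using y by (intro wp[of "\<lambda>w. cQ w" "\<lambda>w. cP w $ i"] lc) (auto simp: weak_config_def)
  have 5: "trace_approx \<Omega> u_b (\<lambda>x. cu (z x)) (\<lambda>i x. cp (z x) $ i)"
  proof (rule trace_approx_limit[where f = "\<lambda>n x. cu (y n x)" and D = "\<lambda>n i x. cp (y n x) $ i"])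
    show "trace_approx \<Omega> u_b (\<lambda>x. cu (y n x)) (\<lambda>i x. cp (y n x) $ i)" for n
      using y[of n] by (simp add: weak_config_def)
  qed (intro linear_contraction_L2[OF lc(1)] linear_contraction_L2[OF lc(3)] linear_contraction_L2_converges[OF lc(1)]
      linear_contraction_L2_converges[OF lc(3)] L z)+
  have 6: "trace_approx \<Omega> Q_b (\<lambda>x. cQ (z x)) (\<lambda>i x. cP (z x) $ i)"
  proof (rule trace_approx_limit[where f = "\<lambda>n x. cQ (y n x)" and D = "\<lambda>n i x. cP (y n x) $ i"])
    show "trace_approx \<Omega> Q_b (\<lambda>x. cQ (y n x)) (\<lambda>i x. cP (y n x) $ i)" for n
      using y[of n] by (simp add: weak_config_def)
  qed (intro linear_contraction_L2[OF lc(2)] linear_contraction_L2[OF lc(4)] linear_contraction_L2_converges[OF lc(2)]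
      linear_contraction_L2_converges[OF lc(4)] L z)+
  show ?thesis
    unfolding weak_config_def using z(1) 2 3 4 5 6 by blast
qed

text \<open>The way back from bundles to functions: uniqueness of weak derivatives identifies the
  chosen representatives with the components almost everywhere. For second derivatives the first
  derivative is exchanged for its representative beforehand.\<close>

lemma weak_config_admissible:
  fixes w :: "real^'n::finite \<Rightarrow> 'n config"
  assumes \<Omega>: "open \<Omega>" "\<Omega> \<in> lmeasurable" and b: "u_b \<in> L2 (surface_measure \<Omega>)" "Q_b \<in> L2 (surface_measure \<Omega>)"
    and w: "w \<in> weak_config \<Omega> u_b Q_b" and S0: "\<And>x. x \<in> \<Omega> \<Longrightarrow> cQ (w x) \<in> S0"
  defines "u \<equiv> \<lambda>x. cu (w x)" and "Q \<equiv> \<lambda>x. cQ (w x)"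
  shows "(u, Q) \<in> admissible \<Omega> u_b Q_b"
    and "AE x in lebesgue_on \<Omega>. weak_hessian \<Omega> u x = cH (w x)"
    and "AE x in lebesgue_on \<Omega>. \<forall>i. weak_partial \<Omega> i Q x = cP (w x) $ i"
proof -
  let ?M = "lebesgue_on \<Omega>"
  note lc = linear_contraction_config[where 'n='n]
  have L: "w \<in> L2 ?M" using w by (simp add: weak_config_def)
  note L' = linear_contraction_L2[OF _ L]
  have wu: "has_weak_partial \<Omega> i u (\<lambda>x. cp (w x) $ i)"
    and wp: "has_weak_partial \<Omega> i (\<lambda>x. cp (w x) $ j) (\<lambda>x. cH (w x) $ i $ j)"
    and wQ: "has_weak_partial \<Omega> i Q (\<lambda>x. cP (w x) $ i)" for i j
    using w by (auto simp: weak_config_def u_def Q_def)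
  have uH1: "u \<in> H1 \<Omega>" unfolding H1_def using L'[OF lc(1)] L'[OF lc(3)] wu by (auto simp: u_def)
  have QH1: "Q \<in> H1 \<Omega>" unfolding H1_def using L'[OF lc(2)] L'[OF lc(4)] wQ by (auto simp: Q_def)
  have au: "AE x in ?M. weak_partial \<Omega> i u x = cp (w x) $ i" for i
    by (rule has_weak_partial_unique[OF \<Omega> weak_partial_H1(1)[OF uH1] L'[OF lc(3)] weak_partial_H1(2)[OF uH1] wu])
  have aQ: "AE x in ?M. weak_partial \<Omega> i Q x = cP (w x) $ i" for i
    by (rule has_weak_partial_unique[OF \<Omega> weak_partial_H1(1)[OF QH1] L'[OF lc(4)] weak_partial_H1(2)[OF QH1] wQ])
  have wp': "has_weak_partial \<Omega> i (weak_partial \<Omega> j u) (\<lambda>x. cH (w x) $ i $ j)" for i j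
    using au[of j] by (intro has_weak_partial_cong_AE[OF \<Omega>(2) wp L'[OF lc(3)] L'[OF lc(7)] weak_partial_H1(1)[OF uH1] L'[OF lc(7)]]) auto
  have "\<exists>g\<in>L2 ?M. has_weak_partial \<Omega> i (weak_partial \<Omega> j u) g" for i j
    by (rule bexI[where x = "\<lambda>x. cH (w x) $ i $ j"], rule wp', rule L'[OF lc(7)])
  then have pH1: "weak_partial \<Omega> j u \<in> H1 \<Omega>" for j
    unfolding H1_def using weak_partial_H1(1)[OF uH1, of j] by blast
  have "AE x in ?M. weak_partial \<Omega> i (weak_partial \<Omega> j u) x = cH (w x) $ i $ j" for i j
    by (rule has_weak_partial_unique[OF \<Omega> weak_partial_H1(1)[OF pH1] L'[OF lc(7)] weak_partial_H1(2)[OF pH1] wp'])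
  then have "AE x in ?M. \<forall>i j. weak_partial \<Omega> i (weak_partial \<Omega> j u) x = cH (w x) $ i $ j"
    by (simp add: AE_all_countable)
  then show "AE x in ?M. weak_hessian \<Omega> u x = cH (w x)"
    by eventually_elim (simp add: weak_hessian_def vec_eq_iff)
  show "AE x in ?M. \<forall>i. weak_partial \<Omega> i Q x = cP (w x) $ i"
    using aQ by (simp add: AE_all_countable)
  have "u \<in> H2 \<Omega>" unfolding H2_def using uH1 pH1 by blast
  moreover have "Q \<in> H1_S0 \<Omega>" unfolding H1_S0_def using QH1 S0 by (auto simp: Q_def)
  moreover have "has_trace \<Omega> u u_b"
    unfolding has_trace_iff
  proof (intro conjI uH1 b)
    have "trace_approx \<Omega> u_b u (\<lambda>i x. cp (w x) $ i)" using w by (simp add: weak_config_def u_def)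
    then show "trace_approx \<Omega> u_b u (\<lambda>i. weak_partial \<Omega> i u)"
    proof (rule trace_approx_cong_AE)
      show "AE x in ?M. cp (w x) $ i = weak_partial \<Omega> i u x" for i
        using au[of i] by eventually_elim simp
    qed simp
  qed
  moreover have "has_trace \<Omega> Q Q_b"
    unfolding has_trace_iff
  proof (intro conjI QH1 b)
    have "trace_approx \<Omega> Q_b Q (\<lambda>i x. cP (w x) $ i)" using w by (simp add: weak_config_def Q_def)
    then show "trace_approx \<Omega> Q_b Q (\<lambda>i. weak_partial \<Omega> i Q)"
    proof (rule trace_approx_cong_AE)
      show "AE x in ?M. cP (w x) $ i = weak_partial \<Omega> i Q x" for i
        using aQ[of i] by eventually_elim simp
    qed simp
  qed
  ultimately show "(u, Q) \<in> admissible \<Omega> u_b Q_b" by (simp add: admissible_def)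
qed

definition config_of :: "(real^'n::finite) set \<Rightarrow> (real^'n \<Rightarrow> real) \<Rightarrow> (real^'n \<Rightarrow> real^'n^'n) \<Rightarrow>
    (real^'n \<Rightarrow> real^'n^'n) \<Rightarrow> real^'n \<Rightarrow> 'n config" where
  "config_of \<Omega> u Q h x =
     (u x, Q x, \<chi> i. weak_partial \<Omega> i u x, \<chi> i. weak_partial \<Omega> i Q x, weak_hessian \<Omega> u x, h x)"

lemma admissible_L2:
  fixes u :: "real^'n::finite \<Rightarrow> real"
  assumes "(u, Q) \<in> admissible \<Omega> u_b Q_b"
  shows "u \<in> L2 (lebesgue_on \<Omega>)" "Q \<in> L2 (lebesgue_on \<Omega>)"
    "weak_partial \<Omega> i u \<in> L2 (lebesgue_on \<Omega>)" "weak_partial \<Omega> i Q \<in> L2 (lebesgue_on \<Omega>)"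
    "weak_partial \<Omega> i (weak_partial \<Omega> j u) \<in> L2 (lebesgue_on \<Omega>)"
    "weak_hessian \<Omega> u \<in> L2 (lebesgue_on \<Omega>)"
proof -
  have u: "u \<in> H1 \<Omega>" "\<And>j. weak_partial \<Omega> j u \<in> H1 \<Omega>" and Q: "Q \<in> H1 \<Omega>"
    using assms by (auto simp: admissible_def H2_def H1_S0_def)
  show "u \<in> L2 (lebesgue_on \<Omega>)" "Q \<in> L2 (lebesgue_on \<Omega>)" using u Q by (auto simp: H1_def)
  show "weak_partial \<Omega> i u \<in> L2 (lebesgue_on \<Omega>)" "weak_partial \<Omega> i Q \<in> L2 (lebesgue_on \<Omega>)"
    using weak_partial_H1(1)[OF u(1)] weak_partial_H1(1)[OF Q] by auto
  have h: "weak_partial \<Omega> i (weak_partial \<Omega> j u) \<in> L2 (lebesgue_on \<Omega>)" for i j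
    by (rule weak_partial_H1(1)[OF u(2)])
  then show "weak_partial \<Omega> i (weak_partial \<Omega> j u) \<in> L2 (lebesgue_on \<Omega>)" .
  show "weak_hessian \<Omega> u \<in> L2 (lebesgue_on \<Omega>)"
    by (rule L2_vecI, rule L2_vecI) (simp add: weak_hessian_def h)
qed

lemma admissible_weak_partial:
  fixes u :: "real^'n::finite \<Rightarrow> real"
  assumes "(u, Q) \<in> admissible \<Omega> u_b Q_b"
  shows "has_weak_partial \<Omega> i u (weak_partial \<Omega> i u)" "has_weak_partial \<Omega> i Q (weak_partial \<Omega> i Q)"
    "has_weak_partial \<Omega> i (weak_partial \<Omega> j u) (weak_partial \<Omega> i (weak_partial \<Omega> j u))"
  using assms by (auto simp: admissible_def H2_def H1_S0_def intro!: weak_partial_H1(2))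

lemma config_of_weak_config:
  fixes u :: "real^'n::finite \<Rightarrow> real"
  assumes A: "(u, Q) \<in> admissible \<Omega> u_b Q_b" and h: "h \<in> L2 (lebesgue_on \<Omega>)"
  shows "config_of \<Omega> u Q h \<in> weak_config \<Omega> u_b Q_b"
proof -
  have "(\<lambda>x. \<chi> i. weak_partial \<Omega> i u x) \<in> L2 (lebesgue_on \<Omega>)" "(\<lambda>x. \<chi> i. weak_partial \<Omega> i Q x) \<in> L2 (lebesgue_on \<Omega>)"
    by (rule L2_vecI, simp add: admissible_L2[OF A])+
  then have "config_of \<Omega> u Q h \<in> L2 (lebesgue_on \<Omega>)"
    unfolding config_of_def[abs_def] by (intro L2_Pair h admissible_L2[OF A])
  then show ?thesis
    unfolding weak_config_def config_of_def using admissible_weak_partial[OF A] A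
    by (simp add: weak_hessian_def admissible_def has_trace_iff)
qed

section \<open>Energy densities\<close>

text \<open>Everything that depends on the values of \<open>u\<close> and \<open>Q\<close> alone,
  that is, the nonconvex part of the density. The gradient term is switched off inside
  \<open>nematic_density\<close>.\<close>

definition bulk_density :: "real \<Rightarrow> real \<Rightarrow> real \<Rightarrow> real \<Rightarrow> real \<Rightarrow> real^'n::finite^'n \<Rightarrow> real" where
  "bulk_density a1 a2 a3 l u Q = smectic_bulk a1 a2 a3 u + nematic_density 0 l Q (\<lambda>_. 0)"

definition coupling :: "real \<Rightarrow> real \<Rightarrow> real^'n::finite^'n \<Rightarrow> real^'n^'n" where
  "coupling q u Q = (q\<^sup>2 * u) *\<^sub>R (Q + (1 / real CARD('n)) *\<^sub>R mat 1)"

text \<open>Two completions of squares, each spending a quarter of \<open>\<alpha> * t ^ 4\<close>: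
  one absorbs the cubic term and leaves \<open>\<beta>\<^sup>2 / \<alpha> * t\<^sup>2\<close>, the
  other absorbs all quadratic terms, collected in \<open>\<delta>\<close>, and leaves the
  constant.\<close>

lemma quartic_lower_bound:
  fixes \<alpha> \<beta> \<gamma> :: real
  assumes "0 < \<alpha>"
  shows "\<exists>C\<ge>0. \<forall>t. \<alpha> / 2 * t ^ 4 - C \<le> \<alpha> * t ^ 4 + \<beta> * t ^ 3 + \<gamma> * t\<^sup>2"
proof -
  define \<delta> where "\<delta> = \<beta>\<^sup>2 / \<alpha> + \<bar>\<gamma>\<bar>"
  show ?thesis
  proof (intro exI[of _ "\<delta>\<^sup>2 / \<alpha>"] conjI allI)
    show "0 \<le> \<delta>\<^sup>2 / \<alpha>" using assms by simp
    fix t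
    have "0 \<le> t\<^sup>2 / \<alpha> * (\<alpha> * t / 2 + \<beta>)\<^sup>2 + (\<alpha> * t\<^sup>2 / 2 - \<delta>)\<^sup>2 / \<alpha> + (\<bar>\<gamma>\<bar> + \<gamma>) * t\<^sup>2"
    proof -
      have "0 \<le> (\<bar>\<gamma>\<bar> + \<gamma>) * t\<^sup>2" by (intro mult_nonneg_nonneg) auto
      moreover have "0 \<le> t\<^sup>2 / \<alpha> * (\<alpha> * t / 2 + \<beta>)\<^sup>2" "0 \<le> (\<alpha> * t\<^sup>2 / 2 - \<delta>)\<^sup>2 / \<alpha>"
        using assms by auto
      ultimately show ?thesis by linarith
    qed
    also have "t\<^sup>2 / \<alpha> * (\<alpha> * t / 2 + \<beta>)\<^sup>2 = \<alpha> / 4 * t ^ 4 + \<beta> * t ^ 3 + \<beta>\<^sup>2 / \<alpha> * t\<^sup>2"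
      using assms by (simp add: field_simps power2_eq_square power3_eq_cube power4_eq_xxxx)
    also have "(\<alpha> * t\<^sup>2 / 2 - \<delta>)\<^sup>2 / \<alpha> = \<alpha> / 4 * t ^ 4 - \<delta> * t\<^sup>2 + \<delta>\<^sup>2 / \<alpha>"
      using assms by (simp add: field_simps power2_eq_square power4_eq_xxxx)
    finally have "0 \<le> \<alpha> / 4 * t ^ 4 + \<beta> * t ^ 3 + \<beta>\<^sup>2 / \<alpha> * t\<^sup>2 + (\<alpha> / 4 * t ^ 4 - \<delta> * t\<^sup>2 + \<delta>\<^sup>2 / \<alpha>) + (\<bar>\<gamma>\<bar> + \<gamma>) * t\<^sup>2" .
    moreover have "\<delta> * t\<^sup>2 = \<beta>\<^sup>2 / \<alpha> * t\<^sup>2 + \<bar>\<gamma>\<bar> * t\<^sup>2" by (simp add: \<delta>_def distrib_right)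
    ultimately show "\<alpha> / 2 * t ^ 4 - \<delta>\<^sup>2 / \<alpha> \<le> \<alpha> * t ^ 4 + \<beta> * t ^ 3 + \<gamma> * t\<^sup>2"
      by (simp add: distrib_right)
  qed
qed

lemma norm_matrix_sq: "(norm (Q :: real^'n::finite^'n))\<^sup>2 = (\<Sum>i\<in>UNIV. \<Sum>j\<in>UNIV. (Q $ i $ j)\<^sup>2)"
  by (simp add: norm_vec_def L2_set_def sum_nonneg)

lemma trace_square_symmetric:
  fixes Q :: "real^'n::finite^'n"
  assumes "transpose Q = Q"
  shows "trace (Q ** Q) = (norm Q)\<^sup>2"
proof -
  have "Q $ j $ i = Q $ i $ j" for i j using assms by (metis transpose_def vec_lambda_beta)
  then show ?thesis
    unfolding norm_matrix_sq by (simp add: trace_def matrix_matrix_mult_def power2_eq_square)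
qed

text \<open>The trace is a sum of \<open>CARD('n) ^ 3\<close> products of three entries. A crude
  constant is good enough, as a cubic term is absorbed by the quartic one.\<close>

lemma abs_trace_cube_le:
  fixes Q :: "real^'n::finite^'n"
  shows "\<bar>trace (Q ** Q ** Q)\<bar> \<le> real CARD('n) ^ 3 * norm Q ^ 3"
proof -
  have c: "\<bar>Q $ i $ j\<bar> \<le> norm Q" for i j
    using component_le_norm_cart[of "Q $ i" j] vec_nth_norm_le[of Q i] by linarith
  have t: "\<bar>Q $ i $ j * Q $ j $ k * Q $ k $ i\<bar> \<le> norm Q * norm Q * norm Q" for i j k
    unfolding abs_mult by (intro mult_mono c mult_nonneg_nonneg) auto
  have "\<bar>trace (Q ** Q ** Q)\<bar> = \<bar>\<Sum>i\<in>UNIV. \<Sum>k\<in>UNIV. \<Sum>j\<in>UNIV. Q $ i $ j * Q $ j $ k * Q $ k $ i\<bar>"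
    by (simp add: trace_def matrix_matrix_mult_def sum_distrib_right)
  also have "\<dots> \<le> (\<Sum>i\<in>(UNIV::'n set). \<Sum>k\<in>(UNIV::'n set). \<Sum>j\<in>(UNIV::'n set). norm Q * norm Q * norm Q)"
    by (intro order_trans[OF sum_abs] sum_mono t)
  also have "\<dots> = real CARD('n) ^ 3 * norm Q ^ 3" by (simp add: power3_eq_cube)
  finally show ?thesis .
qed

text \<open>Symmetry of the elements of \<open>S0\<close> turns the trace of the square into the
  squared norm. Hence in either case of the nematic density a quartic polynomial in
  \<open>norm Q\<close> with positive leading coefficient bounds it from below.\<close>

lemma bulk_density_lower_bound:
  assumes "0 < a3" "0 < l"
  shows "\<exists>c>0. \<exists>C\<ge>0. \<forall>u. \<forall>Q \<in> (S0 :: (real^'n::finite^'n) set).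
           c * (u ^ 4 + norm Q ^ 4) - C \<le> bulk_density a1 a2 a3 l u Q"
proof -
  obtain C1 where C1: "0 \<le> C1" "\<And>t::real. a3 / 4 / 2 * t ^ 4 - C1 \<le> a3 / 4 * t ^ 4 + a2 / 3 * t ^ 3 + a1 / 2 * t\<^sup>2"
    using quartic_lower_bound[of "a3 / 4" "a2 / 3" "a1 / 2"] assms by auto
  obtain C2 where C2: "0 \<le> C2" "\<And>t::real. l / 2 * t ^ 4 - C2 \<le> l * t ^ 4 + 0 * t ^ 3 + (- l) * t\<^sup>2"
    using quartic_lower_bound[of l 0 "- l"] assms by auto
  define D where "D = l / 3 * real CARD('n) ^ 3"
  obtain C3 where C3: "0 \<le> C3" "\<And>t::real. l / 2 / 2 * t ^ 4 - C3 \<le> l / 2 * t ^ 4 + (- D) * t ^ 3 + (- l / 2) * t\<^sup>2"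
    using quartic_lower_bound[of "l / 2" "- D" "- l / 2"] assms by auto
  have "\<forall>u. \<forall>Q \<in> (S0 :: (real^'n^'n) set).
     min (a3 / 8) (l / 4) * (u ^ 4 + norm Q ^ 4) - (C1 + max C2 C3) \<le> bulk_density a1 a2 a3 l u Q"
  proof (intro allI ballI)
    fix u :: real and Q :: "real^'n^'n" assume "Q \<in> S0"
    then have tr: "trace (Q ** Q) = (norm Q)\<^sup>2" by (intro trace_square_symmetric) (simp add: S0_def)
    have "l / 4 * norm Q ^ 4 - max C2 C3 \<le> nematic_density 0 l Q (\<lambda>_. 0)"
    proof (cases "CARD('n) = 2")
      case True
      have "l / 4 * norm Q ^ 4 \<le> l / 2 * norm Q ^ 4" using assms by (intro mult_right_mono) auto
      then show ?thesis using C2(2)[of "norm Q"] True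
        by (simp add: nematic_density_def tr flip: power_mult)
    next
      case False
      have "l / 3 * \<bar>trace (Q ** Q ** Q)\<bar> \<le> l / 3 * (real CARD('n) ^ 3 * norm Q ^ 3)"
        using assms by (intro mult_left_mono abs_trace_cube_le) auto
      moreover have "l / 3 * trace (Q ** Q ** Q) \<le> l / 3 * \<bar>trace (Q ** Q ** Q)\<bar>"
        using assms by (intro mult_left_mono) auto
      moreover have "l / 3 * (real CARD('n) ^ 3 * norm Q ^ 3) = D * norm Q ^ 3" by (simp add: D_def)
      moreover have "nematic_density 0 l Q (\<lambda>_. 0) = - (l / 2) * (norm Q)\<^sup>2 - l / 3 * trace (Q ** Q ** Q) + l / 2 * norm Q ^ 4"
        using False by (simp add: nematic_density_def tr flip: power_mult)
      moreover have "l / 2 / 2 * norm Q ^ 4 = l / 4 * norm Q ^ 4" "- l / 2 * (norm Q)\<^sup>2 = - (l / 2) * (norm Q)\<^sup>2"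
        "- D * norm Q ^ 3 = - (D * norm Q ^ 3)" "C3 \<le> max C2 C3" by simp_all
      ultimately show ?thesis using C3(2)[of "norm Q"] by linarith
    qed
    moreover have "a3 / 8 * u ^ 4 - C1 \<le> smectic_bulk a1 a2 a3 u"
      using C1(2)[of u] by (simp add: smectic_bulk_def)
    moreover have "min (a3 / 8) (l / 4) * (u ^ 4 + norm Q ^ 4) \<le> a3 / 8 * u ^ 4 + l / 4 * norm Q ^ 4"
      unfolding distrib_left by (intro add_mono mult_right_mono) auto
    ultimately show "min (a3 / 8) (l / 4) * (u ^ 4 + norm Q ^ 4) - (C1 + max C2 C3) \<le> bulk_density a1 a2 a3 l u Q"
      by (simp add: bulk_density_def)
  qed
  moreover have "0 < min (a3 / 8) (l / 4)" "0 \<le> C1 + max C2 C3" using assms C1 C2 by auto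
  ultimately show ?thesis by blast
qed

text \<open>The product of the squares of \<open>u\<close> and \<open>Q\<close> is split by Young's
  inequality into fourth powers, which are exactly what the bulk density controls.\<close>

lemma coupling_norm_sq_le:
  "\<exists>k\<ge>0. \<forall>u. \<forall>Q :: real^'n::finite^'n. (norm (coupling q u Q))\<^sup>2 \<le> k * (1 + u ^ 4 + norm Q ^ 4)"
proof -
  define J where "J = ((1 / real CARD('n)) *\<^sub>R mat 1 :: real^'n^'n)"
  define b where "b = (norm J)\<^sup>2"
  show ?thesis
  proof (intro exI[of _ "q ^ 4 * (2 + b\<^sup>2)"] conjI allI)
    show "0 \<le> q ^ 4 * (2 + b\<^sup>2)" by simp
    fix u :: real and Q :: "real^'n^'n"
    have "(norm (Q + J))\<^sup>2 \<le> 2 * (norm Q)\<^sup>2 + 2 * b" unfolding b_def by (rule norm_add_sq_le)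
    then have "u\<^sup>2 * (norm (Q + J))\<^sup>2 \<le> u\<^sup>2 * (2 * (norm Q)\<^sup>2 + 2 * b)" by (intro mult_left_mono) auto
    also have "\<dots> \<le> (2 * u ^ 4 + norm Q ^ 4) + b\<^sup>2"
      using zero_le_power2[of "u\<^sup>2 - (norm Q)\<^sup>2"] zero_le_power2[of "u\<^sup>2 - b"]
      by (simp add: power2_eq_square power4_eq_xxxx algebra_simps)
    also have "\<dots> \<le> (2 + b\<^sup>2) * (1 + u ^ 4 + norm Q ^ 4)"
    proof -
      have "0 \<le> b\<^sup>2 * (u ^ 4 + norm Q ^ 4)" "0 \<le> norm Q ^ 4" by auto
      then show ?thesis by (simp add: algebra_simps)
    qed
    finally have "q ^ 4 * (u\<^sup>2 * (norm (Q + J))\<^sup>2) \<le> q ^ 4 * ((2 + b\<^sup>2) * (1 + u ^ 4 + norm Q ^ 4))"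
      by (intro mult_left_mono) auto
    moreover have "(norm (coupling q u Q))\<^sup>2 = q ^ 4 * (u\<^sup>2 * (norm (Q + J))\<^sup>2)"
      by (simp add: coupling_def J_def power_mult_distrib flip: power_mult)
    ultimately show "(norm (coupling q u Q))\<^sup>2 \<le> q ^ 4 * (2 + b\<^sup>2) * (1 + u ^ 4 + norm Q ^ 4)"
      by (simp add: mult.assoc)
  qed
qed

lemma continuous_on_matrix_entry: "continuous_on UNIV (\<lambda>Q :: real^'n::finite^'n. Q $ i $ j)"
  by (rule linear_continuous_on[OF bounded_linear_compose[OF bounded_linear_vec_nth bounded_linear_vec_nth]])

lemma continuous_on_bulk_density:
  "continuous_on UNIV (\<lambda>z :: real \<times> (real^'n::finite^'n). bulk_density a1 a2 a3 l (fst z) (snd z))"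
proof -
  have e: "continuous_on UNIV (\<lambda>z :: real \<times> (real^'n^'n). snd z $ i $ j)" for i j
    by (rule continuous_on_compose2[OF continuous_on_matrix_entry[of i j]]) (auto intro: continuous_intros)
  have "continuous_on UNIV (\<lambda>z :: real \<times> (real^'n^'n). trace (snd z ** snd z))"
    "continuous_on UNIV (\<lambda>z :: real \<times> (real^'n^'n). trace (snd z ** snd z ** snd z))"
    by (auto simp: trace_def matrix_matrix_mult_def intro!: continuous_intros e)
  then show ?thesis
    unfolding bulk_density_def nematic_density_def smectic_bulk_def
    by (cases "CARD('n) = 2") (auto intro!: continuous_intros)
qed

lemma continuous_on_coupling:
  "continuous_on UNIV (\<lambda>z :: real \<times> (real^'n::finite^'n). coupling q (fst z) (snd z))"
  unfolding coupling_def by (intro continuous_intros)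

lemma measurable_of_continuous_pair:
  assumes "continuous_on UNIV (\<lambda>z :: real \<times> (real^'n::finite^'n). f (fst z) (snd z))"
    and "u \<in> borel_measurable M" "Q \<in> borel_measurable M"
  shows "(\<lambda>x. f (u x) (Q x)) \<in> borel_measurable M"
proof -
  have "(\<lambda>x. (u x, Q x)) \<in> borel_measurable M" using assms(2,3) by (rule borel_measurable_Pair)
  from measurable_compose[OF this borel_measurable_continuous_onI[OF assms(1)]] show ?thesis by simp
qed

lemma tendsto_of_continuous_pair:
  assumes "continuous_on UNIV (\<lambda>z :: real \<times> (real^'n::finite^'n). f (fst z) (snd z))"
    and "(\<lambda>k. u k) \<longlonglongrightarrow> u'" "(\<lambda>k. Q k) \<longlonglongrightarrow> Q'"
  shows "(\<lambda>k. f (u k) (Q k)) \<longlonglongrightarrow> f u' Q'"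
  using continuous_on_tendsto_compose[OF assms(1) tendsto_Pair[OF assms(2,3)]] by simp

text \<open>All three terms are bounded below, so none can cancel another: each is dominated by the
  absolute value of the sum plus a constant. This justifies splitting the integral of the
  density.\<close>

lemma integrable_three_terms:
  fixes W V Z :: "'a \<Rightarrow> real"
  assumes fin: "emeasure M (space M) < \<infinity>"
    and m[measurable]: "W \<in> borel_measurable M" "V \<in> borel_measurable M" "Z \<in> borel_measurable M"
    and lo: "\<And>x. x \<in> space M \<Longrightarrow> - C \<le> W x" "\<And>x. x \<in> space M \<Longrightarrow> 0 \<le> V x" "\<And>x. x \<in> space M \<Longrightarrow> 0 \<le> Z x"
    and pos: "0 < B" "0 < K"
    and int: "integrable M (\<lambda>x. W x + B * V x + K * Z x)"
  shows "integrable M W" "integrable M V" "integrable M Z"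
proof -
  let ?F = "\<lambda>x. W x + B * V x + K * Z x"
  interpret finite_measure M using fin by (intro finite_measureI) auto
  have c: "integrable M (\<lambda>x. \<bar>?F x\<bar> + \<bar>C\<bar>)" using int by auto
  have bd: "\<bar>W x\<bar> \<le> \<bar>?F x\<bar> + \<bar>C\<bar>" "B * V x \<le> \<bar>?F x\<bar> + \<bar>C\<bar>" "K * Z x \<le> \<bar>?F x\<bar> + \<bar>C\<bar>" if "x \<in> space M" for x
  proof -
    have "0 \<le> B * V x" "0 \<le> K * Z x" using lo that pos by auto
    with lo(1)[OF that] show "\<bar>W x\<bar> \<le> \<bar>?F x\<bar> + \<bar>C\<bar>" "B * V x \<le> \<bar>?F x\<bar> + \<bar>C\<bar>" "K * Z x \<le> \<bar>?F x\<bar> + \<bar>C\<bar>"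
      by linarith+
  qed
  show "integrable M W"
    by (rule Bochner_Integration.integrable_bound[OF c]) (auto intro!: AE_I2 dest: bd(1))
  have "integrable M (\<lambda>x. B * V x)"
    using lo(2) pos by (intro Bochner_Integration.integrable_bound[OF c]) (auto intro!: AE_I2 simp: abs_mult dest: bd(2))
  then show "integrable M V" using pos by simp
  have "integrable M (\<lambda>x. K * Z x)"
    using lo(3) pos by (intro Bochner_Integration.integrable_bound[OF c]) (auto intro!: AE_I2 simp: abs_mult dest: bd(3))
  then show "integrable M Z" using pos by simp
qed

section \<open>Coercivity\<close>

locale smectic =
  fixes \<Omega> :: "(real^'n::finite) set" and a1 a2 a3 B K l q :: real
    and u_b :: "real^'n \<Rightarrow> real" and Q_b :: "real^'n \<Rightarrow> real^'n^'n"
  assumes open_dom: "open \<Omega>" and dom_nonempty: "\<Omega> \<noteq> {}" and bounded_dom: "bounded \<Omega>" and convex_dom: "convex \<Omega>"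
    and pos: "0 < a3" "0 < B" "0 < K" "0 < l"
    and bdry: "u_b \<in> L2 (surface_measure \<Omega>)" "Q_b \<in> L2 (surface_measure \<Omega>)"
begin

abbreviation "M \<equiv> lebesgue_on \<Omega>"
abbreviation "W u Q \<equiv> \<lambda>x. bulk_density a1 a2 a3 l (u x) (Q x :: real^'n^'n)"
abbreviation "V u Q \<equiv> \<lambda>x. (norm (weak_hessian \<Omega> u x + coupling q (u x) (Q x)))\<^sup>2"
abbreviation "Z Q \<equiv> \<lambda>x. \<Sum>i\<in>UNIV. (norm (weak_partial \<Omega> i Q x :: real^'n^'n))\<^sup>2"
abbreviation "edens u Q \<equiv> \<lambda>x. W u Q x + B * V u Q x + K / 2 * Z Q x"
abbreviation "energy \<equiv> smectic_energy \<Omega> a1 a2 a3 B K l q"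
abbreviation "adm \<equiv> admissible \<Omega> u_b Q_b"

text \<open>For other admissible pairs the value of the energy is the default \<open>0\<close> and
  carries no information about the functions.\<close>

definition finite_energy :: "((real^'n \<Rightarrow> real) \<times> (real^'n \<Rightarrow> real^'n^'n)) set" where
  "finite_energy = {(u, Q) \<in> adm. integrable M (edens u Q)}"

lemma dom_lmeasurable: "\<Omega> \<in> lmeasurable"
  using open_dom bounded_dom by (simp add: lmeasurable_open)

lemma finite_M: "emeasure M (space M) < \<infinity>"
  by (rule emeasure_lebesgue_on_finite[OF dom_lmeasurable])

lemma space_M: "space M = \<Omega>"
  by simp

definition vol :: real where "vol = measure M (space M)"

lemma integral_const_M: "integrable M (\<lambda>_. c :: real)" "(\<integral>x. c \<partial>M) = c * vol"
proof -
  interpret finite_measure M using finite_M by (intro finite_measureI) simp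
  show "integrable M (\<lambda>_. c :: real)" "(\<integral>x. c \<partial>M) = c * vol" by (simp_all add: vol_def)
qed

lemma energy_eq: "energy u Q = (\<integral>x. edens u Q x \<partial>M)"
  unfolding smectic_energy_def
  by (intro Bochner_Integration.integral_cong)
     (auto simp: bulk_density_def nematic_density_def coupling_def)

lemma energy_nonintegrable: "\<not> integrable M (edens u Q) \<Longrightarrow> energy u Q = 0"
  unfolding energy_eq by (rule not_integrable_integral_eq)

lemma adm_measurable:
  assumes "(u, Q) \<in> adm"
  shows "u \<in> borel_measurable M" "Q \<in> borel_measurable M" "W u Q \<in> borel_measurable M"
    "(\<lambda>x. coupling q (u x) (Q x)) \<in> borel_measurable M"
    "weak_hessian \<Omega> u \<in> borel_measurable M" "weak_partial \<Omega> i Q \<in> borel_measurable M"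
    "V u Q \<in> borel_measurable M" "Z Q \<in> borel_measurable M"
proof -
  note L = admissible_L2[OF assms, THEN L2_measurable]
  show u[measurable]: "u \<in> borel_measurable M" and Q[measurable]: "Q \<in> borel_measurable M" by (rule L)+
  show "W u Q \<in> borel_measurable M"
    by (rule measurable_of_continuous_pair[OF continuous_on_bulk_density u Q])
  show c[measurable]: "(\<lambda>x. coupling q (u x) (Q x)) \<in> borel_measurable M"
    by (rule measurable_of_continuous_pair[OF continuous_on_coupling u Q])
  show h[measurable]: "weak_hessian \<Omega> u \<in> borel_measurable M" by (rule L)
  have p[measurable]: "weak_partial \<Omega> i Q \<in> borel_measurable M" for i by (rule L)
  show "weak_partial \<Omega> i Q \<in> borel_measurable M" by (rule p)
  show "V u Q \<in> borel_measurable M" "Z Q \<in> borel_measurable M" by measurable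
qed

lemma adm_S0: "(u, Q) \<in> adm \<Longrightarrow> x \<in> \<Omega> \<Longrightarrow> Q x \<in> S0"
  by (auto simp: admissible_def H1_S0_def)

lemma bulk_lower:
  obtains c C where "0 < c" "0 \<le> C" 
    "\<forall>u. \<forall>Q \<in> (S0 :: (real^'n^'n) set). c * (u ^ 4 + norm Q ^ 4) - C \<le> bulk_density a1 a2 a3 l u Q"
proof -
  from bulk_density_lower_bound[OF pos(1,4)]
  obtain c C where cC: "0 < c" "0 \<le> C"
    "\<forall>u. \<forall>Q \<in> (S0 :: (real^'n^'n) set). c * (u ^ 4 + norm Q ^ 4) - C \<le> bulk_density a1 a2 a3 l u Q"
    by blast
  show thesis by (rule that[OF cC])
qed

lemma finite_energy_integrable:
  assumes "(u, Q) \<in> finite_energy"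
  shows "(u, Q) \<in> adm" "integrable M (W u Q)" "integrable M (V u Q)" "integrable M (Z Q)"
    "energy u Q = (\<integral>x. W u Q x \<partial>M) + B * (\<integral>x. V u Q x \<partial>M) + K / 2 * (\<integral>x. Z Q x \<partial>M)"
proof -
  show A: "(u, Q) \<in> adm" using assms by (simp add: finite_energy_def)
  have i: "integrable M (edens u Q)" using assms by (simp add: finite_energy_def)
  obtain c C where cC: "0 < c" "0 \<le> C" 
    "\<forall>u. \<forall>Q \<in> (S0 :: (real^'n^'n) set). c * (u ^ 4 + norm Q ^ 4) - C \<le> bulk_density a1 a2 a3 l u Q"
    by (rule bulk_lower)
  have lo: "- C \<le> W u Q x" if "x \<in> space M" for x
  proof -
    have "0 \<le> c * ((u x) ^ 4 + norm (Q x) ^ 4)" using cC(1) by simp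
    with bspec[OF spec[OF cC(3)] adm_S0[OF A, of x], of "u x"] that show ?thesis by (simp add: space_M)
  qed
  have K2: "0 < K / 2" using pos by simp
  note m = adm_measurable[OF A]
  have Z0: "0 \<le> Z Q x" for x by (simp add: sum_nonneg)
  show I: "integrable M (W u Q)" "integrable M (V u Q)" "integrable M (Z Q)"
    by (rule integrable_three_terms[OF finite_M m(3) m(7) m(8) lo _ Z0 pos(2) K2 i]; simp)+
  have "(\<integral>x. edens u Q x \<partial>M) = (\<integral>x. W u Q x + B * V u Q x \<partial>M) + (\<integral>x. K / 2 * Z Q x \<partial>M)"
    by (rule Bochner_Integration.integral_add)
       (intro Bochner_Integration.integrable_add integrable_mult_right I)+
  also have "(\<integral>x. W u Q x + B * V u Q x \<partial>M) = (\<integral>x. W u Q x \<partial>M) + (\<integral>x. B * V u Q x \<partial>M)"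
    by (rule Bochner_Integration.integral_add) (intro integrable_mult_right I)+
  finally show "energy u Q = (\<integral>x. W u Q x \<partial>M) + B * (\<integral>x. V u Q x \<partial>M) + K / 2 * (\<integral>x. Z Q x \<partial>M)"
    by (simp only: energy_eq integral_mult_right_zero)
qed

text \<open>Once the lower bound of the bulk part is compensated by a constant, all parts are
  nonnegative, so each is at most the total divided by its coefficient. A single \<open>R\<close>,
  the sum of all these bounds, serves every part.\<close>

lemma energy_parts_bounded:
  "\<exists>R\<ge>0. \<forall>(u, Q) \<in> finite_energy. energy u Q \<le> e \<longrightarrow>
     - R \<le> (\<integral>x. W u Q x \<partial>M) \<and> (\<integral>x. W u Q x \<partial>M) \<le> R \<and>
     (\<integral>x. V u Q x \<partial>M) \<le> R \<and> (\<integral>x. Z Q x \<partial>M) \<le> R \<and>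
     integrable M (\<lambda>x. 1 + (u x) ^ 4 + norm (Q x) ^ 4) \<and> (\<integral>x. 1 + (u x) ^ 4 + norm (Q x) ^ 4 \<partial>M) \<le> R"
proof -
  obtain c C where cC: "0 < c" "0 \<le> C" 
    "\<forall>u. \<forall>Q \<in> (S0 :: (real^'n^'n) set). c * (u ^ 4 + norm Q ^ 4) - C \<le> bulk_density a1 a2 a3 l u Q"
    by (rule bulk_lower)
  have v0: "0 \<le> vol" by (simp add: vol_def)
  \<comment> \<open>The energy level plus the compensating constant \<open>C\<close> integrated over
    the domain.\<close>
  define E where "E = \<bar>e\<bar> + C * vol"
  have E0: "0 \<le> E" using cC v0 by (simp add: E_def)
  define R where "R = E + E / B + E / (K / 2) + (vol + E / c)"
  have parts: "0 \<le> E / B" "0 \<le> E / (K / 2)" "0 \<le> E / c" using E0 pos cC by auto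
  show ?thesis
  proof (intro exI[of _ R] conjI)
    show "0 \<le> R" unfolding R_def using E0 parts v0 by linarith
    show "\<forall>(u, Q) \<in> finite_energy. energy u Q \<le> e \<longrightarrow>
     - R \<le> (\<integral>x. W u Q x \<partial>M) \<and> (\<integral>x. W u Q x \<partial>M) \<le> R \<and>
     (\<integral>x. V u Q x \<partial>M) \<le> R \<and> (\<integral>x. Z Q x \<partial>M) \<le> R \<and>
     integrable M (\<lambda>x. 1 + (u x) ^ 4 + norm (Q x) ^ 4) \<and> (\<integral>x. 1 + (u x) ^ 4 + norm (Q x) ^ 4 \<partial>M) \<le> R"
    proof (clarify)
      fix u Q assume F: "(u, Q) \<in> finite_energy" and le: "energy u Q \<le> e"
      note I = finite_energy_integrable[OF F]
      note m = adm_measurable[OF I(1)]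
      note [measurable] = m(1,2)
      let ?X = "\<lambda>x. (u x) ^ 4 + norm (Q x) ^ 4"
      have low: "c * ?X x - C \<le> W u Q x" if "x \<in> space M" for x
        using bspec[OF spec[OF cC(3)] adm_S0[OF I(1), of x], of "u x"] that by (simp add: space_M)
      have X: "integrable M ?X"
      proof (rule Bochner_Integration.integrable_bound)
        show "integrable M (\<lambda>x. (W u Q x + C) / c)"
          using I(2) integral_const_M(1)[of C] by (intro integrable_divide_zero Bochner_Integration.integrable_add) auto
        show "AE x in M. norm (?X x) \<le> norm ((W u Q x + C) / c)"
        proof (rule AE_I2)
          fix x assume "x \<in> space M"
          then have "?X x \<le> (W u Q x + C) / c" using low[of x] cC(1) by (simp add: field_simps)
          then have "?X x \<le> norm ((W u Q x + C) / c)" unfolding real_norm_def by (rule order_trans[OF _ abs_ge_self])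
          then show "norm (?X x) \<le> norm ((W u Q x + C) / c)" by simp
        qed
      qed measurable
      have lowi: "c * (\<integral>x. ?X x \<partial>M) - C * vol \<le> (\<integral>x. W u Q x \<partial>M)"
      proof -
        have "(\<integral>x. c * ?X x - C \<partial>M) \<le> (\<integral>x. W u Q x \<partial>M)"
          by (rule integral_mono[OF _ I(2) low]) (use X integral_const_M(1)[of C] in auto)
        also have "(\<integral>x. c * ?X x - C \<partial>M) = c * (\<integral>x. ?X x \<partial>M) - C * vol"
          using X integral_const_M[of C] by (subst Bochner_Integration.integral_diff) auto
        finally show ?thesis .
      qed
      have X0: "0 \<le> (\<integral>x. ?X x \<partial>M)" by (intro Bochner_Integration.integral_nonneg) auto
      have V0: "0 \<le> (\<integral>x. V u Q x \<partial>M)" by (intro Bochner_Integration.integral_nonneg) auto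
      have Z0: "0 \<le> (\<integral>x. Z Q x \<partial>M)" by (intro Bochner_Integration.integral_nonneg) (auto intro: sum_nonneg)
      have cX: "0 \<le> c * (\<integral>x. ?X x \<partial>M)" "0 \<le> B * (\<integral>x. V u Q x \<partial>M)" "0 \<le> K / 2 * (\<integral>x. Z Q x \<partial>M)"
        using X0 V0 Z0 cC(1) pos by auto
      have le': "(\<integral>x. W u Q x \<partial>M) + B * (\<integral>x. V u Q x \<partial>M) + K / 2 * (\<integral>x. Z Q x \<partial>M) \<le> \<bar>e\<bar>"
        using le I(5) by linarith
      have b: "(\<integral>x. W u Q x \<partial>M) \<le> E" "- E \<le> (\<integral>x. W u Q x \<partial>M)" "B * (\<integral>x. V u Q x \<partial>M) \<le> E"
         "K / 2 * (\<integral>x. Z Q x \<partial>M) \<le> E" "c * (\<integral>x. ?X x \<partial>M) \<le> E"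
        using le' lowi cX cC(2) v0 mult_nonneg_nonneg[OF cC(2) v0] unfolding E_def by linarith+
      have b': "(\<integral>x. V u Q x \<partial>M) \<le> E / B" "(\<integral>x. Z Q x \<partial>M) \<le> E / (K / 2)" "(\<integral>x. ?X x \<partial>M) \<le> E / c"
        using b(3-5) pos cC(1) by (simp_all add: pos_le_divide_eq mult.commute)
      have Y: "integrable M (\<lambda>x. 1 + (u x) ^ 4 + norm (Q x) ^ 4)" "(\<integral>x. 1 + (u x) ^ 4 + norm (Q x) ^ 4 \<partial>M) = vol + (\<integral>x. ?X x \<partial>M)"
        using Bochner_Integration.integrable_add[OF integral_const_M(1)[of 1] X]
          Bochner_Integration.integral_add[OF integral_const_M(1)[of 1] X] integral_const_M(2)[of 1]
        by (simp_all add: add.assoc)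
      show "- R \<le> (\<integral>x. W u Q x \<partial>M) \<and> (\<integral>x. W u Q x \<partial>M) \<le> R \<and>
         (\<integral>x. V u Q x \<partial>M) \<le> R \<and> (\<integral>x. Z Q x \<partial>M) \<le> R \<and>
         integrable M (\<lambda>x. 1 + (u x) ^ 4 + norm (Q x) ^ 4) \<and> (\<integral>x. 1 + (u x) ^ 4 + norm (Q x) ^ 4 \<partial>M) \<le> R"
        unfolding Y(2) R_def using Y(1) b(1,2) b' E0 parts v0 by (intro conjI) linarith+
    qed
  qed
qed

lemma sqnorm_le_integral:
  assumes "integrable M Y" "\<And>x. x \<in> space M \<Longrightarrow> (norm (f x))\<^sup>2 \<le> k * Y x" "(\<integral>x. Y x \<partial>M) \<le> R" "0 \<le> k"
    "\<And>x. 0 \<le> Y x"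
  shows "sqnorm M f \<le> ennreal (k * R)"
proof -
  have "sqnorm M f \<le> (\<integral>\<^sup>+x. ennreal (k * Y x) \<partial>M)"
    unfolding sqnorm_def using assms(2) by (intro nn_integral_mono ennreal_leI) auto
  also have "\<dots> = ennreal (\<integral>x. k * Y x \<partial>M)"
    using assms by (intro nn_integral_eq_integral) auto
  also have "\<dots> \<le> ennreal (k * R)" using assms by (intro ennreal_leI) (simp add: mult_left_mono)
  finally show ?thesis .
qed

lemma config_bounded:
  "\<exists>R. \<forall>(u, Q) \<in> finite_energy. energy u Q \<le> e \<longrightarrow>
     (\<lambda>x. coupling q (u x) (Q x)) \<in> L2 M \<and>
     sqnorm M (config_of \<Omega> u Q (\<lambda>x. coupling q (u x) (Q x))) \<le> ennreal R"
proof -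
  obtain R where R: "0 \<le> R" "\<And>u Q. (u, Q) \<in> finite_energy \<Longrightarrow> energy u Q \<le> e \<Longrightarrow>
     (\<integral>x. V u Q x \<partial>M) \<le> R \<and> (\<integral>x. Z Q x \<partial>M) \<le> R \<and>
     integrable M (\<lambda>x. 1 + (u x) ^ 4 + norm (Q x) ^ 4) \<and> (\<integral>x. 1 + (u x) ^ 4 + norm (Q x) ^ 4 \<partial>M) \<le> R"
    using energy_parts_bounded[of e] by fast
  obtain k where k: "0 \<le> k" "\<And>u (Q::real^'n^'n). (norm (coupling q u Q))\<^sup>2 \<le> k * (1 + u ^ 4 + norm Q ^ 4)"
    using coupling_norm_sq_le by blast
  obtain g where g: "0 \<le> g" "\<And>u p G j. u \<in> L2 M \<Longrightarrow> (\<And>i. p i \<in> L2 M) \<Longrightarrow> (\<And>i. G i \<in> L2 M) \<Longrightarrow>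
     (\<And>i. has_weak_partial \<Omega> i u (p i)) \<Longrightarrow> (\<And>i. has_weak_partial \<Omega> i (p j) (G i)) \<Longrightarrow>
     l2norm M (p j) \<le> g * (l2norm M u + (\<Sum>i\<in>UNIV. l2norm M (G i)))"
    using gradient_estimate[OF open_dom dom_nonempty bounded_dom convex_dom] by blast
  \<comment> \<open>\<open>H\<close> bounds the Hessian, written as Hessian plus coupling minus
    coupling; \<open>P\<close> is the resulting bound for one partial derivative of \<open>u\<close>
    from the interpolation inequality.\<close>
  define H where "H = 2 * R + 2 * (k * R)"
  define P where "P = g * (sqrt R + real CARD('n) * sqrt H)"
  have H0: "0 \<le> H" using R(1) k(1) by (simp add: H_def)
  have P0: "0 \<le> P" using R(1) g(1) H0 by (simp add: P_def)
  \<comment> \<open>The summands are nested like the components of a configuration: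
    \<open>u\<close>, \<open>Q\<close>, gradient of \<open>u\<close>, gradient of \<open>Q\<close>,
    Hessian, coupling.\<close>
  define T where "T = R + (R + (real CARD('n) * P\<^sup>2 + (R + (H + k * R))))"
  show ?thesis
  proof (intro exI[of _ T], clarify)
    fix u Q assume F: "(u, Q) \<in> finite_energy" and le: "energy u Q \<le> e"
    note I = finite_energy_integrable[OF F]
    note m = adm_measurable[OF I(1)]
    note A = admissible_L2[OF I(1)]
    note b = R(2)[OF F le]
    let ?h = "\<lambda>x. coupling q (u x) (Q x)"
    let ?Y = "\<lambda>x. 1 + (u x) ^ 4 + norm (Q x) ^ 4"
    have Y0: "0 \<le> ?Y x" for x by simp
    have sq: "t\<^sup>2 \<le> 1 + t ^ 4" for t :: real
    proof -
      have "t\<^sup>2 \<le> 1 + (t\<^sup>2)\<^sup>2"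
        using zero_le_power2[of "t\<^sup>2 - 1"] by (simp add: power2_diff) (smt (verit) zero_le_power2)
      then show ?thesis by (simp flip: power_mult)
    qed
    have su: "sqnorm M u \<le> ennreal R"
    proof -
      have "(norm (u x))\<^sup>2 \<le> 1 * ?Y x" for x using sq[of "u x"] by (simp add: add_increasing2)
      then show ?thesis using sqnorm_le_integral[of ?Y u 1 R] b Y0 by auto
    qed
    have sQ: "sqnorm M Q \<le> ennreal R"
    proof -
      have "(norm (Q x))\<^sup>2 \<le> 1 * ?Y x" for x
      proof -
        have "1 + norm (Q x) ^ 4 \<le> 1 * ?Y x" by simp
        with sq[of "norm (Q x)"] show ?thesis by (rule order_trans)
      qed
      then show ?thesis using sqnorm_le_integral[of ?Y Q 1 R] b Y0 by auto
    qed
    have sh: "sqnorm M ?h \<le> ennreal (k * R)"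
      using sqnorm_le_integral[of ?Y ?h k R] b Y0 k by auto
    have hL: "?h \<in> L2 M" using sh m(4) by (auto simp: L2_iff_sqnorm elim: order.strict_trans1)
    have sV: "sqnorm M (\<lambda>x. weak_hessian \<Omega> u x + ?h x) \<le> ennreal (1 * R)"
      using b I(3) by (intro sqnorm_le_integral[of "V u Q"]) auto
    have sH: "sqnorm M (weak_hessian \<Omega> u) \<le> ennreal H"
    proof -
      have "sqnorm M (weak_hessian \<Omega> u) = sqnorm M (\<lambda>x. (weak_hessian \<Omega> u x + ?h x) - ?h x)" by simp
      also have "\<dots> \<le> 2 * sqnorm M (\<lambda>x. weak_hessian \<Omega> u x + ?h x) + 2 * sqnorm M ?h"
        using m by (intro sqnorm_diff_le borel_measurable_add)
      also have "\<dots> \<le> 2 * ennreal (1 * R) + 2 * ennreal (k * R)" by (intro add_mono mult_left_mono sV sh) auto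
      also have "\<dots> = ennreal H" using R(1) k(1) by (simp add: H_def ennreal_plus ennreal_mult)
      finally show ?thesis .
    qed
    have l2: "l2norm M f \<le> sqrt r" if "f \<in> L2 M" "sqnorm M f \<le> ennreal r" "0 \<le> r" for f r
    proof -
      have "ennreal (\<integral>x. (norm (f x))\<^sup>2 \<partial>M) \<le> ennreal r"
        using that(2) unfolding sqnorm_eq_integral[OF that(1)] .
      then have "(\<integral>x. (f x)\<^sup>2 \<partial>M) \<le> r" by (subst (asm) ennreal_le_iff[OF that(3)]) simp
      then show ?thesis unfolding l2norm_def by (rule real_sqrt_le_mono)
    qed
    have hess: "l2norm M (weak_partial \<Omega> i (weak_partial \<Omega> j u)) \<le> sqrt H" for i j
    proof (rule l2[OF A(5) _ H0])
      have "sqnorm M (weak_partial \<Omega> i (weak_partial \<Omega> j u)) \<le> sqnorm M (weak_hessian \<Omega> u)"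
      proof (rule sqnorm_mono)
        fix x
        have "norm (weak_hessian \<Omega> u x $ i $ j) \<le> norm (weak_hessian \<Omega> u x)"
          by (rule order_trans[OF vec_nth_norm_le vec_nth_norm_le])
        then show "norm (weak_partial \<Omega> i (weak_partial \<Omega> j u) x) \<le> norm (weak_hessian \<Omega> u x)"
          by (simp add: weak_hessian_def)
      qed
      then show "sqnorm M (weak_partial \<Omega> i (weak_partial \<Omega> j u)) \<le> ennreal H" using sH by simp
    qed
    have grad: "sqnorm M (weak_partial \<Omega> j u) \<le> ennreal (P\<^sup>2)" for j
    proof -
      have "l2norm M (weak_partial \<Omega> j u) \<le> g * (l2norm M u + (\<Sum>i\<in>UNIV. l2norm M (weak_partial \<Omega> i (weak_partial \<Omega> j u))))"
        by (rule g(2)[of u "\<lambda>i. weak_partial \<Omega> i u" "\<lambda>i. weak_partial \<Omega> i (weak_partial \<Omega> j u)" j])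
           (rule A(1) A(3) A(5) admissible_weak_partial[OF I(1)])+
      also have "\<dots> \<le> g * (sqrt R + (\<Sum>i\<in>(UNIV::'n set). sqrt H))"
        by (intro mult_left_mono add_mono sum_mono hess l2[OF A(1) su R(1)] g(1))
      also have "\<dots> = P" by (simp add: P_def)
      finally have "(l2norm M (weak_partial \<Omega> j u))\<^sup>2 \<le> P\<^sup>2"
        by (intro power_mono l2norm_nonneg)
      then show ?thesis
        by (simp add: sqnorm_eq_integral[OF A(3)] l2norm_def ennreal_leI)
    qed
    have sp: "sqnorm M (\<lambda>x. \<chi> i. weak_partial \<Omega> i u x) \<le> ennreal (real CARD('n) * P\<^sup>2)"
    proof -
      have "sqnorm M (\<lambda>x. \<chi> i. weak_partial \<Omega> i u x) = (\<Sum>i\<in>UNIV. sqnorm M (weak_partial \<Omega> i u))"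
        using A(3)[THEN L2_measurable] by (subst sqnorm_vec) simp_all
      also have "\<dots> \<le> (\<Sum>i\<in>(UNIV::'n set). ennreal (P\<^sup>2))" by (intro sum_mono grad)
      also have "\<dots> = ennreal (real CARD('n) * P\<^sup>2)" by (simp add: ennreal_mult ennreal_of_nat_eq_real_of_nat)
      finally show ?thesis .
    qed
    have vm: "(\<lambda>x. \<chi> i. weak_partial \<Omega> i u x) \<in> borel_measurable M" "(\<lambda>x. \<chi> i. weak_partial \<Omega> i Q x) \<in> borel_measurable M"
      by (rule borel_measurable_vecI, simp add: A(3)[THEN L2_measurable] m(6))+
    have sZ: "sqnorm M (\<lambda>x. \<chi> i. weak_partial \<Omega> i Q x) \<le> ennreal (1 * R)"
      using b I(4) by (intro sqnorm_le_integral[of "Z Q"]) (auto simp: norm_vec_def L2_set_def sum_nonneg)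
    have "sqnorm M (config_of \<Omega> u Q ?h) \<le> ennreal R + (ennreal R + (ennreal (real CARD('n) * P\<^sup>2) + (ennreal (1 * R) + (ennreal H + ennreal (k * R)))))"
      unfolding config_of_def[abs_def]
      using su sQ sp sZ sH sh vm m
      by (simp only: sqnorm_Pair borel_measurable_Pair add_mono)
    also have "\<dots> = ennreal T"
      unfolding T_def
      by (simp only: ennreal_plus add_nonneg_nonneg mult_nonneg_nonneg zero_le_power2 of_nat_0_le_iff mult_1 R(1) k(1) H0)
    finally show "?h \<in> L2 M \<and> sqnorm M (config_of \<Omega> u Q ?h) \<le> ennreal T" using hL by blast
  qed
qed

end

section \<open>Existence of minimisers\<close>

text \<open>Balls are convex: if a tail of \<open>X\<close> lies in a ball around the limit, so does
  its convex hull.\<close>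

lemma convex_hull_tail_tendsto:
  fixes X Y :: "nat \<Rightarrow> 'a::real_normed_vector"
  assumes X: "X \<longlonglongrightarrow> l" and Y: "\<And>n. Y n \<in> convex hull (X ` {n..})"
  shows "Y \<longlonglongrightarrow> l"
proof (rule LIMSEQ_I)
  fix r :: real assume r: "0 < r"
  then obtain N where N: "\<And>n. n \<ge> N \<Longrightarrow> norm (X n - l) < r" using LIMSEQ_D[OF X r] by blast
  have "Y n \<in> ball l r" if "n \<ge> N" for n
  proof -
    have "convex hull (X ` {n..}) \<subseteq> ball l r"
    proof (rule hull_minimal)
      show "X ` {n..} \<subseteq> ball l r"
      proof (rule image_subsetI)
        fix k assume "k \<in> {n..}"
        with N[of k] that show "X k \<in> ball l r" by (simp add: dist_norm norm_minus_commute)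
      qed
    qed (rule convex_ball)
    with Y show ?thesis by blast
  qed
  then show "\<exists>N. \<forall>n\<ge>N. norm (Y n - l) < r"
    by (intro exI[of _ N]) (auto simp: dist_norm norm_minus_commute)
qed

lemma convex_hull_midpoint:
  assumes "x \<in> convex hull S" "y \<in> convex hull S"
  shows "(1/2) *\<^sub>R (x + y) \<in> convex hull (S :: 'a::real_vector set)"
  using convexD[OF convex_convex_hull assms, of "1/2" "1/2"] by (simp add: scaleR_add_right)

lemma S0_midpoint: "P \<in> S0 \<Longrightarrow> Q \<in> S0 \<Longrightarrow> (1/2) *\<^sub>R (P + Q) \<in> (S0 :: (real^'n::finite^'n) set)"
  by (auto simp: S0_def trace_def transpose_def vec_eq_iff sum.distrib simp flip: sum_divide_distrib)

lemma zero_S0: "(0 :: real^'n::finite^'n) \<in> S0"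
  by (simp add: S0_def trace_def transpose_def vec_eq_iff)

lemma closed_S0: "closed (S0 :: (real^'n::finite^'n) set)"
proof -
  have "S0 = (\<Inter>i. \<Inter>j. {Q :: real^'n^'n. Q $ i $ j = Q $ j $ i}) \<inter> {Q. (\<Sum>i\<in>UNIV. Q $ i $ i) = 0}"
    by (auto simp: S0_def trace_def transpose_def vec_eq_iff)
  also have "closed \<dots>"
    by (intro closed_Int closed_INT ballI closed_Collect_eq continuous_on_sum continuous_on_matrix_entry continuous_on_const)
  finally show ?thesis .
qed

context smectic
begin

text \<open>
  The sets \<open>C n\<close> below are convex and decreasing. Membership controls the convex parts of the energy
  by those of the tail of the sequence, and the convex hull condition makes every choice of elements
  of \<open>C n\<close> converge to the pointwise limit of the sequence.
\<close>

lemma energy_lsc_configs: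
  fixes u :: "nat \<Rightarrow> real^'n \<Rightarrow> real" and Q :: "nat \<Rightarrow> real^'n \<Rightarrow> real^'n^'n"
  assumes F: "\<And>k. (u k, Q k) \<in> finite_energy"
    and hL: "\<And>k. (\<lambda>x. coupling q (u k x) (Q k x)) \<in> L2 M"
    and R: "\<And>k. sqnorm M (config_of \<Omega> (u k) (Q k) (\<lambda>x. coupling q (u k x) (Q k x))) \<le> ennreal R"
    and AE: "AE x in M. convergent (\<lambda>k. u k x)" "AE x in M. convergent (\<lambda>k. Q k x)"
  shows "\<exists>u' Q'. (u', Q') \<in> adm \<and>
    (AE x in M. (\<lambda>k. u k x) \<longlonglongrightarrow> u' x) \<and> (AE x in M. (\<lambda>k. Q k x) \<longlonglongrightarrow> Q' x) \<and>
    (\<forall>c n. (\<forall>k\<ge>n. (\<integral>x. V (u k) (Q k) x \<partial>M) \<le> c) \<longrightarrow> sqnorm M (\<lambda>x. weak_hessian \<Omega> u' x + coupling q (u' x) (Q' x)) \<le> ennreal c) \<and>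
    (\<forall>c n. (\<forall>k\<ge>n. (\<integral>x. Z (Q k) x \<partial>M) \<le> c) \<longrightarrow> sqnorm M (\<lambda>x. \<chi> i. weak_partial \<Omega> i Q' x) \<le> ennreal c)"
proof -
  define h where "h k = (\<lambda>x. coupling q (u k x) (Q k x))" for k
  define w where "w k = config_of \<Omega> (u k) (Q k) (h k)" for k
  \<comment> \<open>One hull of triples instead of three separate hulls, so that at every point the
    same weights act on \<open>u\<close>, \<open>Q\<close> and the coupling.\<close>
  define tail where "tail n x = convex hull ((\<lambda>k. (u k x, Q k x, h k x)) ` {n..})" for n x
  note I = finite_energy_integrable[OF F]
  note lc = linear_contraction_config[where 'n='n]
  have w: "w k \<in> weak_config \<Omega> u_b Q_b" for k
    unfolding w_def h_def by (rule config_of_weak_config[OF I(1) hL])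
  have wL: "w k \<in> L2 M" for k using w[of k] by (simp add: weak_config_def)
  \<comment> \<open>The bounds range over all \<open>c\<close> and all starting indices
    \<open>m\<close> up to \<open>n\<close>. So the sets decrease with \<open>n\<close>, each
    condition is preserved by midpoints, and no limit of the integrals has to be fixed
    beforehand.\<close>
  define C where "C n = {f \<in> weak_config \<Omega> u_b Q_b.
      (\<forall>x\<in>\<Omega>. cQ (f x) \<in> S0) \<and> (\<forall>x\<in>\<Omega>. (cu (f x), cQ (f x), ch (f x)) \<in> tail n x) \<and>
      (\<forall>c. \<forall>m\<le>n. (\<forall>k\<ge>m. (\<integral>x. V (u k) (Q k) x \<partial>M) \<le> c) \<longrightarrow> sqnorm M (\<lambda>x. cH (f x) + ch (f x)) \<le> ennreal c) \<and>
      (\<forall>c. \<forall>m\<le>n. (\<forall>k\<ge>m. (\<integral>x. Z (Q k) x \<partial>M) \<le> c) \<longrightarrow> sqnorm M (\<lambda>x. cP (f x)) \<le> ennreal c)}" for n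
  have CL: "f \<in> L2 M" if "f \<in> C n" for f n using that by (auto simp: C_def weak_config_def)
  have CV: "sqnorm M (\<lambda>x. cH (f x) + ch (f x)) \<le> ennreal c"
    if "f \<in> C n" "m \<le> n" "\<forall>k\<ge>m. (\<integral>x. V (u k) (Q k) x \<partial>M) \<le> c" for f n m c
    using that unfolding C_def by blast
  have CZ: "sqnorm M (\<lambda>x. cP (f x)) \<le> ennreal c"
    if "f \<in> C n" "m \<le> n" "\<forall>k\<ge>m. (\<integral>x. Z (Q k) x \<partial>M) \<le> c" for f n m c
    using that unfolding C_def by blast
  note comp = linear_contraction_L2[OF _ CL, THEN L2_measurable]
  \<comment> \<open>The configurations of the sequence itself show that every \<open>C n\<close>
    contains an element of bounded norm.\<close>
  have wC: "w k \<in> C n" if "n \<le> k" for k n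
  proof -
    have 1: "cQ (w k x) \<in> S0" if "x \<in> \<Omega>" for x
      using adm_S0[OF I(1) that] by (simp add: w_def config_of_def)
    have 2: "(cu (w k x), cQ (w k x), ch (w k x)) \<in> tail n x" for x
      unfolding tail_def w_def config_of_def using \<open>n \<le> k\<close> by (auto intro!: hull_inc)
    have 3: "sqnorm M (\<lambda>x. cH (w k x) + ch (w k x)) \<le> ennreal c" if "(\<integral>x. V (u k) (Q k) x \<partial>M) \<le> c" for c
      using sqnorm_le_integral[of "V (u k) (Q k)" "\<lambda>x. cH (w k x) + ch (w k x)" 1 c] I(3)[of k] that
      by (simp add: w_def config_of_def h_def)
    have 4: "sqnorm M (\<lambda>x. cP (w k x)) \<le> ennreal c" if "(\<integral>x. Z (Q k) x \<partial>M) \<le> c" for c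
      using sqnorm_le_integral[of "Z (Q k)" "\<lambda>x. cP (w k x)" 1 c] I(4)[of k] that
      by (simp add: w_def config_of_def norm_vec_def L2_set_def sum_nonneg)
    show ?thesis
      unfolding C_def using w 1 2 3 4 \<open>n \<le> k\<close> by (auto intro: order_trans)
  qed
  have nested: "\<exists>y z. (\<forall>n. y n \<in> C n) \<and> z \<in> L2 M \<and> L2_converges M y z \<and>
           (AE x in M. (\<lambda>n. y n x) \<longlonglongrightarrow> z x) \<and>
           (\<forall>x. ((\<lambda>n. y n x) \<longlonglongrightarrow> z x) \<or> z x = 0) \<and>
           (\<forall>w. (\<forall>n. w \<in> C n) \<longrightarrow> sqnorm M z \<le> sqnorm M w)"
  proof (rule L2_nested_convex)
    show "C n \<subseteq> L2 M" for n using CL by blast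
    show "C (Suc n) \<subseteq> C n" for n
    proof -
      have "tail (Suc n) x \<subseteq> tail n x" for x
        unfolding tail_def by (intro hull_mono image_mono) auto
      moreover have "m \<le> Suc n" if "m \<le> n" for m using that by simp
      ultimately show ?thesis unfolding C_def by blast
    qed
    show "\<exists>f\<in>C n. sqnorm M f \<le> ennreal R" for n
      using wC[of n n] R[of n] by (auto simp: w_def h_def)
    fix n f g assume fg: "f \<in> C n" "g \<in> C n"
    let ?m = "\<lambda>x. (1/2) *\<^sub>R (f x + g x)"
    have 0: "?m \<in> weak_config \<Omega> u_b Q_b"
      using fg by (intro weak_config_midpoint[OF dom_lmeasurable bdry]) (auto simp: C_def)
    have 1: "cQ (?m x) \<in> S0" if "x \<in> \<Omega>" for x
      unfolding linear_contraction_midpoint[OF lc(2)] using fg that by (intro S0_midpoint) (auto simp: C_def)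
    have 2: "(cu (?m x), cQ (?m x), ch (?m x)) \<in> tail n x" if "x \<in> \<Omega>" for x
    proof -
      have "(1/2) *\<^sub>R ((cu (f x), cQ (f x), ch (f x)) + (cu (g x), cQ (g x), ch (g x))) \<in> tail n x"
        using fg that unfolding tail_def by (intro convex_hull_midpoint) (auto simp: C_def tail_def)
      then show ?thesis by simp
    qed
    have 3: "sqnorm M (\<lambda>x. cH (?m x) + ch (?m x)) \<le> ennreal c"
      if "sqnorm M (\<lambda>x. cH (f x) + ch (f x)) \<le> ennreal c" "sqnorm M (\<lambda>x. cH (g x) + ch (g x)) \<le> ennreal c" for c
    proof -
      have "(\<lambda>x. cH (?m x) + ch (?m x)) = (\<lambda>x. (1/2) *\<^sub>R ((cH (f x) + ch (f x)) + (cH (g x) + ch (g x))))"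
        by (simp add: scaleR_add_right algebra_simps)
      then show ?thesis
        using sqnorm_midpoint_le[OF borel_measurable_add[OF comp[OF lc(5) fg(1)] comp[OF lc(6) fg(1)]]
            borel_measurable_add[OF comp[OF lc(5) fg(2)] comp[OF lc(6) fg(2)]] that] by simp
    qed
    have 4: "sqnorm M (\<lambda>x. cP (?m x)) \<le> ennreal c"
      if "sqnorm M (\<lambda>x. cP (f x)) \<le> ennreal c" "sqnorm M (\<lambda>x. cP (g x)) \<le> ennreal c" for c
      unfolding linear_contraction_midpoint[OF lc(8)]
      by (rule sqnorm_midpoint_le[OF comp[OF lc(8) fg(1)] comp[OF lc(8) fg(2)] that])
    show "?m \<in> C n"
      unfolding C_def
    proof (rule CollectI, intro conjI ballI allI impI)
      fix c m assume "m \<le> n" "\<forall>k\<ge>m. (\<integral>x. V (u k) (Q k) x \<partial>M) \<le> c"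
      from CV[OF fg(1) this] CV[OF fg(2) this] show "sqnorm M (\<lambda>x. cH (?m x) + ch (?m x)) \<le> ennreal c" by (rule 3)
    next
      fix c m assume "m \<le> n" "\<forall>k\<ge>m. (\<integral>x. Z (Q k) x \<partial>M) \<le> c"
      from CZ[OF fg(1) this] CZ[OF fg(2) this] show "sqnorm M (\<lambda>x. cP (?m x)) \<le> ennreal c" by (rule 4)
    qed (fact 0, erule 1, erule 2)
  qed
  then obtain y z where y: "\<And>n. y n \<in> C n" and z: "z \<in> L2 M" "L2_converges M y z"
    and yzAE: "AE x in M. (\<lambda>n. y n x) \<longlonglongrightarrow> z x" and yz0: "\<And>x. ((\<lambda>n. y n x) \<longlonglongrightarrow> z x) \<or> z x = 0"
    by blast
  have zc: "z \<in> weak_config \<Omega> u_b Q_b"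
    using y by (intro weak_config_limit[OF dom_lmeasurable _ z]) (auto simp: C_def)
  \<comment> \<open>Here the description of \<open>z\<close> at every point is used: either it is a
    limit of elements of the closed set \<open>S0\<close>, or it is \<open>0\<close>.\<close>
  have zS0: "cQ (z x) \<in> S0" if "x \<in> \<Omega>" for x
    using yz0[of x]
  proof
    assume "(\<lambda>n. y n x) \<longlonglongrightarrow> z x"
    then have "(\<lambda>n. cQ (y n x)) \<longlonglongrightarrow> cQ (z x)" by (intro tendsto_intros)
    then show ?thesis
      by (rule closed_sequentially[OF closed_S0, rotated]) (use y that in \<open>auto simp: C_def\<close>)
  qed (simp add: zero_S0)
  define u' where "u' = (\<lambda>x. cu (z x))"
  define Q' where "Q' = (\<lambda>x. cQ (z x))"
  have adm: "(u', Q') \<in> adm" "AE x in M. weak_hessian \<Omega> u' x = cH (z x)"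
    "AE x in M. \<forall>i. weak_partial \<Omega> i Q' x = cP (z x) $ i"
    unfolding u'_def Q'_def
    by (rule weak_config_admissible[OF open_dom dom_lmeasurable bdry zc], erule zS0)+
  have lim: "AE x in M. (\<lambda>k. u k x) \<longlonglongrightarrow> u' x \<and> (\<lambda>k. Q k x) \<longlonglongrightarrow> Q' x \<and> ch (z x) = coupling q (u' x) (Q' x)"
  proof -
    have "AE x in M. x \<in> space M" by (rule AE_space)
    with AE yzAE show ?thesis
    proof eventually_elim
      case (elim x)
      then obtain a b where ab: "(\<lambda>k. u k x) \<longlonglongrightarrow> a" "(\<lambda>k. Q k x) \<longlonglongrightarrow> b" by (auto simp: convergent_def)
      have "(\<lambda>k. h k x) \<longlonglongrightarrow> coupling q a b"
        unfolding h_def by (rule tendsto_of_continuous_pair[OF continuous_on_coupling ab])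
      then have "(\<lambda>k. (u k x, Q k x, h k x)) \<longlonglongrightarrow> (a, b, coupling q a b)"
        by (intro tendsto_Pair ab)
      \<comment> \<open>The triples of \<open>y n\<close> lie in the hulls of tails of a convergent
        sequence, so they share its limit; comparison with the limit \<open>z\<close> identifies
        \<open>ch (z x)\<close> as the coupling.\<close>
      then have "(\<lambda>n. (cu (y n x), cQ (y n x), ch (y n x))) \<longlonglongrightarrow> (a, b, coupling q a b)"
        by (rule convex_hull_tail_tendsto) (use y elim(4) in \<open>auto simp: C_def tail_def\<close>)
      moreover have "(\<lambda>n. (cu (y n x), cQ (y n x), ch (y n x))) \<longlonglongrightarrow> (cu (z x), cQ (z x), ch (z x))"
        using elim(3) by (intro tendsto_intros)
      ultimately have "(a, b, coupling q a b) = (cu (z x), cQ (z x), ch (z x))"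
        by (rule LIMSEQ_unique)
      with ab show ?case by (auto simp: u'_def Q'_def)
    qed
  qed
  have yL: "y n \<in> L2 M" for n using CL[OF y] .
  have V': "sqnorm M (\<lambda>x. weak_hessian \<Omega> u' x + coupling q (u' x) (Q' x)) \<le> ennreal c"
    if c: "\<forall>k\<ge>n. (\<integral>x. V (u k) (Q k) x \<partial>M) \<le> c" for c n
  proof -
    \<comment> \<open>From index \<open>n\<close> on, membership of \<open>y m\<close> in
      \<open>C m\<close> includes the bound \<open>c\<close>, and the convergence is strong.\<close>
    have "sqnorm M (\<lambda>x. cH (z x) + ch (z x)) \<le> ennreal c"
    proof (rule L2_converges_sqnorm_le[where N=n])
      show "(\<lambda>x. cH (y m x) + ch (y m x)) \<in> borel_measurable M" for m
        by (intro borel_measurable_add comp[OF lc(5) y] comp[OF lc(6) y])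
      show "(\<lambda>x. cH (z x) + ch (z x)) \<in> borel_measurable M"
        by (intro borel_measurable_add linear_contraction_L2[OF lc(5) z(1), THEN L2_measurable]
            linear_contraction_L2[OF lc(6) z(1), THEN L2_measurable])
      have "(\<lambda>k. 2 * sqnorm M (\<lambda>x. cH (y k x) - cH (z x)) + 2 * sqnorm M (\<lambda>x. ch (y k x) - ch (z x))) \<longlonglongrightarrow> 2 * 0 + 2 * 0"
        using linear_contraction_L2_converges[OF lc(5) z(2)] linear_contraction_L2_converges[OF lc(6) z(2)]
        unfolding L2_converges_sqnorm by (intro tendsto_add ennreal_tendsto_cmult) auto
      moreover have "sqnorm M (\<lambda>x. cH (y k x) + ch (y k x) - (cH (z x) + ch (z x)))
          \<le> 2 * sqnorm M (\<lambda>x. cH (y k x) - cH (z x)) + 2 * sqnorm M (\<lambda>x. ch (y k x) - ch (z x))" for k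
        unfolding add_diff_add
        by (intro sqnorm_add borel_measurable_diff comp[OF lc(5) y] comp[OF lc(6) y] linear_contraction_L2[OF lc(5) z(1), THEN L2_measurable]
            linear_contraction_L2[OF lc(6) z(1), THEN L2_measurable])
      ultimately show "L2_converges M (\<lambda>m x. cH (y m x) + ch (y m x)) (\<lambda>x. cH (z x) + ch (z x))"
        unfolding L2_converges_sqnorm
        using tendsto_sandwich[OF _ _ tendsto_const[of 0],
           of "\<lambda>k. sqnorm M (\<lambda>x. cH (y k x) + ch (y k x) - (cH (z x) + ch (z x)))" sequentially
              "\<lambda>k. 2 * sqnorm M (\<lambda>x. cH (y k x) - cH (z x)) + 2 * sqnorm M (\<lambda>x. ch (y k x) - ch (z x))"]
        by simp
      show "sqnorm M (\<lambda>x. cH (y m x) + ch (y m x)) \<le> ennreal c" if "n \<le> m" for m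
        by (rule CV[OF y that c])
    qed
    moreover have "sqnorm M (\<lambda>x. weak_hessian \<Omega> u' x + coupling q (u' x) (Q' x)) = sqnorm M (\<lambda>x. cH (z x) + ch (z x))"
      by (rule sqnorm_cong_AE, use adm(2) lim in eventually_elim) simp
    ultimately show ?thesis by simp
  qed
  have Z': "sqnorm M (\<lambda>x. \<chi> i. weak_partial \<Omega> i Q' x) \<le> ennreal c"
    if c: "\<forall>k\<ge>n. (\<integral>x. Z (Q k) x \<partial>M) \<le> c" for c n
  proof -
    have "sqnorm M (\<lambda>x. cP (z x)) \<le> ennreal c"
    proof (rule L2_converges_sqnorm_le[where N=n])
      show "(\<lambda>x. cP (y m x)) \<in> borel_measurable M" for m by (rule comp[OF lc(8) y])
      show "(\<lambda>x. cP (z x)) \<in> borel_measurable M" by (rule linear_contraction_L2[OF lc(8) z(1), THEN L2_measurable])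
      show "L2_converges M (\<lambda>m x. cP (y m x)) (\<lambda>x. cP (z x))" by (rule linear_contraction_L2_converges[OF lc(8) z(2)])
      show "sqnorm M (\<lambda>x. cP (y m x)) \<le> ennreal c" if "n \<le> m" for m
        by (rule CZ[OF y that c])
    qed
    moreover have "sqnorm M (\<lambda>x. \<chi> i. weak_partial \<Omega> i Q' x) = sqnorm M (\<lambda>x. cP (z x))"
      by (rule sqnorm_cong_AE, use adm(3) in eventually_elim) simp
    ultimately show ?thesis by simp
  qed
  have "AE x in M. (\<lambda>k. u k x) \<longlonglongrightarrow> u' x" "AE x in M. (\<lambda>k. Q k x) \<longlonglongrightarrow> Q' x"
    using lim by (eventually_elim, simp)+
  then show ?thesis using adm(1) V' Z' by blast
qed

text \<open>Fatou's lemma for the nonconvex part, weak lower semicontinuity for the convex ones.\<close>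

lemma energy_lsc:
  fixes u :: "nat \<Rightarrow> real^'n \<Rightarrow> real" and Q :: "nat \<Rightarrow> real^'n \<Rightarrow> real^'n^'n"
  assumes F: "\<And>k. (u k, Q k) \<in> finite_energy"
    and hL: "\<And>k. (\<lambda>x. coupling q (u k x) (Q k x)) \<in> L2 M"
    and R: "\<And>k. sqnorm M (config_of \<Omega> (u k) (Q k) (\<lambda>x. coupling q (u k x) (Q k x))) \<le> ennreal R"
    and AE: "AE x in M. convergent (\<lambda>k. u k x)" "AE x in M. convergent (\<lambda>k. Q k x)"
    and lim: "(\<lambda>k. energy (u k) (Q k)) \<longlonglongrightarrow> e" "(\<lambda>k. \<integral>x. V (u k) (Q k) x \<partial>M) \<longlonglongrightarrow> \<alpha>" "(\<lambda>k. \<integral>x. Z (Q k) x \<partial>M) \<longlonglongrightarrow> \<beta>"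
  shows "\<exists>(u', Q') \<in> finite_energy. energy u' Q' \<le> e"
proof -
  note I = finite_energy_integrable[OF F]
  obtain u' Q' where A: "(u', Q') \<in> adm"
    and AE': "AE x in M. (\<lambda>k. u k x) \<longlonglongrightarrow> u' x" "AE x in M. (\<lambda>k. Q k x) \<longlonglongrightarrow> Q' x"
    and V': "\<And>c n. (\<forall>k\<ge>n. (\<integral>x. V (u k) (Q k) x \<partial>M) \<le> c) \<Longrightarrow> sqnorm M (\<lambda>x. weak_hessian \<Omega> u' x + coupling q (u' x) (Q' x)) \<le> ennreal c"
    and Z': "\<And>c n. (\<forall>k\<ge>n. (\<integral>x. Z (Q k) x \<partial>M) \<le> c) \<Longrightarrow> sqnorm M (\<lambda>x. \<chi> i. weak_partial \<Omega> i Q' x) \<le> ennreal c"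
    using energy_lsc_configs[OF F hL R AE] by blast
  note m = adm_measurable[OF A]
  \<comment> \<open>Limits are approached from above by \<open>\<epsilon>\<close> to obtain bounds
    valid for a whole tail, as \<open>V'\<close> and \<open>Z'\<close> require.\<close>
  have ev: "\<exists>n. \<forall>k\<ge>n. X k \<le> l + \<epsilon>" if "X \<longlonglongrightarrow> l" "0 < \<epsilon>" for X :: "nat \<Rightarrow> real" and l \<epsilon>
  proof -
    have "\<forall>\<^sub>F k in sequentially. X k < l + \<epsilon>" using that by (intro order_tendstoD(2)) auto
    then show ?thesis by (auto simp: eventually_sequentially intro: less_imp_le)
  qed
  have nn: "integrable M f \<and> (\<integral>x. f x \<partial>M) \<le> l"
    if f: "f \<in> borel_measurable M" "\<And>x. 0 \<le> f x" and le: "\<And>\<epsilon>. 0 < \<epsilon> \<Longrightarrow> (\<integral>\<^sup>+x. ennreal (f x) \<partial>M) \<le> ennreal (l + \<epsilon>)" "0 \<le> l" for f :: "real^'n \<Rightarrow> real" and l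
  proof -
    have i: "integrable M f"
      using f le(1)[of 1] by (intro integrableI_bounded) (auto elim: order.strict_trans1)
    then have "(\<integral>\<^sup>+x. ennreal (f x) \<partial>M) = ennreal (\<integral>x. f x \<partial>M)"
      using f by (intro nn_integral_eq_integral) auto
    then have "(\<integral>x. f x \<partial>M) \<le> l + \<epsilon>" if "0 < \<epsilon>" for \<epsilon>
      using le(1)[OF that] le(2) that by (simp del: ennreal_plus)
    with i show ?thesis by (blast intro: field_le_epsilon)
  qed
  have a0: "0 \<le> \<alpha>" "0 \<le> \<beta>"
    by (rule LIMSEQ_le_const[OF lim(2)], auto)
       (rule LIMSEQ_le_const[OF lim(3)], auto intro!: Bochner_Integration.integral_nonneg sum_nonneg)
  have V: "integrable M (V u' Q') \<and> (\<integral>x. V u' Q' x \<partial>M) \<le> \<alpha>"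
  proof (rule nn[OF m(7)])
    fix \<epsilon> :: real assume "0 < \<epsilon>"
    from ev[OF lim(2) this] obtain n where "\<forall>k\<ge>n. (\<integral>x. V (u k) (Q k) x \<partial>M) \<le> \<alpha> + \<epsilon>" by blast
    from V'[OF this] show "(\<integral>\<^sup>+x. ennreal (V u' Q' x) \<partial>M) \<le> ennreal (\<alpha> + \<epsilon>)" by (simp add: sqnorm_def)
  qed (use a0 in auto)
  have Z: "integrable M (Z Q') \<and> (\<integral>x. Z Q' x \<partial>M) \<le> \<beta>"
  proof (rule nn[OF m(8)])
    fix \<epsilon> :: real assume "0 < \<epsilon>"
    from ev[OF lim(3) this] obtain n where "\<forall>k\<ge>n. (\<integral>x. Z (Q k) x \<partial>M) \<le> \<beta> + \<epsilon>" by blast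
    from Z'[OF this] show "(\<integral>\<^sup>+x. ennreal (Z Q' x) \<partial>M) \<le> ennreal (\<beta> + \<epsilon>)"
      by (simp add: sqnorm_def norm_vec_def L2_set_def sum_nonneg)
  qed (use a0 in \<open>auto intro: sum_nonneg\<close>)
  obtain c C where cC: "0 < c" "0 \<le> C" 
    "\<forall>u. \<forall>Q \<in> (S0 :: (real^'n^'n) set). c * (u ^ 4 + norm Q ^ 4) - C \<le> bulk_density a1 a2 a3 l u Q"
    by (rule bulk_lower)
  have low: "0 \<le> W u Q x + C" if "(u, Q) \<in> adm" "x \<in> \<Omega>" for u Q x
  proof -
    have "0 \<le> c * ((u x) ^ 4 + norm (Q x) ^ 4)" using cC(1) by simp
    with bspec[OF spec[OF cC(3)] adm_S0[OF that], of "u x"] show ?thesis by simp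
  qed
  \<comment> \<open>As the energies and both convex parts converge, the bulk integrals converge to
    what remains.\<close>
  define \<gamma> where "\<gamma> = e - B * \<alpha> - K / 2 * \<beta>"
  have limW: "(\<lambda>k. \<integral>x. W (u k) (Q k) x \<partial>M) \<longlonglongrightarrow> \<gamma>"
  proof -
    have "(\<lambda>k. energy (u k) (Q k) - B * (\<integral>x. V (u k) (Q k) x \<partial>M) - K / 2 * (\<integral>x. Z (Q k) x \<partial>M)) \<longlonglongrightarrow> \<gamma>"
      unfolding \<gamma>_def by (intro tendsto_intros lim)
    then show ?thesis using I(5) by simp
  qed
  have add_const: "(\<integral>x. f x + C \<partial>M) = (\<integral>x. f x \<partial>M) + C * vol" if "integrable M f" for f
    unfolding Bochner_Integration.integral_add[OF that integral_const_M(1)] integral_const_M(2) ..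
  \<comment> \<open>The constant \<open>C\<close> makes the bulk density nonnegative, as Fatou's
    lemma demands; on a domain of finite volume it contributes the same \<open>C * vol\<close> on
    both sides and cancels in the end.\<close>
  have W_int: "(\<integral>\<^sup>+x. ennreal (W (u k) (Q k) x + C) \<partial>M) = ennreal ((\<integral>x. W (u k) (Q k) x \<partial>M) + C * vol)" for k
  proof -
    have "(\<integral>\<^sup>+x. ennreal (W (u k) (Q k) x + C) \<partial>M) = ennreal (\<integral>x. W (u k) (Q k) x + C \<partial>M)"
      using I(2) integral_const_M(1)[of C] low[OF I(1)] by (intro nn_integral_eq_integral) (auto intro!: AE_I2)
    then show ?thesis unfolding add_const[OF I(2)] .
  qed
  have "(\<integral>\<^sup>+x. ennreal (W u' Q' x + C) \<partial>M) = (\<integral>\<^sup>+x. liminf (\<lambda>k. ennreal (W (u k) (Q k) x + C)) \<partial>M)"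
  proof (rule nn_integral_cong_AE, use AE' in eventually_elim)
    case (elim x)
    then have "(\<lambda>k. W (u k) (Q k) x) \<longlonglongrightarrow> W u' Q' x"
      by (intro tendsto_of_continuous_pair[OF continuous_on_bulk_density])
    then have "(\<lambda>k. ennreal (W (u k) (Q k) x + C)) \<longlonglongrightarrow> ennreal (W u' Q' x + C)"
      by (intro tendsto_ennrealI tendsto_intros)
    then show ?case by (intro lim_imp_Liminf[symmetric]) auto
  qed
  also have "\<dots> \<le> liminf (\<lambda>k. \<integral>\<^sup>+x. ennreal (W (u k) (Q k) x + C) \<partial>M)"
    using adm_measurable(3)[OF I(1)] by (intro nn_integral_liminf) simp
  also have "\<dots> = ennreal (\<gamma> + C * vol)"
    unfolding W_int by (intro lim_imp_Liminf tendsto_ennrealI tendsto_intros limW) auto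
  finally have WF: "(\<integral>\<^sup>+x. ennreal (W u' Q' x + C) \<partial>M) \<le> ennreal (\<gamma> + C * vol)" .
  have \<gamma>0: "0 \<le> \<gamma> + C * vol"
  proof (rule LIMSEQ_le_const[OF tendsto_add[OF limW tendsto_const[of "C * vol"]]], intro exI allI impI)
    fix k
    have "0 \<le> (\<integral>x. W (u k) (Q k) x + C \<partial>M)"
      using low[OF I(1)] by (intro integral_nonneg_AE AE_I2) simp
    then show "0 \<le> (\<integral>x. W (u k) (Q k) x \<partial>M) + C * vol"
      unfolding add_const[OF I(2)] .
  qed
  have WC0: "AE x in M. 0 \<le> W u' Q' x + C" using low[OF A] by (intro AE_I2) simp
  have WC: "integrable M (\<lambda>x. W u' Q' x + C)"
  proof (rule integrableI_nonneg)
    show "(\<lambda>x. W u' Q' x + C) \<in> borel_measurable M" using m(3) by simp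
    show "AE x in M. 0 \<le> W u' Q' x + C" by (rule WC0)
    show "(\<integral>\<^sup>+x. ennreal (W u' Q' x + C) \<partial>M) < \<infinity>" using WF by (rule order.strict_trans1) simp
  qed
  have "integrable M (\<lambda>x. (W u' Q' x + C) - C)"
    by (rule Bochner_Integration.integrable_diff[OF WC integral_const_M(1)])
  then have W: "integrable M (W u' Q')" by simp
  have "ennreal (\<integral>x. W u' Q' x + C \<partial>M) \<le> ennreal (\<gamma> + C * vol)"
    using WF unfolding nn_integral_eq_integral[OF WC WC0] .
  then have "(\<integral>x. W u' Q' x + C \<partial>M) \<le> \<gamma> + C * vol"
    by (subst (asm) ennreal_le_iff[OF \<gamma>0])
  then have Wle: "(\<integral>x. W u' Q' x \<partial>M) \<le> \<gamma>"
    unfolding add_const[OF W] by simp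
  have "integrable M (edens u' Q')"
    using W V Z by (intro Bochner_Integration.integrable_add integrable_mult_right) auto
  then have fin: "(u', Q') \<in> finite_energy" using A by (simp add: finite_energy_def)
  have "B * (\<integral>x. V u' Q' x \<partial>M) \<le> B * \<alpha>" "K / 2 * (\<integral>x. Z Q' x \<partial>M) \<le> K / 2 * \<beta>"
    using V Z pos by (auto intro: mult_left_mono)
  with Wle have "energy u' Q' \<le> e"
    unfolding finite_energy_integrable(5)[OF fin] \<gamma>_def by linarith
  with fin show ?thesis by blast
qed

text \<open>From a minimising sequence subsequences are extracted along which \<open>u\<close>, then
  \<open>Q\<close>, converge almost everywhere, and along which the two convex parts of the energy
  converge as numbers; the lower semicontinuity result applies to the last one.\<close>

lemma finite_energy_minimizer:
  assumes "finite_energy \<noteq> {}"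
  shows "\<exists>(u', Q') \<in> finite_energy. \<forall>(u, Q) \<in> finite_energy. energy u' Q' \<le> energy u Q"
proof -
  let ?E = "\<lambda>p. energy (fst p) (snd p)"
  obtain p0 where p0: "p0 \<in> finite_energy" using assms by blast
  \<comment> \<open>A level above \<open>e + 1 / Suc k\<close> for every \<open>k\<close>, so the
    coercivity bounds hold uniformly for the whole minimising sequence.\<close>
  define e1 where "e1 = \<bar>?E p0\<bar> + 1"
  obtain R where R0: "0 \<le> R" and R: "\<And>u Q. (u, Q) \<in> finite_energy \<Longrightarrow> energy u Q \<le> e1 \<Longrightarrow>
     - R \<le> (\<integral>x. W u Q x \<partial>M) \<and> (\<integral>x. V u Q x \<partial>M) \<le> R \<and> (\<integral>x. Z Q x \<partial>M) \<le> R"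
    using energy_parts_bounded[of e1] by fast
  obtain T where T: "\<And>u Q. (u, Q) \<in> finite_energy \<Longrightarrow> energy u Q \<le> e1 \<Longrightarrow>
     (\<lambda>x. coupling q (u x) (Q x)) \<in> L2 M \<and>
     sqnorm M (config_of \<Omega> u Q (\<lambda>x. coupling q (u x) (Q x))) \<le> ennreal T"
    using config_bounded[of e1] by fast
  have V0: "0 \<le> (\<integral>x. V u Q x \<partial>M)" for u Q by (intro Bochner_Integration.integral_nonneg) auto
  have Z0: "0 \<le> (\<integral>x. Z Q x \<partial>M)" for Q by (intro Bochner_Integration.integral_nonneg) (auto intro: sum_nonneg)
  have lower: "- R \<le> energy u Q" if "(u, Q) \<in> finite_energy" "energy u Q \<le> e1" for u Q
  proof -
    have "0 \<le> B * (\<integral>x. V u Q x \<partial>M)" "0 \<le> K / 2 * (\<integral>x. Z Q x \<partial>M)" using V0 Z0 pos by auto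
    then show ?thesis using R[OF that] unfolding finite_energy_integrable(5)[OF that(1)] by linarith
  qed
  have bdd: "bdd_below (?E ` finite_energy)"
  proof (rule bdd_belowI2)
    fix p assume "p \<in> finite_energy"
    \<comment> \<open>The lower bound \<open>- R\<close> is known below the level \<open>e1\<close>
      only; above it the level itself is a bound.\<close>
    then show "min (- R) e1 \<le> ?E p"
      using lower[of "fst p" "snd p"] by (cases "?E p \<le> e1") auto
  qed
  define e where "e = (INF p\<in>finite_energy. ?E p)"
  have "\<exists>p\<in>finite_energy. ?E p < e + 1 / Suc k" for k
  proof -
    have "(INF p\<in>finite_energy. ?E p) < e + 1 / Suc k" by (simp add: e_def)
    then show ?thesis using cINF_less_iff[OF assms bdd] by blast
  qed
  then obtain p where p: "\<And>k. p k \<in> finite_energy" "\<And>k. ?E (p k) < e + 1 / Suc k" by metis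
  have ele: "e \<le> ?E x" if "x \<in> finite_energy" for x unfolding e_def by (rule cINF_lower[OF bdd that])
  have small: "?E (p k) \<le> e1" for k
  proof -
    have "1 / real (Suc k) \<le> 1" by simp
    then show ?thesis using p(2)[of k] ele[OF p0] unfolding e1_def by linarith
  qed
  have plim: "(\<lambda>k. ?E (p k)) \<longlonglongrightarrow> e"
  proof (rule tendsto_sandwich[OF _ _ tendsto_const])
    show "\<forall>\<^sub>F k in sequentially. e \<le> ?E (p k)" using ele p(1) by simp
    show "\<forall>\<^sub>F k in sequentially. ?E (p k) \<le> e + 1 / Suc k" using p(2) by (auto intro: always_eventually less_imp_le)
    show "(\<lambda>k. e + 1 / Suc k) \<longlonglongrightarrow> e"
      using tendsto_add[OF tendsto_const[of e] LIMSEQ_Suc[OF lim_1_over_n]] by simp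
  qed
  define u where "u k = fst (p k)" for k
  define Q where "Q k = snd (p k)" for k
  have F: "(u k, Q k) \<in> finite_energy" and Ek: "energy (u k) (Q k) \<le> e1" for k
    using p(1)[of k] small[of k] by (simp_all add: u_def Q_def)
  note A = finite_energy_integrable(1)[OF F]
  note T' = T[OF F Ek]
  have comp: "sqnorm M f \<le> ennreal T" if "\<And>x. norm (f x) \<le> norm (config_of \<Omega> (u k) (Q k) (\<lambda>x. coupling q (u k x) (Q k x)) x)"
    for f :: "real^'n \<Rightarrow> 'b::real_normed_vector" and k
    by (rule order_trans[OF sqnorm_mono[OF that] conjunct2[OF T']])
  have lcb: "linear_contraction t \<Longrightarrow> norm (t w) \<le> norm w" for t :: "'n config \<Rightarrow> 'b::euclidean_space" and w
    unfolding linear_contraction_def by blast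
  note lc = linear_contraction_config[where 'n='n]
  have su: "sqnorm M (u k) \<le> ennreal T" for k
    by (rule comp[of _ k], rule order_trans[OF _ lcb[OF lc(1)]]) (simp add: config_of_def)
  have sQ: "sqnorm M (Q k) \<le> ennreal T" for k
    by (rule comp[of _ k], rule order_trans[OF _ lcb[OF lc(2)]]) (simp add: config_of_def)
  have sp: "sqnorm M (weak_partial \<Omega> i (u k)) \<le> ennreal T" for i k
    by (rule comp[of _ k], rule order_trans[OF _ lcb[OF lc(3)[of i]]]) (simp add: config_of_def)
  have sP: "sqnorm M (weak_partial \<Omega> i (Q k)) \<le> ennreal T" for i k
    by (rule comp[of _ k], rule order_trans[OF _ lcb[OF lc(4)[of i]]]) (simp add: config_of_def)
  have tu: "trace_approx \<Omega> u_b (u k) (\<lambda>i. weak_partial \<Omega> i (u k))"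
    and tQ: "trace_approx \<Omega> Q_b (Q k) (\<lambda>i. weak_partial \<Omega> i (Q k))" for k
    using A[of k] by (auto simp: admissible_def has_trace_iff)
  obtain r1 :: "nat \<Rightarrow> nat" where r1: "strict_mono r1" "AE x in M. convergent (\<lambda>k. u (r1 k) x)"
    using H1_bounded_imp_AE_convergent_subseq[where f = u, OF open_dom convex_dom tu admissible_L2(1)[OF A] admissible_L2(3)[OF A] su sp]
    by blast
  obtain r2 :: "nat \<Rightarrow> nat" where r2: "strict_mono r2" "AE x in M. convergent (\<lambda>k. Q (r1 (r2 k)) x)"
    using H1_bounded_imp_AE_convergent_subseq[where f = "\<lambda>k. Q (r1 k)", OF open_dom convex_dom tQ admissible_L2(2)[OF A] admissible_L2(4)[OF A] sQ sP]
    by blast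
  define s where "s = (\<lambda>k. r1 (r2 k))"
  have s: "strict_mono s" using strict_mono_o[OF r1(1) r2(1)] by (simp add: s_def o_def)
  \<comment> \<open>Both integrals take values in \<open>{0..R}\<close>, and compactness of the
    square gives a subsequence for the two together.\<close>
  define VZ where "VZ k = (\<integral>x. V (u (s k)) (Q (s k)) x \<partial>M, \<integral>x. Z (Q (s k)) x \<partial>M)" for k
  have bV: "\<forall>k. VZ k \<in> {0..R} \<times> {0..R}"
    unfolding VZ_def using R[OF F Ek] V0 Z0 by simp
  have "seq_compact ({0..R} \<times> {0..R})"
    by (intro compact_imp_seq_compact compact_Times compact_Icc)
  from seq_compactE[OF this bV]
  obtain ab r3 where r3: "strict_mono (r3 :: nat \<Rightarrow> nat)" and lim3: "(VZ \<circ> r3) \<longlonglongrightarrow> ab" by blast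
  define t where "t = (\<lambda>k. s (r3 k))"
  have t: "strict_mono t" using strict_mono_o[OF s r3] by (simp add: t_def o_def)
  have AEu: "AE x in M. convergent (\<lambda>k. u (t k) x)" 
    using r1(2)
  proof eventually_elim
    case (elim x)
    have "strict_mono (\<lambda>k. r2 (r3 k))" using strict_mono_o[OF r2(1) r3] by (simp add: o_def)
    from convergent_subseq_convergent[OF elim this] show ?case by (simp add: t_def s_def o_def)
  qed
  have AEQ: "AE x in M. convergent (\<lambda>k. Q (t k) x)" 
    using r2(2)
  proof eventually_elim
    case (elim x)
    from convergent_subseq_convergent[OF elim r3] show ?case by (simp add: t_def s_def o_def)
  qed
  have "(\<lambda>k. energy (u (t k)) (Q (t k))) \<longlonglongrightarrow> e"
    using LIMSEQ_subseq_LIMSEQ[OF plim t] by (simp add: u_def Q_def o_def)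
  moreover have "(\<lambda>k. \<integral>x. V (u (t k)) (Q (t k)) x \<partial>M) \<longlonglongrightarrow> fst ab" "(\<lambda>k. \<integral>x. Z (Q (t k)) x \<partial>M) \<longlonglongrightarrow> snd ab"
    using tendsto_fst[OF lim3] tendsto_snd[OF lim3] by (simp_all add: t_def o_def VZ_def)
  ultimately obtain u' Q' where "(u', Q') \<in> finite_energy" "energy u' Q' \<le> e"
    using energy_lsc[of "\<lambda>k. u (t k)" "\<lambda>k. Q (t k)", OF F conjunct1[OF T'] conjunct2[OF T'] AEu AEQ] by blast
  moreover from this have "energy u' Q' \<le> energy v P" if "(v, P) \<in> finite_energy" for v P
    using ele[OF that] by simp
  ultimately show ?thesis by blast
qed

text \<open>
  Pairs with non-integrable energy density have energy \<open>0\<close> by the convention for the Bochner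
  integral. Should they exist and all others have positive energy, they are the minimisers; so no
  Sobolev embedding is needed to rule them out.
\<close>

lemma minimizer:
  assumes "adm \<noteq> {}"
  shows "\<exists>(u', Q') \<in> adm. \<forall>(u, Q) \<in> adm. energy u' Q' \<le> energy u Q"
proof -
  have cases: "(u, Q) \<in> finite_energy \<or> energy u Q = 0" if "(u, Q) \<in> adm" for u Q
    using that energy_nonintegrable[of u Q] by (auto simp: finite_energy_def)
  have sub: "finite_energy \<subseteq> adm" by (auto simp: finite_energy_def)
  show ?thesis
  proof (cases "\<exists>p\<in>adm. p \<notin> finite_energy \<and> (\<forall>(u, Q)\<in>finite_energy. 0 \<le> energy u Q)")
    case True
    then obtain u0 Q0 where p: "(u0, Q0) \<in> adm" "(u0, Q0) \<notin> finite_energy" "\<forall>(u, Q)\<in>finite_energy. 0 \<le> energy u Q"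
      by auto
    then have "energy u0 Q0 = 0" using cases by blast
    then have "\<forall>(u, Q) \<in> adm. energy u0 Q0 \<le> energy u Q" using cases p(3) by fastforce
    with p(1) show ?thesis by blast
  next
    case False
    \<comment> \<open>In this case every admissible pair outside \<open>finite_energy\<close>
      entails one inside with negative energy. Hence the set is nonempty, and its minimiser also
      lies below the default value \<open>0\<close> whenever that value occurs.\<close>
    then have "finite_energy \<noteq> {}" using assms by auto
    from finite_energy_minimizer[OF this] obtain u' Q' where m: "(u', Q') \<in> finite_energy"
      "\<And>u Q. (u, Q) \<in> finite_energy \<Longrightarrow> energy u' Q' \<le> energy u Q" by blast
    have "energy u' Q' \<le> energy u Q" if A: "(u, Q) \<in> adm" for u Q
    proof (cases "(u, Q) \<in> finite_energy")
      case False
      then obtain v P where "(v, P) \<in> finite_energy" "energy v P < 0"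
        using \<open>\<not> (\<exists>p\<in>adm. p \<notin> finite_energy \<and> (\<forall>(u, Q)\<in>finite_energy. 0 \<le> energy u Q))\<close> A by force
      with m(2)[of v P] cases[OF A] False show ?thesis by simp
    qed (rule m(2))
    with m(1) sub show ?thesis by blast
  qed
qed

end

theorem theorem1p1:
  fixes \<Omega> :: "(real^'n::finite) set"
    and a1 a2 a3 B K l q :: real
    and u_b :: "real^'n \<Rightarrow> real"
    and Q_b :: "real^'n \<Rightarrow> real^'n^'n"
  assumes "CARD('n) \<in> {2, 3}"
    and "open \<Omega>" and "\<Omega> \<noteq> {}" and "bounded \<Omega>" and "convex \<Omega>" and "lipschitz_boundary \<Omega>"
    and "a3 > 0" and "B > 0" and "K > 0" and "l > 0" and "q \<ge> 0"
    and "Q_b \<in> H_half_S0 \<Omega>" and "u_b \<in> H_three_halves \<Omega>"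
  shows "\<exists>(u', Q') \<in> admissible \<Omega> u_b Q_b. \<forall>(u, Q) \<in> admissible \<Omega> u_b Q_b.
           smectic_energy \<Omega> a1 a2 a3 B K l q u' Q' \<le> smectic_energy \<Omega> a1 a2 a3 B K l q u Q"
proof -
  \<comment> \<open>The functions whose traces are the boundary data serve twice: they show that the
    data are square integrable on the boundary, and they form an admissible pair.\<close>
  obtain Q0 where Q0: "Q0 \<in> H1_S0 \<Omega>" "has_trace \<Omega> Q0 Q_b" using assms(12) by (auto simp: H_half_S0_def)
  obtain u0 where u0: "u0 \<in> H2 \<Omega>" "has_trace \<Omega> u0 u_b" using assms(13) by (auto simp: H_three_halves_def)
  interpret smectic \<Omega> a1 a2 a3 B K l q u_b Q_b
    using assms Q0(2) u0(2) by unfold_locales (auto simp: has_trace_def)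
  have "(u0, Q0) \<in> admissible \<Omega> u_b Q_b" using Q0 u0 by (simp add: admissible_def)
  then have "admissible \<Omega> u_b Q_b \<noteq> {}" by blast
  from minimizer[OF this] show ?thesis .
qed

end
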